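(* Assume that for each $1\le J\le N$, $F_J(\psi)=-\nabla U_J(\psi)$ with $U_J(\psi)=u_J(|\psi|^2)$, $u_J\in C^2(\mathbb R)$ real-valued, and that there are constants $A_J\in\mathbb R$, $B_J\ge 0$ with $U_J(\psi)\ge A_J-B_J|\psi|^2$ for all $\psi\in\mathbb C$ and $\sum_J B_J<m$. Then: (i) for every $\Psi_0=(\psi_0,\pi_0)\in\mathcal E$ the Cauchy problem (E) has a unique solution $\Psi(t)=(\psi(\cdot,t),\dot\psi(\cdot,t))$ with $\Psi\in C(\mathbb R,\mathcal E)$; (ii) for each $t\in\mathbb R$ the map $W(t):\Psi_0\mapsto\Psi(t)$ is continuous on $\mathcal E$; (iii) $\mathcal H(\Psi(t))$ and $\mathcal Q(\Psi(t))$ are independent of $t$; (iv) there is $C(\Psi_0)<\infty$ with $\|\Psi(t)\|_{\mathcal E}\le C(\Psi_0)$ for all $t\in\mathbb R$.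
   Context: Fix $m>0$, an integer $N\ge 1$ and points $X_1<X_2<\dots<X_N$ in $\mathbb R$. For $1\le J\le N$, $F_J:\mathbb C\to\mathbb C$ and the gradient $\nabla$ is taken with respect to $(\mathrm{Re}\,\psi,\mathrm{Im}\,\psi)$. The Cauchy problem (E) is $\ddot\psi(x,t)=\psi''(x,t)-m^2\psi(x,t)+\sum_{J=1}^N\delta(x-X_J)F_J(\psi(X_J,t))$, $x,t\in\mathbb R$, $\psi|_{t=0}=\psi_0$, $\dot\psi|_{t=0}=\pi_0$, where dots are $t$-derivatives, primes are $x$-derivatives, and the equation is understood in the sense of distributions. The energy space is $\mathcal E=H^1(\mathbb R)\oplus L^2(\mathbb R)$ of pairs $\Psi=(\psi,\pi)$ with norm $\|\Psi\|_{\mathcal E}^2=\|\pi\|_{L^2}^2+\|\psi'\|_{L^2}^2+m^2\|\psi\|_{L^2}^2$. The Hamiltonian is $\mathcal H(\Psi)=\frac12\int_{\mathbb R}(|\pi|^2+|\psi'|^2+m^2|\psi|^2)\,dx+\sum_J U_J(\psi(X_J))$ and the charge is $\mathcal Q(\Psi)=\frac i2\int_{\mathbb R}(\overline\psi\pi-\overline\pi\psi)\,dx$. *)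

theory Defs
  imports "HOL-Analysis.Analysis"
begin

definition test1 :: "(real \<Rightarrow> real) \<Rightarrow> bool" where
  "test1 \<phi> \<longleftrightarrow> (\<forall>n x. ((deriv ^^ n) \<phi>) differentiable (at x))
                 \<and> (\<exists>R. \<forall>x. \<bar>x\<bar> > R \<longrightarrow> \<phi> x = 0)"

definition px :: "(real \<Rightarrow> real \<Rightarrow> real) \<Rightarrow> real \<Rightarrow> real \<Rightarrow> real" where
  "px \<phi> = (\<lambda>x t. deriv (\<lambda>y. \<phi> y t) x)"

definition pt :: "(real \<Rightarrow> real \<Rightarrow> real) \<Rightarrow> real \<Rightarrow> real \<Rightarrow> real" where
  "pt \<phi> = (\<lambda>x t. deriv (\<lambda>s. \<phi> x s) t)"

inductive_set partials :: "(real \<Rightarrow> real \<Rightarrow> real) \<Rightarrow> (real \<Rightarrow> real \<Rightarrow> real) set"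
  for \<phi> where
  base: "\<phi> \<in> partials \<phi>"
| dx: "g \<in> partials \<phi> \<Longrightarrow> px g \<in> partials \<phi>"
| dt: "g \<in> partials \<phi> \<Longrightarrow> pt g \<in> partials \<phi>"

definition test2 :: "(real \<Rightarrow> real \<Rightarrow> real) \<Rightarrow> bool" where
  "test2 \<phi> \<longleftrightarrow>
     (\<forall>g\<in>partials \<phi>. (\<forall>x t. (\<lambda>y. g y t) differentiable (at x) \<and> (\<lambda>s. g x s) differentiable (at t))
                       \<and> continuous_on UNIV (\<lambda>(x, t). g x t))
     \<and> (\<exists>R. \<forall>x t. (\<bar>x\<bar> > R \<or> \<bar>t\<bar> > R) \<longrightarrow> \<phi> x t = 0)"

definition L2 :: "(real \<Rightarrow> complex) \<Rightarrow> bool" where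
  "L2 f \<longleftrightarrow> f \<in> borel_measurable lborel \<and> integrable lborel (\<lambda>x. (cmod (f x))\<^sup>2)"

definition l2sq :: "(real \<Rightarrow> complex) \<Rightarrow> real" where
  "l2sq f = (\<integral>x. (cmod (f x))\<^sup>2 \<partial>lborel)"

definition is_wderiv :: "(real \<Rightarrow> complex) \<Rightarrow> (real \<Rightarrow> complex) \<Rightarrow> bool" where
  "is_wderiv \<psi> g \<longleftrightarrow> L2 g \<and>
     (\<forall>\<phi>. test1 \<phi> \<longrightarrow>
        (\<integral>x. \<psi> x * complex_of_real (deriv \<phi> x) \<partial>lborel) = - (\<integral>x. g x * complex_of_real (\<phi> x) \<partial>lborel))"

definition wderiv :: "(real \<Rightarrow> complex) \<Rightarrow> (real \<Rightarrow> complex)" where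
  "wderiv \<psi> = (SOME g. is_wderiv \<psi> g)"

text \<open>H^1(R), elements represented by their continuous representative
  (so that point values \<psi>(X_J) make sense).\<close>
definition H1 :: "(real \<Rightarrow> complex) \<Rightarrow> bool" where
  "H1 \<psi> \<longleftrightarrow> continuous_on UNIV \<psi> \<and> L2 \<psi> \<and> (\<exists>g. is_wderiv \<psi> g)"

type_synonym state = "(real \<Rightarrow> complex) \<times> (real \<Rightarrow> complex)"

definition Espace :: "state set" where
  "Espace = {(\<psi>, \<pi>). H1 \<psi> \<and> L2 \<pi>}"

definition enorm :: "real \<Rightarrow> state \<Rightarrow> real" where
  "enorm m \<Psi> = sqrt (l2sq (snd \<Psi>) + l2sq (wderiv (fst \<Psi>)) + m\<^sup>2 * l2sq (fst \<Psi>))"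

definition sdiff :: "state \<Rightarrow> state \<Rightarrow> state" where
  "sdiff \<Psi> \<Phi> = ((\<lambda>x. fst \<Psi> x - fst \<Phi> x), (\<lambda>x. snd \<Psi> x - snd \<Phi> x))"

definition cgrad :: "(complex \<Rightarrow> real) \<Rightarrow> complex \<Rightarrow> complex" where
  "cgrad U z = Complex (deriv (\<lambda>a. U (Complex a (Im z))) (Re z))
                       (deriv (\<lambda>b. U (Complex (Re z) b)) (Im z))"

definition C2 :: "(real \<Rightarrow> real) \<Rightarrow> bool" where
  "C2 u \<longleftrightarrow> (\<exists>u' u''. (\<forall>x. (u has_real_derivative u' x) (at x) \<and> (u' has_real_derivative u'' x) (at x))
                     \<and> continuous_on UNIV u'')"

definition Ham :: "real \<Rightarrow> nat \<Rightarrow> (nat \<Rightarrow> real) \<Rightarrow> (nat \<Rightarrow> complex \<Rightarrow> real) \<Rightarrow> state \<Rightarrow> real" where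
  "Ham m N X U \<Psi> =
     (1/2) * (\<integral>x. (cmod (snd \<Psi> x))\<^sup>2 + (cmod (wderiv (fst \<Psi>) x))\<^sup>2 + m\<^sup>2 * (cmod (fst \<Psi> x))\<^sup>2 \<partial>lborel)
     + (\<Sum>J\<in>{1..N}. U J (fst \<Psi> (X J)))"

definition Charge :: "state \<Rightarrow> complex" where
  "Charge \<Psi> = (\<i> / 2) * (\<integral>x. cnj (fst \<Psi> x) * snd \<Psi> x - cnj (snd \<Psi> x) * fst \<Psi> x \<partial>lborel)"

text \<open>\<Psi> t = (\<psi>(.,t), \<pi>(.,t)); \<Psi> \<in> C(R,E); \<pi> is the distributional time derivative
  of \<psi>; the equation holds in D'(R^2); initial data (\<psi>0, \<pi>0) (the latter as an
  L^2 class).\<close>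
definition is_solution ::
  "real \<Rightarrow> nat \<Rightarrow> (nat \<Rightarrow> real) \<Rightarrow> (nat \<Rightarrow> complex \<Rightarrow> complex) \<Rightarrow> state \<Rightarrow> (real \<Rightarrow> state) \<Rightarrow> bool" where
  "is_solution m N X F \<Psi>0 \<Psi> \<longleftrightarrow>
     (\<forall>t. \<Psi> t \<in> Espace)
   \<and> (\<forall>t. \<forall>\<epsilon>>0. \<exists>\<delta>>0. \<forall>s. \<bar>s - t\<bar> < \<delta> \<longrightarrow> enorm m (sdiff (\<Psi> s) (\<Psi> t)) < \<epsilon>)
   \<and> (\<forall>\<phi>. test2 \<phi> \<longrightarrow>
        (\<integral>t. (\<integral>x. fst (\<Psi> t) x * complex_of_real (pt \<phi> x t) \<partial>lborel) \<partial>lborel)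
          = - (\<integral>t. (\<integral>x. snd (\<Psi> t) x * complex_of_real (\<phi> x t) \<partial>lborel) \<partial>lborel))
   \<and> (\<forall>\<phi>. test2 \<phi> \<longrightarrow>
        (\<integral>t. (\<integral>x. fst (\<Psi> t) x *
              complex_of_real (pt (pt \<phi>) x t - px (px \<phi>) x t + m\<^sup>2 * \<phi> x t) \<partial>lborel) \<partial>lborel)
          = (\<integral>t. (\<Sum>J\<in>{1..N}. F J (fst (\<Psi> t) (X J)) * complex_of_real (\<phi> (X J) t)) \<partial>lborel))
   \<and> fst (\<Psi> 0) = fst \<Psi>0
   \<and> (AE x in lborel. snd (\<Psi> 0) x = snd \<Psi>0 x)"

end

theory Submission
  imports Defs "HOL-Computational_Algebra.Polynomial"
begin

text \<open>A distributional solution is a pair of ordinary differential equations in \<open>L\<^sup>2\<close> tested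
  against smooth functions; along the characteristics \<open>x + t\<close> and \<open>x - t\<close> it becomes a Duhamel
  equation whose only nonlinearity is in the traces \<open>\<psi> (X J) t\<close>. For Lipschitz forces this
  is a contraction in an exponentially weighted norm on \<open>[0, \<infinity>)\<close>, which gives existence,
  uniqueness and continuous dependence. Charge is conserved by differentiation; energy is conserved
  through time averages, the error being controlled by \<open>\<bar>f\<bar>\<^sup>2 \<le> \<parallel>f\<parallel> \<parallel>f'\<parallel>\<close>. The same
  inequality and \<open>\<bar>\<psi>\<bar>\<^sup>2 \<le> (\<parallel>\<psi>'\<parallel>\<^sup>2 + m\<^sup>2 \<parallel>\<psi>\<parallel>\<^sup>2) / (2 m)\<close> together with the lower
  bound on the potentials turn the conserved energy into an a priori bound, so that a truncation of
  the forces outside a large ball is never felt by the solution.\<close>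

section \<open>The Hilbert space of square integrable functions\<close>

text \<open>The obstacle is regularity. \<open>P\<close> satisfies the equation only weakly, and
  \<open>u\<close> of class C2 makes \<open>F\<close> just locally Lipschitz, so energy cannot be
  conserved by formal differentiation; averaging in time avoids any approximation of the data. Point
  evaluation is extended to arbitrary pairs of \<open>l2\<close>. The Duhamel map then acts on a
  Banach space without constraint, and that \<open>D\<close> is the space derivative of
  \<open>P\<close> is recovered afterwards, because the defect is constant in time. Along a
  characteristic a point source leaves a function whose norm is the L2 norm of its strength over
  time; this is the origin of \<open>1 / sqrt (2 * \<mu>)\<close> beside \<open>1 / \<mu>\<close> in
  the contraction constant. Conservation of energy is at hand only while truncated and original
  forces agree on the traces, so the truncation is removed by a first exit argument. Only half-lines
  are solved; the equation is invariant under reversal of time with a flipped velocity, and the two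
  halves are glued.\<close>

lemma L2_measurable [measurable_dest]: "L2 f \<Longrightarrow> f \<in> borel_measurable lborel"
  by (simp add: L2_def)

lemma L2_integrable: "L2 f \<Longrightarrow> integrable lborel (\<lambda>x. (cmod (f x))\<^sup>2)"
  by (simp add: L2_def)

lemma L2I:
  assumes "f \<in> borel_measurable lborel" "integrable lborel g" "\<And>x. (cmod (f x))\<^sup>2 \<le> g x"
  shows "L2 f"
  unfolding L2_def
proof (intro conjI)
  have [measurable]: "f \<in> borel_measurable lborel" by fact
  show "integrable lborel (\<lambda>x. (cmod (f x))\<^sup>2)"
    by (rule Bochner_Integration.integrable_bound[OF assms(2)])
       (use assms(3) in \<open>auto intro!: AE_I2 intro: order_trans[OF assms(3) abs_ge_self]\<close>)
qed fact

lemma L2_dominated: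
  assumes "f \<in> borel_measurable lborel" "L2 g" "\<And>x. cmod (f x) \<le> cmod (g x)"
  shows "L2 f"
  by (rule L2I[OF assms(1) L2_integrable[OF assms(2)]]) (simp add: assms(3) power_mono)

lemma sq_norm_add_le: "(norm (a + b :: 'a :: real_normed_vector))\<^sup>2 \<le> 2 * (norm a)\<^sup>2 + 2 * (norm b)\<^sup>2"
proof -
  have "(norm (a + b))\<^sup>2 \<le> (norm a + norm b)\<^sup>2"
    by (intro power_mono norm_triangle_ineq) auto
  also have "\<dots> \<le> 2 * (norm a)\<^sup>2 + 2 * (norm b)\<^sup>2"
    using sum_squares_bound[of "norm a" "norm b"] by (simp add: power2_sum)
  finally show ?thesis .
qed

lemma L2_add [intro]:
  assumes "L2 f" "L2 g" shows "L2 (\<lambda>x. f x + g x)"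
proof (rule L2I)
  show "(\<lambda>x. f x + g x) \<in> borel_measurable lborel"
    using assms by (intro borel_measurable_add) (auto simp: L2_def)
  show "integrable lborel (\<lambda>x. 2 * (cmod (f x))\<^sup>2 + 2 * (cmod (g x))\<^sup>2)"
    using assms by (auto simp: L2_def)
qed (rule sq_norm_add_le)

lemma L2_cmult [intro]: "L2 f \<Longrightarrow> L2 (\<lambda>x. c * f x)"
  by (auto simp: L2_def norm_mult power_mult_distrib)

lemma L2_scaleR [intro]: "L2 f \<Longrightarrow> L2 (\<lambda>x. r *\<^sub>R f x)"
  using L2_cmult[of f "of_real r"] by (simp add: scaleR_conv_of_real)

lemma L2_uminus [intro]: "L2 f \<Longrightarrow> L2 (\<lambda>x. - f x)"
  by (auto simp: L2_def)

lemma L2_diff [intro]: "L2 f \<Longrightarrow> L2 g \<Longrightarrow> L2 (\<lambda>x. f x - g x)"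
  using L2_add[of f "\<lambda>x. - g x"] L2_uminus[of g] by simp

lemma L2_zero [intro, simp]: "L2 (\<lambda>x. 0)"
  by (simp add: L2_def)

lemma L2_cong_AE:
  assumes "L2 f" "g \<in> borel_measurable lborel" "AE x in lborel. f x = g x"
  shows "L2 g"
  unfolding L2_def
proof
  have [measurable]: "g \<in> borel_measurable lborel" by fact
  show "integrable lborel (\<lambda>x. (cmod (g x))\<^sup>2)"
    by (rule integrable_cong_AE_imp[OF L2_integrable[OF assms(1)]]) (use assms(3) in auto)
qed fact

lemma mult_le_sum_squares: "0 \<le> a \<Longrightarrow> 0 \<le> b \<Longrightarrow> a * b \<le> a\<^sup>2 + (b::real)\<^sup>2"
  using sum_squares_bound[of a b] mult_nonneg_nonneg[of a b] by linarith

lemma L2_inner_integrable: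
  assumes "L2 f" "L2 g" shows "integrable lborel (\<lambda>x. inner (f x) (g x))"
proof (rule Bochner_Integration.integrable_bound)
  have [measurable]: "f \<in> borel_measurable lborel" "g \<in> borel_measurable lborel"
    using assms by (auto simp: L2_def)
  show "(\<lambda>x. inner (f x) (g x)) \<in> borel_measurable lborel" by measurable
  show "integrable lborel (\<lambda>x. (cmod (f x))\<^sup>2 + (cmod (g x))\<^sup>2)"
    using assms by (auto simp: L2_def)
  show "AE x in lborel. norm (inner (f x) (g x)) \<le> norm ((cmod (f x))\<^sup>2 + (cmod (g x))\<^sup>2)"
  proof (rule AE_I2)
    fix x
    have "\<bar>inner (f x) (g x)\<bar> \<le> cmod (f x) * cmod (g x)" by (rule Cauchy_Schwarz_ineq2)
    also have "\<dots> \<le> (cmod (f x))\<^sup>2 + (cmod (g x))\<^sup>2"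
      by (rule mult_le_sum_squares) auto
    finally show "norm (inner (f x) (g x)) \<le> norm ((cmod (f x))\<^sup>2 + (cmod (g x))\<^sup>2)" by simp
  qed
qed

lemma L2_mult_integrable:
  assumes "L2 f" "L2 g" shows "integrable lborel (\<lambda>x. f x * g x)"
proof (rule Bochner_Integration.integrable_bound)
  have [measurable]: "f \<in> borel_measurable lborel" "g \<in> borel_measurable lborel"
    using assms by (auto simp: L2_def)
  show "(\<lambda>x. f x * g x) \<in> borel_measurable lborel" by measurable
  show "integrable lborel (\<lambda>x. (cmod (f x))\<^sup>2 + (cmod (g x))\<^sup>2)"
    using assms by (auto simp: L2_def)
  show "AE x in lborel. norm (f x * g x) \<le> norm ((cmod (f x))\<^sup>2 + (cmod (g x))\<^sup>2)"
  proof (rule AE_I2)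
    fix x
    show "norm (f x * g x) \<le> norm ((cmod (f x))\<^sup>2 + (cmod (g x))\<^sup>2)"
      using mult_le_sum_squares[of "cmod (f x)" "cmod (g x)"] by (simp add: norm_mult)
  qed
qed

\<comment> \<open>A type of classes lets the general theory of Banach and inner product spaces, in
  particular derivatives and integrals of curves and the fixed point theorem, apply directly. The
  quotient is partial in order to discard functions that are not square integrable. The inner
  product is the real one, the real part of the Hermitian product.\<close>
quotient_type l2 = "real \<Rightarrow> complex" / partial: "\<lambda>f g. L2 f \<and> L2 g \<and> (AE x in lborel. f x = g x)"
  morphisms rep_l2 cl
proof (rule part_equivpI)
  show "\<exists>x. L2 x \<and> L2 x \<and> (AE xa in lborel. x xa = x xa)"
    by (rule exI[of _ "\<lambda>x. 0"]) auto
  show "symp (\<lambda>f g. L2 f \<and> L2 g \<and> (AE x in lborel. f x = g x))"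
    by (rule sympI) (auto simp: eq_commute)
  show "transp (\<lambda>f g. L2 f \<and> L2 g \<and> (AE x in lborel. f x = g x))"
    by (rule transpI) (auto elim: AE_mp)
qed

instantiation l2 :: real_inner
begin

lift_definition zero_l2 :: l2 is "\<lambda>x. 0" by simp

lift_definition plus_l2 :: "l2 \<Rightarrow> l2 \<Rightarrow> l2" is "\<lambda>f g x. f x + g x"
  by (auto intro: L2_add)

lift_definition minus_l2 :: "l2 \<Rightarrow> l2 \<Rightarrow> l2" is "\<lambda>f g x. f x - g x"
  by (auto intro: L2_diff)

lift_definition uminus_l2 :: "l2 \<Rightarrow> l2" is "\<lambda>f x. - f x"
  by (auto intro: L2_uminus)

lift_definition scaleR_l2 :: "real \<Rightarrow> l2 \<Rightarrow> l2" is "\<lambda>r f x. r *\<^sub>R f x"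
  by (auto intro: L2_scaleR)

lift_definition inner_l2 :: "l2 \<Rightarrow> l2 \<Rightarrow> real" is "\<lambda>f g. \<integral>x. inner (f x) (g x) \<partial>lborel"
proof -
  fix f f' g g'
  assume f: "L2 f \<and> L2 f' \<and> (AE x in lborel. f x = f' x)" and g: "L2 g \<and> L2 g' \<and> (AE x in lborel. g x = g' x)"
  then have [measurable]: "f \<in> borel_measurable lborel" "g \<in> borel_measurable lborel"
      "f' \<in> borel_measurable lborel" "g' \<in> borel_measurable lborel"
    by (auto simp: L2_def)
  show "(\<integral>x. inner (f x) (g x) \<partial>lborel) = (\<integral>x. inner (f' x) (g' x) \<partial>lborel)"
    by (rule integral_cong_AE) (use f g in \<open>auto elim: AE_mp\<close>)
qed

definition norm_l2 :: "l2 \<Rightarrow> real" where "norm_l2 f = sqrt (inner f f)"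
definition dist_l2 :: "l2 \<Rightarrow> l2 \<Rightarrow> real" where "dist_l2 f g = norm (f - g)"
definition sgn_l2 :: "l2 \<Rightarrow> l2" where "sgn_l2 f = inverse (norm f) *\<^sub>R f"
definition uniformity_l2 :: "(l2 \<times> l2) filter" where
  "uniformity_l2 = (INF e\<in>{0 <..}. principal {(x, y). dist x y < e})"
definition open_l2 :: "l2 set \<Rightarrow> bool" where
  "open_l2 U = (\<forall>x\<in>U. eventually (\<lambda>(x', y). x' = x \<longrightarrow> y \<in> U) uniformity)"

instance
proof
  fix f g h :: l2 and r s :: real
  show "dist f g = norm (f - g)" by (rule dist_l2_def)
  show "sgn f = inverse (norm f) *\<^sub>R f" by (rule sgn_l2_def)
  show "norm f = sqrt (inner f f)" by (rule norm_l2_def)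
  show "(uniformity :: (l2 \<times> l2) filter) = (INF e\<in>{0 <..}. principal {(x, y). dist x y < e})"
    by (rule uniformity_l2_def)
  show "open U = (\<forall>x\<in>U. \<forall>\<^sub>F (x', y) in uniformity. x' = x \<longrightarrow> y \<in> U)" for U :: "l2 set"
    by (rule open_l2_def)
  show "f + g + h = f + (g + h)" by transfer (auto simp: algebra_simps)
  show "f + g = g + f" by transfer (auto simp: algebra_simps)
  show "0 + f = f" by transfer auto
  show "- f + f = 0" by transfer auto
  show "f - g = f + - g" by transfer auto
  show "r *\<^sub>R (f + g) = r *\<^sub>R f + r *\<^sub>R g" by transfer (auto simp: algebra_simps)
  show "(r + s) *\<^sub>R f = r *\<^sub>R f + s *\<^sub>R f" by transfer (auto simp: algebra_simps)
  show "r *\<^sub>R s *\<^sub>R f = (r * s) *\<^sub>R f" by transfer auto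
  show "1 *\<^sub>R f = f" by transfer auto
  show "inner f g = inner g f" by transfer (auto simp: inner_commute)
  show "inner (f + g) h = inner f h + inner g h"
    by transfer (auto simp: inner_add_left L2_inner_integrable)
  show "inner (r *\<^sub>R f) g = r * inner f g"
    by transfer auto
  show "0 \<le> inner f f" by transfer (auto intro: integral_nonneg)
  show "inner f f = 0 \<longleftrightarrow> f = 0"
  proof transfer
    fix f :: "real \<Rightarrow> complex"
    assume "L2 f \<and> L2 f \<and> (AE x in lborel. f x = f x)"
    then have f: "L2 f" by simp
    have "(\<integral>x. inner (f x) (f x) \<partial>lborel) = 0 \<longleftrightarrow> (AE x in lborel. inner (f x) (f x) = 0)"
      by (rule integral_nonneg_eq_0_iff_AE[OF L2_inner_integrable[OF f f]]) auto
    with f show "(\<integral>x. inner (f x) (f x) \<partial>lborel) = 0 \<longleftrightarrow> L2 f \<and> L2 (\<lambda>x. 0) \<and> (AE x in lborel. f x = 0)"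
      by simp
  qed
qed

end

lemma L2_rep [simp]: "L2 (rep_l2 F)"
  using Quotient3_rep_reflp[OF Quotient3_l2] by auto

lemma cl_rep [simp]: "cl (rep_l2 F) = F"
  using Quotient3_abs_rep[OF Quotient3_l2] by metis

lemma l2_cases: obtains f where "L2 f" "F = cl f"
  using L2_rep[of F] cl_rep[of F] by metis

lemma cl_eq_iff: "L2 f \<Longrightarrow> L2 g \<Longrightarrow> cl f = cl g \<longleftrightarrow> (AE x in lborel. f x = g x)"
  using Quotient3_rel[OF Quotient3_l2, of f g] by auto

lemma rep_cl: "L2 f \<Longrightarrow> AE x in lborel. rep_l2 (cl f) x = f x"
  using cl_eq_iff[of "rep_l2 (cl f)" f] by simp

lemma cl_add: "L2 f \<Longrightarrow> L2 g \<Longrightarrow> cl f + cl g = cl (\<lambda>x. f x + g x)"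
  by (simp add: plus_l2.abs_eq)

lemma cl_diff: "L2 f \<Longrightarrow> L2 g \<Longrightarrow> cl f - cl g = cl (\<lambda>x. f x - g x)"
  by (simp add: minus_l2.abs_eq)

lemma cl_scaleR: "L2 f \<Longrightarrow> r *\<^sub>R cl f = cl (\<lambda>x. r *\<^sub>R f x)"
  by (simp add: scaleR_l2.abs_eq)

lemma cl_uminus: "L2 f \<Longrightarrow> - cl f = cl (\<lambda>x. - f x)"
  by (simp add: uminus_l2.abs_eq)

lemma cl_zero: "0 = cl (\<lambda>x. 0)"
  by (simp add: zero_l2_def)

lemma inner_cl: "L2 f \<Longrightarrow> L2 g \<Longrightarrow> inner (cl f) (cl g) = (\<integral>x. inner (f x) (g x) \<partial>lborel)"
  by (simp add: inner_l2.abs_eq)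

lemma norm_cl_sq: "L2 f \<Longrightarrow> (norm (cl f))\<^sup>2 = l2sq f"
  by (simp add: power2_norm_eq_inner inner_cl l2sq_def)

lemma norm_cl: "L2 f \<Longrightarrow> norm (cl f) = sqrt (l2sq f)"
  by (simp add: norm_eq_sqrt_inner inner_cl l2sq_def power2_norm_eq_inner)

lemma L2_real:
  assumes "w \<in> borel_measurable lborel" "\<And>x. 0 \<le> w x" "\<And>x. w x \<le> 1" "integrable lborel w"
  shows "L2 (\<lambda>x. complex_of_real (w x))"
proof (rule L2I[OF _ assms(4)])
  show "(\<lambda>x. complex_of_real (w x)) \<in> borel_measurable lborel" using assms(1) by measurable
  show "(cmod (complex_of_real (w x)))\<^sup>2 \<le> w x" for x
    using mult_left_le[OF assms(3) assms(2), of x x] by (simp add: power2_eq_square)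
qed

text \<open>Cauchy-Schwarz in \<open>l2\<close>, applied to the moduli, which are square integrable
  functions with the same norms.\<close>

lemma integrable_cmod_mult:
  assumes "L2 f" "L2 g"
  shows "integrable lborel (\<lambda>x. cmod (f x) * cmod (g x))"
    "(\<integral>x. cmod (f x) * cmod (g x) \<partial>lborel) \<le> norm (cl f) * norm (cl g)"
proof -
  have [measurable]: "f \<in> borel_measurable lborel" "g \<in> borel_measurable lborel"
    using assms by (auto simp: L2_def)
  let ?f = "\<lambda>x. complex_of_real (cmod (f x))" and ?g = "\<lambda>x. complex_of_real (cmod (g x))"
  have L: "L2 ?f" "L2 ?g" using assms by (auto simp: L2_def)
  have i: "inner (?f x) (?g x) = cmod (f x) * cmod (g x)" for x
    by (simp add: inner_complex_def)
  show "integrable lborel (\<lambda>x. cmod (f x) * cmod (g x))"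
    using L2_inner_integrable[OF L] by (simp add: i)
  have "inner (cl ?f) (cl ?g) \<le> norm (cl ?f) * norm (cl ?g)" by (rule norm_cauchy_schwarz)
  then show "(\<integral>x. cmod (f x) * cmod (g x) \<partial>lborel) \<le> norm (cl f) * norm (cl g)"
    using L assms by (simp add: inner_cl i norm_cl l2sq_def)
qed

text \<open>Multiplying by a square integrable positive weight turns a Cauchy sequence of
  \<open>L\<^sup>2\<close> into one of \<open>L\<^sup>1\<close>, which has an almost everywhere convergent subsequence;
  Fatou's lemma identifies the pointwise limit as the limit in \<open>L\<^sup>2\<close>.\<close>

instance l2 :: banach
proof
  fix F :: "nat \<Rightarrow> l2" assume F: "Cauchy F"
  define f where "f n = rep_l2 (F n)" for n
  have f: "L2 (f n)" "F n = cl (f n)" for n by (simp_all add: f_def)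
  have [measurable]: "f n \<in> borel_measurable lborel" for n using f by (auto simp: L2_def)
  \<comment> \<open>Since \<open>w\<close> is integrable and at most 1, also its square is
    integrable, so \<open>w\<close> itself lies in L2.\<close>
  obtain w :: "real \<Rightarrow> real" where w: "w \<in> borel_measurable lborel" "\<And>x. w x > 0" "\<And>x. w x \<le> 1" "integrable lborel w"
    using sigma_finite_measure.obtain_positive_integrable_function[OF lborel.sigma_finite_measure_axioms] by blast
  note [measurable] = w(1)
  have Lw: "L2 (\<lambda>x. complex_of_real (w x))"
    by (rule L2_real) (use w in \<open>auto intro: less_imp_le\<close>)
  define s where "s n x = f n x * complex_of_real (w x)" for n x
  have int_s: "integrable lborel (s n)" for n
    unfolding s_def by (rule L2_mult_integrable[OF f(1) Lw])
  define C where "C = norm (cl (\<lambda>x. complex_of_real (w x))) + 1"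
  then have C: "C > 0" "norm (cl (\<lambda>x. complex_of_real (w x))) < C"
    using norm_ge_zero[of "cl (\<lambda>x. complex_of_real (w x))"] by linarith+
  have "\<exists>N. \<forall>i\<ge>N. \<forall>j\<ge>N. (\<integral>x. norm (s i x - s j x) \<partial>lborel) < e" if "e > 0" for e
  proof -
    obtain N where N: "\<And>i j. i \<ge> N \<Longrightarrow> j \<ge> N \<Longrightarrow> norm (F i - F j) < e / C"
      using CauchyD[OF F, of "e / C"] C(1) \<open>e > 0\<close> by auto
    have "(\<integral>x. norm (s i x - s j x) \<partial>lborel) < e" if "i \<ge> N" "j \<ge> N" for i j
    proof -
      have eq: "norm (s i x - s j x) = cmod (f i x - f j x) * cmod (complex_of_real (w x))" for x
        unfolding s_def left_diff_distrib[symmetric] by (rule norm_mult)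
      have "(\<integral>x. norm (s i x - s j x) \<partial>lborel) \<le> norm (cl (\<lambda>x. f i x - f j x)) * norm (cl (\<lambda>x. complex_of_real (w x)))"
        unfolding eq by (rule integrable_cmod_mult(2)[OF L2_diff[OF f(1) f(1)] Lw])
      also have "\<dots> = norm (F i - F j) * norm (cl (\<lambda>x. complex_of_real (w x)))"
        by (simp add: f cl_diff)
      also have "\<dots> \<le> norm (F i - F j) * C" using C by (intro mult_left_mono) auto
      also have "\<dots> < e" using N[OF that] C(1) by (simp add: field_simps)
      finally show ?thesis .
    qed
    then show ?thesis by blast
  qed
  from cauchy_L1_AE_cauchy_subseq[OF int_s this]
  obtain r where r: "strict_mono r" and ae: "AE x in lborel. Cauchy (\<lambda>i. s (r i) x)" by metis
  define g where "g x = lim (\<lambda>i. f (r i) x)" for x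
  have lim: "AE x in lborel. (\<lambda>i. f (r i) x) \<longlonglongrightarrow> g x"
    using ae
  proof eventually_elim
    case (elim x)
    then have "convergent (\<lambda>i. s (r i) x)" by (simp add: Cauchy_convergent_iff)
    then have "convergent (\<lambda>i. s (r i) x * inverse (complex_of_real (w x)))"
      by (intro convergent_mult convergent_const)
    moreover have "s (r i) x * inverse (complex_of_real (w x)) = f (r i) x" for i
      using w(2)[of x] by (simp add: s_def)
    ultimately show ?case by (simp add: g_def convergent_LIMSEQ_iff)
  qed
  have [measurable]: "g \<in> borel_measurable lborel"
    unfolding g_def by measurable
  \<comment> \<open>Fatou's lemma yields both facts at once: the difference to the pointwise limit
    is square integrable, and its norm inherits the Cauchy bound. The first fact for a single index
    already shows that \<open>g\<close> is square integrable.\<close>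
  have close: "L2 (\<lambda>x. f n x - g x) \<and> norm (cl (\<lambda>x. f n x - g x)) \<le> e"
    if N: "\<And>i. i \<ge> N \<Longrightarrow> norm (F n - F i) \<le> e" and "e > 0" for n N e
  proof -
    let ?h = "\<lambda>x. f n x - g x"
    have b: "(\<integral>\<^sup>+x. ennreal ((cmod (f n x - f i x))\<^sup>2) \<partial>lborel) = ennreal ((norm (F n - F i))\<^sup>2)" for i
    proof -
      have "L2 (\<lambda>x. f n x - f i x)" using f by auto
      then show ?thesis
        by (simp add: f cl_diff norm_cl_sq l2sq_def nn_integral_eq_integral L2_integrable)
    qed
    have "(\<integral>\<^sup>+x. ennreal ((cmod (?h x))\<^sup>2) \<partial>lborel)
        = (\<integral>\<^sup>+x. liminf (\<lambda>i. ennreal ((cmod (f n x - f (r i) x))\<^sup>2)) \<partial>lborel)"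
    proof (rule nn_integral_cong_AE)
      show "AE x in lborel. ennreal ((cmod (?h x))\<^sup>2) = liminf (\<lambda>i. ennreal ((cmod (f n x - f (r i) x))\<^sup>2))"
        using lim
      proof eventually_elim
        case (elim x)
        have "(\<lambda>i. ennreal ((cmod (f n x - f (r i) x))\<^sup>2)) \<longlonglongrightarrow> ennreal ((cmod (?h x))\<^sup>2)"
          by (intro tendsto_ennrealI tendsto_power tendsto_norm tendsto_diff tendsto_const elim)
        from lim_imp_Liminf[OF _ this] show ?case by simp
      qed
    qed
    also have "\<dots> \<le> liminf (\<lambda>i. \<integral>\<^sup>+x. ennreal ((cmod (f n x - f (r i) x))\<^sup>2) \<partial>lborel)"
      by (rule nn_integral_liminf) measurable
    also have "\<dots> \<le> ennreal (e\<^sup>2)"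
    proof (rule Liminf_le)
      have "ennreal ((norm (F n - F (r i)))\<^sup>2) \<le> ennreal (e\<^sup>2)" if "i \<ge> N" for i
        by (intro ennreal_leI power_mono N order_trans[OF that seq_suble[OF r]]) auto
      then show "\<forall>\<^sub>F i in sequentially. (\<integral>\<^sup>+x. ennreal ((cmod (f n x - f (r i) x))\<^sup>2) \<partial>lborel) \<le> ennreal (e\<^sup>2)"
        by (auto simp: b eventually_sequentially)
    qed simp
    finally have le: "(\<integral>\<^sup>+x. ennreal ((cmod (?h x))\<^sup>2) \<partial>lborel) \<le> ennreal (e\<^sup>2)" .
    have int: "integrable lborel (\<lambda>x. (cmod (?h x))\<^sup>2)"
      by (rule integrableI_bounded) (use le in \<open>auto simp: le_less_trans\<close>)
    have L: "L2 ?h" unfolding L2_def using int by auto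
    have "ennreal (l2sq ?h) \<le> ennreal (e\<^sup>2)"
      using le int by (simp add: l2sq_def nn_integral_eq_integral)
    then have "l2sq ?h \<le> e\<^sup>2" by (simp add: ennreal_le_iff)
    then have "norm (cl ?h) \<le> e"
      using L \<open>e > 0\<close> by (intro power2_le_imp_le[of "norm (cl ?h)" e]) (auto simp: norm_cl_sq)
    with L show ?thesis by blast
  qed
  have Cau: "\<exists>N. \<forall>n\<ge>N. \<forall>i\<ge>N. norm (F n - F i) \<le> e" if "e > 0" for e
    using CauchyD[OF F that] by (meson less_imp_le)
  obtain N where "\<forall>n\<ge>N. \<forall>i\<ge>N. norm (F n - F i) \<le> 1" using Cau[of 1] by auto
  then have "L2 (\<lambda>x. f N x - g x)" using close[of N N 1] by auto
  from L2_diff[OF f(1)[of N] this] have Lg: "L2 g" by simp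
  have "F \<longlonglongrightarrow> cl g"
  proof (rule LIMSEQ_I)
    fix e :: real assume "e > 0"
    then obtain N where N: "\<forall>n\<ge>N. \<forall>i\<ge>N. norm (F n - F i) \<le> e/2" using Cau[of "e/2"] by auto
    have "norm (F n - cl g) < e" if "n \<ge> N" for n
    proof -
      have "norm (cl (\<lambda>x. f n x - g x)) \<le> e/2"
        using close[of N n "e/2"] N that \<open>e > 0\<close> by auto
      then show ?thesis using \<open>e > 0\<close> by (simp add: f cl_diff Lg)
    qed
    then show "\<exists>no. \<forall>n\<ge>no. norm (F n - cl g) < e" by blast
  qed
  then show "convergent F" by (auto simp: convergent_def)
qed

text \<open>As the inner product is real, the complex structure survives only through this map:
  \<open>inner f (mulI g)\<close> is the imaginary part of the Hermitian product whose real part is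
  \<open>inner f g\<close>. The charge is of this form.\<close>

lift_definition mulI :: "l2 \<Rightarrow> l2" is "\<lambda>f x. \<i> * f x"
  by (auto intro: L2_cmult)

lemma mulI_cl: "L2 f \<Longrightarrow> mulI (cl f) = cl (\<lambda>x. \<i> * f x)"
  by (simp add: mulI.abs_eq)

lemma inner_mulI_mulI [simp]: "inner (mulI f) (mulI g) = inner f g"
  by transfer (simp add: inner_complex_def add.commute)

lemma mulI_mulI [simp]: "mulI (mulI f) = - f"
  by transfer (auto intro: L2_uminus L2_cmult)

lemma linear_mulI: "linear mulI"
proof (rule linearI)
  show "mulI (f + g) = mulI f + mulI g" for f g
    by transfer (auto simp: distrib_left intro: L2_cmult L2_add)
  show "mulI (r *\<^sub>R f) = r *\<^sub>R mulI f" for r f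
    by transfer (auto intro: L2_cmult L2_scaleR)
qed

lemma norm_mulI [simp]: "norm (mulI f) = norm f"
  by (simp add: norm_eq_sqrt_inner)

lemma bounded_linear_mulI: "bounded_linear mulI"
  using linear_mulI by (auto simp: bounded_linear_def bounded_linear_axioms_def intro!: exI[of _ 1])

lemma inner_mulI_left: "inner (mulI f) g = - inner f (mulI g)"
  using inner_mulI_mulI[of f "mulI g"] by simp

lemma inner_mulI_self [simp]: "inner (mulI f) f = 0"
  using inner_mulI_left[of f f] by (simp add: inner_commute)

section \<open>Affine substitutions and translations\<close>

lemma distr_lborel_affine:
  assumes "\<kappa> \<in> {1, -1::real}"
  shows "distr lborel borel (\<lambda>x. t + \<kappa> * x) = lborel"
proof -
  have "lborel = density (distr lborel borel (\<lambda>x. t + \<kappa> * x)) (\<lambda>_. ennreal \<bar>\<kappa>\<bar>)"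
    by (rule lborel_real_affine) (use assms in auto)
  also have "\<dots> = distr lborel borel (\<lambda>x. t + \<kappa> * x)"
    using assms by (auto simp: density_1)
  finally show ?thesis by simp
qed

lemma AE_lborel_affine:
  assumes "\<kappa> \<in> {1, -1::real}" "AE x in lborel. P x"
  shows "AE x in lborel. P (t + \<kappa> * x)"
proof -
  have "AE x in distr lborel borel (\<lambda>x. t + \<kappa> * x). P x"
    by (subst distr_lborel_affine[OF assms(1)]) (rule assms(2))
  then show ?thesis by (rule AE_distrD[rotated]) simp
qed

text \<open>Reflections are included because the time at which a characteristic with coordinate
  \<open>c\<close> meets a source is \<open>k * (X - c)\<close>, of slope \<open>- k\<close>, for
  either sign of \<open>k\<close>.\<close>

lemma integral_lborel_affine:
  fixes f :: "real \<Rightarrow> 'a :: {banach, second_countable_topology}"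
  assumes "\<kappa> \<in> {1, -1::real}"
  shows "(\<integral>x. f (t + \<kappa> * x) \<partial>lborel) = (\<integral>x. f x \<partial>lborel)"
    "integrable lborel (\<lambda>x. f (t + \<kappa> * x)) \<longleftrightarrow> integrable lborel f"
proof -
  have "\<kappa> \<noteq> 0" using assms by auto
  from lborel_integral_real_affine[OF this, of f t] show "(\<integral>x. f (t + \<kappa> * x) \<partial>lborel) = (\<integral>x. f x \<partial>lborel)"
    using assms by auto
  from lborel_integrable_real_affine_iff[OF \<open>\<kappa> \<noteq> 0\<close>, of f t]
  show "integrable lborel (\<lambda>x. f (t + \<kappa> * x)) \<longleftrightarrow> integrable lborel f" .
qed

lemma L2_shift: "L2 f \<Longrightarrow> L2 (\<lambda>x. f (x - s))"
  using integral_lborel_affine(2)[of 1 "\<lambda>x. (cmod (f x))\<^sup>2" "-s"]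
  unfolding L2_def by (auto simp: algebra_simps)

lift_definition shift :: "real \<Rightarrow> l2 \<Rightarrow> l2" is "\<lambda>s f x. f (x - s)"
proof -
  fix s f g assume *: "L2 f \<and> L2 g \<and> (AE x in lborel. f x = (g x :: complex))"
  then have "AE x in lborel. f (x - s) = g (x - s)"
    using AE_lborel_affine[of 1 "\<lambda>x. f x = g x" "-s"] by simp
  with * show "L2 (\<lambda>x. f (x - s)) \<and> L2 (\<lambda>x. g (x - s)) \<and> (AE x in lborel. f (x - s) = g (x - s))"
    by (auto intro: L2_shift)
qed

lemma shift_cl: "L2 f \<Longrightarrow> shift s (cl f) = cl (\<lambda>x. f (x - s))"
  by (simp add: shift.abs_eq)

lemma shift_0 [simp]: "shift 0 f = f"
  by transfer auto

lemma shift_shift [simp]: "shift s (shift r f) = shift (s + r) f"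
  by transfer (auto simp: algebra_simps intro: L2_shift)

lemma inner_shift_shift [simp]: "inner (shift s f) (shift s g) = inner f g"
proof (transfer, safe)
  fix s :: real and f g :: "real \<Rightarrow> complex"
  show "(\<integral>x. inner (f (x - s)) (g (x - s)) \<partial>lborel) = (\<integral>x. inner (f x) (g x) \<partial>lborel)"
    using integral_lborel_affine(1)[of 1 "\<lambda>x. inner (f x) (g x)" "-s"] by simp
qed

lemma inner_shift_left: "inner (shift s f) g = inner f (shift (- s) g)"
  using inner_shift_shift[of s f "shift (-s) g"] by simp

lemma norm_shift [simp]: "norm (shift s f) = norm f"
  by (simp add: norm_eq_sqrt_inner)

lemma linear_shift: "linear (shift s)"
  by (rule linearI; transfer) (auto intro!: L2_shift L2_add L2_scaleR)

lemmas shift_diff = linear_diff[OF linear_shift]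
  and shift_add = linear_add[OF linear_shift]
  and shift_scaleR = linear_scale[OF linear_shift]

section \<open>Smooth functions and test functions\<close>

definition smooth :: "(real \<Rightarrow> real) \<Rightarrow> bool" where
  "smooth f \<longleftrightarrow> (\<forall>n x. ((deriv ^^ n) f) differentiable (at x))"

lemma test1_smooth: "test1 f \<longleftrightarrow> smooth f \<and> (\<exists>R. \<forall>x. \<bar>x\<bar> > R \<longrightarrow> f x = 0)"
  by (simp add: test1_def smooth_def)

text \<open>Spares every formula for higher derivatives: it is enough to find a class of
  differentiable functions that is closed under \<open>deriv\<close>.\<close>

lemma smooth_coinduct:
  assumes "f \<in> S" "\<And>g x. g \<in> S \<Longrightarrow> g differentiable (at x)" "\<And>g. g \<in> S \<Longrightarrow> deriv g \<in> S"
  shows "smooth f"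
proof -
  have "(deriv ^^ n) f \<in> S" for n
    by (induction n) (use assms in auto)
  with assms show ?thesis by (auto simp: smooth_def)
qed

lemma smooth_deriv: "smooth f \<Longrightarrow> smooth (deriv f)"
  unfolding smooth_def by (metis funpow_Suc_right comp_apply)

lemma smooth_has_deriv: "smooth f \<Longrightarrow> (f has_real_derivative deriv f x) (at x within s)"
  unfolding smooth_def
  by (metis DERIV_deriv_iff_real_differentiable funpow_0 has_field_derivative_at_within)

lemma smooth_continuous: "smooth f \<Longrightarrow> continuous_on s f"
  using smooth_has_deriv[of f] by (meson DERIV_continuous continuous_at_imp_continuous_on)

lemma smooth_measurable: "smooth f \<Longrightarrow> f \<in> borel_measurable borel"
  by (intro borel_measurable_continuous_onI smooth_continuous)

lemma smooth_antideriv: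
  assumes "\<And>x. (F has_real_derivative f x) (at x)" "smooth f"
  shows "smooth F"
proof -
  have "deriv F = f" using assms(1) by (auto intro: DERIV_imp_deriv)
  then have "((deriv ^^ n) F) differentiable (at x)" for n x
    using assms by (cases n) (auto simp: smooth_def funpow_Suc_right real_differentiable_def simp del: funpow.simps)
  then show ?thesis by (simp add: smooth_def)
qed

lemma smooth_const [simp]: "smooth (\<lambda>x. c)"
  by (rule smooth_coinduct[of _ "range (\<lambda>c x. c)"]) auto

text \<open>By the Leibniz rule this class is closed under differentiation, so
  \<open>smooth_coinduct\<close> gives the smoothness of products and of sums together, without the
  binomial formula for iterated derivatives.\<close>

inductive_set sums_of_products :: "(real \<Rightarrow> real) set" where
  prod: "smooth f \<Longrightarrow> smooth g \<Longrightarrow> (\<lambda>x. f x * g x) \<in> sums_of_products"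
| add: "f \<in> sums_of_products \<Longrightarrow> g \<in> sums_of_products \<Longrightarrow> (\<lambda>x. f x + g x) \<in> sums_of_products"

lemma sums_of_products_deriv:
  "h \<in> sums_of_products \<Longrightarrow> (\<exists>h'\<in>sums_of_products. \<forall>x. (h has_real_derivative h' x) (at x))"
proof (induction rule: sums_of_products.induct)
  case (prod f g)
  then have "\<forall>x. ((\<lambda>x. f x * g x) has_real_derivative (deriv f x * g x + f x * deriv g x)) (at x)"
    by (auto intro!: derivative_eq_intros smooth_has_deriv)
  moreover have "(\<lambda>x. deriv f x * g x + f x * deriv g x) \<in> sums_of_products"
    using prod by (intro sums_of_products.intros smooth_deriv)
  ultimately show ?case by (intro bexI)
next
  case (add f g)
  then obtain f' g' where "f' \<in> sums_of_products" "g' \<in> sums_of_products"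
    "\<forall>x. (f has_real_derivative f' x) (at x)" "\<forall>x. (g has_real_derivative g' x) (at x)"
    by blast
  then show ?case
    by (intro bexI[of _ "\<lambda>x. f' x + g' x"]) (auto intro!: derivative_eq_intros sums_of_products.add)
qed

lemma sums_of_products_smooth: "h \<in> sums_of_products \<Longrightarrow> smooth h"
proof (erule smooth_coinduct)
  fix g x assume "g \<in> sums_of_products"
  then obtain h where h: "h\<in>sums_of_products" "\<forall>x. (g has_real_derivative h x) (at x)"
    using sums_of_products_deriv by blast
  then show "g differentiable (at x)" by (auto simp: real_differentiable_def)
  have "deriv g = h" using h by (auto intro: DERIV_imp_deriv)
  then show "deriv g \<in> sums_of_products" using h by simp
qed

lemma smooth_mult: "smooth f \<Longrightarrow> smooth g \<Longrightarrow> smooth (\<lambda>x. f x * g x)"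
  by (rule sums_of_products_smooth[OF sums_of_products.prod])

lemma smooth_cmult: "smooth f \<Longrightarrow> smooth (\<lambda>x. c * f x)"
  by (intro smooth_mult smooth_const)

lemma smooth_add:
  assumes "smooth f" "smooth g" shows "smooth (\<lambda>x. f x + g x)"
proof -
  have "(\<lambda>x. f x * 1 + g x * 1) \<in> sums_of_products"
    by (intro sums_of_products.intros assms smooth_const)
  then show ?thesis using sums_of_products_smooth by simp
qed

lemma smooth_uminus: "smooth f \<Longrightarrow> smooth (\<lambda>x. - f x)"
  using smooth_cmult[of f "-1"] by simp

lemma smooth_diff: "smooth f \<Longrightarrow> smooth g \<Longrightarrow> smooth (\<lambda>x. f x - g x)"
  using smooth_add[of f "\<lambda>x. - g x"] smooth_uminus[of g] by simp

lemma has_deriv_affine: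
  assumes "smooth f"
  shows "((\<lambda>x. f (a * x + b)) has_real_derivative a * deriv f (a * x + b)) (at x)"
proof -
  have "((\<lambda>x. f (a * x + b)) has_real_derivative deriv f (a * x + b) * a) (at x)"
    by (rule DERIV_chain'[where f="\<lambda>x. a * x + b" and g=f])
       (auto intro!: derivative_eq_intros smooth_has_deriv[OF assms])
  then show ?thesis by (simp add: mult.commute)
qed

lemma smooth_affine: "smooth f \<Longrightarrow> smooth (\<lambda>x. f (a * x + b))"
proof (rule smooth_coinduct[of _ "{(\<lambda>x. c * f (a * x + b)) | c f. smooth f}"])
  show "smooth f \<Longrightarrow> (\<lambda>x. f (a * x + b)) \<in> {(\<lambda>x. c * f (a * x + b)) | c f. smooth f}"
    by (auto intro!: exI[of _ 1] exI[of _ f])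
  fix g x assume "g \<in> {(\<lambda>x. c * f (a * x + b)) | c f. smooth f}"
  then obtain c f where g: "g = (\<lambda>x. c * f (a * x + b))" and f: "smooth f" by blast
  have d: "(g has_real_derivative (c * a) * deriv f (a * x + b)) (at x)" for x
    unfolding g using DERIV_cmult[OF has_deriv_affine[OF f, of a b x], of c] by (simp add: mult.assoc)
  then show "g differentiable (at x)" by (auto simp: real_differentiable_def)
  have "deriv g = (\<lambda>x. (c * a) * deriv f (a * x + b))" using d by (auto intro: DERIV_imp_deriv)
  then show "deriv g \<in> {(\<lambda>x. c * f (a * x + b)) | c f. smooth f}"
    using smooth_deriv[OF f] by blast
qed

text \<open>Closed under differentiation and containing \<open>exp (- 1 / x)\<close>, which is therefore smooth.\<close>

definition flat :: "real poly \<Rightarrow> real \<Rightarrow> real" where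
  "flat p x = (if x > 0 then poly p (1 / x) * exp (- (1 / x)) else 0)"

lemma tendsto_poly_exp: "((\<lambda>y. poly p y * exp (- y)) \<longlongrightarrow> (0::real)) at_top"
proof -
  have "((\<lambda>y. \<Sum>i\<le>degree p. coeff p i * (y ^ i / exp y)) \<longlongrightarrow> (\<Sum>i\<le>degree p. coeff p i * 0)) at_top"
    by (intro tendsto_sum tendsto_mult tendsto_const tendsto_power_div_exp_0)
  then show ?thesis
    by (simp add: poly_altdef sum_distrib_right exp_minus divide_inverse mult.assoc)
qed

text \<open>With y = 1 / x one has dy/dx = - y^2, and differentiating p(y) exp(-y) gives y^2 (p -
  p')(y) exp(-y), which is again of the same form; the factor \<open>[:0, 0, 1:]\<close> is y^2. At
  0 the right difference quotient is y p(y) exp(-y), which tends to 0 as y grows.\<close>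

lemma flat_deriv: "(flat p has_real_derivative flat ([:0, 0, 1:] * (p - pderiv p)) x) (at x)"
proof -
  let ?q = "[:0, 0, 1:] * (p - pderiv p)"
  consider "x > 0" | "x < 0" | "x = 0" by linarith
  then show ?thesis
  proof cases
    case 1
    have "((\<lambda>x. poly p (1 / x) * exp (- (1 / x))) has_real_derivative flat ?q x) (at x)"
      using 1 by (auto intro!: derivative_eq_intros DERIV_chain'[OF _ poly_DERIV] simp: flat_def field_simps power2_eq_square)
    then show ?thesis
      by (rule has_field_derivative_transform_within_open[of _ _ _ "{0<..}"]) (use 1 in \<open>auto simp: flat_def\<close>)
  next
    case 2
    have "((\<lambda>x. 0) has_real_derivative flat ?q x) (at x)"
      using 2 by (auto simp: flat_def)
    then show ?thesis
      by (rule has_field_derivative_transform_within_open[of _ _ _ "{..<0}"]) (use 2 in \<open>auto simp: flat_def\<close>)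
  next
    case 3
    have r: "((\<lambda>h. flat p h / h) \<longlongrightarrow> 0) (at_right 0)"
    proof -
      have "((\<lambda>y. poly ([:0, 1:] * p) y * exp (- y)) \<longlongrightarrow> 0) at_top" by (rule tendsto_poly_exp)
      then have "((\<lambda>h. poly ([:0, 1:] * p) (inverse h) * exp (- inverse h)) \<longlongrightarrow> 0) (at_right 0)"
        by (rule filterlim_compose[OF _ filterlim_inverse_at_top_right])
      moreover have "\<forall>\<^sub>F h in at_right 0. poly ([:0, 1:] * p) (inverse h) * exp (- inverse h) = flat p h / h"
        unfolding eventually_at_right_field by (intro exI[of _ 1]) (auto simp: flat_def field_simps)
      ultimately show ?thesis by (rule Lim_transform_eventually)
    qed
    have l: "((\<lambda>h. flat p h / h) \<longlongrightarrow> 0) (at_left 0)"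
      by (rule tendsto_eventually) (auto simp: eventually_at_left_field flat_def intro!: exI[of _ "-1"])
    have "((\<lambda>h. flat p h / h) \<longlongrightarrow> 0) (at 0)"
      using l r by (simp add: filterlim_split_at)
    then show ?thesis
      by (simp add: 3 DERIV_def flat_def[of _ 0])
  qed
qed

lemma smooth_flat: "smooth (flat p)"
proof (rule smooth_coinduct[of _ "range flat"])
  fix g x assume "g \<in> range flat"
  then obtain p where g: "g = flat p" by blast
  show "g differentiable (at x)" using flat_deriv[of p x] by (auto simp: g real_differentiable_def)
  have "deriv g = flat ([:0, 0, 1:] * (p - pderiv p))" using flat_deriv by (auto simp: g intro: DERIV_imp_deriv)
  then show "deriv g \<in> range flat" by simp
qed simp

section \<open>A bump function, a smooth density and a smooth step\<close>

definition bump :: "real \<Rightarrow> real" where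
  "bump x = flat 1 x * flat 1 (1 - x)"

lemma smooth_bump: "smooth bump"
  unfolding bump_def using smooth_affine[OF smooth_flat[of 1], of "-1" 1]
  by (intro smooth_mult smooth_flat) simp

lemma bump_pos: "0 < x \<Longrightarrow> x < 1 \<Longrightarrow> 0 < bump x"
  and bump_zero: "x \<le> 0 \<or> 1 \<le> x \<Longrightarrow> bump x = 0"
  and bump_nonneg: "0 \<le> bump x"
  by (auto simp: bump_def flat_def)

definition prim :: "(real \<Rightarrow> real) \<Rightarrow> real \<Rightarrow> real" where
  "prim f x = (LBINT y=0..x. f y)"

lemma prim_has_deriv:
  assumes "\<And>s. continuous_on s f"
  shows "(prim f has_real_derivative f x) (at x)"
proof -
  \<comment> \<open>An interval that contains 0 and has \<open>x\<close> in its interior, so that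
    the derivative within it is the full derivative.\<close>
  let ?a = "min x 0 - 1" and ?b = "max x 0 + 1"
  have "((\<lambda>u. LBINT y=0..u. f y) has_vector_derivative f x) (at x within {?a..?b})"
    using interval_integral_FTC2[of ?a 0 ?b f x] assms by (simp add: zero_ereal_def)
  then have "((\<lambda>u. LBINT y=0..u. f y) has_real_derivative f x) (at x within {?a..?b})"
    by (simp add: has_real_derivative_iff_has_vector_derivative)
  moreover have "at x within {?a..?b} = at x"
    by (rule at_within_interior) (auto simp: interior_atLeastAtMost_real)
  ultimately show ?thesis by (simp add: prim_def[abs_def])
qed

lemma smooth_prim: "smooth f \<Longrightarrow> smooth (prim f)"
  by (rule smooth_antideriv[OF prim_has_deriv]) (auto intro: smooth_continuous)

text \<open>A smooth transition from 0 on the nonpositive numbers to 1 beyond 1; its derivative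
  \<open>kern\<close> is a smooth probability density supported in the unit interval.\<close>

definition step :: "real \<Rightarrow> real" where
  "step x = prim bump x / prim bump 1"

definition kern :: "real \<Rightarrow> real" where
  "kern x = bump x / prim bump 1"

lemma has_deriv_zero_const_on:
  fixes f :: "real \<Rightarrow> real"
  assumes "\<And>x. (f has_real_derivative f' x) (at x)" "convex S" "\<And>x. x \<in> S \<Longrightarrow> f' x = 0" "x \<in> S" "y \<in> S"
  shows "f x = f y"
  using has_field_derivative_zero_constant[OF assms(2), of f] assms
  by (metis has_field_derivative_at_within)

lemma prim_bump_mono: "x \<le> y \<Longrightarrow> prim bump x \<le> prim bump y"
  by (rule DERIV_nonneg_imp_nondecreasing)
     (use prim_has_deriv[OF smooth_continuous[OF smooth_bump]] bump_nonneg in blast)+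

lemma prim_bump_neg: "x \<le> 0 \<Longrightarrow> prim bump x = 0"
  and prim_bump_ge1: "1 \<le> x \<Longrightarrow> prim bump x = prim bump 1"
proof -
  note d = prim_has_deriv[OF smooth_continuous[OF smooth_bump]]
  show "prim bump x = prim bump 1" if "1 \<le> x"
    by (rule has_deriv_zero_const_on[OF d, of "{1..}"]) (use that in \<open>auto simp: bump_zero\<close>)
  have "prim bump x = prim bump 0" if "x \<le> 0"
    by (rule has_deriv_zero_const_on[OF d, of "{..0}"]) (use that in \<open>auto simp: bump_zero\<close>)
  moreover have "prim bump 0 = 0" by (simp add: prim_def zero_ereal_def[symmetric])
  ultimately show "prim bump x = 0" if "x \<le> 0" using that by simp
qed

lemma prim_bump_1_pos: "0 < prim bump 1"
proof -
  note d = prim_has_deriv[OF smooth_continuous[OF smooth_bump]]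
  have "prim bump 0 < prim bump 1"
    by (rule DERIV_pos_imp_increasing_open)
       (use d bump_pos in \<open>auto intro!: smooth_continuous[OF smooth_prim[OF smooth_bump]]\<close>)
  then show ?thesis by (simp add: prim_bump_neg)
qed

lemma smooth_step: "smooth step"
  unfolding step_def using smooth_cmult[OF smooth_prim[OF smooth_bump], of "inverse (prim bump 1)"]
  by (simp add: divide_inverse mult.commute)

lemma smooth_kern: "smooth kern"
  unfolding kern_def using smooth_cmult[OF smooth_bump, of "inverse (prim bump 1)"]
  by (simp add: divide_inverse mult.commute)

lemma step_has_deriv: "(step has_real_derivative kern x) (at x)"
  unfolding step_def kern_def by (intro DERIV_cdivide prim_has_deriv smooth_continuous smooth_bump)

lemma deriv_step: "deriv step = kern"
  using step_has_deriv by (auto intro: DERIV_imp_deriv)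

lemma step_nonpos: "x \<le> 0 \<Longrightarrow> step x = 0"
  and step_ge1: "1 \<le> x \<Longrightarrow> step x = 1"
  using prim_bump_1_pos prim_bump_neg[of x] prim_bump_ge1[of x] by (auto simp: step_def)

lemma step_bounds: "0 \<le> step x" "step x \<le> 1"
proof -
  have "step x \<ge> step (min x 0)" "step x \<le> step (max x 1)"
    using prim_bump_1_pos by (auto simp: step_def intro!: divide_right_mono prim_bump_mono)
  then show "0 \<le> step x" "step x \<le> 1" by (auto simp: step_nonpos step_ge1)
qed

lemma kern_nonneg: "0 \<le> kern x"
  and kern_zero: "x \<le> 0 \<or> 1 \<le> x \<Longrightarrow> kern x = 0"
  using prim_bump_1_pos by (auto simp: kern_def bump_zero bump_nonneg)

section \<open>Test functions on the line\<close>

lemma test1_kern: "test1 kern"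
  unfolding test1_smooth by (intro conjI smooth_kern exI[of _ 1]) (auto intro!: kern_zero)

lemma test1_support:
  assumes "test1 f" obtains R where "R > 0" "\<And>x. \<bar>x\<bar> \<ge> R \<Longrightarrow> f x = 0"
proof -
  obtain R where "\<And>x. \<bar>x\<bar> > R \<Longrightarrow> f x = 0" using assms by (auto simp: test1_def)
  then show ?thesis using that[of "\<bar>R\<bar> + 1"] by auto
qed

lemma deriv_eq_0_outside:
  assumes "\<And>x. \<bar>x\<bar> > R \<Longrightarrow> f x = (0::real)" "\<bar>x\<bar> > R"
  shows "deriv f x = 0"
proof -
  have "open {x. R < \<bar>x::real\<bar>}" by (intro open_Collect_less continuous_intros)
  then have "(f has_real_derivative 0) (at x)"
    using has_field_derivative_transform_within_open[of "\<lambda>x. 0" 0 x "{x. R < \<bar>x\<bar>}" f] assms by auto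
  then show ?thesis by (rule DERIV_imp_deriv)
qed

lemma test1_deriv: "test1 f \<Longrightarrow> test1 (deriv f)"
  unfolding test1_smooth using deriv_eq_0_outside[of _ f] by (blast intro: smooth_deriv)

lemma test1_mult: "smooth f \<Longrightarrow> test1 g \<Longrightarrow> test1 (\<lambda>x. f x * g x)"
  unfolding test1_smooth using smooth_mult[of f g] by fastforce

lemma test1_cmult: "test1 g \<Longrightarrow> test1 (\<lambda>x. c * g x)"
  by (rule test1_mult[OF smooth_const])

lemma test1_add: "test1 f \<Longrightarrow> test1 g \<Longrightarrow> test1 (\<lambda>x. f x + g x)"
  unfolding test1_smooth
proof safe
  fix R S assume "\<forall>x. R < \<bar>x\<bar> \<longrightarrow> f x = 0" "\<forall>x. S < \<bar>x\<bar> \<longrightarrow> g x = 0"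
  then show "\<exists>R. \<forall>x. R < \<bar>x\<bar> \<longrightarrow> f x + g x = 0"
    by (intro exI[of _ "max R S"]) auto
qed (rule smooth_add)

lemma test1_uminus: "test1 f \<Longrightarrow> test1 (\<lambda>x. - f x)"
  using test1_cmult[of f "-1"] by simp

lemma test1_diff: "test1 f \<Longrightarrow> test1 g \<Longrightarrow> test1 (\<lambda>x. f x - g x)"
  using test1_add[of f "\<lambda>x. - g x"] test1_uminus[of g] by simp

lemma test1_0 [simp]: "test1 (\<lambda>x. 0)"
  by (auto simp: test1_smooth)

lemma test1_affine:
  assumes "test1 f" "a \<noteq> 0" shows "test1 (\<lambda>x. f (a * x + b))"
proof -
  obtain R where R: "R > 0" "\<And>x. \<bar>x\<bar> \<ge> R \<Longrightarrow> f x = 0" using test1_support[OF assms(1)] by blast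
  have "f (a * x + b) = 0" if "(R + \<bar>b\<bar>) / \<bar>a\<bar> < \<bar>x\<bar>" for x
  proof (rule R(2))
    have "R + \<bar>b\<bar> < \<bar>a * x\<bar>" using that assms(2) by (simp add: field_simps abs_mult)
    then show "R \<le> \<bar>a * x + b\<bar>" by linarith
  qed
  then show ?thesis using assms(1) unfolding test1_smooth by (blast intro: smooth_affine)
qed

lemma test1_has_deriv: "test1 f \<Longrightarrow> (f has_real_derivative deriv f x) (at x within s)"
  by (simp add: test1_smooth smooth_has_deriv)

lemma test1_continuous: "test1 f \<Longrightarrow> continuous_on s f"
  by (simp add: test1_smooth smooth_continuous)

lemma test1_measurable [measurable_dest]: "test1 f \<Longrightarrow> f \<in> borel_measurable borel"
  by (simp add: test1_smooth smooth_measurable)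

lemma test1_bounded:
  assumes "test1 f" obtains K where "K > 0" "\<And>x. \<bar>f x\<bar> \<le> K"
proof -
  obtain R where R: "R > 0" "\<And>x. \<bar>x\<bar> \<ge> R \<Longrightarrow> f x = 0" using test1_support[OF assms(1)] by blast
  have "compact (f ` {-R..R})" by (intro compact_continuous_image test1_continuous assms) auto
  then obtain B where B: "\<And>y. y \<in> f ` {-R..R} \<Longrightarrow> \<bar>y\<bar> \<le> B"
    by (metis compact_imp_bounded bounded_iff real_norm_def)
  have "\<bar>f x\<bar> \<le> \<bar>B\<bar> + 1" for x
  proof (cases "\<bar>x\<bar> \<le> R")
    case True
    then have "\<bar>f x\<bar> \<le> B" by (intro B) (auto simp: abs_le_iff)
    then show ?thesis by linarith
  next
    case False
    then show ?thesis using R(2)[of x] by simp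
  qed
  then show ?thesis using that[of "\<bar>B\<bar> + 1"] by simp
qed


section \<open>Test functions are dense in the Hilbert space\<close>

lemma L2_bounded_support:
  assumes [measurable]: "f \<in> borel_measurable lborel"
    and K: "\<And>x. cmod (f x) \<le> K" and R: "\<And>x. x < a \<or> b < x \<Longrightarrow> f x = 0" and "a \<le> b"
  shows "L2 f" "norm (cl f) \<le> K * sqrt (b - a)"
proof -
  have K0: "0 \<le> K" using K[of 0] norm_ge_zero[of "f 0"] by linarith
  have le: "(cmod (f x))\<^sup>2 \<le> K\<^sup>2 * indicator {a..b} x" for x
    using K[of x] R[of x] by (auto simp: indicator_def intro: power_mono)
  have int: "integrable lborel (\<lambda>x. K\<^sup>2 * indicator {a..b} x)"
    by (intro integrable_mult_right integrable_real_indicator) (auto simp: emeasure_lborel_Icc_eq)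
  show L: "L2 f" by (rule L2I[OF assms(1) int le])
  have "l2sq f \<le> (\<integral>x. K\<^sup>2 * indicator {a..b} x \<partial>lborel)"
    unfolding l2sq_def by (intro integral_mono L2_integrable L int le)
  also have "\<dots> = K\<^sup>2 * (b - a)" using \<open>a \<le> b\<close> by simp
  finally have "norm (cl f) \<le> sqrt (K\<^sup>2 * (b - a))" using L by (simp add: norm_cl)
  also have "\<dots> = K * sqrt (b - a)" using K0 by (simp add: real_sqrt_mult)
  finally show "norm (cl f) \<le> K * sqrt (b - a)" .
qed

lemma L2_dominated_convergence:
  assumes f: "\<And>n. L2 (f n)" and g: "g \<in> borel_measurable lborel" and h: "L2 h"
    and lim: "AE x in lborel. (\<lambda>n. f n x) \<longlonglongrightarrow> g x"
    and le: "\<And>n x. cmod (f n x) \<le> cmod (h x)"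
  shows "L2 g" "(\<lambda>n. cl (f n)) \<longlonglongrightarrow> cl g"
proof -
  note [measurable] = g L2_measurable[OF f] L2_measurable[OF h]
  have ae: "AE x in lborel. cmod (g x) \<le> cmod (h x)"
    using lim by eventually_elim (rule Lim_bounded[OF tendsto_norm], auto intro: le)
  show L: "L2 g" unfolding L2_def
    by (rule conjI[OF g], rule Bochner_Integration.integrable_bound[OF L2_integrable[OF h]])
       (use ae in \<open>auto intro: power_mono\<close>)
  have "(\<lambda>n. \<integral>x. (cmod (f n x - g x))\<^sup>2 \<partial>lborel) \<longlonglongrightarrow> (\<integral>x. 0 \<partial>(lborel :: real measure))"
  proof (rule integral_dominated_convergence)
    show "integrable lborel (\<lambda>x. 2 * (cmod (h x))\<^sup>2 + 2 * (cmod (h x))\<^sup>2)"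
      using L2_integrable[OF h] by auto
    show "AE x in lborel. (\<lambda>n. (cmod (f n x - g x))\<^sup>2) \<longlonglongrightarrow> 0"
      using lim by eventually_elim (auto intro!: tendsto_eq_intros)
    show "AE x in lborel. norm ((cmod (f n x - g x))\<^sup>2) \<le> 2 * (cmod (h x))\<^sup>2 + 2 * (cmod (h x))\<^sup>2" for n
      using ae
    proof eventually_elim
      case (elim x)
      have "(cmod (f n x - g x))\<^sup>2 \<le> 2 * (cmod (f n x))\<^sup>2 + 2 * (cmod (g x))\<^sup>2"
        using sq_norm_add_le[of "f n x" "- g x"] by simp
      also have "\<dots> \<le> 2 * (cmod (h x))\<^sup>2 + 2 * (cmod (h x))\<^sup>2"
        using elim le[of n x] by (intro add_mono mult_left_mono power_mono) auto
      finally show ?case by simp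
    qed
  qed auto
  moreover have "(\<integral>x. (cmod (f n x - g x))\<^sup>2 \<partial>lborel) = (norm (cl (f n) - cl g))\<^sup>2" for n
    using f L by (simp add: cl_diff norm_cl_sq L2_diff l2sq_def)
  ultimately have "(\<lambda>n. (norm (cl (f n) - cl g))\<^sup>2) \<longlonglongrightarrow> 0" by simp
  then have "(\<lambda>n. sqrt ((norm (cl (f n) - cl g))\<^sup>2)) \<longlonglongrightarrow> sqrt 0" by (rule tendsto_real_sqrt)
  then show "(\<lambda>n. cl (f n)) \<longlonglongrightarrow> cl g"
    by (simp add: tendsto_norm_zero_iff LIM_zero_iff)
qed

text \<open>A complex test function assembled from two real ones, since only real test functions
  occur in the weak formulation. Under the real inner product the pairs \<open>(a, 0)\<close> and
  \<open>(0, a)\<close> extract the real and the imaginary part of the integral of f against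
  \<open>a\<close>.\<close>

definition cpl :: "(real \<Rightarrow> real) \<Rightarrow> (real \<Rightarrow> real) \<Rightarrow> real \<Rightarrow> complex" where
  "cpl a b x = Complex (a x) (b x)"

lemma cpl_eq: "cpl a b x = complex_of_real (a x) + \<i> * complex_of_real (b x)"
  by (simp add: cpl_def complex_eq_iff)

lemma cpl_measurable:
  assumes [measurable]: "a \<in> borel_measurable borel" "b \<in> borel_measurable borel"
  shows "cpl a b \<in> borel_measurable lborel"
  unfolding cpl_eq[abs_def] by measurable

lemma L2_cpl:
  assumes "test1 a" "test1 b" shows "L2 (cpl a b)"
proof -
  obtain R where R: "R > 0" "\<And>x. \<bar>x\<bar> \<ge> R \<Longrightarrow> a x = 0" using test1_support[OF assms(1)] by blast
  obtain S where S: "S > 0" "\<And>x. \<bar>x\<bar> \<ge> S \<Longrightarrow> b x = 0" using test1_support[OF assms(2)] by blast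
  obtain K where K: "K > 0" "\<And>x. \<bar>a x\<bar> \<le> K" using test1_bounded[OF assms(1)] by blast
  obtain L where L: "L > 0" "\<And>x. \<bar>b x\<bar> \<le> L" using test1_bounded[OF assms(2)] by blast
  show ?thesis
  proof (rule L2_bounded_support(1)[where K="K + L" and a="- max R S" and b="max R S"])
    show "cpl a b \<in> borel_measurable lborel"
      using assms by (intro cpl_measurable test1_measurable)
    show "cmod (cpl a b x) \<le> K + L" for x
      using cmod_le[of "cpl a b x"] K(2)[of x] L(2)[of x] by (simp add: cpl_def)
    show "cpl a b x = 0" if "x < - max R S \<or> max R S < x" for x
      using that R(2)[of x] S(2)[of x] by (auto simp: cpl_def zero_complex.code)
  qed (use R S in auto)
qed

definition testcl :: "l2 set" where
  "testcl = {cl (cpl a b) | a b. test1 a \<and> test1 b}"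

lemma testclI: "test1 a \<Longrightarrow> test1 b \<Longrightarrow> cl (cpl a b) \<in> testcl"
  by (auto simp: testcl_def)

lemma subspace_testcl: "subspace testcl"
  unfolding subspace_def
proof (intro conjI ballI allI)
  show "0 \<in> testcl"
    using testclI[of "\<lambda>x. 0" "\<lambda>x. 0"] by (simp add: cl_zero cpl_def[abs_def] zero_complex.code)
  fix f g assume "f \<in> testcl" "g \<in> testcl"
  then obtain a b a' b' where *: "f = cl (cpl a b)" "g = cl (cpl a' b')" "test1 a" "test1 b" "test1 a'" "test1 b'"
    by (auto simp: testcl_def)
  then have "f + g = cl (cpl (\<lambda>x. a x + a' x) (\<lambda>x. b x + b' x))"
    by (simp add: cl_add L2_cpl) (simp add: cpl_def[abs_def] plus_complex.code)
  then show "f + g \<in> testcl" using * by (auto intro!: testclI test1_add)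
next
  fix c f assume "f \<in> testcl"
  then obtain a b where *: "f = cl (cpl a b)" "test1 a" "test1 b" by (auto simp: testcl_def)
  then have "c *\<^sub>R f = cl (cpl (\<lambda>x. c * a x) (\<lambda>x. c * b x))"
    by (simp add: cl_scaleR L2_cpl) (simp add: cpl_def[abs_def] complex_scaleR)
  then show "c *\<^sub>R f \<in> testcl" using * by (auto intro!: testclI test1_cmult)
qed

lemma closed_subspace_closure: "subspace (closure testcl)"
proof (rule subspaceI)
  show "0 \<in> closure testcl" using subspace_0[OF subspace_testcl] closure_subset by blast
  fix f g assume "f \<in> closure testcl" "g \<in> closure testcl"
  then obtain F G where "\<And>n. F n \<in> testcl" "\<And>n. G n \<in> testcl" "F \<longlonglongrightarrow> f" "G \<longlonglongrightarrow> g"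
    by (auto simp: closure_sequential)
  then show "f + g \<in> closure testcl"
    unfolding closure_sequential
    by (intro exI[of _ "\<lambda>n. F n + G n"]) (auto intro: tendsto_add subspace_add[OF subspace_testcl])
next
  fix c f assume "f \<in> closure testcl"
  then obtain F where "\<And>n. F n \<in> testcl" "F \<longlonglongrightarrow> f"
    by (auto simp: closure_sequential)
  then show "c *\<^sub>R f \<in> closure testcl"
    unfolding closure_sequential
    by (intro exI[of _ "\<lambda>n. c *\<^sub>R F n"]) (auto intro: tendsto_scaleR subspace_scale[OF subspace_testcl])
qed

lemma plateau_test1:
  assumes "0 < e" shows "test1 (\<lambda>x. step ((x - a) / e) - step ((x - b) / e))"
  unfolding test1_smooth
proof (intro conjI exI allI impI)
  have "smooth (\<lambda>x. step ((x - c) / e))" for c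
    using smooth_affine[OF smooth_step, of "1/e" "- c / e"] by (simp add: diff_divide_distrib)
  then show "smooth (\<lambda>x. step ((x - a) / e) - step ((x - b) / e))" by (intro smooth_diff)
  show "step ((x - a) / e) - step ((x - b) / e) = 0" if "\<bar>x\<bar> > \<bar>a\<bar> + \<bar>b\<bar> + e" for x
  proof (cases "x > 0")
    case True
    then have "1 \<le> (x - a) / e" "1 \<le> (x - b) / e" using that \<open>0 < e\<close> by (auto simp: field_simps)
    then show ?thesis by (simp add: step_ge1)
  next
    case False
    then have "(x - a) / e \<le> 0" "(x - b) / e \<le> 0" using that \<open>0 < e\<close> by (auto simp: field_simps)
    then show ?thesis by (simp add: step_nonpos)
  qed
qed

text \<open>Because \<open>step\<close> vanishes at 0, the limit is the indicator of an open ray.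
  Differences of two such limits are indicators of half-open intervals, which form an intersection
  stable generator of the Borel sets.\<close>

lemma step_tendsto:
  "(\<lambda>n. step ((x - a) * real (Suc n))) \<longlonglongrightarrow> indicator {a<..} x"
proof (cases "x > a")
  case True
  obtain N where N: "1 / (x - a) < real N" using reals_Archimedean2 by blast
  have "step ((x - a) * real (Suc n)) = indicator {a<..} x" if "n \<ge> N" for n
  proof -
    have "1 / (x - a) \<le> real (Suc n)" using N that by simp
    then have "1 \<le> (x - a) * real (Suc n)" using True by (simp add: field_simps)
    then show ?thesis using True by (simp add: step_ge1)
  qed
  then show ?thesis by (intro tendsto_eventually) (auto simp: eventually_sequentially)
next
  case False
  then have "step ((x - a) * real (Suc n)) = 0" for n
    by (intro step_nonpos mult_nonpos_nonneg) auto
  then show ?thesis using False by simp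
qed

lemma interval_in_closure:
  assumes "a \<le> b"
  shows "cl (\<lambda>x. c * indicator {a<..b} x) \<in> closure testcl"
proof -
  define s where "s n x = step ((x - a) * real (Suc n)) - step ((x - b) * real (Suc n))" for n x
  have t: "test1 (s n)" for n
    using plateau_test1[of "1 / real (Suc n)" a b] by (simp add: s_def[abs_def])
  have sb: "\<bar>s n x\<bar> \<le> 1" for n x
    using step_bounds[of "(x - a) * real (Suc n)"] step_bounds[of "(x - b) * real (Suc n)"] by (auto simp: s_def)
  have s0: "s n x = 0" if "x < a \<or> b + 1 < x" for n x
  proof -
    from that show ?thesis
    proof
      assume "x < a"
      then have "(x - a) * real (Suc n) \<le> 0" "(x - b) * real (Suc n) \<le> 0"
        using assms by (auto intro!: mult_nonpos_nonneg)
      then show ?thesis by (simp add: s_def step_nonpos)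
    next
      assume "b + 1 < x"
      then have "1 \<le> (x - a) * real (Suc n)" "1 \<le> (x - b) * real (Suc n)"
        using assms mult_mono[of 1 "x - a" 1 "real (Suc n)"] mult_mono[of 1 "x - b" 1 "real (Suc n)"] by auto
      then show ?thesis by (simp add: s_def step_ge1)
    qed
  qed
  let ?f = "\<lambda>n x. c * complex_of_real (s n x)"
  have eq: "?f n = cpl (\<lambda>x. Re c * s n x) (\<lambda>x. Im c * s n x)" for n
    by (auto simp: cpl_def complex_eq_iff)
  have mem: "cl (?f n) \<in> testcl" for n
    unfolding eq by (intro testclI test1_cmult t)
  have L: "L2 (?f n)" for n
    unfolding eq by (intro L2_cpl test1_cmult t)
  have "(\<lambda>n. cl (?f n)) \<longlonglongrightarrow> cl (\<lambda>x. c * indicator {a<..b} x)"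
  proof (rule L2_dominated_convergence(2)[OF L])
    show "L2 (\<lambda>x. c * indicator {a..b+1} x)"
      by (rule L2_bounded_support(1)[where K="cmod c" and a=a and b="b+1"])
         (use assms in \<open>auto simp: indicator_def\<close>)
    show "AE x in lborel. (\<lambda>n. ?f n x) \<longlonglongrightarrow> c * indicator {a<..b} x"
    proof (rule AE_I2)
      fix x
      have "(\<lambda>n. s n x) \<longlonglongrightarrow> indicator {a<..} x - indicator {b<..} x"
        unfolding s_def by (intro tendsto_diff step_tendsto)
      moreover have "indicator {a<..} x - indicator {b<..} x = (indicator {a<..b} x :: real)"
        using assms by (auto simp: indicator_def)
      ultimately have "(\<lambda>n. ?f n x) \<longlonglongrightarrow> c * complex_of_real (indicator {a<..b} x)"
        by (intro tendsto_mult tendsto_const tendsto_of_real) simp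
      then show "(\<lambda>n. ?f n x) \<longlonglongrightarrow> c * indicator {a<..b} x"
        by (simp add: of_real_indicator)
    qed
    show "cmod (?f n x) \<le> cmod (c * indicator {a..b+1} x)" for n x
      using sb[of n x] s0[of x n] mult_left_mono[OF sb[of n x] norm_ge_zero[of c]]
      by (auto simp: norm_mult indicator_def)
  qed simp
  then show ?thesis
    unfolding closure_sequential using mem by (intro exI[of _ "\<lambda>n. cl (?f n)"]) auto
qed

text \<open>Induction over the Borel sets as a Dynkin system generated by half-open intervals.
  Everything is intersected with one bounded interval, since otherwise the step to complements would
  leave L2; disjoint unions are dominated limits of finite ones.\<close>

lemma borel_set_in_closure:
  assumes "A \<in> sets borel" "a \<le> b"
  shows "cl (\<lambda>x. c * indicator (A \<inter> {a<..b}) x) \<in> closure testcl"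
proof -
  have b: "sets borel = sigma_sets UNIV (range (\<lambda>(a, b). {a<..b::real}))"
    by (subst borel_sigma_sets_Ioc) (simp add: sets_measure_of_conv)
  have Lb: "L2 (\<lambda>x. c * indicator (A \<inter> {a<..b}) x)" if "A \<in> sets borel" for A
    by (rule L2_bounded_support(1)[where K="cmod c" and a=a and b=b])
       (use assms that in \<open>auto simp: indicator_def\<close>)
  have I: "Int_stable (range (\<lambda>(a, b). {a<..b::real}))"
    by (auto simp: Int_stable_def)
  have P: "range (\<lambda>(a, b). {a<..b::real}) \<subseteq> Pow UNIV" by simp
  from I P assms(1)[unfolded b] show ?thesis
  proof (induction rule: sigma_sets_induct_disjoint)
    case (basic A)
    then obtain l u where A: "A = {l<..u}" by auto
    show ?case
    proof (cases "max l a \<le> min u b")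
      case True
      then show ?thesis unfolding A Int_greaterThanAtMost by (rule interval_in_closure)
    next
      case False
      then have "A \<inter> {a<..b} = {}" by (auto simp: A)
      then show ?thesis using subspace_0[OF closed_subspace_closure] by (simp add: cl_zero)
    qed
  next
    case empty
    then show ?case using subspace_0[OF closed_subspace_closure] by (simp add: cl_zero)
  next
    case (compl A)
    have A: "A \<in> sets borel" using compl b by simp
    have "cl (\<lambda>x. c * indicator {a<..b} x) - cl (\<lambda>x. c * indicator (A \<inter> {a<..b}) x) \<in> closure testcl"
      by (intro subspace_diff closed_subspace_closure compl interval_in_closure assms)
    moreover have "L2 (\<lambda>x. c * indicator {a<..b} x)" using Lb[of UNIV] by simp
    ultimately have "cl (\<lambda>x. c * indicator {a<..b} x - c * indicator (A \<inter> {a<..b}) x) \<in> closure testcl"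
      using Lb[OF A] by (simp add: cl_diff)
    moreover have "(\<lambda>x. c * indicator {a<..b} x - c * indicator (A \<inter> {a<..b}) x) = (\<lambda>x. c * indicator ((UNIV - A) \<inter> {a<..b}) x)"
      by (auto simp: indicator_def)
    ultimately show ?case by simp
  next
    case (union A)
    have A: "A i \<in> sets borel" for i using union(2) b by auto
    have part: "cl (\<lambda>x. c * indicator ((\<Union>i<n. A i) \<inter> {a<..b}) x) \<in> closure testcl" for n :: nat
    proof (induction n)
      case 0
      then show ?case using subspace_0[OF closed_subspace_closure] by (simp add: cl_zero)
    next
      case (Suc n)
      have "x \<notin> A i" if "x \<in> A n" "i < n" for x i
        using union(1) that by (auto simp: disjoint_family_on_def) (metis disjoint_iff less_irrefl)
      then have eq: "(\<lambda>x. c * indicator ((\<Union>i<Suc n. A i) \<inter> {a<..b}) x)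
          = (\<lambda>x. c * indicator ((\<Union>i<n. A i) \<inter> {a<..b}) x + c * indicator (A n \<inter> {a<..b}) x)"
        by (intro ext) (auto simp: indicator_def lessThan_Suc)
      show ?case unfolding eq
        using subspace_add[OF closed_subspace_closure Suc union(3)[of n]] A by (simp add: cl_add Lb)
    qed
    have "(\<lambda>n. cl (\<lambda>x. c * indicator ((\<Union>i<n. A i) \<inter> {a<..b}) x)) \<longlonglongrightarrow> cl (\<lambda>x. c * indicator ((\<Union>i. A i) \<inter> {a<..b}) x)"
    proof (rule L2_dominated_convergence(2))
      show "L2 (\<lambda>x. c * indicator ((\<Union>i<n. A i) \<inter> {a<..b}) x)" for n using A by (intro Lb) auto
      show "L2 (\<lambda>x. c * indicator (UNIV \<inter> {a<..b}) x)" by (intro Lb) auto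
      show "(\<lambda>x. c * indicator ((\<Union>i. A i) \<inter> {a<..b}) x) \<in> borel_measurable lborel" using A by measurable
      have "(\<lambda>n. indicator ((\<Union>i<n. A i) \<inter> {a<..b}) x :: complex) \<longlonglongrightarrow> indicator ((\<Union>i. A i) \<inter> {a<..b}) x" for x
      proof (rule tendsto_eventually)
        show "\<forall>\<^sub>F n in sequentially. indicator ((\<Union>i<n. A i) \<inter> {a<..b}) x = (indicator ((\<Union>i. A i) \<inter> {a<..b}) x :: complex)"
        proof (cases "x \<in> (\<Union>i. A i)")
          case True
          then obtain i where "x \<in> A i" by auto
          then show ?thesis by (auto simp: eventually_sequentially indicator_def intro!: exI[of _ "Suc i"])
        qed (auto simp: indicator_def)
      qed
      then show "AE x in lborel. (\<lambda>n. c * indicator ((\<Union>i<n. A i) \<inter> {a<..b}) x) \<longlonglongrightarrow> c * indicator ((\<Union>i. A i) \<inter> {a<..b}) x"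
        by (intro AE_I2 tendsto_mult tendsto_const)
    qed (auto simp: indicator_def)
    then show ?case
      by (rule closed_sequentially[OF closed_closure part])
  qed
qed

text \<open>Density climbs from bounded Borel sets to simple functions and from there, by dominated
  convergence, to all of L2. The truncation to \<open>{- real n<..real n}\<close> comes first
  because level sets of a simple function may have infinite measure.\<close>

theorem tests_dense: "closure testcl = UNIV"
proof -
  have "F \<in> closure testcl" for F
  proof -
    obtain f where f: "L2 f" "F = cl f" by (rule l2_cases)
    note [measurable] = L2_measurable[OF f(1)]
    have trunc: "cl (\<lambda>x. f x * indicator {- real n<..real n} x) \<in> closure testcl" for n
    proof -
      obtain s where s: "\<And>i. simple_function lborel (s i)" "\<And>x. (\<lambda>i. s i x) \<longlonglongrightarrow> f x"
        "\<And>i x. dist (s i x) 0 \<le> 2 * dist (f x) 0"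
        using borel_measurable_implies_sequence_metric[of f lborel 0] by auto
      note [measurable] = borel_measurable_simple_function[OF s(1)]
      have L: "L2 (\<lambda>x. s i x * indicator {- real n<..real n} x)" for i
      proof (rule L2_dominated[OF _ L2_cmult[OF f(1), of 2]])
        show "cmod (s i x * indicator {- real n<..real n} x) \<le> cmod (2 * f x)" for x
          using s(3)[of i x] by (auto simp: indicator_def norm_mult)
      qed measurable
      have mem: "cl (\<lambda>x. s i x * indicator {- real n<..real n} x) \<in> closure testcl" for i
      proof -
        have fin: "finite (range (s i))" using s(1)[of i] by (simp add: simple_function_def)
        have A: "s i -` {y} \<in> sets borel" if "y \<in> range (s i)" for y
          using s(1)[of i] that by (auto simp: simple_function_def)
        have sum_mem: "finite Y \<Longrightarrow> Y \<subseteq> range (s i) \<Longrightarrow>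
            L2 (\<lambda>x. \<Sum>y\<in>Y. y * indicator (s i -` {y} \<inter> {- real n<..real n}) x) \<and>
            cl (\<lambda>x. \<Sum>y\<in>Y. y * indicator (s i -` {y} \<inter> {- real n<..real n}) x) \<in> closure testcl" for Y
        proof (induction Y rule: finite_induct)
          case empty
          then show ?case using subspace_0[OF closed_subspace_closure] by (simp add: cl_zero)
        next
          case (insert y Y)
          have "L2 (\<lambda>x. y * indicator (s i -` {y} \<inter> {- real n<..real n}) x)"
            by (rule L2_bounded_support(1)[where K="cmod y" and a="-real n" and b="real n"])
               (use A[of y] insert in \<open>auto simp: indicator_def\<close>)
          moreover have "cl (\<lambda>x. y * indicator (s i -` {y} \<inter> {- real n<..real n}) x) \<in> closure testcl"
            by (rule borel_set_in_closure[OF A]) (use insert in auto)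
          moreover have "(\<lambda>x. \<Sum>y\<in>insert y Y. y * indicator (s i -` {y} \<inter> {- real n<..real n}) x)
            = (\<lambda>x. y * indicator (s i -` {y} \<inter> {- real n<..real n}) x
                + (\<Sum>y\<in>Y. y * indicator (s i -` {y} \<inter> {- real n<..real n}) x))"
            by (rule ext, rule sum.insert) (use insert in auto)
          moreover have "L2 (\<lambda>x. \<Sum>y\<in>Y. y * indicator (s i -` {y} \<inter> {- real n<..real n}) x)"
            "cl (\<lambda>x. \<Sum>y\<in>Y. y * indicator (s i -` {y} \<inter> {- real n<..real n}) x) \<in> closure testcl"
            using insert by auto
          ultimately show ?case
            using subspace_add[OF closed_subspace_closure] by (simp only: cl_add[symmetric] L2_add)
        qed
        have "(\<lambda>x. \<Sum>y\<in>range (s i). y * indicator (s i -` {y} \<inter> {- real n<..real n}) x)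
            = (\<lambda>x. s i x * indicator {- real n<..real n} x)"
        proof
          fix x
          have "(\<Sum>y\<in>range (s i). y * indicator (s i -` {y} \<inter> {- real n<..real n}) x)
              = (\<Sum>y\<in>range (s i). if y = s i x then y * indicator {- real n<..real n} x else 0)"
            by (rule sum.cong) (auto simp: indicator_def)
          also have "\<dots> = s i x * indicator {- real n<..real n} x"
            using fin by (simp add: sum.delta)
          finally show "(\<Sum>y\<in>range (s i). y * indicator (s i -` {y} \<inter> {- real n<..real n}) x) = s i x * indicator {- real n<..real n} x" .
        qed
        then show ?thesis using sum_mem[OF fin] by simp
      qed
      have "(\<lambda>i. cl (\<lambda>x. s i x * indicator {- real n<..real n} x)) \<longlonglongrightarrow> cl (\<lambda>x. f x * indicator {- real n<..real n} x)"
      proof (rule L2_dominated_convergence(2)[OF L _ L2_cmult[OF f(1), of 2]])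
        show "AE x in lborel. (\<lambda>i. s i x * indicator {- real n<..real n} x) \<longlonglongrightarrow> f x * indicator {- real n<..real n} x"
          by (intro AE_I2 tendsto_mult tendsto_const s)
        show "cmod (s i x * indicator {- real n<..real n} x) \<le> cmod (2 * f x)" for i x
          using s(3)[of i x] by (auto simp: indicator_def norm_mult)
      qed measurable
      then show ?thesis by (rule closed_sequentially[OF closed_closure mem])
    qed
    have "(\<lambda>n. cl (\<lambda>x. f x * indicator {- real n<..real n} x)) \<longlonglongrightarrow> cl f"
    proof (rule L2_dominated_convergence(2)[OF _ _ f(1)])
      show "L2 (\<lambda>x. f x * indicator {- real n<..real n} x)" for n
        by (rule L2_dominated[OF _ f(1)]) (auto simp: indicator_def)
      show "AE x in lborel. (\<lambda>n. f x * indicator {- real n<..real n} x) \<longlonglongrightarrow> f x"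
      proof (rule AE_I2)
        fix x
        obtain N where N: "\<bar>x\<bar> < real N" using reals_Archimedean2 by blast
        then show "(\<lambda>n. f x * indicator {- real n<..real n} x) \<longlonglongrightarrow> f x"
          by (intro tendsto_eventually) (auto simp: eventually_sequentially indicator_def intro!: exI[of _ N])
      qed
    qed (auto simp: indicator_def)
    then show ?thesis unfolding f(2) by (rule closed_sequentially[OF closed_closure trunc])
  qed
  then show ?thesis by blast
qed

lemma tests_approx:
  assumes "e > 0"
  obtains a b where "test1 a" "test1 b" "norm (cl (cpl a b) - F) < e"
proof -
  have "F \<in> closure testcl" using tests_dense by simp
  then obtain g where "g \<in> testcl" "dist g F < e" using assms by (auto simp: closure_approachable)
  then show ?thesis using that by (auto simp: testcl_def dist_norm)
qed

lemma closed_UNIV_if_tests: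
  assumes "closed S" "\<And>a b. test1 a \<Longrightarrow> test1 b \<Longrightarrow> cl (cpl a b) \<in> S"
  shows "F \<in> S"
proof -
  have "closure testcl \<subseteq> S" using assms by (intro closure_minimal) (auto simp: testcl_def)
  then show ?thesis using tests_dense by auto
qed

lemma eq_if_tests:
  assumes "\<And>a b. test1 a \<Longrightarrow> test1 b \<Longrightarrow> inner F (cl (cpl a b)) = inner G (cl (cpl a b))"
  shows "F = G"
proof -
  have "closed {H. inner F H = inner G H}"
    by (intro closed_Collect_eq continuous_intros)
  \<comment> \<open>The closed set on which the two functionals agree is the whole space, so the
    difference \<open>F - G\<close> may be tested with itself.\<close>
  then have "F - G \<in> {H. inner F H = inner G H}"
    by (rule closed_UNIV_if_tests) (use assms in auto)
  then have "inner (F - G) (F - G) = 0" by (simp add: inner_diff_left)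
  then show ?thesis by simp
qed

section \<open>Translations\<close>

lemma taylor2_bound:
  fixes f :: "real \<Rightarrow> real"
  assumes "\<And>x. (f has_real_derivative f' x) (at x)" "\<And>x. (f' has_real_derivative f'' x) (at x)"
    "\<And>x. \<bar>f'' x\<bar> \<le> K"
  shows "\<bar>f y - f x - (y - x) * f' x\<bar> \<le> K * (y - x)\<^sup>2"
proof -
  have lip: "\<bar>f' u - f' v\<bar> \<le> K * \<bar>u - v\<bar>" for u v
    using field_differentiable_bound[of UNIV f' f'' K u v] assms by simp
  have "norm ((f y - y * f' x) - (f x - x * f' x)) \<le> (K * \<bar>y - x\<bar>) * norm (y - x)"
  proof (rule field_differentiable_bound[of "closed_segment x y" "\<lambda>z. f z - z * f' x" "\<lambda>z. f' z - f' x"])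
    have "((\<lambda>z. f z - z * f' x) has_real_derivative f' z - 1 * f' x) (at z)" for z
      by (intro DERIV_diff assms DERIV_cmult_right DERIV_ident)
    then show "((\<lambda>z. f z - z * f' x) has_real_derivative f' z - f' x) (at z within closed_segment x y)" for z
      by (simp add: has_field_derivative_at_within)
    show "norm (f' z - f' x) \<le> K * \<bar>y - x\<bar>" if "z \<in> closed_segment x y" for z
    proof -
      have "\<bar>z - x\<bar> \<le> \<bar>y - x\<bar>" using that by (auto simp: closed_segment_eq_real_ivl split: if_splits)
      moreover have "0 \<le> K" using assms(3)[of x] by linarith
      ultimately have "K * \<bar>z - x\<bar> \<le> K * \<bar>y - x\<bar>" by (intro mult_left_mono)
      with lip[of z x] show ?thesis by simp
    qed
  qed auto
  then show ?thesis by (simp add: algebra_simps power2_eq_square abs_mult_self_eq flip: abs_mult)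
qed

text \<open>On a common bounded support a pointwise remainder of order
  \<open>(s - t)\<^sup>2\<close> is a remainder of the same order in the L2 norm, and this survives
  the division by \<open>s - t\<close>.\<close>

lemma cl_curve_has_vector_derivative:
  fixes F :: "real \<Rightarrow> real \<Rightarrow> complex"
  assumes L: "\<And>s. L2 (F s)" "L2 G"
    and K: "\<And>s x. \<bar>s - t\<bar> < 1 \<Longrightarrow> cmod (F s x - F t x - (s - t) *\<^sub>R G x) \<le> K * (s - t)\<^sup>2"
    and R: "\<And>s x. \<bar>s - t\<bar> < 1 \<Longrightarrow> x < a \<or> b < x \<Longrightarrow> F s x = 0 \<and> G x = 0" and "a \<le> b"
  shows "((\<lambda>s. cl (F s)) has_vector_derivative cl G) (at t)"
proof -
  have est: "norm (cl (F s) - cl (F t) - (s - t) *\<^sub>R cl G) \<le> K * sqrt (b - a) * (s - t)\<^sup>2" if "\<bar>s - t\<bar> < 1" for s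
  proof -
    have eq: "cl (F s) - cl (F t) - (s - t) *\<^sub>R cl G = cl (\<lambda>x. F s x - F t x - (s - t) *\<^sub>R G x)"
      by (simp add: cl_diff cl_scaleR L L2_diff L2_scaleR)
    have "norm (cl (\<lambda>x. F s x - F t x - (s - t) *\<^sub>R G x)) \<le> (K * (s - t)\<^sup>2) * sqrt (b - a)"
    proof (rule L2_bounded_support(2)[OF _ K[OF that] _ \<open>a \<le> b\<close>])
      show "(\<lambda>x. F s x - F t x - (s - t) *\<^sub>R G x) \<in> borel_measurable lborel"
        using L by (intro L2_measurable L2_diff L2_scaleR)
    qed (use R[OF that] R[of t] in auto)
    then show ?thesis by (simp add: eq mult.commute mult.left_commute)
  qed
  have "((\<lambda>s. norm (cl (F s) - cl (F t) - (s - t) *\<^sub>R cl G) / norm (s - t)) \<longlongrightarrow> 0) (at t)"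
  proof (rule tendsto_sandwich[of "\<lambda>s. 0" _ _ "\<lambda>s. K * sqrt (b - a) * \<bar>s - t\<bar>"])
    show "\<forall>\<^sub>F s in at t. norm (cl (F s) - cl (F t) - (s - t) *\<^sub>R cl G) / norm (s - t) \<le> K * sqrt (b - a) * \<bar>s - t\<bar>"
      unfolding eventually_at
    proof (intro exI[of _ 1] conjI ballI impI)
      fix s assume "s \<noteq> t \<and> dist s t < 1"
      then show "norm (cl (F s) - cl (F t) - (s - t) *\<^sub>R cl G) / norm (s - t) \<le> K * sqrt (b - a) * \<bar>s - t\<bar>"
        using est[of s] by (simp add: dist_real_def divide_le_eq power2_eq_square mult.assoc abs_mult_self_eq)
    qed simp
    have "((\<lambda>s. K * sqrt (b - a) * \<bar>s - t\<bar>) \<longlongrightarrow> K * sqrt (b - a) * \<bar>t - t\<bar>) (at t)"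
      by (intro tendsto_intros)
    then show "((\<lambda>s. K * sqrt (b - a) * \<bar>s - t\<bar>) \<longlongrightarrow> 0) (at t)" by simp
  qed auto
  then show ?thesis
    unfolding has_vector_derivative_def has_derivative_iff_norm by (auto intro: bounded_linear_scaleR_left)
qed

abbreviation tc :: "(real \<Rightarrow> real) \<Rightarrow> (real \<Rightarrow> real) \<Rightarrow> l2" where
  "tc a b \<equiv> cl (cpl a b)"

abbreviation td :: "(real \<Rightarrow> real) \<Rightarrow> (real \<Rightarrow> real) \<Rightarrow> l2" where
  "td a b \<equiv> cl (cpl (deriv a) (deriv b))"

lemma cpl_simps: "Re (cpl a b x) = a x" "Im (cpl a b x) = b x"
  by (simp_all add: cpl_def)

lemma cmod_cpl_le: "cmod (cpl a b x) \<le> \<bar>a x\<bar> + \<bar>b x\<bar>"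
  using cmod_le[of "cpl a b x"] by (simp add: cpl_def)

lemma shift_tc: "test1 a \<Longrightarrow> test1 b \<Longrightarrow> shift s (tc a b) = tc (\<lambda>x. a (x - s)) (\<lambda>x. b (x - s))"
  by (simp add: shift_cl L2_cpl) (simp add: cpl_def[abs_def])

lemma test1_shift: "test1 a \<Longrightarrow> test1 (\<lambda>x. a (x - s))"
  using test1_affine[of a 1 "- s"] by simp

lemma deriv_shift: "test1 a \<Longrightarrow> deriv (\<lambda>x. a (x - s)) = (\<lambda>x. deriv a (x - s))"
  using has_deriv_affine[of a 1 "- s"] by (auto simp: test1_smooth intro: DERIV_imp_deriv)

lemma shift_td: "test1 a \<Longrightarrow> test1 b \<Longrightarrow> shift s (td a b) = td (\<lambda>x. a (x - s)) (\<lambda>x. b (x - s))"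
  by (simp add: shift_tc test1_deriv deriv_shift)

lemma test1_taylor:
  assumes "test1 a"
  obtains K where "\<And>x y. \<bar>a y - a x - (y - x) * deriv a x\<bar> \<le> K * (y - x)\<^sup>2"
proof -
  obtain K where "\<And>x. \<bar>deriv (deriv a) x\<bar> \<le> K"
    using test1_bounded[OF test1_deriv[OF test1_deriv[OF assms]]] by blast
  then show ?thesis
    using taylor2_bound[of a "deriv a" "deriv (deriv a)" K] that
      test1_has_deriv[OF assms] test1_has_deriv[OF test1_deriv[OF assms]] by blast
qed

lemma shift_tc_has_vector_derivative:
  assumes a: "test1 a" and b: "test1 b"
  shows "((\<lambda>s. shift s (tc a b)) has_vector_derivative - shift t (td a b)) (at t)"
proof -
  obtain K where K: "\<And>x y. \<bar>a y - a x - (y - x) * deriv a x\<bar> \<le> K * (y - x)\<^sup>2"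
    using test1_taylor[OF a] by blast
  obtain L where L: "\<And>x y. \<bar>b y - b x - (y - x) * deriv b x\<bar> \<le> L * (y - x)\<^sup>2"
    using test1_taylor[OF b] by blast
  obtain R where R: "R > 0" "\<And>x. \<bar>x\<bar> \<ge> R \<Longrightarrow> a x = 0" using test1_support[OF a] by blast
  obtain S where S: "S > 0" "\<And>x. \<bar>x\<bar> \<ge> S \<Longrightarrow> b x = 0" using test1_support[OF b] by blast
  \<comment> \<open>Large enough for the supports of all translates with
    \<open>\<bar>s - t\<bar> < 1\<close>.\<close>
  define A where "A = max R S + \<bar>t\<bar> + 1"
  have L2s: "L2 (\<lambda>x. cpl a b (x - s))" "L2 (\<lambda>x. - cpl (deriv a) (deriv b) (x - s))" for s
    by (intro L2_uminus L2_shift[of "cpl _ _"] L2_cpl a b test1_deriv)+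
  have "((\<lambda>s. cl (\<lambda>x. cpl a b (x - s))) has_vector_derivative cl (\<lambda>x. - cpl (deriv a) (deriv b) (x - t))) (at t)"
  proof (rule cl_curve_has_vector_derivative[where K="K + L" and a="-A" and b=A])
    fix s x :: real assume st: "\<bar>s - t\<bar> < 1"
    have e: "(x - s) - (x - t) = - (s - t)" by simp
    have "cmod (cpl a b (x - s) - cpl a b (x - t) - (s - t) *\<^sub>R - cpl (deriv a) (deriv b) (x - t))
      \<le> \<bar>a (x - s) - a (x - t) - ((x - s) - (x - t)) * deriv a (x - t)\<bar>
       + \<bar>b (x - s) - b (x - t) - ((x - s) - (x - t)) * deriv b (x - t)\<bar>"
      by (rule order_trans[OF cmod_le]) (simp add: cpl_simps algebra_simps)
    also have "\<dots> \<le> K * ((x - s) - (x - t))\<^sup>2 + L * ((x - s) - (x - t))\<^sup>2"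
      by (intro add_mono K L)
    also have "\<dots> = (K + L) * (s - t)\<^sup>2" unfolding e by (simp only: distrib_right power2_minus)
    finally show "cmod (cpl a b (x - s) - cpl a b (x - t) - (s - t) *\<^sub>R - cpl (deriv a) (deriv b) (x - t)) \<le> (K + L) * (s - t)\<^sup>2" .
  next
    fix s x :: real assume "\<bar>s - t\<bar> < 1" "x < - A \<or> A < x"
    then have "\<bar>x - s\<bar> > R" "\<bar>x - s\<bar> > S" "\<bar>x - t\<bar> > R" "\<bar>x - t\<bar> > S" by (auto simp: A_def)
    then show "cpl a b (x - s) = 0 \<and> - cpl (deriv a) (deriv b) (x - t) = 0"
      using R(2) S(2) deriv_eq_0_outside[of R a] deriv_eq_0_outside[of S b] by (auto simp: cpl_eq)
  qed (use R S L2s in \<open>auto simp: A_def\<close>)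
  then show ?thesis
    using a b L2s by (simp add: shift_cl L2_cpl test1_deriv L2_shift[of "cpl _ _"] cl_uminus)
qed

text \<open>Strong continuity of the translation group. Translations are isometries, so the vectors
  with a continuous orbit form a closed set; it contains the test functions, whose orbits are even
  differentiable, and these are dense.\<close>

lemma continuous_shift: "continuous_on UNIV (\<lambda>s. shift s f)"
proof -
  let ?S = "{f. continuous_on UNIV (\<lambda>s. shift s f)}"
  have "closed ?S"
    unfolding closed_sequential_limits
  proof (intro allI impI, elim conjE, simp)
    fix F f assume F: "\<forall>n. continuous_on UNIV (\<lambda>s. shift s (F n))" "F \<longlonglongrightarrow> f"
    have "uniform_limit UNIV (\<lambda>n s. shift s (F n)) (\<lambda>s. shift s f) sequentially"
    proof (rule uniform_limitI)
      fix e :: real assume "e > 0"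
      then have "\<forall>\<^sub>F n in sequentially. dist (F n) f < e" using F(2) by (rule tendstoD[rotated])
      then show "\<forall>\<^sub>F n in sequentially. \<forall>s\<in>UNIV. dist (shift s (F n)) (shift s f) < e"
        by eventually_elim (simp add: dist_norm flip: shift_diff)
    qed
    then show "continuous_on UNIV (\<lambda>s. shift s f)"
      by (rule uniform_limit_theorem[rotated]) (use F in auto)
  qed
  moreover have "tc a b \<in> ?S" if "test1 a" "test1 b" for a b
    using shift_tc_has_vector_derivative[OF that]
    by (auto intro!: continuous_at_imp_continuous_on has_vector_derivative_continuous)
  ultimately have "f \<in> ?S" by (rule closed_UNIV_if_tests)
  then show ?thesis by simp
qed

text \<open>Joint continuity: the part \<open>shift (r x) (f x - g)\<close> is small because
  translations are isometries, and the part \<open>shift (r x) g\<close> converges by strong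
  continuity.\<close>

lemma tendsto_shift:
  assumes "(r \<longlongrightarrow> s) F" "(f \<longlongrightarrow> g) F"
  shows "((\<lambda>x. shift (r x) (f x)) \<longlongrightarrow> shift s g) F"
proof -
  have "((\<lambda>x. shift (r x) g) \<longlongrightarrow> shift s g) F"
    by (rule isCont_tendsto_compose[OF continuous_on_interior[OF continuous_shift[of g]] assms(1)]) simp
  moreover have "((\<lambda>x. shift (r x) (f x - g)) \<longlongrightarrow> 0) F"
    by (rule tendsto_norm_zero_cancel) (use tendsto_norm_zero[OF LIM_zero[OF assms(2)]] in simp)
  ultimately have "((\<lambda>x. shift (r x) (f x - g) + shift (r x) g) \<longlongrightarrow> 0 + shift s g) F"
    by (intro tendsto_add)
  then show ?thesis by (simp add: shift_diff)
qed

lemma continuous_on_shift [continuous_intros]: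
  assumes "continuous_on S r" "continuous_on S f"
  shows "continuous_on S (\<lambda>x. shift (r x) (f x))"
  unfolding continuous_on_def
proof
  fix x assume "x \<in> S"
  then have "(r \<longlongrightarrow> r x) (at x within S)" "(f \<longlongrightarrow> f x) (at x within S)"
    using assms by (auto simp: continuous_on_def)
  then show "((\<lambda>x. shift (r x) (f x)) \<longlongrightarrow> shift (r x) (f x)) (at x within S)"
    by (rule tendsto_shift)
qed

section \<open>Weak derivatives\<close>

text \<open>The graph of weak differentiation as a closed operator in \<open>l2\<close>. Stating it
  as a relation between classes keeps representatives and the choice in \<open>wderiv\<close> out of
  the analysis.\<close>

definition wd :: "l2 \<Rightarrow> l2 \<Rightarrow> bool" where
  "wd f g \<longleftrightarrow> (\<forall>a b. test1 a \<longrightarrow> test1 b \<longrightarrow> inner f (td a b) = - inner g (tc a b))"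

lemma inner_tc:
  assumes "L2 f" "test1 a" "test1 b"
  shows "inner (cl f) (tc a b)
    = Re (\<integral>x. f x * complex_of_real (a x) \<partial>lborel) + Im (\<integral>x. f x * complex_of_real (b x) \<partial>lborel)"
proof -
  have L: "L2 (\<lambda>x. complex_of_real (a x))" if "test1 a" for a
    using L2_cpl[OF that test1_0] by (simp add: cpl_eq[abs_def])
  have i: "integrable lborel (\<lambda>x. f x * complex_of_real (a x))" "integrable lborel (\<lambda>x. f x * complex_of_real (b x))"
    using assms L by (auto intro: L2_mult_integrable)
  have "inner (cl f) (tc a b) = (\<integral>x. Re (f x * complex_of_real (a x)) + Im (f x * complex_of_real (b x)) \<partial>lborel)"
    using assms by (simp add: inner_cl L2_cpl inner_complex_def cpl_simps)
  also have "\<dots> = Re (\<integral>x. f x * complex_of_real (a x) \<partial>lborel) + Im (\<integral>x. f x * complex_of_real (b x) \<partial>lborel)"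
    by (subst Bochner_Integration.integral_add[OF integrable_Re[OF i(1)] integrable_Im[OF i(2)]])
       (simp only: integral_Re[OF i(1)] integral_Im[OF i(2)])
  finally show ?thesis .
qed

text \<open>The complex identity of \<open>is_wderiv\<close> is split into its real and imaginary
  parts by testing with \<open>(\<phi>, 0)\<close> and with \<open>(0, \<phi>)\<close>.\<close>

lemma is_wderiv_iff:
  assumes "L2 f" shows "is_wderiv f g \<longleftrightarrow> L2 g \<and> wd (cl f) (cl g)"
proof (cases "L2 g")
  case True
  have "(\<forall>\<phi>. test1 \<phi> \<longrightarrow> (\<integral>x. f x * complex_of_real (deriv \<phi> x) \<partial>lborel) = - (\<integral>x. g x * complex_of_real (\<phi> x) \<partial>lborel))
      \<longleftrightarrow> wd (cl f) (cl g)"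
  proof safe
    assume *: "\<forall>\<phi>. test1 \<phi> \<longrightarrow> (\<integral>x. f x * complex_of_real (deriv \<phi> x) \<partial>lborel) = - (\<integral>x. g x * complex_of_real (\<phi> x) \<partial>lborel)"
    show "wd (cl f) (cl g)"
      unfolding wd_def using * assms True by (simp add: inner_tc test1_deriv)
  next
    fix \<phi> assume *: "wd (cl f) (cl g)" "test1 \<phi>"
    have d0: "deriv (\<lambda>x::real. 0::real) = (\<lambda>x. 0)" by auto
    from *(1)[unfolded wd_def, rule_format, OF *(2) test1_0] *(1)[unfolded wd_def, rule_format, OF test1_0 *(2)]
    show "(\<integral>x. f x * complex_of_real (deriv \<phi> x) \<partial>lborel) = - (\<integral>x. g x * complex_of_real (\<phi> x) \<partial>lborel)"
      using assms True * by (auto simp: inner_tc test1_deriv d0 complex_eq_iff)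
  qed
  with True show ?thesis by (simp add: is_wderiv_def)
qed (simp add: is_wderiv_def)

lemma wd_diff: "wd f g \<Longrightarrow> wd f' g' \<Longrightarrow> wd (f - f') (g - g')"
  by (simp add: wd_def inner_diff_left)

lemma wd_limit:
  assumes "\<And>n. wd (f n) (g n)" "f \<longlonglongrightarrow> F" "g \<longlonglongrightarrow> G"
  shows "wd F G"
  unfolding wd_def
proof (intro allI impI)
  fix a b assume "test1 a" "test1 b"
  then have "inner (f n) (td a b) = - inner (g n) (tc a b)" for n using assms(1) by (auto simp: wd_def)
  moreover have "(\<lambda>n. inner (f n) (td a b)) \<longlonglongrightarrow> inner F (td a b)" "(\<lambda>n. - inner (g n) (tc a b)) \<longlonglongrightarrow> - inner G (tc a b)"
    by (intro tendsto_intros assms)+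
  ultimately show "inner F (td a b) = - inner G (tc a b)" using LIMSEQ_unique by auto
qed

lemma isCont_if_continuous_on: "(\<And>s. continuous_on s f) \<Longrightarrow> isCont f x"
  using continuous_on_eq_continuous_at[of UNIV f] by simp

lemma integral_compact_support_FTC:
  assumes "\<And>x. (F has_real_derivative f x) (at x)" "\<And>s. continuous_on s f" "a \<le> b" "\<And>x. x < a \<or> b < x \<Longrightarrow> f x = 0"
  shows "(\<integral>x. f x \<partial>lborel) = F b - F a"
proof -
  have "(\<integral>x. f x * indicator {a..b} x \<partial>lborel) = F b - F a"
    by (rule integral_FTC_Icc_real)
       (use assms in \<open>auto intro: isCont_if_continuous_on\<close>)
  moreover have "f x * indicator {a..b} x = f x" for x
    using assms(4)[of x] by (cases "x < a \<or> b < x") (auto simp: indicator_def)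
  ultimately show ?thesis by simp
qed

lemma integral_zero_except_point:
  fixes f :: "real \<Rightarrow> real"
  assumes "\<And>x. x \<noteq> c \<Longrightarrow> f x = 0"
  shows "(\<integral>x. f x \<partial>lborel) = 0"
  by (rule integral_eq_zero_AE) (use AE_lborel_singleton[of c] assms in \<open>auto elim: eventually_mono\<close>)

text \<open>The primitive that starts at \<open>l\<close> is constant beyond \<open>u\<close>, with
  the total integral as its value; a vanishing mean therefore gives it compact support, inside the
  same interval.\<close>

lemma test1_prim:
  assumes "test1 a" "(\<integral>x. a x \<partial>lborel) = 0" "\<And>x. x < l \<or> u < x \<Longrightarrow> a x = 0" "l \<le> u"
  obtains A where "test1 A" "deriv A = a" "\<And>x. x < l \<or> u < x \<Longrightarrow> A x = 0"
proof -
  have d: "(prim a has_real_derivative a x) (at x)" for x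
    by (intro prim_has_deriv test1_continuous assms)
  define A where "A x = prim a x - prim a l" for x
  have dA: "(A has_real_derivative a x) (at x)" for x
    unfolding A_def by (auto intro!: derivative_eq_intros d)
  have eq: "prim a u = prim a l"
    using integral_compact_support_FTC[OF d test1_continuous[OF assms(1)] assms(4,3)] assms(2) by simp
  have left: "A x = 0" if "x < l" for x
  proof -
    have "prim a x = prim a l"
    proof -
      have "(\<integral>y. a y * indicator {x..l} y \<partial>lborel) = prim a l - prim a x"
        by (rule integral_FTC_Icc_real)
           (use that d test1_continuous[OF assms(1)] in \<open>auto intro: isCont_if_continuous_on\<close>)
      moreover have "(\<integral>y. a y * indicator {x..l} y \<partial>lborel) = 0"
        by (rule integral_zero_except_point[of l]) (use assms(3) in \<open>auto simp: indicator_def not_less_iff_gr_or_eq\<close>)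
      ultimately show ?thesis by simp
    qed
    then show ?thesis by (simp add: A_def)
  qed
  have right: "A x = 0" if "u < x" for x
  proof -
    have "(\<integral>y. a y * indicator {u..x} y \<partial>lborel) = prim a x - prim a u"
      by (rule integral_FTC_Icc_real)
         (use that d test1_continuous[OF assms(1)] in \<open>auto intro: isCont_if_continuous_on\<close>)
    moreover have "(\<integral>y. a y * indicator {u..x} y \<partial>lborel) = 0"
      by (rule integral_zero_except_point[of u]) (use assms(3) in \<open>auto simp: indicator_def not_less_iff_gr_or_eq\<close>)
    ultimately show ?thesis by (simp add: A_def eq)
  qed
  have "smooth A" by (rule smooth_antideriv[OF dA]) (use assms(1) in \<open>simp add: test1_smooth\<close>)
  moreover have "\<forall>x. \<bar>x\<bar> > \<bar>l\<bar> + \<bar>u\<bar> \<longrightarrow> A x = 0"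
  proof (intro allI impI)
    fix x assume "\<bar>x\<bar> > \<bar>l\<bar> + \<bar>u\<bar>"
    then have "x < l \<or> u < x" by arith
    then show "A x = 0" using left right by blast
  qed
  ultimately have "test1 A" unfolding test1_smooth by blast
  moreover have "deriv A = a" using dA by (auto intro: DERIV_imp_deriv)
  ultimately show ?thesis using that left right by blast
qed


lemma wd_tests:
  assumes "test1 a" "test1 b" shows "wd (tc a b) (td a b)"
  unfolding wd_def
proof (intro allI impI)
  fix c d assume "test1 c" "test1 d"
  note t = assms this
  note t' = t[THEN test1_deriv]
  have ip: "inner (tc f g) (tc h k) = (\<integral>x. f x * h x + g x * k x \<partial>lborel)"
    "integrable lborel (\<lambda>x. f x * h x + g x * k x)"
    if "test1 f" "test1 g" "test1 h" "test1 k" for f g h k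
    using that L2_inner_integrable[OF L2_cpl L2_cpl, of f g h k]
    by (simp_all add: inner_cl L2_cpl inner_complex_def cpl_simps)
  obtain R where R: "R > 0" "\<And>x. \<bar>x\<bar> \<ge> R \<Longrightarrow> a x = 0" using test1_support[OF t(1)] by blast
  obtain S where S: "S > 0" "\<And>x. \<bar>x\<bar> \<ge> S \<Longrightarrow> b x = 0" using test1_support[OF t(2)] by blast
  let ?F = "\<lambda>x. a x * c x + b x * d x"
  let ?f = "\<lambda>x. (a x * deriv c x + b x * deriv d x) + (deriv a x * c x + deriv b x * d x)"
  have "(\<integral>x. ?f x \<partial>lborel) = ?F (max R S) - ?F (- max R S)"
  proof (rule integral_compact_support_FTC[where F="?F" and a="- max R S" and b="max R S"])
    show "(?F has_real_derivative ?f x) (at x)" for x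
      by (auto intro!: derivative_eq_intros test1_has_deriv t simp: algebra_simps)
    show "continuous_on s ?f" for s
      by (intro continuous_intros test1_continuous t t')
    show "?f x = 0" if "x < - max R S \<or> max R S < x" for x
      using that R(2)[of x] S(2)[of x] deriv_eq_0_outside[of R a x] deriv_eq_0_outside[of S b x] R S by auto
  qed (use R in auto)
  also have "\<dots> = 0" using R S by auto
  finally have "inner (tc a b) (td c d) + inner (td a b) (tc c d) = 0"
    using t t' by (simp add: ip Bochner_Integration.integral_add[OF ip(2) ip(2)])
  then show "inner (tc a b) (td c d) = - inner (td a b) (tc c d)" by simp
qed

text \<open>Integrating \<open>(\<bar>\<chi>\<bar>\<^sup>2)' = 2 Re (\<chi>' cnj \<chi>)\<close> from both ends gains the factor \<open>2\<close>
  without which \<open>sum B {1..N} < m\<close> would not suffice for the a priori bound.\<close>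

lemma test_sup_bound:
  assumes t: "test1 a" "test1 b"
  shows "(cmod (cpl a b x))\<^sup>2 \<le> norm (tc a b) * norm (td a b)"
proof -
  note t' = t[THEN test1_deriv]
  obtain R where R: "R > 0" "\<And>x. \<bar>x\<bar> \<ge> R \<Longrightarrow> a x = 0" using test1_support[OF t(1)] by blast
  obtain S where S: "S > 0" "\<And>x. \<bar>x\<bar> \<ge> S \<Longrightarrow> b x = 0" using test1_support[OF t(2)] by blast
  define M where "M = max R S + \<bar>x\<bar> + 1"
  let ?F = "\<lambda>x. (a x)\<^sup>2 + (b x)\<^sup>2"
  let ?f = "\<lambda>x. 2 * (a x * deriv a x + b x * deriv b x)"
  let ?g = "\<lambda>x. cmod (cpl a b x) * cmod (cpl (deriv a) (deriv b) x)"
  have d: "(?F has_real_derivative ?f x) (at x)" for x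
    by (auto intro!: derivative_eq_intros test1_has_deriv t simp: algebra_simps)
  have c: "continuous_on s ?f" for s
    by (intro continuous_intros test1_continuous t t')
  have fg: "\<bar>?f x\<bar> \<le> 2 * ?g x" for x
    using Cauchy_Schwarz_ineq2[of "cpl a b x" "cpl (deriv a) (deriv b) x"]
    by (simp add: inner_complex_def cpl_simps abs_mult)
  have gi: "integrable lborel ?g" and gle: "(\<integral>x. ?g x \<partial>lborel) \<le> norm (tc a b) * norm (td a b)"
    using integrable_cmod_mult[OF L2_cpl[OF t] L2_cpl[OF t']] by auto
  have FTC: "(\<integral>y. ?f y * indicator {u..v} y \<partial>lborel) = ?F v - ?F u" if "u \<le> v" for u v
    by (rule integral_FTC_Icc_real[OF that d]) (rule isCont_if_continuous_on[OF c])
  have int_f: "integrable lborel (\<lambda>y. ?f y * indicator A y)" if "A \<in> sets borel" for A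
  proof (rule Bochner_Integration.integrable_bound[OF integrable_mult_right[OF gi, of 2]])
    have [measurable]: "?f \<in> borel_measurable borel" by (rule borel_measurable_continuous_onI[OF c])
    show "(\<lambda>y. ?f y * indicator A y) \<in> borel_measurable lborel" using that by measurable
    show "AE y in lborel. norm (?f y * indicator A y) \<le> norm (2 * ?g y)"
      using fg by (intro AE_I2) (auto simp: indicator_def)
  qed
  have F0: "?F M = 0" "?F (- M) = 0"
    using R S by (auto simp: M_def)
  have "?F x = (\<integral>y. ?f y * indicator {-M..x} y \<partial>lborel)" "?F x = - (\<integral>y. ?f y * indicator {x..M} y \<partial>lborel)"
    by (subst FTC; use F0 R S in \<open>auto simp: M_def\<close>)+
  then have "2 * ?F x = (\<integral>y. ?f y * indicator {-M..x} y - ?f y * indicator {x..M} y \<partial>lborel)"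
    by (subst Bochner_Integration.integral_diff[OF int_f int_f]) auto
  also have "\<dots> \<le> (\<integral>y. 2 * ?g y \<partial>lborel)"
  proof (rule integral_mono_AE)
    show "integrable lborel (\<lambda>y. ?f y * indicator {-M..x} y - ?f y * indicator {x..M} y)"
      by (intro Bochner_Integration.integrable_diff int_f) auto
    show "integrable lborel (\<lambda>y. 2 * ?g y)" using gi by auto
    show "AE y in lborel. ?f y * indicator {-M..x} y - ?f y * indicator {x..M} y \<le> 2 * ?g y"
    proof (rule AE_I2)
      fix y
      have "0 \<le> ?g y" by simp
      with fg[of y] show "?f y * indicator {-M..x} y - ?f y * indicator {x..M} y \<le> 2 * ?g y"
        by (auto simp: indicator_def abs_le_iff split: if_splits)
    qed
  qed
  also have "\<dots> \<le> 2 * (norm (tc a b) * norm (td a b))" using gle by simp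
  finally show ?thesis by (simp add: cmod_power2 cpl_simps)
qed

text \<open>Defined through representatives and not lifted, because multiplication by an unbounded
  \<open>\<sigma>\<close> does not preserve L2; it is meaningful for test functions.\<close>

definition mulr :: "(real \<Rightarrow> real) \<Rightarrow> l2 \<Rightarrow> l2" where
  "mulr \<sigma> f = cl (\<lambda>x. complex_of_real (\<sigma> x) * rep_l2 f x)"

lemma L2_mulr:
  assumes "\<sigma> \<in> borel_measurable borel" "\<And>x. \<bar>\<sigma> x\<bar> \<le> K" "L2 f"
  shows "L2 (\<lambda>x. complex_of_real (\<sigma> x) * f x)"
proof (rule L2_dominated[OF _ L2_cmult[OF assms(3), of "complex_of_real K"]])
  show "(\<lambda>x. complex_of_real (\<sigma> x) * f x) \<in> borel_measurable lborel"
    using assms(1) L2_measurable[OF assms(3)] by measurable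
  show "cmod (complex_of_real (\<sigma> x) * f x) \<le> cmod (complex_of_real K * f x)" for x
    using assms(2)[of x] by (auto simp: norm_mult intro!: mult_right_mono)
qed

lemma L2_mulr_test: "test1 \<sigma> \<Longrightarrow> L2 f \<Longrightarrow> L2 (\<lambda>x. complex_of_real (\<sigma> x) * f x)"
  by (metis L2_mulr test1_bounded test1_measurable)

lemma mulr_cl:
  assumes "test1 \<sigma>" "L2 f" shows "mulr \<sigma> (cl f) = cl (\<lambda>x. complex_of_real (\<sigma> x) * f x)"
  unfolding mulr_def using rep_cl[OF assms(2)] assms
  by (subst cl_eq_iff) (auto intro!: L2_mulr_test elim: eventually_mono)

lemma inner_mulr:
  assumes "test1 \<sigma>" shows "inner (mulr \<sigma> f) g = inner f (mulr \<sigma> g)"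
proof -
  obtain f' g' where *: "L2 f'" "L2 g'" "f = cl f'" "g = cl g'" by (meson l2_cases)
  have "inner (complex_of_real (\<sigma> x) * f' x) (g' x) = inner (f' x) (complex_of_real (\<sigma> x) * g' x)" for x
    by (simp add: inner_complex_def algebra_simps)
  with * assms show ?thesis by (simp add: mulr_cl inner_cl L2_mulr_test)
qed

lemma mulr_tc:
  assumes "test1 \<sigma>" "test1 a" "test1 b"
  shows "mulr \<sigma> (tc a b) = tc (\<lambda>x. \<sigma> x * a x) (\<lambda>x. \<sigma> x * b x)"
proof -
  have "(\<lambda>x. complex_of_real (\<sigma> x) * cpl a b x) = cpl (\<lambda>x. \<sigma> x * a x) (\<lambda>x. \<sigma> x * b x)"
    by (auto simp: cpl_def complex_eq_iff)
  then show ?thesis using assms by (simp add: mulr_cl L2_cpl)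
qed

lemma test1_mult': "test1 f \<Longrightarrow> test1 g \<Longrightarrow> test1 (\<lambda>x. f x * g x)"
  by (simp add: test1_mult test1_smooth[of f])

text \<open>The Leibniz rule by duality: multiplication by \<open>\<sigma>\<close> is symmetric, so
  it is moved to the test function, where the classical product rule holds.\<close>

lemma wd_mulr:
  assumes s: "test1 \<sigma>" and "wd f g"
  shows "wd (mulr \<sigma> f) (mulr (deriv \<sigma>) f + mulr \<sigma> g)"
  unfolding wd_def
proof (intro allI impI)
  fix a b assume t: "test1 a" "test1 b"
  note t' = t[THEN test1_deriv] and s' = s[THEN test1_deriv]
  have d: "deriv (\<lambda>x. \<sigma> x * c x) = (\<lambda>x. deriv \<sigma> x * c x + \<sigma> x * deriv c x)" if "test1 c" for c
    by (rule ext, rule DERIV_imp_deriv)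
       (auto intro!: derivative_eq_intros test1_has_deriv that s)
  have "td (\<lambda>x. \<sigma> x * a x) (\<lambda>x. \<sigma> x * b x) = mulr (deriv \<sigma>) (tc a b) + mulr \<sigma> (td a b)"
    using t t' s s' by (simp add: d mulr_tc cl_add L2_cpl test1_mult')
      (simp add: cpl_def[abs_def] plus_complex.code)
  moreover have "inner f (td (\<lambda>x. \<sigma> x * a x) (\<lambda>x. \<sigma> x * b x)) = - inner g (tc (\<lambda>x. \<sigma> x * a x) (\<lambda>x. \<sigma> x * b x))"
    using assms(2) t s unfolding wd_def by (auto intro: test1_mult')
  ultimately show "inner (mulr \<sigma> f) (td a b) = - inner (mulr (deriv \<sigma>) f + mulr \<sigma> g) (tc a b)"
    using t s s' by (simp add: inner_mulr inner_add_left inner_add_right mulr_tc)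
qed


lemma tc_add: "test1 a \<Longrightarrow> test1 b \<Longrightarrow> test1 c \<Longrightarrow> test1 d \<Longrightarrow>
    tc a b + tc c d = tc (\<lambda>x. a x + c x) (\<lambda>x. b x + d x)"
  by (simp add: cl_add L2_cpl) (simp add: cpl_def[abs_def] plus_complex.code)

lemma tc_diff: "test1 a \<Longrightarrow> test1 b \<Longrightarrow> test1 c \<Longrightarrow> test1 d \<Longrightarrow>
    tc a b - tc c d = tc (\<lambda>x. a x - c x) (\<lambda>x. b x - d x)"
  by (simp add: cl_diff L2_cpl) (simp add: cpl_def[abs_def] minus_complex.code)

lemma deriv_test_diff: "test1 a \<Longrightarrow> test1 c \<Longrightarrow> deriv (\<lambda>x. a x - c x) = (\<lambda>x. deriv a x - deriv c x)"
  by (rule ext, rule DERIV_imp_deriv) (auto intro!: derivative_eq_intros test1_has_deriv)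

lemma td_diff: "test1 a \<Longrightarrow> test1 b \<Longrightarrow> test1 c \<Longrightarrow> test1 d \<Longrightarrow>
    td a b - td c d = td (\<lambda>x. a x - c x) (\<lambda>x. b x - d x)"
  by (simp add: tc_diff test1_deriv deriv_test_diff)

lemma tc_scale: "test1 a \<Longrightarrow> test1 b \<Longrightarrow> tc (\<lambda>x. c * a x) (\<lambda>x. d * b x) = c *\<^sub>R tc a (\<lambda>x. 0) + d *\<^sub>R tc (\<lambda>x. 0) b"
  by (simp add: cl_scaleR L2_cpl cl_add L2_scaleR) (simp add: cpl_def[abs_def] complex_eq_iff plus_complex.code)

lemma step_affine_has_deriv: "((\<lambda>x. step (a * x + b)) has_real_derivative a * kern (a * x + b)) (at x)"
  using has_deriv_affine[OF smooth_step, of a b x] by (simp add: deriv_step)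

lemma kern_scaled:
  assumes "N > 0"
  shows "test1 (\<lambda>x. kern (x / N) / N)" "(\<integral>x. kern (x / N) / N \<partial>lborel) = 1"
proof -
  show t: "test1 (\<lambda>x. kern (x / N) / N)"
    using test1_cmult[OF test1_affine[OF test1_kern, of "1 / N" 0], of "1 / N"] assms by simp
  have "(\<integral>x. kern (x / N) / N \<partial>lborel) = step (N / N) - step (0 / N)"
  proof (rule integral_compact_support_FTC[where F="\<lambda>x. step (x / N)" and a=0 and b=N])
    show "((\<lambda>x. step (x / N)) has_real_derivative kern (x / N) / N) (at x)" for x
      using step_affine_has_deriv[of "1 / N" 0 x] by simp
    show "continuous_on s (\<lambda>x. kern (x / N) / N)" for s by (rule test1_continuous[OF t])
    show "kern (x / N) / N = 0" if "x < 0 \<or> N < x" for x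
      using that assms by (auto simp: kern_zero divide_nonpos_pos)
  qed (use assms in auto)
  then show "(\<integral>x. kern (x / N) / N \<partial>lborel) = 1" using assms by (simp add: step_nonpos step_ge1)
qed

lemma test1_integrable: "test1 a \<Longrightarrow> integrable lborel a"
proof -
  assume a: "test1 a"
  obtain R where R: "R > 0" "\<And>x. \<bar>x\<bar> \<ge> R \<Longrightarrow> a x = 0" using test1_support[OF a] by blast
  have "integrable lborel (\<lambda>x. indicator {-R..R} x *\<^sub>R a x)"
    using borel_integrable_compact[of "{-R..R}" a] test1_continuous[OF a] by simp
  moreover have "(\<lambda>x. indicator {-R..R} x *\<^sub>R a x) = a"
    using R(2) by (force simp: indicator_def)
  ultimately show ?thesis by simp
qed

lemma test1_mean_zero_prim:
  assumes "test1 a" "(\<integral>x. a x \<partial>lborel) = 0"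
  obtains A where "test1 A" "deriv A = a"
proof -
  obtain R where R: "R > 0" "\<And>x. \<bar>x\<bar> \<ge> R \<Longrightarrow> a x = 0" using test1_support[OF assms(1)] by blast
  show ?thesis by (rule test1_prim[OF assms, of "-R" R]) (use R that in auto)
qed

text \<open>A constant in L2 is zero, in weak form. A test function minus a suitable multiple of a
  density of width \<open>N\<close> has mean zero, hence is the derivative of a test function and is
  orthogonal to \<open>u\<close>. The density has norm of order \<open>1 / sqrt N\<close>, so what
  remains of the pairing vanishes as \<open>N\<close> grows.\<close>

lemma wd_zero:
  assumes "wd u 0" shows "u = 0"
proof -
  have "inner u (tc a b) = 0" if t: "test1 a" "test1 b" for a b
  proof -
    define c d where "c = (\<integral>x. a x \<partial>lborel)" and "d = (\<integral>x. b x \<partial>lborel)"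
    obtain K where K: "K > 0" "\<And>x. \<bar>kern x\<bar> \<le> K" using test1_bounded[OF test1_kern] by blast
    have le: "\<bar>inner u (tc a b)\<bar> \<le> norm u * ((\<bar>c\<bar> + \<bar>d\<bar>) * K) / sqrt N" if "N > 0" for N
    proof -
      define k where "k x = kern (x / N) / N" for x
      have k: "test1 k" "(\<integral>x. k x \<partial>lborel) = 1" using kern_scaled[OF that] by (auto simp: k_def[abs_def])
      have ta: "test1 (\<lambda>x. a x - c * k x)" and tb: "test1 (\<lambda>x. b x - d * k x)"
        by (intro test1_diff test1_cmult t k)+
      have ma: "(\<integral>x. a x - c * k x \<partial>lborel) = 0" and mb: "(\<integral>x. b x - d * k x \<partial>lborel) = 0"
        using t k by (simp_all add: test1_integrable c_def d_def)
      obtain A where A: "test1 A" "deriv A = (\<lambda>x. a x - c * k x)" by (rule test1_mean_zero_prim[OF ta ma])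
      obtain B where B: "test1 B" "deriv B = (\<lambda>x. b x - d * k x)" by (rule test1_mean_zero_prim[OF tb mb])
      have "tc a b = td A B + tc (\<lambda>x. c * k x) (\<lambda>x. d * k x)"
        unfolding A B using ta tb t k by (simp add: tc_add test1_cmult)
      moreover have "inner u (td A B) = 0" using assms A(1) B(1) unfolding wd_def by auto
      ultimately have "inner u (tc a b) = inner u (tc (\<lambda>x. c * k x) (\<lambda>x. d * k x))"
        by (simp add: inner_add_right)
      also have "\<bar>\<dots>\<bar> \<le> norm u * norm (tc (\<lambda>x. c * k x) (\<lambda>x. d * k x))"
        by (rule Cauchy_Schwarz_ineq2)
      also have "\<dots> \<le> norm u * ((\<bar>c\<bar> + \<bar>d\<bar>) * K / N * sqrt (N - 0))"
      proof (intro mult_left_mono L2_bounded_support(2))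
        show "cpl (\<lambda>x. c * k x) (\<lambda>x. d * k x) \<in> borel_measurable lborel"
          using k by (intro L2_measurable L2_cpl test1_cmult)
        show "cmod (cpl (\<lambda>x. c * k x) (\<lambda>x. d * k x) x) \<le> (\<bar>c\<bar> + \<bar>d\<bar>) * K / N" for x
        proof -
          have kx: "\<bar>k x\<bar> \<le> K / N" using K(2)[of "x / N"] that by (simp add: k_def divide_right_mono)
          have "cmod (cpl (\<lambda>x. c * k x) (\<lambda>x. d * k x) x) \<le> \<bar>c\<bar> * \<bar>k x\<bar> + \<bar>d\<bar> * \<bar>k x\<bar>"
            using cmod_cpl_le[of "\<lambda>x. c * k x" "\<lambda>x. d * k x" x] by (simp add: abs_mult)
          also have "\<dots> \<le> \<bar>c\<bar> * (K / N) + \<bar>d\<bar> * (K / N)" using kx by (intro add_mono mult_left_mono) auto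
          finally show ?thesis by (simp add: algebra_simps add_divide_distrib)
        qed
        show "cpl (\<lambda>x. c * k x) (\<lambda>x. d * k x) x = 0" if "x < 0 \<or> N < x" for x
          using that \<open>N > 0\<close> by (auto simp: k_def cpl_eq kern_zero divide_nonpos_pos)
      qed (use that in auto)
      also have "\<dots> = norm u * ((\<bar>c\<bar> + \<bar>d\<bar>) * K) / sqrt N"
      proof -
        define r where "r = sqrt N"
        have "N = r * r" "r > 0" using that by (simp_all add: r_def)
        then show ?thesis by (simp flip: r_def add: field_simps)
      qed
      finally show ?thesis .
    qed
    have "((\<lambda>N. norm u * ((\<bar>c\<bar> + \<bar>d\<bar>) * K) / sqrt N) \<longlongrightarrow> 0) at_top"
      by (intro tendsto_divide_0[OF tendsto_const] filterlim_at_top_imp_at_infinity sqrt_at_top)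
    moreover have "\<forall>\<^sub>F N in at_top. \<bar>inner u (tc a b)\<bar> \<le> norm u * ((\<bar>c\<bar> + \<bar>d\<bar>) * K) / sqrt N"
      using eventually_gt_at_top[of 0] by eventually_elim (rule le)
    ultimately have "\<bar>inner u (tc a b)\<bar> \<le> 0"
      by (intro tendsto_lowerbound) auto
    then show ?thesis by simp
  qed
  then show ?thesis by (intro eq_if_tests) simp
qed

lemma norm_mulr_le:
  assumes "test1 \<sigma>" "\<And>x. \<bar>\<sigma> x\<bar> \<le> K" "0 \<le> K"
  shows "norm (mulr \<sigma> f) \<le> K * norm f"
proof -
  obtain f' where f: "L2 f'" "f = cl f'" by (rule l2_cases)
  have "l2sq (\<lambda>x. complex_of_real (\<sigma> x) * f' x) \<le> (\<integral>x. K\<^sup>2 * (cmod (f' x))\<^sup>2 \<partial>lborel)"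
    unfolding l2sq_def
  proof (rule integral_mono)
    show "(cmod (complex_of_real (\<sigma> x) * f' x))\<^sup>2 \<le> K\<^sup>2 * (cmod (f' x))\<^sup>2" for x
      using assms(2)[of x] assms(3)
      by (simp add: norm_mult power_mult_distrib mult_right_mono abs_le_square_iff flip: abs_le_square_iff)
  qed (use L2_integrable[OF L2_mulr_test[OF assms(1) f(1)]] L2_integrable[OF f(1)] in auto)
  then have "(norm (mulr \<sigma> f))\<^sup>2 \<le> (K * norm f)\<^sup>2"
    using f assms(1) by (simp add: mulr_cl norm_cl_sq L2_mulr_test power_mult_distrib l2sq_def)
  then show ?thesis by (rule power2_le_imp_le) (use assms(3) in simp)
qed

lemma mulr_diff: "test1 \<sigma> \<Longrightarrow> mulr \<sigma> (f - g) = mulr \<sigma> f - mulr \<sigma> g"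
proof -
  assume s: "test1 \<sigma>"
  obtain f' g' where "L2 f'" "L2 g'" "f = cl f'" "g = cl g'" by (meson l2_cases)
  with s show ?thesis by (simp add: mulr_cl cl_diff L2_mulr_test L2_diff right_diff_distrib)
qed

text \<open>Integrate the pointwise bound \<open>test_sup_bound\<close> over the support and cancel
  one factor \<open>norm (tc a b)\<close>.\<close>

lemma test_poincare:
  assumes t: "test1 a" "test1 b" and R: "\<And>x. x < l \<or> u < x \<Longrightarrow> a x = 0 \<and> b x = 0" and "l \<le> u"
  shows "norm (tc a b) \<le> (u - l) * norm (td a b)"
proof -
  let ?N = "norm (tc a b)" and ?D = "norm (td a b)"
  have "?N \<le> sqrt (?N * ?D) * sqrt (u - l)"
  proof (rule L2_bounded_support(2))
    show "cmod (cpl a b x) \<le> sqrt (?N * ?D)" for x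
      by (rule real_le_rsqrt[OF test_sup_bound[OF t]])
  qed (use R \<open>l \<le> u\<close> L2_measurable[OF L2_cpl[OF t]] in \<open>auto simp: cpl_eq\<close>)
  then have "?N\<^sup>2 \<le> (sqrt (?N * ?D) * sqrt (u - l))\<^sup>2" by (rule power_mono) simp
  also have "\<dots> = ?N * (?D * (u - l))" using \<open>l \<le> u\<close> by (simp add: power_mult_distrib mult.assoc)
  finally have "?N * ?N \<le> ?N * ((u - l) * ?D)" by (simp add: power2_eq_square mult.commute)
  then show ?thesis using \<open>l \<le> u\<close> by (cases "?N = 0") (auto simp: mult_le_cancel_left)
qed


section \<open>Approximation of functions of finite energy by test functions\<close>

definition cutoff :: "real \<Rightarrow> real \<Rightarrow> real" where
  "cutoff R x = step (x + R + 1) - step (x - R)"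

lemma test1_cutoff: "test1 (cutoff R)"
proof -
  have eq: "cutoff R = (\<lambda>x. step ((x - (- R - 1)) / 1) - step ((x - R) / 1))"
    by (rule ext) (simp add: cutoff_def algebra_simps)
  show ?thesis unfolding eq by (rule plateau_test1) simp
qed

lemma cutoff_1: "\<bar>x\<bar> \<le> R \<Longrightarrow> cutoff R x = 1"
  and cutoff_0: "0 \<le> R \<Longrightarrow> R + 1 \<le> \<bar>x\<bar> \<Longrightarrow> cutoff R x = 0"
  and cutoff_bound: "\<bar>cutoff R x\<bar> \<le> 1"
  using step_bounds[of "x + R + 1"] step_bounds[of "x - R"]
  by (auto simp: cutoff_def abs_if step_nonpos step_ge1 split: if_splits)

lemma deriv_cutoff: "deriv (cutoff R) x = kern (x + R + 1) - kern (x - R)"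
proof (rule DERIV_imp_deriv)
  have "((\<lambda>x. step (x + c)) has_real_derivative kern (x + c)) (at x)" for c
    using step_affine_has_deriv[of 1 c x] by simp
  from DERIV_diff[OF this[of "R + 1"] this[of "- R"]]
  show "(cutoff R has_real_derivative kern (x + R + 1) - kern (x - R)) (at x)"
    by (simp add: cutoff_def[abs_def] add.assoc)
qed

lemma deriv_cutoff_0: "\<bar>x\<bar> \<le> R \<Longrightarrow> deriv (cutoff R) x = 0"
  by (simp add: deriv_cutoff kern_zero abs_le_iff)

text \<open>Instead of convolving \<open>f\<close>, the weak derivative \<open>G\<close> of
  \<open>\<sigma>\<close> times \<open>f\<close> is approximated by test functions, which are then
  integrated. Their primitives have compact support only if the means vanish; the mean of
  \<open>G\<close> vanishes, so the approximants have small means and are corrected by small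
  multiples of \<open>kern\<close>. The Poincare inequality carries convergence from the derivatives
  to the functions, and \<open>wd_zero\<close> identifies the limit.\<close>

lemma wd_compact_approx:
  assumes wd: "wd f g" and s: "test1 \<sigma>"
  obtains a b where "\<And>n. test1 (a n)" "\<And>n. test1 (b n)"
    "(\<lambda>n. tc (a n) (b n)) \<longlonglongrightarrow> mulr \<sigma> f" "(\<lambda>n. td (a n) (b n)) \<longlonglongrightarrow> mulr (deriv \<sigma>) f + mulr \<sigma> g"
proof -
  define G where "G = mulr (deriv \<sigma>) f + mulr \<sigma> g"
  note s' = test1_deriv[OF s]
  have wdG: "wd (mulr \<sigma> f) G" unfolding G_def by (rule wd_mulr[OF s wd])
  obtain R0 where R0: "R0 > 0" "\<And>x. \<bar>x\<bar> \<ge> R0 \<Longrightarrow> \<sigma> x = 0" using test1_support[OF s] by blast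
  define R where "R = R0 + 1"
  have R: "R \<ge> 1" "\<And>x. \<bar>x\<bar> \<ge> R \<Longrightarrow> \<sigma> x = 0" "\<And>x. \<bar>x\<bar> \<ge> R \<Longrightarrow> deriv \<sigma> x = 0"
    using R0 deriv_eq_0_outside[of R0 \<sigma>] by (auto simp: R_def)
  have tau_G: "mulr (cutoff R) G = G"
  proof -
    obtain f' g' where fg: "L2 f'" "L2 g'" "f = cl f'" "g = cl g'" by (meson l2_cases)
    have "complex_of_real (cutoff R x) * (complex_of_real (deriv \<sigma> x) * f' x + complex_of_real (\<sigma> x) * g' x)
        = complex_of_real (deriv \<sigma> x) * f' x + complex_of_real (\<sigma> x) * g' x" for x
      using R(2,3)[of x] cutoff_1[of x R] by (cases "\<bar>x\<bar> \<ge> R") auto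
    moreover have "mulr (cutoff R) G = cl (\<lambda>x. complex_of_real (cutoff R x) * (complex_of_real (deriv \<sigma> x) * f' x + complex_of_real (\<sigma> x) * g' x))"
      "G = cl (\<lambda>x. complex_of_real (deriv \<sigma> x) * f' x + complex_of_real (\<sigma> x) * g' x)"
      using fg s s' by (simp_all add: G_def mulr_cl cl_add L2_mulr_test L2_add test1_cutoff)
    ultimately show ?thesis by (simp only:)
  qed
  define T where "T = cutoff (R + 1)"
  have T: "test1 T" by (simp add: T_def test1_cutoff)
  \<comment> \<open>The mean of \<open>G\<close> is zero. Since \<open>G\<close> need not be
    integrated by itself, this is expressed by pairing with a plateau \<open>T\<close> that equals 1
    on the relevant supports and whose derivative vanishes on the support of
    \<open>\<sigma>\<close>.\<close>
  have orth: "inner G (tc T (\<lambda>x. 0)) = 0" "inner G (tc (\<lambda>x. 0) T) = 0"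
  proof -
    have z: "\<sigma> x * deriv T x = 0" for x
      using R(2)[of x] deriv_cutoff_0[of x "R + 1"] by (cases "\<bar>x\<bar> \<ge> R") (auto simp: T_def)
    have d0: "deriv (\<lambda>x::real. 0::real) = (\<lambda>x. 0)" by auto
    have c0: "cl (cpl (\<lambda>x. 0) (\<lambda>x. 0)) = 0" using tc_diff[of T T T T] T by simp
    have "inner (mulr \<sigma> f) (td T (\<lambda>x. 0)) = 0" "inner (mulr \<sigma> f) (td (\<lambda>x. 0) T) = 0"
      using s T by (simp_all add: inner_mulr mulr_tc test1_deriv d0 z c0 del: deriv_const)
    then show "inner G (tc T (\<lambda>x. 0)) = 0" "inner G (tc (\<lambda>x. 0) T) = 0"
      using wdG[unfolded wd_def, rule_format, OF T test1_0] wdG[unfolded wd_def, rule_format, OF test1_0 T] by simp_all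
  qed
  \<comment> \<open>The 1 accounts for the approximation error itself; the other two terms account
    for the corrections by \<open>kern\<close>, whose coefficients \<open>c\<close> and
    \<open>d\<close> are bounded by the error times the norm of the plateau.\<close>
  define C where "C = 1 + norm (tc T (\<lambda>x. 0)) * norm (tc kern (\<lambda>x. 0)) + norm (tc (\<lambda>x. 0) T) * norm (tc (\<lambda>x. 0) kern)"
  have C: "C > 0" unfolding C_def by (intro add_pos_nonneg mult_nonneg_nonneg) auto
  have approx: "\<exists>a b. test1 a \<and> test1 b \<and> (\<forall>x. x < - R - 1 \<or> R + 1 < x \<longrightarrow> a x = 0 \<and> b x = 0) \<and> norm (td a b - G) \<le> C * e"
    if e: "e > 0" for e
  proof -
    obtain a b where t: "test1 a" "test1 b" and ab: "norm (tc a b - G) < e" using tests_approx[OF e] by blast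
    define \<alpha> \<beta> where "\<alpha> x = cutoff R x * a x" and "\<beta> x = cutoff R x * b x" for x
    have ab': "test1 \<alpha>" "test1 \<beta>" unfolding \<alpha>_def[abs_def] \<beta>_def[abs_def] by (intro test1_mult' test1_cutoff t)+
    have "tc \<alpha> \<beta> - G = mulr (cutoff R) (tc a b - G)"
      using t by (simp add: mulr_diff test1_cutoff tau_G mulr_tc \<alpha>_def[abs_def] \<beta>_def[abs_def])
    then have near: "norm (tc \<alpha> \<beta> - G) \<le> e"
      using norm_mulr_le[OF test1_cutoff cutoff_bound, of R "tc a b - G"] ab by simp
    define c d where "c = (\<integral>x. \<alpha> x \<partial>lborel)" and "d = (\<integral>x. \<beta> x \<partial>lborel)"
    have Tab: "\<alpha> x * T x = \<alpha> x" "\<beta> x * T x = \<beta> x" for x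
      using cutoff_1[of x "R + 1"] cutoff_0[of R x] R(1) by (cases "\<bar>x\<bar> \<le> R + 1"; simp add: \<alpha>_def \<beta>_def T_def)+
    have ip: "inner (tc \<alpha> \<beta>) (tc T (\<lambda>x. 0)) = c" "inner (tc \<alpha> \<beta>) (tc (\<lambda>x. 0) T) = d"
      using ab' T by (simp_all add: inner_cl L2_cpl inner_complex_def cpl_simps Tab c_def d_def)
    have cb: "\<bar>c\<bar> \<le> e * norm (tc T (\<lambda>x. 0))"
    proof -
      have "\<bar>inner (tc \<alpha> \<beta> - G) (tc T (\<lambda>x. 0))\<bar> \<le> norm (tc \<alpha> \<beta> - G) * norm (tc T (\<lambda>x. 0))"
        by (rule Cauchy_Schwarz_ineq2)
      also have "\<dots> \<le> e * norm (tc T (\<lambda>x. 0))" by (intro mult_right_mono near) auto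
      finally show ?thesis by (simp add: inner_diff_left ip orth)
    qed
    have db: "\<bar>d\<bar> \<le> e * norm (tc (\<lambda>x. 0) T)"
    proof -
      have "\<bar>inner (tc \<alpha> \<beta> - G) (tc (\<lambda>x. 0) T)\<bar> \<le> norm (tc \<alpha> \<beta> - G) * norm (tc (\<lambda>x. 0) T)"
        by (rule Cauchy_Schwarz_ineq2)
      also have "\<dots> \<le> e * norm (tc (\<lambda>x. 0) T)" by (intro mult_right_mono near) auto
      finally show ?thesis by (simp add: inner_diff_left ip orth)
    qed
    have ta: "test1 (\<lambda>x. \<alpha> x - c * kern x)" and tb: "test1 (\<lambda>x. \<beta> x - d * kern x)"
      by (intro test1_diff test1_cmult ab' test1_kern)+
    have k1: "(\<integral>x. kern x \<partial>lborel) = 1" using kern_scaled(2)[of 1] by simp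
    have ma: "(\<integral>x. \<alpha> x - c * kern x \<partial>lborel) = 0" and mb: "(\<integral>x. \<beta> x - d * kern x \<partial>lborel) = 0"
      using ab' k1 by (simp_all add: test1_integrable test1_kern c_def d_def)
    have supp: "\<alpha> x - c * kern x = 0" "\<beta> x - d * kern x = 0" if "x < - R - 1 \<or> R + 1 < x" for x
    proof -
      have "kern x = 0" using that R(1) by (intro kern_zero) auto
      moreover have "cutoff R x = 0" using that R(1) by (intro cutoff_0) auto
      ultimately show "\<alpha> x - c * kern x = 0" "\<beta> x - d * kern x = 0" by (simp_all add: \<alpha>_def \<beta>_def)
    qed
    obtain A where A: "test1 A" "deriv A = (\<lambda>x. \<alpha> x - c * kern x)" "\<And>x. x < - R - 1 \<or> R + 1 < x \<Longrightarrow> A x = 0"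
      by (rule test1_prim[OF ta ma, of "- R - 1" "R + 1"]) (use supp R(1) in auto)
    obtain B where B: "test1 B" "deriv B = (\<lambda>x. \<beta> x - d * kern x)" "\<And>x. x < - R - 1 \<or> R + 1 < x \<Longrightarrow> B x = 0"
      by (rule test1_prim[OF tb mb, of "- R - 1" "R + 1"]) (use supp R(1) in auto)
    have eq: "td A B - G = (tc \<alpha> \<beta> - G) - (c *\<^sub>R tc kern (\<lambda>x. 0) + d *\<^sub>R tc (\<lambda>x. 0) kern)"
      unfolding A B using ab' by (simp add: tc_scale[symmetric] tc_diff[symmetric] test1_kern test1_cmult)
    have "norm (td A B - G) \<le> e + (e * norm (tc T (\<lambda>x. 0)) * norm (tc kern (\<lambda>x. 0)) + e * norm (tc (\<lambda>x. 0) T) * norm (tc (\<lambda>x. 0) kern))"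
      unfolding eq
    proof (rule order_trans[OF norm_triangle_ineq4], rule add_mono[OF near], rule order_trans[OF norm_triangle_ineq])
      show "norm (c *\<^sub>R tc kern (\<lambda>x. 0)) + norm (d *\<^sub>R tc (\<lambda>x. 0) kern)
          \<le> e * norm (tc T (\<lambda>x. 0)) * norm (tc kern (\<lambda>x. 0)) + e * norm (tc (\<lambda>x. 0) T) * norm (tc (\<lambda>x. 0) kern)"
        using cb db by (auto intro!: add_mono mult_right_mono)
    qed
    also have "\<dots> = C * e" by (simp add: C_def algebra_simps)
    finally show ?thesis using A B by blast
  qed
  have "\<exists>a b. test1 a \<and> test1 b \<and> (\<forall>x. x < - R - 1 \<or> R + 1 < x \<longrightarrow> a x = 0 \<and> b x = 0) \<and> norm (td a b - G) \<le> 1 / real (Suc n)" for n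
    using approx[of "1 / real (Suc n) / C"] C by simp
  then obtain a b where ab: "\<And>n. test1 (a n)" "\<And>n. test1 (b n)"
    "\<And>n x. x < - R - 1 \<or> R + 1 < x \<Longrightarrow> a n x = 0 \<and> b n x = 0" "\<And>n. norm (td (a n) (b n) - G) \<le> 1 / real (Suc n)"
    by metis
  have limG: "(\<lambda>n. td (a n) (b n)) \<longlonglongrightarrow> G"
  proof (rule LIM_zero_cancel, rule tendsto_norm_zero_cancel, rule tendsto_sandwich[OF _ _ tendsto_const])
    show "(\<lambda>n. 1 / real (Suc n)) \<longlonglongrightarrow> 0" using LIMSEQ_inverse_real_of_nat by (simp add: inverse_eq_divide)
  qed (use ab in auto)
  have "Cauchy (\<lambda>n. tc (a n) (b n))"
  proof (rule CauchyI)
    fix e :: real assume "e > 0"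
    \<comment> \<open>The common support has length \<open>2 * R + 2\<close>; one more makes the
      final inequality strict.\<close>
    then have "e / (2 * R + 3) > 0" using R(1) by simp
    from CauchyD[OF LIMSEQ_imp_Cauchy[OF limG] this]
    obtain M where M: "\<And>m n. m \<ge> M \<Longrightarrow> n \<ge> M \<Longrightarrow> norm (td (a m) (b m) - td (a n) (b n)) < e / (2 * R + 3)" by blast
    have "norm (tc (a m) (b m) - tc (a n) (b n)) < e" if "m \<ge> M" "n \<ge> M" for m n
    proof -
      have "norm (tc (a m) (b m) - tc (a n) (b n)) \<le> ((R + 1) - (- R - 1)) * norm (td (a m) (b m) - td (a n) (b n))"
        unfolding tc_diff[OF ab(1,2) ab(1,2)] td_diff[OF ab(1,2) ab(1,2)]
        by (rule test_poincare) (use ab R(1) in \<open>auto intro: test1_diff\<close>)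
      also have "\<dots> \<le> ((R + 1) - (- R - 1)) * (e / (2 * R + 3))"
        using M[OF that] R(1) by (intro mult_left_mono) auto
      also have "\<dots> < e" using R(1) \<open>e > 0\<close> by (simp add: field_simps)
      finally show ?thesis .
    qed
    then show "\<exists>M. \<forall>m\<ge>M. \<forall>n\<ge>M. norm (tc (a m) (b m) - tc (a n) (b n)) < e" by blast
  qed
  then obtain h where h: "(\<lambda>n. tc (a n) (b n)) \<longlonglongrightarrow> h" using Cauchy_convergent convergent_def by blast
  have "wd h G" by (rule wd_limit[OF _ h limG]) (intro wd_tests ab)
  from wd_diff[OF this wdG] have "h = mulr \<sigma> f" using wd_zero by force
  then show ?thesis using that[of a b] ab h limG unfolding G_def by blast
qed

lemma tendsto_mulr_cutoff: "(\<lambda>n. mulr (cutoff (real n)) f) \<longlonglongrightarrow> f"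
  and tendsto_mulr_deriv_cutoff: "(\<lambda>n. mulr (deriv (cutoff (real n))) f) \<longlonglongrightarrow> 0"
proof -
  obtain f' where f: "L2 f'" "f = cl f'" by (rule l2_cases)
  note [measurable] = L2_measurable[OF f(1)]
  have ev: "\<forall>\<^sub>F n in sequentially. \<bar>x\<bar> \<le> real n" for x :: real
    using filterlim_real_sequentially by (simp add: filterlim_at_top)
  show "(\<lambda>n. mulr (cutoff (real n)) f) \<longlonglongrightarrow> f"
    unfolding f(2) mulr_cl[OF test1_cutoff f(1)]
  proof (rule L2_dominated_convergence(2)[OF _ _ f(1)])
    show "L2 (\<lambda>x. complex_of_real (cutoff (real n) x) * f' x)" for n by (intro L2_mulr_test test1_cutoff f)
    show "AE x in lborel. (\<lambda>n. complex_of_real (cutoff (real n) x) * f' x) \<longlonglongrightarrow> f' x"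
    proof (rule AE_I2, rule tendsto_eventually)
      show "\<forall>\<^sub>F n in sequentially. complex_of_real (cutoff (real n) x) * f' x = f' x" for x
        using ev[of x] by eventually_elim (simp add: cutoff_1)
    qed
    show "cmod (complex_of_real (cutoff (real n) x) * f' x) \<le> cmod (f' x)" for n x
      using mult_right_mono[OF cutoff_bound[of "real n" x] norm_ge_zero[of "f' x"]] by (simp add: norm_mult)
  qed measurable
  obtain K where K: "K > 0" "\<And>x. \<bar>kern x\<bar> \<le> K" using test1_bounded[OF test1_kern] by blast
  have "(\<lambda>n. mulr (deriv (cutoff (real n))) f) \<longlonglongrightarrow> cl (\<lambda>x. 0)"
    unfolding f(2) mulr_cl[OF test1_deriv[OF test1_cutoff] f(1)]
  proof (rule L2_dominated_convergence(2)[OF _ _ L2_cmult[OF f(1), of "complex_of_real (2 * K)"]])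
    show "L2 (\<lambda>x. complex_of_real (deriv (cutoff (real n)) x) * f' x)" for n
      by (intro L2_mulr_test test1_deriv test1_cutoff f)
    show "AE x in lborel. (\<lambda>n. complex_of_real (deriv (cutoff (real n)) x) * f' x) \<longlonglongrightarrow> 0"
    proof (rule AE_I2, rule tendsto_eventually)
      show "\<forall>\<^sub>F n in sequentially. complex_of_real (deriv (cutoff (real n)) x) * f' x = 0" for x
        using ev[of x] by eventually_elim (simp add: deriv_cutoff_0)
    qed
    show "cmod (complex_of_real (deriv (cutoff (real n)) x) * f' x) \<le> cmod (complex_of_real (2 * K) * f' x)" for n x
    proof -
      have "\<bar>deriv (cutoff (real n)) x\<bar> \<le> 2 * K"
        using K(2)[of "x + real n + 1"] K(2)[of "x - real n"] by (simp add: deriv_cutoff)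
      then show ?thesis using K(1) by (simp add: norm_mult mult_right_mono)
    qed
  qed simp
  then show "(\<lambda>n. mulr (deriv (cutoff (real n))) f) \<longlonglongrightarrow> 0" by (simp add: cl_zero)
qed

text \<open>Density of the test functions in H1, in the graph norm. A cutoff reduces it to compact
  support, where the term with the derivative of the cutoff disappears in the limit. The embedding
  and point evaluation are established for test functions and extended by this.\<close>

theorem wd_approx:
  assumes "wd f g" "e > 0"
  obtains a b where "test1 a" "test1 b" "norm (tc a b - f) < e" "norm (td a b - g) < e"
proof -
  have "(\<lambda>n. mulr (deriv (cutoff (real n))) f + mulr (cutoff (real n)) g) \<longlonglongrightarrow> 0 + g"
    by (intro tendsto_add tendsto_mulr_cutoff tendsto_mulr_deriv_cutoff)
  then have "\<forall>\<^sub>F n in sequentially. dist (mulr (deriv (cutoff (real n))) f + mulr (cutoff (real n)) g) g < e / 2"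
    using tendstoD[of _ g _ "e/2"] assms(2) by simp
  moreover have "\<forall>\<^sub>F n in sequentially. dist (mulr (cutoff (real n)) f) f < e / 2"
    using tendstoD[OF tendsto_mulr_cutoff, of "e/2" f] assms(2) by simp
  ultimately have "\<forall>\<^sub>F n in sequentially. dist (mulr (deriv (cutoff (real n))) f + mulr (cutoff (real n)) g) g < e / 2
      \<and> dist (mulr (cutoff (real n)) f) f < e / 2" by eventually_elim simp
  then obtain n where n: "dist (mulr (deriv (cutoff (real n))) f + mulr (cutoff (real n)) g) g < e / 2"
    "dist (mulr (cutoff (real n)) f) f < e / 2"
    by (auto simp: eventually_sequentially)
  obtain a b where ab: "\<And>n. test1 (a n)" "\<And>n. test1 (b n)"
    "(\<lambda>k. tc (a k) (b k)) \<longlonglongrightarrow> mulr (cutoff (real n)) f"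
    "(\<lambda>k. td (a k) (b k)) \<longlonglongrightarrow> mulr (deriv (cutoff (real n))) f + mulr (cutoff (real n)) g"
    using wd_compact_approx[OF assms(1) test1_cutoff] by blast
  have "\<forall>\<^sub>F k in sequentially. dist (tc (a k) (b k)) (mulr (cutoff (real n)) f) < e / 2
      \<and> dist (td (a k) (b k)) (mulr (deriv (cutoff (real n))) f + mulr (cutoff (real n)) g) < e / 2"
    using tendstoD[OF ab(3), of "e/2"] tendstoD[OF ab(4), of "e/2"] assms(2) by (auto elim: eventually_elim2)
  then obtain k where k: "dist (tc (a k) (b k)) (mulr (cutoff (real n)) f) < e / 2"
      "dist (td (a k) (b k)) (mulr (deriv (cutoff (real n))) f + mulr (cutoff (real n)) g) < e / 2"
    by (auto simp: eventually_sequentially)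
  have "dist (tc (a k) (b k)) f < e" "dist (td (a k) (b k)) g < e"
    by (rule dist_triangle_half_l[OF k(1)], subst dist_commute, rule n(2))
       (rule dist_triangle_half_l[OF k(2)], subst dist_commute, rule n(1))
  then show ?thesis using that ab by (auto simp: dist_norm)
qed

section \<open>Point evaluation\<close>

lemma wd_approx_seq:
  assumes "wd f g"
  obtains a b where "\<And>n. test1 (a n)" "\<And>n. test1 (b n)"
    "(\<lambda>n. tc (a n) (b n)) \<longlonglongrightarrow> f" "(\<lambda>n. td (a n) (b n)) \<longlonglongrightarrow> g"
proof -
  have "\<exists>a b. test1 a \<and> test1 b \<and> norm (tc a b - f) < 1 / real (Suc n) \<and> norm (td a b - g) < 1 / real (Suc n)" for n
    using wd_approx[OF assms, of "1 / real (Suc n)"] by (metis of_nat_0_less_iff zero_less_Suc zero_less_divide_1_iff)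
  then obtain a b where ab: "\<And>n. test1 (a n)" "\<And>n. test1 (b n)"
    "\<And>n. norm (tc (a n) (b n) - f) < 1 / real (Suc n)" "\<And>n. norm (td (a n) (b n) - g) < 1 / real (Suc n)"
    by metis
  have lim: "h \<longlonglongrightarrow> H" if "\<And>n. norm (h n - H) < 1 / real (Suc n)" for h :: "nat \<Rightarrow> l2" and H
  proof (rule LIM_zero_cancel, rule tendsto_norm_zero_cancel, rule tendsto_sandwich[OF _ _ tendsto_const])
    show "(\<lambda>n. 1 / real (Suc n)) \<longlonglongrightarrow> 0" using LIMSEQ_inverse_real_of_nat by (simp add: inverse_eq_divide)
  qed (use that[THEN less_imp_le] in auto)
  show ?thesis using that[OF ab(1,2) lim[OF ab(3)] lim[OF ab(4)]] .
qed

definition ker0 :: "real \<Rightarrow> l2" where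
  "ker0 x = cl (\<lambda>z. complex_of_real (indicator {x..x+1} z))"

definition ker1 :: "real \<Rightarrow> l2" where
  "ker1 x = cl (\<lambda>z. complex_of_real ((x + 1 - z) * indicator {x..x+1} z))"

text \<open>If \<open>g\<close> is the weak derivative of \<open>f\<close>, integration by parts over \<open>[x, x + 1]\<close> shows that
  this is \<open>f x\<close>; unlike the point value it makes sense, and is bounded, for arbitrary pairs.\<close>

definition ev :: "real \<Rightarrow> l2 \<Rightarrow> l2 \<Rightarrow> complex" where
  "ev x f g = Complex (inner f (ker0 x) - inner g (ker1 x)) (inner f (mulI (ker0 x)) - inner g (mulI (ker1 x)))"

lemma L2_ker: "L2 (\<lambda>z. complex_of_real (indicator {x..x+1} z))"
    "L2 (\<lambda>z. complex_of_real ((x + 1 - z) * indicator {x..x+1} z))"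
  and norm_ker: "norm (ker0 x) \<le> 1" "norm (ker1 x) \<le> 1"
proof -
  note * = L2_bounded_support[where K=1 and a=x and b="x+1"]
  show "L2 (\<lambda>z. complex_of_real (indicator {x..x+1} z))"
    by (rule *(1)) (auto simp: indicator_def simp del: of_real_mult of_real_diff of_real_add)
  show "L2 (\<lambda>z. complex_of_real ((x + 1 - z) * indicator {x..x+1} z))"
    by (rule *(1)) (auto simp: indicator_def simp del: of_real_mult of_real_diff of_real_add)
  have "norm (ker0 x) \<le> 1 * sqrt (x + 1 - x)"
    unfolding ker0_def by (rule *(2)) (auto simp: indicator_def simp del: of_real_mult of_real_diff of_real_add)
  moreover have "norm (ker1 x) \<le> 1 * sqrt (x + 1 - x)"
    unfolding ker1_def by (rule *(2)) (auto simp: indicator_def simp del: of_real_mult of_real_diff of_real_add)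
  ultimately show "norm (ker0 x) \<le> 1" "norm (ker1 x) \<le> 1" by simp_all
qed

lemma ev_diff: "ev x (f - f') (g - g') = ev x f g - ev x f' g'"
  and ev_zero: "ev x 0 0 = 0"
  by (simp_all add: ev_def complex_eq_iff inner_diff_left algebra_simps)

text \<open>Crude, but valid for unrelated \<open>f\<close> and \<open>g\<close>, as the fixed point
  argument demands; the sharper bound \<open>ev_sup\<close> is restricted to pairs with
  \<open>wd f g\<close>. The factor 2 adds the real and the imaginary component.\<close>

lemma ev_bound: "cmod (ev x f g) \<le> 2 * (norm f + norm g)"
proof -
  have *: "\<bar>inner h k\<bar> \<le> norm h" if "norm k \<le> 1" for h k :: l2
    using Cauchy_Schwarz_ineq2[of h k] mult_left_mono[OF that, of "norm h"] by simp
  have "cmod (ev x f g) \<le> \<bar>inner f (ker0 x) - inner g (ker1 x)\<bar> + \<bar>inner f (mulI (ker0 x)) - inner g (mulI (ker1 x))\<bar>"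
    using cmod_le[of "ev x f g"] by (simp add: ev_def)
  also have "\<dots> \<le> 2 * (norm f + norm g)"
    using *[OF norm_ker(1)[of x], of f] *[OF norm_ker(2)[of x], of g]
      *[of "mulI (ker0 x)" f] *[of "mulI (ker1 x)" g] norm_ker[of x] by auto
  finally show ?thesis .
qed

lemma tendsto_ev:
  assumes "(f \<longlongrightarrow> f') F" "(g \<longlongrightarrow> g') F"
  shows "((\<lambda>n. ev x (f n) (g n)) \<longlongrightarrow> ev x f' g') F"
  unfolding ev_def by (intro tendsto_intros assms)

lemma continuous_on_ev [continuous_intros]:
  "continuous_on S f \<Longrightarrow> continuous_on S g \<Longrightarrow> continuous_on S (\<lambda>t. ev x (f t) (g t))"
  unfolding ev_def by (intro continuous_on_Complex continuous_intros) auto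

lemma ev_test:
  assumes t: "test1 a" "test1 b"
  shows "ev x (tc a b) (td a b) = cpl a b x"
proof -
  note t' = t[THEN test1_deriv]
  have FTC: "(\<integral>z. c z * indicator {x..x+1} z \<partial>lborel) - (\<integral>z. deriv c z * ((x + 1 - z) * indicator {x..x+1} z) \<partial>lborel) = c x"
    if c: "test1 c" for c
  proof -
    have "(\<integral>z. (c z - deriv c z * (x + 1 - z)) * indicator {x..x+1} z \<partial>lborel)
       = - (x + 1 - (x + 1)) * c (x + 1) - (- (x + 1 - x) * c x)"
    proof (rule integral_FTC_Icc_real)
      show "((\<lambda>z. - (x + 1 - z) * c z) has_real_derivative c z - deriv c z * (x + 1 - z)) (at z)" for z
        by (auto intro!: derivative_eq_intros test1_has_deriv c simp: algebra_simps)
      show "isCont (\<lambda>z. c z - deriv c z * (x + 1 - z)) z" for z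
        by (rule isCont_if_continuous_on) (intro continuous_intros test1_continuous test1_deriv c)
    qed simp
    moreover have "continuous_on {x..x+1} (\<lambda>z. deriv c z * (x + 1 - z))"
      by (intro continuous_intros test1_continuous test1_deriv c)
    then have "integrable lborel (\<lambda>z. c z * indicator {x..x+1} z)"
      "integrable lborel (\<lambda>z. deriv c z * ((x + 1 - z) * indicator {x..x+1} z))"
      using borel_integrable_compact[of "{x..x+1}" c] borel_integrable_compact[of "{x..x+1}" "\<lambda>z. deriv c z * (x + 1 - z)"]
        test1_continuous[OF c, of "{x..x+1}"]
      by (auto simp: mult_ac)
    moreover have "(c z - deriv c z * (x + 1 - z)) * indicator {x..x+1} z
        = c z * indicator {x..x+1} z - deriv c z * ((x + 1 - z) * indicator {x..x+1} z)" for z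
      by (simp add: algebra_simps)
    ultimately show ?thesis by simp
  qed
  have "inner (tc a b) (ker0 x) = (\<integral>z. a z * indicator {x..x+1} z \<partial>lborel)"
    "inner (tc a b) (mulI (ker0 x)) = (\<integral>z. b z * indicator {x..x+1} z \<partial>lborel)"
    "inner (td a b) (ker1 x) = (\<integral>z. deriv a z * ((x + 1 - z) * indicator {x..x+1} z) \<partial>lborel)"
    "inner (td a b) (mulI (ker1 x)) = (\<integral>z. deriv b z * ((x + 1 - z) * indicator {x..x+1} z) \<partial>lborel)"
    using t t' L2_ker L2_cmult[OF L2_ker(1)] L2_cmult[OF L2_ker(2)]
    by (simp_all add: ker0_def ker1_def mulI_cl inner_cl L2_cpl inner_complex_def cpl_simps del: of_real_mult of_real_diff)
  then show ?thesis using FTC[OF t(1)] FTC[OF t(2)] by (simp add: ev_def cpl_def)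
qed

lemma ev_sup:
  assumes "wd f g" shows "(cmod (ev x f g))\<^sup>2 \<le> norm f * norm g"
proof -
  obtain a b where ab: "\<And>n. test1 (a n)" "\<And>n. test1 (b n)"
    "(\<lambda>n. tc (a n) (b n)) \<longlonglongrightarrow> f" "(\<lambda>n. td (a n) (b n)) \<longlonglongrightarrow> g"
    using wd_approx_seq[OF assms] by blast
  have "(\<lambda>n. (cmod (ev x (tc (a n) (b n)) (td (a n) (b n))))\<^sup>2) \<longlonglongrightarrow> (cmod (ev x f g))\<^sup>2"
    by (intro tendsto_intros tendsto_ev ab)
  moreover have "(\<lambda>n. norm (tc (a n) (b n)) * norm (td (a n) (b n))) \<longlonglongrightarrow> norm f * norm g"
    by (intro tendsto_intros ab)
  ultimately show ?thesis
    by (rule LIMSEQ_le) (use test_sup_bound ab in \<open>auto simp: ev_test\<close>)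
qed

text \<open>The bound \<open>ev_sup\<close> for the difference does not depend on the point, so
  convergence in the graph norm is uniform convergence of the values.\<close>

lemma ev_uniform_limit:
  assumes "wd f g" "\<And>n. wd (f' n) (g' n)" "f' \<longlonglongrightarrow> f" "g' \<longlonglongrightarrow> g"
  shows "uniform_limit UNIV (\<lambda>n x. ev x (f' n) (g' n)) (\<lambda>x. ev x f g) sequentially"
proof (rule uniform_limitI)
  fix e :: real assume "e > 0"
  have "(\<lambda>n. norm (f' n - f) * norm (g' n - g)) \<longlonglongrightarrow> norm (f - f) * norm (g - g)"
    by (intro tendsto_intros assms)
  then have "(\<lambda>n. norm (f' n - f) * norm (g' n - g)) \<longlonglongrightarrow> 0" by simp
  then have "\<forall>\<^sub>F n in sequentially. norm (f' n - f) * norm (g' n - g) < e\<^sup>2"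
    by (rule order_tendstoD) (use \<open>e > 0\<close> in simp)
  then show "\<forall>\<^sub>F n in sequentially. \<forall>x\<in>UNIV. dist (ev x (f' n) (g' n)) (ev x f g) < e"
  proof eventually_elim
    case (elim n)
    show ?case
    proof
      fix x
      have "(dist (ev x (f' n) (g' n)) (ev x f g))\<^sup>2 = (cmod (ev x (f' n - f) (g' n - g)))\<^sup>2"
        by (simp add: dist_norm ev_diff)
      also have "\<dots> \<le> norm (f' n - f) * norm (g' n - g)" by (intro ev_sup wd_diff assms)
      also have "\<dots> < e\<^sup>2" by (rule elim)
      finally show "dist (ev x (f' n) (g' n)) (ev x f g) < e"
        using \<open>e > 0\<close> by (simp add: power2_less_imp_less)
    qed
  qed
qed

lemma cpl_continuous: "test1 a \<Longrightarrow> test1 b \<Longrightarrow> continuous_on S (cpl a b)"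
  unfolding cpl_eq[abs_def] by (intro continuous_intros test1_continuous)

lemma ev_continuous:
  assumes "wd f g" shows "continuous_on S (\<lambda>x. ev x f g)"
proof -
  obtain a b where ab: "\<And>n. test1 (a n)" "\<And>n. test1 (b n)"
    "(\<lambda>n. tc (a n) (b n)) \<longlonglongrightarrow> f" "(\<lambda>n. td (a n) (b n)) \<longlonglongrightarrow> g"
    using wd_approx_seq[OF assms] by blast
  have "uniform_limit UNIV (\<lambda>n x. ev x (tc (a n) (b n)) (td (a n) (b n))) (\<lambda>x. ev x f g) sequentially"
    by (intro ev_uniform_limit assms wd_tests ab)
  moreover have "continuous_on UNIV (\<lambda>x. ev x (tc (a n) (b n)) (td (a n) (b n)))" for n
    using cpl_continuous[OF ab(1,2)] by (simp add: ev_test ab)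
  ultimately have "continuous_on UNIV (\<lambda>x. ev x f g)"
    by (intro uniform_limit_theorem[where F=sequentially]) auto
  then show ?thesis by (rule continuous_on_subset) simp
qed

text \<open>Approximating test functions converge to \<open>f\<close> in L2 and to the point values
  uniformly. Uniform convergence implies convergence in L2 only on bounded sets, so the two limits
  are compared after multiplication by a cutoff, and the exceptional sets of all cutoffs are
  collected.\<close>

lemma cl_ev:
  assumes "wd f g" shows "L2 (\<lambda>x. ev x f g)" "cl (\<lambda>x. ev x f g) = f"
proof -
  let ?e = "\<lambda>x. ev x f g"
  obtain \<phi> where \<phi>: "L2 \<phi>" "f = cl \<phi>" by (rule l2_cases)
  obtain a b where ab: "\<And>n. test1 (a n)" "\<And>n. test1 (b n)"
    "(\<lambda>n. tc (a n) (b n)) \<longlonglongrightarrow> f" "(\<lambda>n. td (a n) (b n)) \<longlonglongrightarrow> g"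
    using wd_approx_seq[OF assms] by blast
  have U: "uniform_limit UNIV (\<lambda>n. cpl (a n) (b n)) ?e sequentially"
    using ev_uniform_limit[OF assms wd_tests[OF ab(1,2)] ab(3,4)] by (simp add: ev_test ab)
  have [measurable]: "?e \<in> borel_measurable borel" "?e \<in> borel_measurable lborel"
    using borel_measurable_continuous_onI[OF ev_continuous[OF assms]] by auto
  have "AE x in lborel. \<bar>x\<bar> \<le> real k \<longrightarrow> ?e x = \<phi> x" for k
  proof -
    let ?c = "cutoff (real k)"
    have Le: "L2 (\<lambda>x. complex_of_real (?c x) * ?e x)"
    proof (rule L2_bounded_support(1)[where K="sqrt (norm f * norm g)" and a="- real k - 1" and b="real k + 1"])
      show "(\<lambda>x. complex_of_real (?c x) * ?e x) \<in> borel_measurable lborel"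
        using test1_measurable[OF test1_cutoff] by measurable
      show "cmod (complex_of_real (?c x) * ?e x) \<le> sqrt (norm f * norm g)" for x
      proof -
        have "cmod (complex_of_real (?c x) * ?e x) \<le> cmod (?e x)"
          using mult_right_mono[OF cutoff_bound[of "real k" x] norm_ge_zero[of "?e x"]] by (simp add: norm_mult)
        also have "\<dots> \<le> sqrt (norm f * norm g)" by (rule real_le_rsqrt[OF ev_sup[OF assms]])
        finally show ?thesis .
      qed
      show "complex_of_real (?c x) * ?e x = 0" if "x < - real k - 1 \<or> real k + 1 < x" for x
        using that by (auto simp: cutoff_0)
    qed simp
    have "(\<lambda>n. mulr ?c (tc (a n) (b n))) \<longlonglongrightarrow> mulr ?c f"
    proof (rule LIM_zero_cancel, rule tendsto_norm_zero_cancel, rule tendsto_sandwich[OF _ _ tendsto_const])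
      show "\<forall>\<^sub>F n in sequentially. norm (mulr ?c (tc (a n) (b n)) - mulr ?c f) \<le> norm (tc (a n) (b n) - f)"
        using norm_mulr_le[OF test1_cutoff cutoff_bound] by (simp add: mulr_diff[symmetric] test1_cutoff)
      show "(\<lambda>n. norm (tc (a n) (b n) - f)) \<longlonglongrightarrow> 0" using ab(3) by (simp add: tendsto_norm_zero LIM_zero)
    qed auto
    moreover have "(\<lambda>n. mulr ?c (tc (a n) (b n))) \<longlonglongrightarrow> cl (\<lambda>x. complex_of_real (?c x) * ?e x)"
    proof (rule LIMSEQ_I)
      fix e :: real assume "e > 0"
      \<comment> \<open>The square root of the length of the support of the cutoff is absorbed here;
        the 1 keeps the denominator positive and the final estimate strict.\<close>
      define e' where "e' = e / (sqrt (2 * real k + 2) + 1)"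
      have e': "e' > 0" unfolding e'_def using \<open>e > 0\<close> by (intro divide_pos_pos add_nonneg_pos) auto
      obtain M where M: "\<And>n x. n \<ge> M \<Longrightarrow> dist (cpl (a n) (b n) x) (?e x) < e'"
        using uniform_limitD[OF U e'] by (auto simp: eventually_sequentially)
      have "norm (mulr ?c (tc (a n) (b n)) - cl (\<lambda>x. complex_of_real (?c x) * ?e x)) < e" if "n \<ge> M" for n
      proof -
        have "mulr ?c (tc (a n) (b n)) - cl (\<lambda>x. complex_of_real (?c x) * ?e x)
            = cl (\<lambda>x. complex_of_real (?c x) * cpl (a n) (b n) x - complex_of_real (?c x) * ?e x)"
          using ab Le by (simp add: mulr_cl test1_cutoff L2_cpl cl_diff L2_mulr_test)
        also have "norm \<dots> \<le> e' * sqrt ((real k + 1) - (- real k - 1))"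
        proof (rule L2_bounded_support(2))
          show "(\<lambda>x. complex_of_real (?c x) * cpl (a n) (b n) x - complex_of_real (?c x) * ?e x) \<in> borel_measurable lborel"
            by (intro L2_measurable L2_diff Le L2_mulr_test test1_cutoff L2_cpl ab)
          show "cmod (complex_of_real (?c x) * cpl (a n) (b n) x - complex_of_real (?c x) * ?e x) \<le> e'" for x
          proof -
            have "cmod (complex_of_real (?c x) * cpl (a n) (b n) x - complex_of_real (?c x) * ?e x)
                = \<bar>?c x\<bar> * cmod (cpl (a n) (b n) x - ?e x)"
              by (simp add: norm_mult flip: right_diff_distrib)
            also have "\<dots> \<le> 1 * e'"
              using M[OF that, of x] e' by (intro mult_mono cutoff_bound) (auto simp: dist_norm)
            finally show ?thesis by simp
          qed
        qed (auto simp: cutoff_0)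
        also have "\<dots> = e' * sqrt (2 * real k + 2)" by (simp add: algebra_simps)
        also have "\<dots> < e' * (sqrt (2 * real k + 2) + 1)" using e' by simp
        also have "\<dots> = e"
        proof -
          have "0 \<le> sqrt (2 * real k + 2)" by simp
          then have "sqrt (2 * real k + 2) + 1 \<noteq> 0" by linarith
          then show ?thesis by (simp add: e'_def)
        qed
        finally show ?thesis .
      qed
      then show "\<exists>no. \<forall>n\<ge>no. norm (mulr ?c (tc (a n) (b n)) - cl (\<lambda>x. complex_of_real (?c x) * ?e x)) < e" by blast
    qed
    ultimately have "mulr ?c f = cl (\<lambda>x. complex_of_real (?c x) * ?e x)" by (rule LIMSEQ_unique)
    then have "AE x in lborel. complex_of_real (?c x) * \<phi> x = complex_of_real (?c x) * ?e x"
      using \<phi> Le by (simp add: mulr_cl test1_cutoff cl_eq_iff L2_mulr_test)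
    then show ?thesis by eventually_elim (auto simp: cutoff_1)
  qed
  then have "AE x in lborel. \<forall>k::nat. \<bar>x\<bar> \<le> real k \<longrightarrow> ?e x = \<phi> x" unfolding AE_all_countable by blast
  then have ae: "AE x in lborel. \<phi> x = ?e x"
  proof eventually_elim
    case (elim x)
    then show ?case using real_arch_simple[of "\<bar>x\<bar>"] by metis
  qed
  show L: "L2 ?e" by (rule L2_cong_AE[OF \<phi>(1) _ ae]) measurable
  show "cl ?e = f" using ae \<phi> L by (simp add: cl_eq_iff eq_commute)
qed

lemma continuous_AE_eq:
  fixes f g :: "real \<Rightarrow> 'a :: real_normed_vector"
  assumes "continuous_on UNIV f" "continuous_on UNIV g" "AE x in lborel. f x = g x"
  shows "f = g"
proof (rule ccontr)
  assume "f \<noteq> g"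
  then obtain x where x: "f x \<noteq> g x" by blast
  have "open {y. f y \<noteq> g y}" using assms by (intro open_Collect_neq)
  then obtain e where e: "e > 0" "cball x e \<subseteq> {y. f y \<noteq> g y}"
    using x by (auto simp: open_contains_cball)
  have "emeasure lborel {x-e..x+e} = 0"
  proof -
    obtain S where S: "{y \<in> space lborel. f y \<noteq> g y} \<subseteq> S" "emeasure lborel S = 0" "S \<in> sets lborel"
      using AE_E[OF assms(3)] by blast
    have "emeasure lborel {x-e..x+e} \<le> emeasure lborel S"
      using S e by (intro emeasure_mono) (auto simp: cball_eq_atLeastAtMost)
    then show ?thesis using S by auto
  qed
  then show False using e by (simp add: emeasure_lborel_Icc_eq)
qed

lemma ev_rep:
  assumes "continuous_on UNIV \<psi>" "L2 \<psi>" "wd (cl \<psi>) g"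
  shows "ev x (cl \<psi>) g = \<psi> x"
proof -
  have "AE x in lborel. ev x (cl \<psi>) g = \<psi> x"
    using cl_ev[OF assms(3)] assms(2) by (simp add: cl_eq_iff)
  then have "(\<lambda>x. ev x (cl \<psi>) g) = \<psi>"
    by (intro continuous_AE_eq ev_continuous assms)
  then show ?thesis by (rule fun_cong)
qed

lemma wd_unique: "wd f g \<Longrightarrow> wd f h \<Longrightarrow> g = h"
  by (rule eq_if_tests) (metis wd_def minus_equation_iff)

section \<open>The lemma of du Bois-Reymond\<close>

text \<open>The difference of two narrow densities placed at \<open>a\<close> and \<open>b\<close>
  has mean zero and is thus the derivative of a test function. Hence the averages of
  \<open>h\<close> near \<open>a\<close> and near \<open>b\<close> coincide, and by continuity they
  are as close to \<open>h a\<close> and \<open>h b\<close> as desired.\<close>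

lemma du_bois_reymond_const:
  fixes h :: "real \<Rightarrow> real"
  assumes c: "continuous_on UNIV h" and int: "\<And>\<phi>. test1 \<phi> \<Longrightarrow> (\<integral>x. h x * deriv \<phi> x \<partial>lborel) = 0"
  shows "h a = h b"
proof -
  have "\<bar>h a - h b\<bar> \<le> e" if "e > 0" for e
  proof -
    have "isCont h a" "isCont h b" using c by (auto simp: continuous_on_eq_continuous_at)
    then obtain d1 d2 where d: "d1 > 0" "\<And>x. \<bar>x - a\<bar> < d1 \<Longrightarrow> \<bar>h x - h a\<bar> < e / 2"
      "d2 > 0" "\<And>x. \<bar>x - b\<bar> < d2 \<Longrightarrow> \<bar>h x - h b\<bar> < e / 2"
      using \<open>e > 0\<close> unfolding continuous_at_eps_delta by (metis dist_real_def half_gt_zero)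
    define \<delta> where "\<delta> = min d1 d2 / 2"
    have \<delta>: "\<delta> > 0" "\<delta> < d1" "\<delta> < d2" using d by (auto simp: \<delta>_def)
    define k where "k x = kern (x / \<delta>) / \<delta>" for x
    have k: "test1 k" "(\<integral>x. k x \<partial>lborel) = 1" using kern_scaled[OF \<delta>(1)] by (auto simp: k_def[abs_def])
    have ks: "test1 (\<lambda>x. k (x - s))" "(\<integral>x. k (x - s) \<partial>lborel) = 1" for s
      using test1_shift[OF k(1)] integral_lborel_affine(1)[of 1 k "- s"] k(2) by auto
    have hk: "integrable lborel (\<lambda>x. h x * k (x - s))" for s
    proof -
      obtain R where R: "R > 0" "\<And>x. \<bar>x\<bar> \<ge> R \<Longrightarrow> k (x - s) = 0" using test1_support[OF ks(1)] by blast
      have "integrable lborel (\<lambda>x. indicator {-R..R} x *\<^sub>R (h x * k (x - s)))"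
        using continuous_on_subset[OF c] by (intro borel_integrable_compact continuous_on_mult test1_continuous[OF ks(1)]) auto
      moreover have "(\<lambda>x. indicator {-R..R} x *\<^sub>R (h x * k (x - s))) = (\<lambda>x. h x * k (x - s))"
        using R(2) by (force simp: indicator_def)
      ultimately show ?thesis by simp
    qed
    have near: "\<bar>(\<integral>x. h x * k (x - s) \<partial>lborel) - h s\<bar> \<le> e / 2"
      if "\<And>x. \<bar>x - s\<bar> \<le> \<delta> \<Longrightarrow> \<bar>h x - h s\<bar> < e / 2" for s
    proof -
      have "(\<integral>x. h x * k (x - s) \<partial>lborel) - h s = (\<integral>x. h x * k (x - s) \<partial>lborel) - (\<integral>x. h s * k (x - s) \<partial>lborel)"
        using ks by simp
      also have "\<dots> = (\<integral>x. (h x - h s) * k (x - s) \<partial>lborel)"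
        using hk test1_integrable[OF ks(1)] by (simp add: left_diff_distrib)
      also have "\<bar>\<dots>\<bar> \<le> (\<integral>x. e / 2 * k (x - s) \<partial>lborel)"
      proof (rule integral_abs_bound_integral)
        show "integrable lborel (\<lambda>x. (h x - h s) * k (x - s))"
          using hk test1_integrable[OF ks(1)] by (simp add: left_diff_distrib)
        show "integrable lborel (\<lambda>x. e / 2 * k (x - s))" using test1_integrable[OF ks(1)] by simp
        fix x
        have k0: "0 \<le> k (x - s)" using \<delta> by (simp add: k_def kern_nonneg)
        show "\<bar>(h x - h s) * k (x - s)\<bar> \<le> e / 2 * k (x - s)"
        proof (cases "\<bar>x - s\<bar> \<le> \<delta>")
          case True
          from mult_right_mono[OF less_imp_le[OF that[OF this]] k0] show ?thesis
            using k0 by (simp add: abs_mult)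
        next
          case False
          then have "(x - s) / \<delta> \<le> 0 \<or> 1 \<le> (x - s) / \<delta>" using \<delta>(1) by (auto simp: field_simps abs_le_iff)
          then show ?thesis by (simp add: k_def kern_zero)
        qed
      qed
      also have "\<dots> = e / 2" using ks by simp
      finally show ?thesis .
    qed
    have "test1 (\<lambda>x. k (x - a) - k (x - b))" by (intro test1_diff ks)
    moreover have "(\<integral>x. k (x - a) - k (x - b) \<partial>lborel) = 0"
      using ks test1_integrable[OF ks(1)] by simp
    ultimately obtain \<phi> where \<phi>: "test1 \<phi>" "deriv \<phi> = (\<lambda>x. k (x - a) - k (x - b))" by (rule test1_mean_zero_prim)
    have "(\<integral>x. h x * k (x - a) \<partial>lborel) = (\<integral>x. h x * k (x - b) \<partial>lborel)"
      using int[OF \<phi>(1)] hk by (simp add: \<phi>(2) right_diff_distrib)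
    moreover have "\<bar>(\<integral>x. h x * k (x - a) \<partial>lborel) - h a\<bar> \<le> e / 2" by (rule near) (use d \<delta> in auto)
    moreover have "\<bar>(\<integral>x. h x * k (x - b) \<partial>lborel) - h b\<bar> \<le> e / 2" by (rule near) (use d \<delta> in auto)
    ultimately show ?thesis by linarith
  qed
  then have "\<bar>h a - h b\<bar> \<le> 0" by (rule field_le_epsilon[of _ 0, simplified])
  then show ?thesis by simp
qed

lemma continuous_mult_test_integrable:
  fixes h :: "real \<Rightarrow> real"
  assumes "continuous_on UNIV h" "test1 \<phi>"
  shows "integrable lborel (\<lambda>x. h x * \<phi> x)"
proof -
  obtain R where R: "R > 0" "\<And>x. \<bar>x\<bar> \<ge> R \<Longrightarrow> \<phi> x = 0" using test1_support[OF assms(2)] by blast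
  have "integrable lborel (\<lambda>x. indicator {-R..R} x *\<^sub>R (h x * \<phi> x))"
    using continuous_on_subset[OF assms(1)] by (intro borel_integrable_compact continuous_on_mult test1_continuous[OF assms(2)]) auto
  moreover have "(\<lambda>x. indicator {-R..R} x *\<^sub>R (h x * \<phi> x)) = (\<lambda>x. h x * \<phi> x)"
    using R(2) by (force simp: indicator_def)
  ultimately show ?thesis by simp
qed

lemma integration_by_parts_test:
  fixes h :: "real \<Rightarrow> real"
  assumes d: "\<And>x. (h has_real_derivative h' x) (at x)" and c: "continuous_on UNIV h'" and t: "test1 \<phi>"
  shows "(\<integral>x. h x * deriv \<phi> x \<partial>lborel) = - (\<integral>x. h' x * \<phi> x \<partial>lborel)"
proof -
  obtain R where R: "R > 0" "\<And>x. \<bar>x\<bar> \<ge> R \<Longrightarrow> \<phi> x = 0" using test1_support[OF t] by blast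
  have ch: "continuous_on UNIV h" using d by (meson DERIV_continuous continuous_at_imp_continuous_on)
  have "(\<integral>x. h x * deriv \<phi> x + h' x * \<phi> x \<partial>lborel) = h R * \<phi> R - h (- R) * \<phi> (- R)"
  proof (rule integral_compact_support_FTC[where F="\<lambda>x. h x * \<phi> x"])
    show "((\<lambda>x. h x * \<phi> x) has_real_derivative h x * deriv \<phi> x + h' x * \<phi> x) (at x)" for x
      by (auto intro!: derivative_eq_intros d test1_has_deriv t)
    show "continuous_on s (\<lambda>x. h x * deriv \<phi> x + h' x * \<phi> x)" for s
      using continuous_on_subset[OF ch] continuous_on_subset[OF c]
      by (intro continuous_on_add continuous_on_mult test1_continuous[OF t] test1_continuous[OF test1_deriv[OF t]]) auto
    show "h x * deriv \<phi> x + h' x * \<phi> x = 0" if "x < - R \<or> R < x" for x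
      using that R deriv_eq_0_outside[of R \<phi> x] by auto
  qed (use R in auto)
  then show ?thesis using R continuous_mult_test_integrable[OF ch test1_deriv[OF t]] continuous_mult_test_integrable[OF c t] by simp
qed

text \<open>By integration by parts \<open>p - prim q\<close> has derivative zero in the sense of
  distributions, so it is constant. This turns a distributional identity in time between continuous
  functions into a classical derivative.\<close>

lemma du_bois_reymond:
  fixes p q :: "real \<Rightarrow> real"
  assumes p: "continuous_on UNIV p" and q: "continuous_on UNIV q"
    and int: "\<And>\<phi>. test1 \<phi> \<Longrightarrow> (\<integral>x. p x * deriv \<phi> x \<partial>lborel) = - (\<integral>x. q x * \<phi> x \<partial>lborel)"
  shows "(p has_real_derivative q x) (at x)"
proof -
  have dq: "(prim q has_real_derivative q x) (at x)" for x
    by (rule prim_has_deriv) (rule continuous_on_subset[OF q], simp)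
  have cq: "continuous_on UNIV (prim q)" using dq by (meson DERIV_continuous continuous_at_imp_continuous_on)
  have "p x - prim q x = p 0 - prim q 0" for x
  proof (rule du_bois_reymond_const[where h="\<lambda>x. p x - prim q x"])
    show "continuous_on UNIV (\<lambda>x. p x - prim q x)" by (intro continuous_intros p cq)
    show "(\<integral>x. (p x - prim q x) * deriv \<phi> x \<partial>lborel) = 0" if "test1 \<phi>" for \<phi>
      using int[OF that] integration_by_parts_test[OF dq q that] continuous_mult_test_integrable[OF p test1_deriv[OF that]]
        continuous_mult_test_integrable[OF cq test1_deriv[OF that]]
      by (simp add: left_diff_distrib)
  qed
  then have "p = (\<lambda>x. prim q x + (p 0 - prim q 0))" by (auto simp: algebra_simps)
  moreover have "((\<lambda>x. prim q x + (p 0 - prim q 0)) has_real_derivative q x) (at x)"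
    by (auto intro!: derivative_eq_intros dq)
  ultimately show ?thesis by metis
qed

section \<open>Finite energy states\<close>

lemma EspaceD:
  assumes "\<Psi> \<in> Espace"
  shows "continuous_on UNIV (fst \<Psi>)" "L2 (fst \<Psi>)" "L2 (snd \<Psi>)" "L2 (wderiv (fst \<Psi>))"
    "wd (cl (fst \<Psi>)) (cl (wderiv (fst \<Psi>)))"
    "ev x (cl (fst \<Psi>)) (cl (wderiv (fst \<Psi>))) = fst \<Psi> x"
proof -
  have H: "H1 (fst \<Psi>)" and L: "L2 (snd \<Psi>)" using assms by (auto simp: Espace_def)
  then show *: "continuous_on UNIV (fst \<Psi>)" "L2 (fst \<Psi>)" "L2 (snd \<Psi>)" by (auto simp: H1_def)
  have "is_wderiv (fst \<Psi>) (wderiv (fst \<Psi>))"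
    using H someI_ex[of "is_wderiv (fst \<Psi>)"] by (simp add: H1_def wderiv_def)
  then show **: "L2 (wderiv (fst \<Psi>))" "wd (cl (fst \<Psi>)) (cl (wderiv (fst \<Psi>)))"
    using * by (auto simp: is_wderiv_iff)
  show "ev x (cl (fst \<Psi>)) (cl (wderiv (fst \<Psi>))) = fst \<Psi> x"
    by (intro ev_rep * **)
qed

lemma EspaceI:
  assumes "wd f g" "L2 \<pi>"
  shows "((\<lambda>x. ev x f g), \<pi>) \<in> Espace" "cl (wderiv (\<lambda>x. ev x f g)) = g"
proof -
  have "is_wderiv (\<lambda>x. ev x f g) (rep_l2 g)"
    using cl_ev[OF assms(1)] assms(1) by (simp add: is_wderiv_iff)
  then have "H1 (\<lambda>x. ev x f g)"
    using cl_ev[OF assms(1)] ev_continuous[OF assms(1)] by (auto simp: H1_def)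
  then show E: "((\<lambda>x. ev x f g), \<pi>) \<in> Espace" using assms by (simp add: Espace_def)
  show "cl (wderiv (\<lambda>x. ev x f g)) = g"
    using EspaceD(5)[OF E] cl_ev[OF assms(1)] assms(1) wd_unique by fastforce
qed

lemma enorm_eq:
  assumes "\<Psi> \<in> Espace"
  shows "(enorm m \<Psi>)\<^sup>2 = (norm (cl (snd \<Psi>)))\<^sup>2 + (norm (cl (wderiv (fst \<Psi>))))\<^sup>2 + m\<^sup>2 * (norm (cl (fst \<Psi>)))\<^sup>2"
    and "0 \<le> enorm m \<Psi>"
proof -
  have nn: "0 \<le> l2sq f" for f by (simp add: l2sq_def)
  show "(enorm m \<Psi>)\<^sup>2 = (norm (cl (snd \<Psi>)))\<^sup>2 + (norm (cl (wderiv (fst \<Psi>))))\<^sup>2 + m\<^sup>2 * (norm (cl (fst \<Psi>)))\<^sup>2"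
    unfolding enorm_def using EspaceD(2,3,4)[OF assms] nn by (simp add: norm_cl_sq)
  show "0 \<le> enorm m \<Psi>" using nn by (simp add: enorm_def)
qed

lemma sdiff_Espace:
  assumes "\<Psi> \<in> Espace" "\<Phi> \<in> Espace"
  shows "sdiff \<Psi> \<Phi> \<in> Espace"
    "cl (fst (sdiff \<Psi> \<Phi>)) = cl (fst \<Psi>) - cl (fst \<Phi>)"
    "cl (snd (sdiff \<Psi> \<Phi>)) = cl (snd \<Psi>) - cl (snd \<Phi>)"
    "cl (wderiv (fst (sdiff \<Psi> \<Phi>))) = cl (wderiv (fst \<Psi>)) - cl (wderiv (fst \<Phi>))"
proof -
  note a = EspaceD[OF assms(1)] and b = EspaceD[OF assms(2)]
  show 1: "cl (fst (sdiff \<Psi> \<Phi>)) = cl (fst \<Psi>) - cl (fst \<Phi>)"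
    "cl (snd (sdiff \<Psi> \<Phi>)) = cl (snd \<Psi>) - cl (snd \<Phi>)"
    using a b by (auto simp: sdiff_def cl_diff)
  have w: "wd (cl (fst (sdiff \<Psi> \<Phi>))) (cl (\<lambda>x. wderiv (fst \<Psi>) x - wderiv (fst \<Phi>) x))"
    using wd_diff[OF a(5) b(5)] a b by (simp add: 1 cl_diff)
  moreover have L: "L2 (fst (sdiff \<Psi> \<Phi>))" using a b by (auto simp: sdiff_def)
  ultimately have "is_wderiv (fst (sdiff \<Psi> \<Phi>)) (\<lambda>x. wderiv (fst \<Psi>) x - wderiv (fst \<Phi>) x)"
    using a b by (auto simp: is_wderiv_iff)
  moreover have "continuous_on UNIV (fst (sdiff \<Psi> \<Phi>))"
    unfolding sdiff_def using a b by (auto intro!: continuous_intros)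
  ultimately show E: "sdiff \<Psi> \<Phi> \<in> Espace"
    using L a b by (auto simp: Espace_def H1_def sdiff_def)
  show "cl (wderiv (fst (sdiff \<Psi> \<Phi>))) = cl (wderiv (fst \<Psi>)) - cl (wderiv (fst \<Phi>))"
    using wd_unique[OF EspaceD(5)[OF E] w] a b by (simp add: cl_diff)
qed

lemma enorm_sdiff:
  assumes "\<Psi> \<in> Espace" "\<Phi> \<in> Espace"
  shows "(enorm m (sdiff \<Psi> \<Phi>))\<^sup>2 = (norm (cl (snd \<Psi>) - cl (snd \<Phi>)))\<^sup>2
    + (norm (cl (wderiv (fst \<Psi>)) - cl (wderiv (fst \<Phi>))))\<^sup>2 + m\<^sup>2 * (norm (cl (fst \<Psi>) - cl (fst \<Phi>)))\<^sup>2"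
  using enorm_eq(1)[OF sdiff_Espace(1)[OF assms]] by (simp add: sdiff_Espace[OF assms])

lemma norm_le_enorm_sdiff:
  assumes "\<Psi> \<in> Espace" "\<Phi> \<in> Espace" "m > 0"
  shows "norm (cl (snd \<Psi>) - cl (snd \<Phi>)) \<le> enorm m (sdiff \<Psi> \<Phi>)"
    "norm (cl (wderiv (fst \<Psi>)) - cl (wderiv (fst \<Phi>))) \<le> enorm m (sdiff \<Psi> \<Phi>)"
    "m * norm (cl (fst \<Psi>) - cl (fst \<Phi>)) \<le> enorm m (sdiff \<Psi> \<Phi>)"
proof -
  note e = enorm_sdiff[OF assms(1,2), of m] and p = enorm_eq(2)[OF sdiff_Espace(1)[OF assms(1,2)], of m]
  show "norm (cl (snd \<Psi>) - cl (snd \<Phi>)) \<le> enorm m (sdiff \<Psi> \<Phi>)"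
    by (rule power2_le_imp_le[OF _ p]) (simp add: e)
  show "norm (cl (wderiv (fst \<Psi>)) - cl (wderiv (fst \<Phi>))) \<le> enorm m (sdiff \<Psi> \<Phi>)"
    by (rule power2_le_imp_le[OF _ p]) (simp add: e)
  show "m * norm (cl (fst \<Psi>) - cl (fst \<Phi>)) \<le> enorm m (sdiff \<Psi> \<Phi>)"
    by (rule power2_le_imp_le[OF _ p]) (simp add: e power_mult_distrib)
qed

lemma enorm_sdiff_le:
  assumes "\<Psi> \<in> Espace" "\<Phi> \<in> Espace" "m > 0"
  shows "enorm m (sdiff \<Psi> \<Phi>) \<le> norm (cl (snd \<Psi>) - cl (snd \<Phi>))
    + norm (cl (wderiv (fst \<Psi>)) - cl (wderiv (fst \<Phi>))) + m * norm (cl (fst \<Psi>) - cl (fst \<Phi>))"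
proof (rule power2_le_imp_le)
  have *: "a\<^sup>2 + b\<^sup>2 + c\<^sup>2 \<le> (a + b + c)\<^sup>2" if "0 \<le> a" "0 \<le> b" "0 \<le> c" for a b c :: real
    using that by (simp add: power2_sum mult_nonneg_nonneg distrib_right)
  show "(enorm m (sdiff \<Psi> \<Phi>))\<^sup>2 \<le> (norm (cl (snd \<Psi>) - cl (snd \<Phi>))
    + norm (cl (wderiv (fst \<Psi>)) - cl (wderiv (fst \<Phi>))) + m * norm (cl (fst \<Psi>) - cl (fst \<Phi>)))\<^sup>2"
    unfolding enorm_sdiff[OF assms(1,2)] power_mult_distrib[symmetric] using assms(3) by (intro *) auto
qed (use assms(3) in simp)

section \<open>The weak formulation as a family of ordinary differential equations\<close>

text \<open>\<open>P\<close>, \<open>D\<close> and \<open>Q\<close> are the displacement, its space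
  derivative and its time derivative, as curves in \<open>l2\<close>. The source strengths
  \<open>G\<close> are prescribed functions of time, unrelated to any force, so that the same linear
  facts serve the original and the truncated problem. The set \<open>T\<close> is a half-line or the
  whole line.\<close>

definition weak_sol :: "real \<Rightarrow> nat \<Rightarrow> (nat \<Rightarrow> real) \<Rightarrow> real set \<Rightarrow> (nat \<Rightarrow> real \<Rightarrow> complex)
    \<Rightarrow> (real \<Rightarrow> l2) \<Rightarrow> (real \<Rightarrow> l2) \<Rightarrow> (real \<Rightarrow> l2) \<Rightarrow> bool" where
  "weak_sol m N X T G P D Q \<longleftrightarrow>
     continuous_on T P \<and> continuous_on T D \<and> continuous_on T Q
   \<and> (\<forall>J\<in>{1..N}. continuous_on T (G J)) \<and> (\<forall>t\<in>T. wd (P t) (D t))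
   \<and> (\<forall>a b t. test1 a \<longrightarrow> test1 b \<longrightarrow> t \<in> T \<longrightarrow>
        ((\<lambda>s. inner (P s) (tc a b)) has_real_derivative inner (Q t) (tc a b)) (at t within T)
      \<and> ((\<lambda>s. inner (Q s) (tc a b)) has_real_derivative
          (- inner (D t) (td a b) - m\<^sup>2 * inner (P t) (tc a b) + (\<Sum>J\<in>{1..N}. inner (G J t) (cpl a b (X J)))))
          (at t within T))"

lemma weak_sol_subset: "weak_sol m N X T G P D Q \<Longrightarrow> S \<subseteq> T \<Longrightarrow> weak_sol m N X S G P D Q"
  unfolding weak_sol_def
  by (auto intro: continuous_on_subset has_field_derivative_subset) (meson has_field_derivative_subset subsetD)+

lemma pairing_eq:
  assumes "L2 f" "test1 a"
  shows "(\<integral>x. f x * complex_of_real (a x) \<partial>lborel) = Complex (inner (cl f) (tc a (\<lambda>x. 0))) (inner (cl f) (tc (\<lambda>x. 0) a))"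
  using assms by (simp add: inner_tc complex_eq_iff)

lemma tc_split: "test1 a \<Longrightarrow> test1 b \<Longrightarrow> tc a b = tc a (\<lambda>x. 0) + tc (\<lambda>x. 0) b"
  using tc_scale[of a b 1 1] by simp

lemma deriv_zero: "deriv (\<lambda>x. 0) = (\<lambda>x. 0::real)"
  by auto

lemma continuous_test_complex:
  assumes "continuous_on UNIV c" "test1 \<rho>"
  shows "integrable lborel (\<lambda>t. complex_of_real (\<rho> t) * c t)"
    "(\<integral>t. complex_of_real (\<rho> t) * c t \<partial>lborel)
      = Complex (\<integral>t. Re (c t) * \<rho> t \<partial>lborel) (\<integral>t. Im (c t) * \<rho> t \<partial>lborel)"
proof -
  obtain R where R: "R > 0" "\<And>x. \<bar>x\<bar> \<ge> R \<Longrightarrow> \<rho> x = 0" using test1_support[OF assms(2)] by blast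
  have "integrable lborel (\<lambda>x. indicator {-R..R} x *\<^sub>R (complex_of_real (\<rho> x) * c x))"
    using continuous_on_subset[OF assms(1)]
    by (intro borel_integrable_compact continuous_on_mult continuous_on_of_real test1_continuous[OF assms(2)]) auto
  moreover have "(\<lambda>x. indicator {-R..R} x *\<^sub>R (complex_of_real (\<rho> x) * c x)) = (\<lambda>x. complex_of_real (\<rho> x) * c x)"
    using R(2) by (force simp: indicator_def)
  ultimately show i: "integrable lborel (\<lambda>t. complex_of_real (\<rho> t) * c t)" by simp
  show "(\<integral>t. complex_of_real (\<rho> t) * c t \<partial>lborel)
      = Complex (\<integral>t. Re (c t) * \<rho> t \<partial>lborel) (\<integral>t. Im (c t) * \<rho> t \<partial>lborel)"
    using integral_Re[OF i] integral_Im[OF i] by (simp add: complex_eq_iff mult.commute)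
qed

lemma du_bois_reymond_complex:
  assumes p: "continuous_on UNIV p" and q: "continuous_on UNIV q"
    and int: "\<And>\<rho>. test1 \<rho> \<Longrightarrow> (\<integral>t. complex_of_real (deriv \<rho> t) * p t \<partial>lborel) = - (\<integral>t. complex_of_real (\<rho> t) * q t \<partial>lborel)"
  shows "((\<lambda>t. Re (p t)) has_real_derivative Re (q t)) (at t)" "((\<lambda>t. Im (p t)) has_real_derivative Im (q t)) (at t)"
proof -
  have "(\<integral>t. Re (p t) * deriv \<rho> t \<partial>lborel) = - (\<integral>t. Re (q t) * \<rho> t \<partial>lborel)
      \<and> (\<integral>t. Im (p t) * deriv \<rho> t \<partial>lborel) = - (\<integral>t. Im (q t) * \<rho> t \<partial>lborel)" if "test1 \<rho>" for \<rho>
    using int[OF that] continuous_test_complex(2)[OF p test1_deriv[OF that]] continuous_test_complex(2)[OF q that]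
    by (simp add: complex_eq_iff)
  then show "((\<lambda>t. Re (p t)) has_real_derivative Re (q t)) (at t)" "((\<lambda>t. Im (p t)) has_real_derivative Im (q t)) (at t)"
    by (auto intro!: du_bois_reymond continuous_intros p q)
qed

lemma px_separable: "smooth e \<Longrightarrow> px (\<lambda>x t. r t * e x) = (\<lambda>x t. r t * deriv e x)"
  unfolding px_def by (intro ext DERIV_imp_deriv DERIV_cmult smooth_has_deriv)

lemma pt_separable: "smooth r \<Longrightarrow> pt (\<lambda>x t. r t * e x) = (\<lambda>x t. deriv r t * e x)"
  unfolding pt_def by (intro ext DERIV_imp_deriv DERIV_cmult_right smooth_has_deriv)

text \<open>Every iterated partial derivative of a product of a function of \<open>t\<close> and a
  function of \<open>x\<close> is such a product again, which makes the induction over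
  \<open>partials\<close> close.\<close>

lemma test2_separable:
  assumes "test1 \<rho>" "test1 \<eta>" shows "test2 (\<lambda>x t. \<rho> t * \<eta> x)"
proof -
  have sep: "\<exists>r e. smooth r \<and> smooth e \<and> g = (\<lambda>x t. r t * e x)" if "g \<in> partials (\<lambda>x t. \<rho> t * \<eta> x)" for g
    using that
  proof (induction rule: partials.induct)
    case base
    then show ?case using assms by (auto simp: test1_smooth)
  next
    case (dx g)
    then obtain r e where "smooth r" "smooth e" "g = (\<lambda>x t. r t * e x)" by blast
    then show ?case by (intro exI[of _ r] exI[of _ "deriv e"]) (auto simp: px_separable smooth_deriv)
  next
    case (dt g)
    then obtain r e where "smooth r" "smooth e" "g = (\<lambda>x t. r t * e x)" by blast
    then show ?case by (intro exI[of _ "deriv r"] exI[of _ e]) (auto simp: pt_separable smooth_deriv)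
  qed
  have reg: "(\<forall>x t. (\<lambda>y. r t * e y) differentiable (at x) \<and> (\<lambda>s. r s * e x) differentiable (at t))
      \<and> continuous_on UNIV (\<lambda>(x, t). r t * e x)" if "smooth r" "smooth e" for r e
  proof (intro conjI allI)
    have "((\<lambda>y. r t * e y) has_real_derivative r t * deriv e x) (at x)"
      "((\<lambda>s. r s * e x) has_real_derivative deriv r t * e x) (at t)" for x t
      by (intro DERIV_cmult DERIV_cmult_right smooth_has_deriv that)+
    then show "(\<lambda>y. r t * e y) differentiable (at x)" "(\<lambda>s. r s * e x) differentiable (at t)" for x t
      unfolding real_differentiable_def by blast+
    show "continuous_on UNIV (\<lambda>(x, t). r t * e x)"
      unfolding case_prod_beta
      by (intro continuous_on_mult continuous_on_compose2[OF smooth_continuous[OF that(1), of UNIV]]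
          continuous_on_compose2[OF smooth_continuous[OF that(2), of UNIV]] continuous_intros) auto
  qed
  have supp: "\<exists>R. \<forall>x t. R < \<bar>x\<bar> \<or> R < \<bar>t\<bar> \<longrightarrow> \<rho> t * \<eta> x = 0"
  proof -
    obtain R where R: "R > 0" "\<And>x. \<bar>x\<bar> \<ge> R \<Longrightarrow> \<rho> x = 0" using test1_support[OF assms(1)] by blast
    obtain S where S: "S > 0" "\<And>x. \<bar>x\<bar> \<ge> S \<Longrightarrow> \<eta> x = 0" using test1_support[OF assms(2)] by blast
    show ?thesis by (intro exI[of _ "max R S"]) (use R S in auto)
  qed
  show ?thesis
    unfolding test2_def
  proof (intro conjI[OF ballI supp])
    fix g assume "g \<in> partials (\<lambda>x t. \<rho> t * \<eta> x)"
    then obtain r e where re: "smooth r" "smooth e" and g: "g = (\<lambda>x t. r t * e x)" using sep by blast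
    show "(\<forall>x t. (\<lambda>y. g y t) differentiable (at x) \<and> (\<lambda>s. g x s) differentiable (at t))
        \<and> continuous_on UNIV (\<lambda>(x, t). g x t)"
      unfolding g by (rule reg[OF re])
  qed
qed

text \<open>Test functions that are products of \<open>\<rho>\<close> in time and
  \<open>\<eta>\<close> in space freeze \<open>\<eta>\<close> and leave distributional equations in
  \<open>t\<close> alone. Their ingredients are continuous in time, since the solution is a
  continuous curve in the energy space, so the lemma of du Bois-Reymond makes them
  classical.\<close>

theorem solution_weak_sol:
  assumes sol: "is_solution m N X F \<Psi>0 \<Psi>" and "m > 0"
    and F: "\<And>J. J \<in> {1..N} \<Longrightarrow> continuous_on UNIV (F J)"
  shows "weak_sol m N X UNIV (\<lambda>J t. F J (fst (\<Psi> t) (X J)))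
    (\<lambda>t. cl (fst (\<Psi> t))) (\<lambda>t. cl (wderiv (fst (\<Psi> t)))) (\<lambda>t. cl (snd (\<Psi> t)))"
proof -
  define P D Q where "P t = cl (fst (\<Psi> t))" and "D t = cl (wderiv (fst (\<Psi> t)))" and "Q t = cl (snd (\<Psi> t))" for t
  define G where "G J t = F J (fst (\<Psi> t) (X J))" for J t
  have E: "\<Psi> t \<in> Espace" for t using sol by (simp add: is_solution_def)
  note e = EspaceD[OF E]
  have small: "\<forall>\<epsilon>>0. \<exists>\<delta>>0. \<forall>s. \<bar>s - t\<bar> < \<delta> \<longrightarrow> enorm m (sdiff (\<Psi> s) (\<Psi> t)) < \<epsilon>" for t
    using sol by (simp add: is_solution_def)
  have lim: "((\<lambda>s. enorm m (sdiff (\<Psi> s) (\<Psi> t))) \<longlongrightarrow> 0) (at t)" for t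
  proof (rule tendstoI)
    fix e :: real assume "e > 0"
    then obtain \<delta> where "\<delta> > 0" "\<forall>s. \<bar>s - t\<bar> < \<delta> \<longrightarrow> enorm m (sdiff (\<Psi> s) (\<Psi> t)) < e"
      using small by blast
    then show "\<forall>\<^sub>F s in at t. dist (enorm m (sdiff (\<Psi> s) (\<Psi> t))) 0 < e"
      unfolding eventually_at using enorm_eq(2)[OF sdiff_Espace(1)[OF E E]]
      by (intro exI[of _ \<delta>]) (auto simp: dist_real_def)
  qed
  have cont: "continuous_on UNIV H" if "\<And>s t. norm (H s - H t) \<le> C * enorm m (sdiff (\<Psi> s) (\<Psi> t))" for H :: "real \<Rightarrow> l2" and C
    unfolding continuous_on_def
  proof
    fix t
    have "((\<lambda>s. C * enorm m (sdiff (\<Psi> s) (\<Psi> t))) \<longlongrightarrow> C * 0) (at t)" by (intro tendsto_intros lim)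
    then have z: "((\<lambda>s. C * enorm m (sdiff (\<Psi> s) (\<Psi> t))) \<longlongrightarrow> 0) (at t)" by simp
    have "((\<lambda>s. norm (H s - H t)) \<longlongrightarrow> 0) (at t)"
      by (rule tendsto_sandwich[OF _ _ tendsto_const z]) (use that in auto)
    then show "(H \<longlongrightarrow> H t) (at t)" by (rule LIM_zero_cancel[OF tendsto_norm_zero_cancel])
  qed
  have cP: "continuous_on UNIV P"
    by (rule cont[of _ "1 / m"]) (use norm_le_enorm_sdiff(3)[OF E E \<open>m > 0\<close>] \<open>m > 0\<close> in \<open>simp add: P_def field_simps\<close>)
  have cD: "continuous_on UNIV D" and cQ: "continuous_on UNIV Q"
    by (rule cont[of _ 1]; use norm_le_enorm_sdiff[OF E E \<open>m > 0\<close>] in \<open>simp add: D_def Q_def\<close>)+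
  have Gev: "G J t = F J (ev (X J) (P t) (D t))" for J t
    by (simp add: G_def P_def D_def e)
  have cG: "continuous_on UNIV (G J)" if "J \<in> {1..N}" for J
    unfolding Gev[abs_def] by (intro continuous_on_compose2[OF F[OF that]] continuous_intros cP cD) auto
  have wPD: "wd (P t) (D t)" for t unfolding P_def D_def by (rule e)
  have main: "((\<lambda>s. inner (P s) (tc \<eta> (\<lambda>x. 0))) has_real_derivative inner (Q t) (tc \<eta> (\<lambda>x. 0))) (at t)"
    "((\<lambda>s. inner (P s) (tc (\<lambda>x. 0) \<eta>)) has_real_derivative inner (Q t) (tc (\<lambda>x. 0) \<eta>)) (at t)"
    "((\<lambda>s. inner (Q s) (tc \<eta> (\<lambda>x. 0))) has_real_derivative
        - inner (D t) (tc (deriv \<eta>) (\<lambda>x. 0)) - m\<^sup>2 * inner (P t) (tc \<eta> (\<lambda>x. 0)) + (\<Sum>J\<in>{1..N}. Re (G J t) * \<eta> (X J))) (at t)"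
    "((\<lambda>s. inner (Q s) (tc (\<lambda>x. 0) \<eta>)) has_real_derivative
        - inner (D t) (tc (\<lambda>x. 0) (deriv \<eta>)) - m\<^sup>2 * inner (P t) (tc (\<lambda>x. 0) \<eta>) + (\<Sum>J\<in>{1..N}. Im (G J t) * \<eta> (X J))) (at t)"
    if \<eta>: "test1 \<eta>" for \<eta> t
  proof -
    define pr where "pr f a = Complex (inner f (tc a (\<lambda>x. 0))) (inner f (tc (\<lambda>x. 0) a))" for f a
    have pr: "(\<integral>x. f x * complex_of_real (a x) \<partial>lborel) = pr (cl f) a" if "L2 f" "test1 a" for f a
      using pairing_eq[OF that] by (simp add: pr_def)
    have cpr: "continuous_on UNIV (\<lambda>t. pr (H t) a)" if "continuous_on UNIV H" for H a
      unfolding pr_def by (intro continuous_on_Complex continuous_intros that)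
    have eq1: "(\<integral>t. complex_of_real (deriv \<rho> t) * pr (P t) \<eta> \<partial>lborel) = - (\<integral>t. complex_of_real (\<rho> t) * pr (Q t) \<eta> \<partial>lborel)"
      if \<rho>: "test1 \<rho>" for \<rho>
    proof -
      have "(\<integral>t. (\<integral>x. fst (\<Psi> t) x * complex_of_real (pt (\<lambda>x t. \<rho> t * \<eta> x) x t) \<partial>lborel) \<partial>lborel)
          = - (\<integral>t. (\<integral>x. snd (\<Psi> t) x * complex_of_real (\<rho> t * \<eta> x) \<partial>lborel) \<partial>lborel)"
        using sol test2_separable[OF \<rho> \<eta>] unfolding is_solution_def by blast
      moreover have "(\<integral>x. fst (\<Psi> t) x * complex_of_real (pt (\<lambda>x t. \<rho> t * \<eta> x) x t) \<partial>lborel) = complex_of_real (deriv \<rho> t) * pr (P t) \<eta>" for t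
      proof -
        have "(\<integral>x. fst (\<Psi> t) x * complex_of_real (pt (\<lambda>x t. \<rho> t * \<eta> x) x t) \<partial>lborel)
            = (\<integral>x. complex_of_real (deriv \<rho> t) * (fst (\<Psi> t) x * complex_of_real (\<eta> x)) \<partial>lborel)"
          using \<rho> by (intro Bochner_Integration.integral_cong refl) (simp add: pt_separable test1_smooth)
        then show ?thesis using e \<eta> by (simp add: pr P_def)
      qed
      moreover have "(\<integral>x. snd (\<Psi> t) x * complex_of_real (\<rho> t * \<eta> x) \<partial>lborel) = complex_of_real (\<rho> t) * pr (Q t) \<eta>" for t
      proof -
        have "(\<integral>x. snd (\<Psi> t) x * complex_of_real (\<rho> t * \<eta> x) \<partial>lborel)
            = (\<integral>x. complex_of_real (\<rho> t) * (snd (\<Psi> t) x * complex_of_real (\<eta> x)) \<partial>lborel)"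
          by (simp add: mult_ac)
        then show ?thesis using e \<eta> by (simp add: pr Q_def)
      qed
      ultimately show ?thesis by simp
    qed
    define S where "S t = (\<Sum>J\<in>{1..N}. G J t * complex_of_real (\<eta> (X J)))" for t
    \<comment> \<open>The expected time derivative of \<open>pr (Q t) \<eta>\<close>, with the
      second space derivative moved once to the test function.\<close>
    define q where "q t = - pr (D t) (deriv \<eta>) - complex_of_real (m\<^sup>2) * pr (P t) \<eta> + S t" for t
    have cq: "continuous_on UNIV q" unfolding q_def S_def
      by (intro continuous_intros cpr cP cD cG)
    have eq2: "(\<integral>t. complex_of_real (deriv \<rho> t) * pr (Q t) \<eta> \<partial>lborel) = - (\<integral>t. complex_of_real (\<rho> t) * q t \<partial>lborel)"
      if \<rho>: "test1 \<rho>" for \<rho>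
    proof -
      note \<rho>' = test1_deriv[OF \<rho>] and \<rho>'' = test1_deriv[OF test1_deriv[OF \<rho>]]
      note \<eta>' = test1_deriv[OF \<eta>] and \<eta>'' = test1_deriv[OF test1_deriv[OF \<eta>]]
      let ?\<phi> = "\<lambda>x t. \<rho> t * \<eta> x"
      have "(\<integral>t. (\<integral>x. fst (\<Psi> t) x * complex_of_real (pt (pt ?\<phi>) x t - px (px ?\<phi>) x t + m\<^sup>2 * ?\<phi> x t) \<partial>lborel) \<partial>lborel)
          = (\<integral>t. (\<Sum>J\<in>{1..N}. F J (fst (\<Psi> t) (X J)) * complex_of_real (\<rho> t * \<eta> (X J))) \<partial>lborel)"
        using sol test2_separable[OF \<rho> \<eta>] unfolding is_solution_def by blast
      moreover have "(\<Sum>J\<in>{1..N}. F J (fst (\<Psi> t) (X J)) * complex_of_real (\<rho> t * \<eta> (X J))) = complex_of_real (\<rho> t) * S t" for t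
        by (simp add: S_def sum_distrib_left G_def mult_ac)
      moreover have "(\<integral>x. fst (\<Psi> t) x * complex_of_real (pt (pt ?\<phi>) x t - px (px ?\<phi>) x t + m\<^sup>2 * ?\<phi> x t) \<partial>lborel)
          = complex_of_real (deriv (deriv \<rho>) t) * pr (P t) \<eta> + complex_of_real (\<rho> t) * (S t - q t)" for t
      proof -
        define \<kappa> where "\<kappa> x = (deriv (deriv \<rho>) t + m\<^sup>2 * \<rho> t) * \<eta> x - \<rho> t * deriv (deriv \<eta>) x" for x
        have \<kappa>: "test1 \<kappa>" unfolding \<kappa>_def[abs_def] by (intro test1_diff test1_cmult \<eta> \<eta>'')
        have "pt (pt ?\<phi>) x t - px (px ?\<phi>) x t + m\<^sup>2 * ?\<phi> x t = \<kappa> x" for x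
          using \<rho> \<eta> by (simp add: pt_separable px_separable test1_smooth smooth_deriv \<kappa>_def) (simp add: algebra_simps)
        then have "(\<integral>x. fst (\<Psi> t) x * complex_of_real (pt (pt ?\<phi>) x t - px (px ?\<phi>) x t + m\<^sup>2 * ?\<phi> x t) \<partial>lborel) = pr (P t) \<kappa>"
          using pr[OF e(2)[of t] \<kappa>] by (simp add: P_def)
        also have "\<dots> = complex_of_real (deriv (deriv \<rho>) t + m\<^sup>2 * \<rho> t) * pr (P t) \<eta> - complex_of_real (\<rho> t) * pr (P t) (deriv (deriv \<eta>))"
        proof -
          have "tc \<kappa> (\<lambda>x. 0) = (deriv (deriv \<rho>) t + m\<^sup>2 * \<rho> t) *\<^sub>R tc \<eta> (\<lambda>x. 0) - \<rho> t *\<^sub>R tc (deriv (deriv \<eta>)) (\<lambda>x. 0)"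
            "tc (\<lambda>x. 0) \<kappa> = (deriv (deriv \<rho>) t + m\<^sup>2 * \<rho> t) *\<^sub>R tc (\<lambda>x. 0) \<eta> - \<rho> t *\<^sub>R tc (\<lambda>x. 0) (deriv (deriv \<eta>))"
            using \<eta> \<eta>'' by (simp_all add: cl_scaleR L2_cpl cl_diff L2_scaleR) (simp_all add: cpl_def[abs_def] \<kappa>_def[abs_def] complex_scaleR minus_complex.code)
          then show ?thesis by (simp add: pr_def complex_eq_iff inner_diff_right)
        qed
        also have "pr (P t) (deriv (deriv \<eta>)) = - pr (D t) (deriv \<eta>)"
          using wPD[of t, unfolded wd_def, rule_format, OF \<eta>' test1_0] wPD[of t, unfolded wd_def, rule_format, OF test1_0 \<eta>']
          by (simp add: pr_def deriv_zero complex_eq_iff del: deriv_const)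
        finally show ?thesis by (simp add: q_def algebra_simps)
      qed
      ultimately have eq: "(\<integral>t. complex_of_real (deriv (deriv \<rho>) t) * pr (P t) \<eta> + complex_of_real (\<rho> t) * (S t - q t) \<partial>lborel)
          = (\<integral>t. complex_of_real (\<rho> t) * S t \<partial>lborel)" by simp
      have cS: "continuous_on UNIV S" unfolding S_def by (intro continuous_intros cG)
      have "(\<integral>t. complex_of_real (deriv (deriv \<rho>) t) * pr (P t) \<eta> \<partial>lborel) = (\<integral>t. complex_of_real (\<rho> t) * q t \<partial>lborel)"
        using eq continuous_test_complex(1)[OF cpr[OF cP] \<rho>''] continuous_test_complex(1)[OF cS \<rho>] continuous_test_complex(1)[OF cq \<rho>]
        by (simp add: right_diff_distrib)
      \<comment> \<open>The first identity, tested with the derivative of \<open>\<rho>\<close>,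
        replaces the second derivative of \<open>\<rho>\<close> against \<open>P\<close> by the
        first derivative against \<open>Q\<close>.\<close>
      with eq1[OF \<rho>'] show ?thesis by (metis minus_minus)
    qed
    note d1 = du_bois_reymond_complex[OF cpr[OF cP, of \<eta>] cpr[OF cQ, of \<eta>] eq1, of t]
    note d2 = du_bois_reymond_complex[OF cpr[OF cQ, of \<eta>] cq eq2, of t]
    show "((\<lambda>s. inner (P s) (tc \<eta> (\<lambda>x. 0))) has_real_derivative inner (Q t) (tc \<eta> (\<lambda>x. 0))) (at t)"
    "((\<lambda>s. inner (P s) (tc (\<lambda>x. 0) \<eta>)) has_real_derivative inner (Q t) (tc (\<lambda>x. 0) \<eta>)) (at t)"
    "((\<lambda>s. inner (Q s) (tc \<eta> (\<lambda>x. 0))) has_real_derivative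
        - inner (D t) (tc (deriv \<eta>) (\<lambda>x. 0)) - m\<^sup>2 * inner (P t) (tc \<eta> (\<lambda>x. 0)) + (\<Sum>J\<in>{1..N}. Re (G J t) * \<eta> (X J))) (at t)"
    "((\<lambda>s. inner (Q s) (tc (\<lambda>x. 0) \<eta>)) has_real_derivative
        - inner (D t) (tc (\<lambda>x. 0) (deriv \<eta>)) - m\<^sup>2 * inner (P t) (tc (\<lambda>x. 0) \<eta>) + (\<Sum>J\<in>{1..N}. Im (G J t) * \<eta> (X J))) (at t)"
      using d1 d2 by (simp_all add: pr_def q_def S_def)
  qed
  have "weak_sol m N X UNIV G P D Q"
    unfolding weak_sol_def
  proof (intro conjI allI impI ballI cP cD cQ cG wPD)
    fix a b t assume t: "test1 a" "test1 b"
    have td_split: "td a b = tc (deriv a) (\<lambda>x. 0) + tc (\<lambda>x. 0) (deriv b)"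
      using t by (intro tc_split test1_deriv)
    show "((\<lambda>s. inner (P s) (tc a b)) has_real_derivative inner (Q t) (tc a b)) (at t)"
      unfolding tc_split[OF t] inner_add_right by (intro DERIV_add main t)
    have "((\<lambda>s. inner (Q s) (tc a b)) has_real_derivative
        (- inner (D t) (tc (deriv a) (\<lambda>x. 0)) - m\<^sup>2 * inner (P t) (tc a (\<lambda>x. 0)) + (\<Sum>J\<in>{1..N}. Re (G J t) * a (X J)))
       + (- inner (D t) (tc (\<lambda>x. 0) (deriv b)) - m\<^sup>2 * inner (P t) (tc (\<lambda>x. 0) b) + (\<Sum>J\<in>{1..N}. Im (G J t) * b (X J)))) (at t)"
      unfolding tc_split[OF t] inner_add_right by (intro DERIV_add main t)
    then show "((\<lambda>s. inner (Q s) (tc a b)) has_real_derivative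
        - inner (D t) (td a b) - m\<^sup>2 * inner (P t) (tc a b) + (\<Sum>J\<in>{1..N}. inner (G J t) (cpl a b (X J)))) (at t)"
      unfolding tc_split[OF t] td_split inner_add_right
      by (simp add: inner_complex_def cpl_simps sum.distrib algebra_simps)
  qed
  then show ?thesis by (simp add: P_def[abs_def] D_def[abs_def] Q_def[abs_def] G_def[abs_def])
qed


section \<open>From differential equations back to distributions\<close>

lemma has_vector_derivative_quotient:
  "(g has_vector_derivative g') (at t within T) \<longleftrightarrow> ((\<lambda>s. (g s - g t) /\<^sub>R (s - t)) \<longlongrightarrow> g') (at t within T)"
proof -
  have "(g has_vector_derivative g') (at t within T)
    \<longleftrightarrow> ((\<lambda>s. norm (g s - g t - (s - t) *\<^sub>R g') / norm (s - t)) \<longlongrightarrow> 0) (at t within T)"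
    unfolding has_vector_derivative_def has_derivative_iff_norm by (simp add: bounded_linear_scaleR_left)
  also have "\<dots> \<longleftrightarrow> ((\<lambda>s. norm ((g s - g t) /\<^sub>R (s - t) - g')) \<longlongrightarrow> 0) (at t within T)"
  proof (rule tendsto_cong)
    have "norm (g s - g t - (s - t) *\<^sub>R g') / norm (s - t) = norm ((g s - g t) /\<^sub>R (s - t) - g')" if "s \<noteq> t" for s
    proof -
      have "(g s - g t) /\<^sub>R (s - t) - g' = (g s - g t - (s - t) *\<^sub>R g') /\<^sub>R (s - t)"
        using that by (simp add: scaleR_diff_right)
      then show ?thesis by (simp add: divide_inverse mult.commute)
    qed
    then show "\<forall>\<^sub>F s in at t within T. norm (g s - g t - (s - t) *\<^sub>R g') / norm (s - t) = norm ((g s - g t) /\<^sub>R (s - t) - g')"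
      by (auto simp: eventually_at_filter)
  qed
  also have "\<dots> \<longleftrightarrow> ((\<lambda>s. (g s - g t) /\<^sub>R (s - t)) \<longlongrightarrow> g') (at t within T)"
    by (simp add: tendsto_norm_zero_iff LIM_zero_iff)
  finally show ?thesis .
qed

text \<open>A product rule in which \<open>f\<close> need be differentiable only against the one
  vector \<open>g t\<close>. The increment of the product splits into the increment of
  \<open>f\<close> against \<open>g t\<close> and \<open>f s\<close> against the increment of
  \<open>g\<close>; for the latter, norm continuity of \<open>f\<close> suffices.\<close>

lemma weak_strong_product:
  fixes f g :: "real \<Rightarrow> 'a :: real_inner"
  assumes f: "((\<lambda>s. inner (f s) (g t)) has_real_derivative p) (at t within T)"
    and c: "continuous_on T f" "t \<in> T"
    and g: "(g has_vector_derivative g') (at t within T)"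
  shows "((\<lambda>s. inner (f s) (g s)) has_real_derivative p + inner (f t) g') (at t within T)"
proof -
  have "((\<lambda>s. (inner (f s) (g t) - inner (f t) (g t)) / (s - t) + inner (f s) ((g s - g t) /\<^sub>R (s - t))) \<longlongrightarrow> p + inner (f t) g') (at t within T)"
  proof (intro tendsto_add tendsto_inner)
    show "((\<lambda>s. (inner (f s) (g t) - inner (f t) (g t)) / (s - t)) \<longlongrightarrow> p) (at t within T)"
      using f by (simp add: has_field_derivative_iff)
    show "(f \<longlongrightarrow> f t) (at t within T)" using c by (simp add: continuous_on_def)
    show "((\<lambda>s. (g s - g t) /\<^sub>R (s - t)) \<longlongrightarrow> g') (at t within T)" using g by (simp add: has_vector_derivative_quotient)
  qed
  moreover have "(inner (f s) (g t) - inner (f t) (g t)) / (s - t) + inner (f s) ((g s - g t) /\<^sub>R (s - t))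
      = (inner (f s) (g s) - inner (f t) (g t)) / (s - t)" for s
    by (simp add: inner_diff_right divide_inverse algebra_simps)
  ultimately show ?thesis by (simp add: has_field_derivative_iff)
qed

lemma test2_diff:
  assumes "test2 \<phi>" "g \<in> partials \<phi>"
  shows "((\<lambda>y. g y t) has_real_derivative px g x t) (at x)" "((\<lambda>s. g x s) has_real_derivative pt g x t) (at t)"
    "continuous_on UNIV (\<lambda>(x, t). g x t)"
proof -
  have "(\<lambda>y. g y t) differentiable (at x)" "(\<lambda>s. g x s) differentiable (at t)"
    using assms unfolding test2_def by blast+
  then show "((\<lambda>y. g y t) has_real_derivative px g x t) (at x)" "((\<lambda>s. g x s) has_real_derivative pt g x t) (at t)"
    unfolding px_def pt_def by (simp_all add: DERIV_deriv_iff_real_differentiable)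
  show "continuous_on UNIV (\<lambda>(x, t). g x t)" using assms unfolding test2_def by blast
qed

lemma test2_partial_support:
  assumes "\<And>x t. \<bar>x\<bar> > R \<or> \<bar>t\<bar> > R \<Longrightarrow> \<phi> x t = 0" "g \<in> partials \<phi>" "\<bar>x\<bar> > R \<or> \<bar>t\<bar> > R"
  shows "g x t = 0"
  using assms(2,3)
proof (induction arbitrary: x t rule: partials.induct)
  case (dx g)
  show ?case
  proof (cases "\<bar>t\<bar> > R")
    case True
    then have "(\<lambda>y. g y t) = (\<lambda>y. 0)" using dx.IH by auto
    then show ?thesis by (simp add: px_def)
  next
    case False
    then show ?thesis unfolding px_def using dx by (intro deriv_eq_0_outside[of R "\<lambda>y. g y t"]) auto
  qed
next
  case (dt g)
  show ?case
  proof (cases "\<bar>x\<bar> > R")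
    case True
    then have "(\<lambda>s. g x s) = (\<lambda>s. 0)" using dt.IH by auto
    then show ?thesis by (simp add: pt_def)
  next
    case False
    then show ?thesis unfolding pt_def using dt by (intro deriv_eq_0_outside[of R "\<lambda>s. g x s"]) auto
  qed
qed (use assms(1) in auto)

lemma test2_partial:
  assumes "test2 \<phi>" "g \<in> partials \<phi>" shows "test2 g"
proof -
  have sub: "h \<in> partials \<phi>" if "h \<in> partials g" for h
    using that by (induction rule: partials.induct) (auto intro: partials.intros assms)
  obtain R where R: "\<And>x t. \<bar>x\<bar> > R \<or> \<bar>t\<bar> > R \<Longrightarrow> \<phi> x t = 0" using assms(1) unfolding test2_def by blast
  have "\<bar>x\<bar> > R \<or> \<bar>t\<bar> > R \<Longrightarrow> g x t = 0" for x t by (rule test2_partial_support[OF R assms(2)])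
  then show ?thesis using assms(1) sub unfolding test2_def by blast
qed

lemma test2_slice:
  assumes "test2 \<phi>" shows "test1 (\<lambda>x. \<phi> x t)"
proof -
  have "(deriv ^^ n) (\<lambda>x. \<phi> x t) = (\<lambda>x. (px ^^ n) \<phi> x t) \<and> (px ^^ n) \<phi> \<in> partials \<phi>" for n
  proof (induction n)
    case (Suc n)
    then show ?case
      using partials.dx[of "(px ^^ n) \<phi>" \<phi>] by (simp add: px_def[of "(px ^^ n) \<phi>"])
  qed (auto intro: partials.intros)
  then have "((deriv ^^ n) (\<lambda>x. \<phi> x t)) differentiable (at x)" for n x
    using test2_diff(1)[OF assms, of "(px ^^ n) \<phi>" t x] by (auto simp: real_differentiable_def)
  moreover obtain R where "\<And>x t. \<bar>x\<bar> > R \<or> \<bar>t\<bar> > R \<Longrightarrow> \<phi> x t = 0" using assms unfolding test2_def by blast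
  ultimately show ?thesis unfolding test1_def by blast
qed

lemma test2_bounded:
  assumes "test2 \<phi>" obtains K where "\<And>x t. \<bar>\<phi> x t\<bar> \<le> K"
proof -
  obtain R where R: "\<And>x t. \<bar>x\<bar> > R \<or> \<bar>t\<bar> > R \<Longrightarrow> \<phi> x t = 0" using assms unfolding test2_def by blast
  have "continuous_on ({-R..R} \<times> {-R..R}) (\<lambda>(x, t). \<phi> x t)"
    using test2_diff(3)[OF assms partials.base] by (rule continuous_on_subset) simp
  then have "compact ((\<lambda>(x, t). \<phi> x t) ` ({-R..R} \<times> {-R..R}))"
    by (intro compact_continuous_image compact_Times compact_Icc)
  then obtain B where B: "\<And>y. y \<in> (\<lambda>(x, t). \<phi> x t) ` ({-R..R} \<times> {-R..R}) \<Longrightarrow> \<bar>y\<bar> \<le> B"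
    by (metis compact_imp_bounded bounded_iff real_norm_def)
  have "\<bar>\<phi> x t\<bar> \<le> \<bar>B\<bar>" for x t
  proof (cases "\<bar>x\<bar> > R \<or> \<bar>t\<bar> > R")
    case False
    then have "(x, t) \<in> {-R..R} \<times> {-R..R}" by auto
    then have "\<phi> x t \<in> (\<lambda>(x, t). \<phi> x t) ` ({-R..R} \<times> {-R..R})"
      by (metis (no_types, lifting) case_prod_conv imageI)
    then show ?thesis using B by fastforce
  qed (use R in auto)
  then show ?thesis using that by blast
qed

lemma test2_curve:
  assumes "test2 \<phi>"
  shows "((\<lambda>s. tc (\<lambda>x. c * \<phi> x s) (\<lambda>x. d * \<phi> x s)) has_vector_derivative tc (\<lambda>x. c * pt \<phi> x t) (\<lambda>x. d * pt \<phi> x t)) (at t)"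
proof -
  have p: "pt \<phi> \<in> partials \<phi>" "pt (pt \<phi>) \<in> partials \<phi>" by (auto intro: partials.intros)
  obtain K where K: "\<And>x t. \<bar>pt (pt \<phi>) x t\<bar> \<le> K" using test2_bounded[OF test2_partial[OF assms p(2)]] by blast
  obtain R where R: "\<And>x t. \<bar>x\<bar> > R \<or> \<bar>t\<bar> > R \<Longrightarrow> \<phi> x t = 0" using assms unfolding test2_def by blast
  have tay: "\<bar>\<phi> x s - \<phi> x t - (s - t) * pt \<phi> x t\<bar> \<le> K * (s - t)\<^sup>2" for x s
    using taylor2_bound[of "\<lambda>s. \<phi> x s" "\<lambda>s. pt \<phi> x s" "\<lambda>s. pt (pt \<phi>) x s" K s t]
      test2_diff(2)[OF assms partials.base] test2_diff(2)[OF assms p(1)] K by blast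
  show ?thesis
  proof (rule cl_curve_has_vector_derivative[where K="(\<bar>c\<bar> + \<bar>d\<bar>) * K" and a="- \<bar>R\<bar>" and b="\<bar>R\<bar>"])
    show "L2 (cpl (\<lambda>x. c * \<phi> x s) (\<lambda>x. d * \<phi> x s))" "L2 (cpl (\<lambda>x. c * pt \<phi> x t) (\<lambda>x. d * pt \<phi> x t))" for s
      by (intro L2_cpl test1_cmult test2_slice assms test2_partial[OF assms p(1)])+
    show "cpl (\<lambda>x. c * \<phi> x s) (\<lambda>x. d * \<phi> x s) x = 0 \<and> cpl (\<lambda>x. c * pt \<phi> x t) (\<lambda>x. d * pt \<phi> x t) x = 0"
      if "x < - \<bar>R\<bar> \<or> \<bar>R\<bar> < x" for s x
    proof -
      have "\<bar>x\<bar> > R" using that by linarith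
      then show ?thesis using R test2_partial_support[OF R p(1)] by (simp add: cpl_eq)
    qed
    show "cmod (cpl (\<lambda>x. c * \<phi> x s) (\<lambda>x. d * \<phi> x s) x - cpl (\<lambda>x. c * \<phi> x t) (\<lambda>x. d * \<phi> x t) x
        - (s - t) *\<^sub>R cpl (\<lambda>x. c * pt \<phi> x t) (\<lambda>x. d * pt \<phi> x t) x) \<le> (\<bar>c\<bar> + \<bar>d\<bar>) * K * (s - t)\<^sup>2" for s x
    proof -
      let ?r = "\<phi> x s - \<phi> x t - (s - t) * pt \<phi> x t"
      have "cpl (\<lambda>x. c * \<phi> x s) (\<lambda>x. d * \<phi> x s) x - cpl (\<lambda>x. c * \<phi> x t) (\<lambda>x. d * \<phi> x t) x
        - (s - t) *\<^sub>R cpl (\<lambda>x. c * pt \<phi> x t) (\<lambda>x. d * pt \<phi> x t) x = Complex (c * ?r) (d * ?r)"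
        by (simp add: complex_eq_iff cpl_simps algebra_simps)
      moreover have "cmod (Complex (c * ?r) (d * ?r)) \<le> (\<bar>c\<bar> + \<bar>d\<bar>) * \<bar>?r\<bar>"
        using cmod_le[of "Complex (c * ?r) (d * ?r)"] by (simp add: abs_mult distrib_right)
      moreover have "(\<bar>c\<bar> + \<bar>d\<bar>) * \<bar>?r\<bar> \<le> (\<bar>c\<bar> + \<bar>d\<bar>) * (K * (s - t)\<^sup>2)"
        by (intro mult_left_mono tay) auto
      ultimately show ?thesis by (simp add: mult.assoc)
    qed
  qed auto
qed

lemma complex_integral_Complex:
  assumes "integrable lborel f" "integrable lborel g"
  shows "(\<integral>t. Complex (f t) (g t) \<partial>lborel) = Complex (\<integral>t. f t \<partial>lborel) (\<integral>t. g t \<partial>lborel)"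
proof -
  have eq: "Complex (f t) (g t) = complex_of_real (f t) + \<i> * complex_of_real (g t)" for t by (simp add: complex_eq_iff)
  show ?thesis unfolding eq using assms by (simp add: complex_eq_iff)
qed

lemma integrable_compact_support:
  fixes f :: "real \<Rightarrow> real"
  assumes "continuous_on UNIV f" "\<And>x. \<bar>x\<bar> > R \<Longrightarrow> f x = 0" shows "integrable lborel f"
proof -
  have "integrable lborel (\<lambda>x. indicator {-R..R} x *\<^sub>R f x)"
    by (rule borel_integrable_compact) (auto intro: continuous_on_subset[OF assms(1)])
  moreover have "(\<lambda>x. indicator {-R..R} x *\<^sub>R f x) = f"
    using assms(2) by (force simp: indicator_def abs_le_iff not_le)
  ultimately show ?thesis by simp
qed

text \<open>A general test function on the plane is no product, so it is read as a differentiable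
  curve of test functions in \<open>x\<close>, and \<open>weak_strong_product\<close> differentiates
  its pairing with \<open>P\<close> and with \<open>Q\<close>. Both pairings have compact support in
  time, hence their derivatives integrate to zero, and these are the two distributional
  identities.\<close>

theorem weak_sol_solution:
  assumes w: "weak_sol m N X UNIV G P D Q"
    and G: "\<And>J t. J \<in> {1..N} \<Longrightarrow> G J t = F J (ev (X J) (P t) (D t))"
    and init: "\<Psi>0 \<in> Espace" "P 0 = cl (fst \<Psi>0)" "Q 0 = cl (snd \<Psi>0)" and "m > 0"
  shows "is_solution m N X F \<Psi>0 (\<lambda>t. ((\<lambda>x. ev x (P t) (D t)), rep_l2 (Q t)))"
proof -
  define \<Psi> where "\<Psi> t = ((\<lambda>x. ev x (P t) (D t)), rep_l2 (Q t))" for t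
  have cP: "continuous_on UNIV P" and cD: "continuous_on UNIV D" and cQ: "continuous_on UNIV Q"
    and cG: "\<And>J. J \<in> {1..N} \<Longrightarrow> continuous_on UNIV (G J)" and wPD: "\<And>t. wd (P t) (D t)"
    and dP: "\<And>a b t. test1 a \<Longrightarrow> test1 b \<Longrightarrow> ((\<lambda>s. inner (P s) (tc a b)) has_real_derivative inner (Q t) (tc a b)) (at t)"
    and dQ: "\<And>a b t. test1 a \<Longrightarrow> test1 b \<Longrightarrow> ((\<lambda>s. inner (Q s) (tc a b)) has_real_derivative
          (- inner (D t) (td a b) - m\<^sup>2 * inner (P t) (tc a b) + (\<Sum>J\<in>{1..N}. inner (G J t) (cpl a b (X J))))) (at t)"
    using w unfolding weak_sol_def by auto
  have E: "\<Psi> t \<in> Espace" for t unfolding \<Psi>_def by (rule EspaceI(1)[OF wPD]) simp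
  have cl\<Psi>: "cl (fst (\<Psi> t)) = P t" "cl (wderiv (fst (\<Psi> t))) = D t" "cl (snd (\<Psi> t)) = Q t" for t
    using cl_ev[OF wPD] EspaceI(2)[OF wPD L2_zero] by (simp_all add: \<Psi>_def)
  have L: "L2 (fst (\<Psi> t))" "L2 (snd (\<Psi> t))" for t using EspaceD[OF E] by auto
  have cont: "\<forall>\<epsilon>>0. \<exists>\<delta>>0. \<forall>s. \<bar>s - t\<bar> < \<delta> \<longrightarrow> enorm m (sdiff (\<Psi> s) (\<Psi> t)) < \<epsilon>" for t
  proof (intro allI impI)
    fix e :: real assume "e > 0"
    have "((\<lambda>s. norm (Q s - Q t) + norm (D s - D t) + m * norm (P s - P t)) \<longlongrightarrow> norm (Q t - Q t) + norm (D t - D t) + m * norm (P t - P t)) (at t)"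
      using cP cD cQ by (intro tendsto_intros) (auto simp: continuous_on_def)
    then have "((\<lambda>s. norm (Q s - Q t) + norm (D s - D t) + m * norm (P s - P t)) \<longlongrightarrow> 0) (at t)" by simp
    then have "\<forall>\<^sub>F s in at t. norm (Q s - Q t) + norm (D s - D t) + m * norm (P s - P t) < e"
      using \<open>e > 0\<close> by (intro order_tendstoD)
    then obtain d where d: "d > 0" "\<And>s. s \<noteq> t \<Longrightarrow> dist s t < d \<Longrightarrow> norm (Q s - Q t) + norm (D s - D t) + m * norm (P s - P t) < e"
      by (auto simp: eventually_at)
    show "\<exists>\<delta>>0. \<forall>s. \<bar>s - t\<bar> < \<delta> \<longrightarrow> enorm m (sdiff (\<Psi> s) (\<Psi> t)) < e"
    proof (intro exI[of _ d] conjI allI impI d(1))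
      fix s assume "\<bar>s - t\<bar> < d"
      then have "norm (Q s - Q t) + norm (D s - D t) + m * norm (P s - P t) < e"
        using d(2)[of s] \<open>e > 0\<close> by (cases "s = t") (auto simp: dist_real_def)
      then show "enorm m (sdiff (\<Psi> s) (\<Psi> t)) < e"
        using enorm_sdiff_le[OF E E \<open>m > 0\<close>, of s t] by (simp add: cl\<Psi>)
    qed
  qed
  text \<open>The real and imaginary parts of the distributional identities are obtained by pairing
    with the real and with the imaginary multiple of the test function.\<close>
  define A where "A c d \<phi> t = tc (\<lambda>x. c * \<phi> x t) (\<lambda>x. d * \<phi> x t)" for c d :: real and \<phi> :: "real \<Rightarrow> real \<Rightarrow> real" and t
  have dA: "(A c d \<phi> has_vector_derivative A c d (pt \<phi>) t) (at t)" if "test2 \<phi>" for c d \<phi> t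
    unfolding A_def[abs_def] by (rule test2_curve[OF that])
  have cA: "continuous_on UNIV (A c d \<phi>)" if "test2 \<phi>" for c d \<phi>
    using dA[OF that] by (intro continuous_at_imp_continuous_on) (auto intro: has_vector_derivative_continuous)
  have A0: "A c d \<phi> t = 0" if "\<And>x. \<phi> x t = 0" for c d \<phi> t
    using that by (simp add: A_def cpl_eq[abs_def] cl_zero)
  have pr: "(\<integral>x. f x * complex_of_real (\<phi> x t) \<partial>lborel) = Complex (inner (cl f) (A 1 0 \<phi> t)) (inner (cl f) (A 0 1 \<phi> t))"
    if "L2 f" "test2 \<phi>" for f \<phi> t
    using pairing_eq[OF that(1) test2_slice[OF that(2)]] by (simp add: A_def)
  have eq1: "(\<integral>t. inner (P t) (A c d (pt \<phi>) t) \<partial>lborel) = - (\<integral>t. inner (Q t) (A c d \<phi> t) \<partial>lborel)"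
    and int1: "integrable lborel (\<lambda>t. inner (P t) (A c d \<phi> t))" "integrable lborel (\<lambda>t. inner (Q t) (A c d \<phi> t))"
    if \<phi>: "test2 \<phi>" for c d \<phi>
  proof -
    have int: "integrable lborel (\<lambda>t. inner (H t) (A c d \<phi> t))" if H: "continuous_on UNIV H" and t2: "test2 \<phi>" for H \<phi>
    proof -
      obtain R where R: "\<And>x t. \<bar>x\<bar> > R \<or> \<bar>t\<bar> > R \<Longrightarrow> \<phi> x t = 0" using t2 unfolding test2_def by blast
      show ?thesis
        by (rule integrable_compact_support[where R=R]) (auto intro!: continuous_intros H cA[OF t2] simp: A0 R)
    qed
    show int1: "integrable lborel (\<lambda>t. inner (P t) (A c d \<phi> t))" "integrable lborel (\<lambda>t. inner (Q t) (A c d \<phi> t))"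
      by (intro int cP cQ \<phi>)+
    have \<phi>': "test2 (pt \<phi>)" by (rule test2_partial[OF \<phi>]) (intro partials.intros)
    obtain R where R: "\<And>x t. \<bar>x\<bar> > R \<or> \<bar>t\<bar> > R \<Longrightarrow> \<phi> x t = 0" using \<phi> unfolding test2_def by blast
    have R': "pt \<phi> x t = 0" if "\<bar>x\<bar> > R \<or> \<bar>t\<bar> > R" for x t
      by (rule test2_partial_support[where \<phi>=\<phi> and R=R]) (use that in \<open>auto intro: partials.intros R\<close>)
    let ?M = "\<bar>R\<bar> + 1"
    have "(\<integral>t. inner (Q t) (A c d \<phi> t) + inner (P t) (A c d (pt \<phi>) t) \<partial>lborel)
        = inner (P ?M) (A c d \<phi> ?M) - inner (P (- ?M)) (A c d \<phi> (- ?M))"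
    proof (rule integral_compact_support_FTC[where F="\<lambda>t. inner (P t) (A c d \<phi> t)"])
      show "((\<lambda>t. inner (P t) (A c d \<phi> t)) has_real_derivative inner (Q t) (A c d \<phi> t) + inner (P t) (A c d (pt \<phi>) t)) (at t)" for t
      proof (rule weak_strong_product[OF _ cP UNIV_I dA[OF \<phi>]])
        show "((\<lambda>s. inner (P s) (A c d \<phi> t)) has_real_derivative inner (Q t) (A c d \<phi> t)) (at t)"
          unfolding A_def by (intro dP test1_cmult test2_slice \<phi>)
      qed
      show "continuous_on s (\<lambda>t. inner (Q t) (A c d \<phi> t) + inner (P t) (A c d (pt \<phi>) t))" for s
        by (rule continuous_on_subset[OF _ subset_UNIV]) (intro continuous_intros cP cQ cA \<phi> \<phi>')
      show "inner (Q t) (A c d \<phi> t) + inner (P t) (A c d (pt \<phi>) t) = 0" if "t < - ?M \<or> ?M < t" for t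
      proof -
        have "\<bar>t\<bar> > R" using that by auto
        then show ?thesis by (simp add: A0 R R')
      qed
    qed auto
    also have "\<dots> = 0"
    proof -
      have "A c d \<phi> ?M = 0" "A c d \<phi> (- ?M) = 0" by (rule A0, rule R, arith)+
      then show ?thesis by (simp only: inner_zero_right diff_self)
    qed
    finally show "(\<integral>t. inner (P t) (A c d (pt \<phi>) t) \<partial>lborel) = - (\<integral>t. inner (Q t) (A c d \<phi> t) \<partial>lborel)"
      using int[OF cQ \<phi>] int[OF cP \<phi>'] by simp
  qed
  have eq2: "(\<integral>t. inner (P t) (A c d (\<lambda>x t. pt (pt \<phi>) x t - px (px \<phi>) x t + m\<^sup>2 * \<phi> x t) t) \<partial>lborel)
      = (\<integral>t. (\<Sum>J\<in>{1..N}. inner (G J t) (cpl (\<lambda>x. c * \<phi> x t) (\<lambda>x. d * \<phi> x t) (X J))) \<partial>lborel)"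
    and int2: "integrable lborel (\<lambda>t. inner (P t) (A c d (\<lambda>x t. pt (pt \<phi>) x t - px (px \<phi>) x t + m\<^sup>2 * \<phi> x t) t))"
      "integrable lborel (\<lambda>t. (\<Sum>J\<in>{1..N}. inner (G J t) (cpl (\<lambda>x. c * \<phi> x t) (\<lambda>x. d * \<phi> x t) (X J))))"
    if \<phi>: "test2 \<phi>" for c d \<phi>
  proof -
    let ?S = "\<lambda>t. (\<Sum>J\<in>{1..N}. inner (G J t) (cpl (\<lambda>x. c * \<phi> x t) (\<lambda>x. d * \<phi> x t) (X J)))"
    let ?lhs = "\<integral>t. inner (P t) (A c d (\<lambda>x t. pt (pt \<phi>) x t - px (px \<phi>) x t + m\<^sup>2 * \<phi> x t) t) \<partial>lborel"
    have t: "test2 (pt \<phi>)" "test2 (pt (pt \<phi>))" "test2 (px \<phi>)" "test2 (px (px \<phi>))"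
      by (rule test2_partial[OF \<phi>], intro partials.intros)+
    obtain R where R: "\<And>x t. \<bar>x\<bar> > R \<or> \<bar>t\<bar> > R \<Longrightarrow> \<phi> x t = 0" using \<phi> unfolding test2_def by blast
    have R': "pt \<phi> x t = 0" "px \<phi> x t = 0" "px (px \<phi>) x t = 0" if "\<bar>x\<bar> > R \<or> \<bar>t\<bar> > R" for x t
      by (rule test2_partial_support[where \<phi>=\<phi> and R=R]; use that in \<open>auto intro: partials.intros R\<close>)+
    have split: "A c d (\<lambda>x t. pt (pt \<phi>) x t - px (px \<phi>) x t + m\<^sup>2 * \<phi> x t) t
      = A c d (pt (pt \<phi>)) t - A c d (px (px \<phi>)) t + m\<^sup>2 *\<^sub>R A c d \<phi> t" for t
    proof -
      note s = test2_slice[OF \<phi>] test2_slice[OF t(2)] test2_slice[OF t(4)]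
      have "m\<^sup>2 *\<^sub>R A c d \<phi> t = tc (\<lambda>x. m\<^sup>2 * (c * \<phi> x t)) (\<lambda>x. m\<^sup>2 * (d * \<phi> x t))"
        unfolding A_def using s by (simp add: cl_scaleR L2_cpl test1_cmult) (simp add: cpl_def[abs_def] complex_scaleR)
      then show ?thesis
        unfolding A_def using s by (simp add: tc_add tc_diff test1_cmult test1_diff) (simp add: algebra_simps)
    qed
    have Dx: "inner (D t) (A c d (px \<phi>) t) = - inner (P t) (A c d (px (px \<phi>)) t)" for t
    proof -
      have "deriv (\<lambda>x. e * px \<phi> x t) = (\<lambda>x. e * px (px \<phi>) x t)" for e
        by (intro ext DERIV_imp_deriv DERIV_cmult test2_diff(1)[OF t(3) partials.base])
      then show ?thesis
        using wPD[of t, unfolded wd_def, rule_format, of "\<lambda>x. c * px \<phi> x t" "\<lambda>x. d * px \<phi> x t"] test2_slice[OF t(3)]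
        by (simp add: A_def test1_cmult)
    qed
    have "continuous_on UNIV (\<lambda>t. \<phi> (X J) t)" for J
      using test2_diff(2)[OF \<phi> partials.base] by (meson DERIV_continuous continuous_at_imp_continuous_on)
    then have cS: "continuous_on UNIV ?S"
      unfolding cpl_eq by (intro continuous_intros cG)
    have S0: "?S t = 0" if "\<bar>t\<bar> > R" for t using R that by (simp add: cpl_eq)
    show intS: "integrable lborel ?S" by (rule integrable_compact_support[OF cS S0])
    show intP: "integrable lborel (\<lambda>t. inner (P t) (A c d (\<lambda>x t. pt (pt \<phi>) x t - px (px \<phi>) x t + m\<^sup>2 * \<phi> x t) t))"
      unfolding split inner_diff_right inner_add_right inner_scaleR_right
      by (intro Bochner_Integration.integrable_add Bochner_Integration.integrable_diff integrable_mult_right int1 t \<phi>)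
    let ?M = "\<bar>R\<bar> + 1"
    let ?f = "\<lambda>t. (inner (P t) (A c d (px (px \<phi>)) t) - m\<^sup>2 * inner (P t) (A c d \<phi> t) + ?S t) + inner (Q t) (A c d (pt \<phi>) t)"
    have "(\<integral>t. ?f t \<partial>lborel) = inner (Q ?M) (A c d \<phi> ?M) - inner (Q (- ?M)) (A c d \<phi> (- ?M))"
    proof (rule integral_compact_support_FTC[where F="\<lambda>t. inner (Q t) (A c d \<phi> t)"])
      show "((\<lambda>t. inner (Q t) (A c d \<phi> t)) has_real_derivative ?f t) (at t)" for t
      proof (rule weak_strong_product[OF _ cQ UNIV_I dA[OF \<phi>]])
        have "deriv (\<lambda>x. e * \<phi> x t) = (\<lambda>x. e * px \<phi> x t)" for e
          by (intro ext DERIV_imp_deriv DERIV_cmult test2_diff(1)[OF \<phi> partials.base])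
        then have "td (\<lambda>x. c * \<phi> x t) (\<lambda>x. d * \<phi> x t) = A c d (px \<phi>) t" by (simp add: A_def)
        then show "((\<lambda>s. inner (Q s) (A c d \<phi> t)) has_real_derivative
            inner (P t) (A c d (px (px \<phi>)) t) - m\<^sup>2 * inner (P t) (A c d \<phi> t) + ?S t) (at t)"
          using dQ[of "\<lambda>x. c * \<phi> x t" "\<lambda>x. d * \<phi> x t" t] test2_slice[OF \<phi>] Dx[of t]
          by (simp add: A_def test1_cmult)
      qed
      show "continuous_on s ?f" for s
        by (rule continuous_on_subset[OF _ subset_UNIV]) (intro continuous_intros cS cP cQ cA \<phi> t)
      show "?f t' = 0" if "t' < - ?M \<or> ?M < t'" for t'
      proof -
        have "\<bar>t'\<bar> > R" using that by auto
        then show ?thesis by (simp add: A0 R R' cpl_eq)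
      qed
    qed auto
    also have "\<dots> = 0"
    proof -
      have "A c d \<phi> ?M = 0" "A c d \<phi> (- ?M) = 0" by (rule A0, rule R, arith)+
      then show ?thesis by (simp only: inner_zero_right diff_self)
    qed
    finally have "(\<integral>t. inner (P t) (A c d (px (px \<phi>)) t) \<partial>lborel) - m\<^sup>2 * (\<integral>t. inner (P t) (A c d \<phi> t) \<partial>lborel)
        + (\<integral>t. ?S t \<partial>lborel) + (\<integral>t. inner (Q t) (A c d (pt \<phi>) t) \<partial>lborel) = 0"
      using int1[OF \<phi>] int1[OF t(1)] int1[OF t(4)] intS by simp
    \<comment> \<open>The first identity for \<open>pt \<phi>\<close> exchanges the pairing of
      \<open>Q\<close> with \<open>pt \<phi>\<close> for the pairing of \<open>P\<close> with the
      second time derivative, up to sign.\<close>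
    then show "?lhs = (\<integral>t. ?S t \<partial>lborel)"
      unfolding split inner_diff_right inner_add_right inner_scaleR_right
      using eq1[OF t(1), of c d] int1[OF \<phi>, of c d] int1[OF t(2), of c d] int1[OF t(4), of c d] by simp
  qed
  have "is_solution m N X F \<Psi>0 \<Psi>"
    unfolding is_solution_def
  proof (intro conjI allI impI)
    show "\<Psi> t \<in> Espace" for t by (rule E)
    show "\<exists>\<delta>>0. \<forall>s. \<bar>s - t\<bar> < \<delta> \<longrightarrow> enorm m (sdiff (\<Psi> s) (\<Psi> t)) < \<epsilon>" if "0 < \<epsilon>" for t \<epsilon>
      using cont that by blast
    fix \<phi> assume \<phi>: "test2 \<phi>"
    have \<phi>': "test2 (pt \<phi>)" by (rule test2_partial[OF \<phi>]) (intro partials.intros)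
    show "(\<integral>t. (\<integral>x. fst (\<Psi> t) x * complex_of_real (pt \<phi> x t) \<partial>lborel) \<partial>lborel)
          = - (\<integral>t. (\<integral>x. snd (\<Psi> t) x * complex_of_real (\<phi> x t) \<partial>lborel) \<partial>lborel)"
      using int1[OF \<phi>] int1[OF \<phi>'] eq1[OF \<phi>]
      by (simp add: pr[OF L(1) \<phi>'] pr[OF L(2) \<phi>] cl\<Psi> complex_integral_Complex complex_eq_iff)
    have t: "test2 (pt (pt \<phi>))" "test2 (px (px \<phi>))"
      by (rule test2_partial[OF \<phi>], intro partials.intros)+
    define \<theta> where "\<theta> x t = pt (pt \<phi>) x t - px (px \<phi>) x t + m\<^sup>2 * \<phi> x t" for x t
    have "test1 (\<lambda>x. \<theta> x t)" for t
      unfolding \<theta>_def by (intro test1_add test1_diff test1_cmult test2_slice t \<phi>)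
    then have "(\<integral>x. fst (\<Psi> t) x * complex_of_real (\<theta> x t) \<partial>lborel) = Complex (inner (P t) (A 1 0 \<theta> t)) (inner (P t) (A 0 1 \<theta> t))" for t
      using pairing_eq[OF L(1)[of t]] by (simp add: A_def cl\<Psi>)
    moreover have "(\<Sum>J\<in>{1..N}. F J (fst (\<Psi> t) (X J)) * complex_of_real (\<phi> (X J) t))
        = Complex (\<Sum>J\<in>{1..N}. inner (G J t) (cpl (\<lambda>x. 1 * \<phi> x t) (\<lambda>x. 0 * \<phi> x t) (X J)))
           (\<Sum>J\<in>{1..N}. inner (G J t) (cpl (\<lambda>x. 0 * \<phi> x t) (\<lambda>x. 1 * \<phi> x t) (X J)))" for t
      by (simp add: complex_eq_iff inner_complex_def cpl_simps G \<Psi>_def)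
    ultimately show "(\<integral>t. (\<integral>x. fst (\<Psi> t) x *
              complex_of_real (pt (pt \<phi>) x t - px (px \<phi>) x t + m\<^sup>2 * \<phi> x t) \<partial>lborel) \<partial>lborel)
          = (\<integral>t. (\<Sum>J\<in>{1..N}. F J (fst (\<Psi> t) (X J)) * complex_of_real (\<phi> (X J) t)) \<partial>lborel)"
      using eq2[OF \<phi>, of 1 0] eq2[OF \<phi>, of 0 1] int2[OF \<phi>, of 1 0] int2[OF \<phi>, of 0 1]
      unfolding \<theta>_def[symmetric] by (simp only: complex_integral_Complex)
  next
    have "AE x in lborel. fst (\<Psi> 0) x = fst \<Psi>0 x"
      using cl\<Psi>(1)[of 0] init L(1) EspaceD(2)[OF init(1)] by (simp add: cl_eq_iff)
    then show "fst (\<Psi> 0) = fst \<Psi>0"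
      using EspaceD(1)[OF E] EspaceD(1)[OF init(1)] by (intro continuous_AE_eq)
    show "AE x in lborel. snd (\<Psi> 0) x = snd \<Psi>0 x"
      using cl\<Psi>(3)[of 0] init L(2) EspaceD(3)[OF init(1)] by (simp add: cl_eq_iff)
  qed
  then show ?thesis by (simp add: \<Psi>_def[abs_def])
qed

section \<open>The nonlinearity\<close>

text \<open>The form in which \<open>F\<close> as the negative gradient of a phase invariant
  \<open>U\<close> enters the argument. The orthogonality to \<open>\<i> * z\<close> is the
  infinitesimal phase invariance behind the conservation of charge, the Lipschitz bound serves the
  fixed point, the expansion of \<open>U\<close> with quadratic error serves the energy, and
  \<open>F 0 = 0\<close> makes the zero curve available for comparison.\<close>

definition nl :: "(complex \<Rightarrow> complex) \<Rightarrow> (complex \<Rightarrow> real) \<Rightarrow> bool" where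
  "nl F U \<longleftrightarrow> continuous_on UNIV U \<and> F 0 = 0 \<and> (\<forall>z. inner (F z) (\<i> * z) = 0)
    \<and> (\<forall>R. \<exists>L\<ge>0. \<forall>z w. cmod z \<le> R \<longrightarrow> cmod w \<le> R \<longrightarrow>
         cmod (F z - F w) \<le> L * cmod (z - w) \<and> \<bar>U w - U z + inner (F z) (w - z)\<bar> \<le> L * (cmod (w - z))\<^sup>2)"

text \<open>The gradient of \<open>u ((cmod z)\<^sup>2)\<close> is
  \<open>2 * u' ((cmod z)\<^sup>2)\<close> times \<open>z\<close>; being a real multiple of
  \<open>z\<close>, it vanishes at 0 and is orthogonal to \<open>\<i> * z\<close>. Bounds of
  \<open>u'\<close> and \<open>u''\<close> on a compact interval make \<open>F\<close> locally
  Lipschitz, and integrating the Lipschitz bound along a segment gives the expansion of the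
  potential.\<close>

lemma nl_radial:
  assumes "C2 u" and F: "\<And>z. F z = - cgrad (\<lambda>w. u ((cmod w)\<^sup>2)) z"
  shows "nl F (\<lambda>w. u ((cmod w)\<^sup>2))"
proof -
  obtain u' u'' where d: "\<And>x. (u has_real_derivative u' x) (at x)" "\<And>x. (u' has_real_derivative u'' x) (at x)"
    and c: "continuous_on UNIV u''" using assms(1) unfolding C2_def by blast
  have cu: "continuous_on UNIV u" "continuous_on UNIV u'"
    using d by (meson DERIV_continuous continuous_at_imp_continuous_on)+
  have Feq: "F z = complex_of_real (- 2 * u' ((cmod z)\<^sup>2)) * z" for z
  proof -
    have "((\<lambda>a. u (a\<^sup>2 + (Im z)\<^sup>2)) has_real_derivative u' ((Re z)\<^sup>2 + (Im z)\<^sup>2) * (2 * Re z)) (at (Re z))"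
      by (rule DERIV_chain2[OF d(1)]) (auto intro!: derivative_eq_intros)
    moreover have "((\<lambda>b. u ((Re z)\<^sup>2 + b\<^sup>2)) has_real_derivative u' ((Re z)\<^sup>2 + (Im z)\<^sup>2) * (2 * Im z)) (at (Im z))"
      by (rule DERIV_chain2[OF d(1)]) (auto intro!: derivative_eq_intros)
    ultimately show ?thesis
      unfolding F cgrad_def by (simp add: cmod_power2 DERIV_imp_deriv complex_eq_iff)
  qed
  have lip: "\<exists>L\<ge>0. \<forall>z w. cmod z \<le> R \<longrightarrow> cmod w \<le> R \<longrightarrow> cmod (F z - F w) \<le> L * cmod (z - w)" for R
  proof -
    have "compact (u'' ` {0..R\<^sup>2})" "compact (u' ` {0..R\<^sup>2})"
      using continuous_on_subset[OF c] continuous_on_subset[OF cu(2)] by (auto intro!: compact_continuous_image)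
    then have "bounded (u'' ` {0..R\<^sup>2})" "bounded (u' ` {0..R\<^sup>2})" by (auto intro: compact_imp_bounded)
    then have "\<exists>M. \<forall>x\<in>{0..R\<^sup>2}. \<bar>u'' x\<bar> \<le> M" "\<exists>M. \<forall>x\<in>{0..R\<^sup>2}. \<bar>u' x\<bar> \<le> M"
      unfolding bounded_iff by auto
    then obtain M M0 where M: "\<And>x. x \<in> {0..R\<^sup>2} \<Longrightarrow> \<bar>u'' x\<bar> \<le> M" "\<And>x. x \<in> {0..R\<^sup>2} \<Longrightarrow> \<bar>u' x\<bar> \<le> M0"
      by blast
    have M0: "0 \<le> M" "0 \<le> M0" using M[of 0] by auto
    \<comment> \<open>In the difference, first the coefficient varies, by at most \<open>M\<close>
      times \<open>2 * R * cmod (z - w)\<close>, and is multiplied by 2 and by a vector of length at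
      most \<open>R\<close>; then the vector varies, with coefficient at most
      \<open>2 * M0\<close>.\<close>
    have "cmod (F z - F w) \<le> (4 * M * R\<^sup>2 + 2 * M0) * cmod (z - w)" if zw: "cmod z \<le> R" "cmod w \<le> R" for z w
    proof -
      have R0: "0 \<le> R" using zw(1) norm_ge_zero[of z] by linarith
      have in_R: "(cmod z)\<^sup>2 \<in> {0..R\<^sup>2}" "(cmod w)\<^sup>2 \<in> {0..R\<^sup>2}" using zw by (auto intro: power_mono)
      have "\<bar>u' ((cmod z)\<^sup>2) - u' ((cmod w)\<^sup>2)\<bar> \<le> M * \<bar>(cmod z)\<^sup>2 - (cmod w)\<^sup>2\<bar>"
        using field_differentiable_bound[of "{0..R\<^sup>2}" u' u'' M "(cmod z)\<^sup>2" "(cmod w)\<^sup>2"] M(1) in_R d(2)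
        by (auto intro: has_field_derivative_at_within)
      also have "\<bar>(cmod z)\<^sup>2 - (cmod w)\<^sup>2\<bar> = \<bar>cmod z - cmod w\<bar> * (cmod z + cmod w)"
      proof -
        have "(cmod z)\<^sup>2 - (cmod w)\<^sup>2 = (cmod z - cmod w) * (cmod z + cmod w)"
          by (simp add: power2_eq_square algebra_simps)
        then show ?thesis by (simp only: abs_mult abs_of_nonneg[OF add_nonneg_nonneg[OF norm_ge_zero norm_ge_zero]])
      qed
      also have "M * (\<bar>cmod z - cmod w\<bar> * (cmod z + cmod w)) \<le> M * (cmod (z - w) * (R + R))"
        using zw M0 by (intro mult_left_mono mult_mono norm_triangle_ineq3) auto
      finally have 1: "\<bar>u' ((cmod z)\<^sup>2) - u' ((cmod w)\<^sup>2)\<bar> \<le> 2 * M * R * cmod (z - w)" by (simp add: mult_ac)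
      define \<delta> where "\<delta> = u' ((cmod z)\<^sup>2) - u' ((cmod w)\<^sup>2)"
      have "F z - F w = complex_of_real (- 2 * \<delta>) * z + complex_of_real (- 2 * u' ((cmod w)\<^sup>2)) * (z - w)"
        unfolding Feq \<delta>_def by (simp add: algebra_simps)
      also have "cmod \<dots> \<le> 2 * \<bar>\<delta>\<bar> * cmod z + 2 * \<bar>u' ((cmod w)\<^sup>2)\<bar> * cmod (z - w)"
        by (rule order_trans[OF norm_triangle_ineq]) (simp add: norm_mult abs_mult)
      also have "\<dots> \<le> 2 * (2 * M * R * cmod (z - w)) * R + 2 * M0 * cmod (z - w)"
        using 1[folded \<delta>_def] zw M(2)[OF in_R(2)] R0 M0 by (intro add_mono mult_mono mult_left_mono) auto
      finally show ?thesis by (simp add: algebra_simps power2_eq_square)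
    qed
    moreover have "0 \<le> 4 * M * R\<^sup>2 + 2 * M0" using M0 by simp
    ultimately show ?thesis by blast
  qed
  have expand: "\<bar>u ((cmod w)\<^sup>2) - u ((cmod z)\<^sup>2) + inner (F z) (w - z)\<bar> \<le> L * (cmod (w - z))\<^sup>2"
    if L: "0 \<le> L" "\<And>z w. cmod z \<le> R \<Longrightarrow> cmod w \<le> R \<Longrightarrow> cmod (F z - F w) \<le> L * cmod (z - w)"
      and zw: "cmod z \<le> R" "cmod w \<le> R" for L R z w
  proof -
    define \<gamma> where "\<gamma> s = z + complex_of_real s * (w - z)" for s
    have \<gamma>R: "cmod (\<gamma> s) \<le> R" if "s \<in> {0..1}" for s
    proof -
      have "\<gamma> s = complex_of_real (1 - s) * z + complex_of_real s * w" by (simp add: \<gamma>_def algebra_simps)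
      then have "cmod (\<gamma> s) \<le> (1 - s) * cmod z + s * cmod w"
        using that norm_triangle_ineq[of "complex_of_real (1 - s) * z" "complex_of_real s * w"]
        by (simp add: norm_mult del: of_real_diff)
      also have "\<dots> \<le> (1 - s) * R + s * R" using that zw by (intro add_mono mult_left_mono) auto
      finally show ?thesis by (simp add: algebra_simps)
    qed
    \<comment> \<open>The potential along the segment plus its linear part at \<open>z\<close>; the
      derivative is the increment of \<open>F\<close> against \<open>w - z\<close>, which the
      Lipschitz bound controls.\<close>
    let ?f = "\<lambda>s. u ((Re (\<gamma> s))\<^sup>2 + (Im (\<gamma> s))\<^sup>2) + s * inner (F z) (w - z)"
    have d: "(?f has_real_derivative inner (F z - F (\<gamma> s)) (w - z)) (at s within {0..1})" for s
    proof -
      have "((\<lambda>s. (Re (\<gamma> s))\<^sup>2 + (Im (\<gamma> s))\<^sup>2) has_real_derivative 2 * Re (\<gamma> s) * Re (w - z) + 2 * Im (\<gamma> s) * Im (w - z)) (at s within {0..1})"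
        unfolding \<gamma>_def by (auto intro!: derivative_eq_intros) (simp add: algebra_simps)
      from DERIV_chain2[OF d(1) this]
      have "(?f has_real_derivative u' ((Re (\<gamma> s))\<^sup>2 + (Im (\<gamma> s))\<^sup>2) * (2 * Re (\<gamma> s) * Re (w - z) + 2 * Im (\<gamma> s) * Im (w - z)) + 1 * inner (F z) (w - z)) (at s within {0..1})"
        by (intro DERIV_add DERIV_cmult_right DERIV_ident)
      moreover have "inner (F (\<gamma> s)) (w - z) = - (u' ((Re (\<gamma> s))\<^sup>2 + (Im (\<gamma> s))\<^sup>2) * (2 * Re (\<gamma> s) * Re (w - z) + 2 * Im (\<gamma> s) * Im (w - z)))"
        unfolding Feq by (simp add: inner_complex_def cmod_power2 algebra_simps)
      ultimately show ?thesis by (simp add: inner_diff_left add.commute)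
    qed
    have "norm (?f 1 - ?f 0) \<le> (L * (cmod (w - z))\<^sup>2) * norm (1 - 0 :: real)"
    proof (rule field_differentiable_bound[OF _ d])
      fix s :: real assume s: "s \<in> {0..1}"
      have "\<bar>inner (F z - F (\<gamma> s)) (w - z)\<bar> \<le> cmod (F z - F (\<gamma> s)) * cmod (w - z)" by (rule Cauchy_Schwarz_ineq2)
      also have "\<dots> \<le> (L * cmod (z - \<gamma> s)) * cmod (w - z)" by (intro mult_right_mono L \<gamma>R s zw) auto
      also have "cmod (z - \<gamma> s) \<le> cmod (w - z)"
        using s by (simp add: \<gamma>_def norm_mult mult_left_le_one_le)
      then have "(L * cmod (z - \<gamma> s)) * cmod (w - z) \<le> (L * cmod (w - z)) * cmod (w - z)"
        using L(1) by (intro mult_right_mono mult_left_mono) auto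
      finally show "norm (inner (F z - F (\<gamma> s)) (w - z)) \<le> L * (cmod (w - z))\<^sup>2"
        by (simp add: power2_eq_square mult.assoc)
    qed auto
    then show ?thesis by (simp add: \<gamma>_def cmod_power2 algebra_simps)
  qed
  show ?thesis
    unfolding nl_def
  proof (intro conjI allI)
    show "continuous_on UNIV (\<lambda>w. u ((cmod w)\<^sup>2))"
      by (intro continuous_on_compose2[OF cu(1)] continuous_intros) auto
    show "F 0 = 0" by (simp add: Feq)
    show "inner (F z) (\<i> * z) = 0" for z by (simp add: Feq inner_complex_def)
    show "\<exists>L\<ge>0. \<forall>z w. cmod z \<le> R \<longrightarrow> cmod w \<le> R \<longrightarrow>
         cmod (F z - F w) \<le> L * cmod (z - w) \<and> \<bar>u ((cmod w)\<^sup>2) - u ((cmod z)\<^sup>2) + inner (F z) (w - z)\<bar> \<le> L * (cmod (w - z))\<^sup>2" for R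
    proof -
      obtain L where L: "L \<ge> 0" "\<And>z w. cmod z \<le> R \<Longrightarrow> cmod w \<le> R \<Longrightarrow> cmod (F z - F w) \<le> L * cmod (z - w)"
        using lip by blast
      then show ?thesis using expand[OF L] by blast
    qed
  qed
qed

lemma nl_continuous:
  assumes "nl F U" shows "continuous_on S F"
proof -
  have "isCont F z" for z
  proof -
    obtain L where L: "L \<ge> 0" "\<And>x y. cmod x \<le> cmod z + 1 \<Longrightarrow> cmod y \<le> cmod z + 1 \<Longrightarrow> cmod (F x - F y) \<le> L * cmod (x - y)"
      using assms unfolding nl_def by metis
    have z: "((\<lambda>x. L * cmod (x - z)) \<longlongrightarrow> 0) (at z)"
      by (rule tendsto_eq_intros refl | simp)+
    have "((\<lambda>x. cmod (F x - F z)) \<longlongrightarrow> 0) (at z)"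
    proof (rule tendsto_sandwich[OF _ _ tendsto_const z])
      show "\<forall>\<^sub>F x in at z. cmod (F x - F z) \<le> L * cmod (x - z)"
        unfolding eventually_at
      proof (intro exI[of _ 1] conjI ballI impI)
        fix x assume "x \<noteq> z \<and> dist x z < 1"
        then have "cmod x \<le> cmod z + 1" using norm_triangle_sub[of x z] by (simp add: dist_norm)
        then show "cmod (F x - F z) \<le> L * cmod (x - z)" by (intro L(2)) auto
      qed simp
    qed auto
    then show ?thesis unfolding isCont_def by (rule LIM_zero_cancel[OF tendsto_norm_zero_cancel])
  qed
  then show ?thesis by (simp add: continuous_at_imp_continuous_on)
qed

section \<open>Strong differentiability and testing with functions of finite energy\<close>

lemma at_within_Ici: "0 \<le> t \<Longrightarrow> at t within {0..} = at t within {0..t + 1 :: real}"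
  by (rule at_within_nhd[of _ "{..<t + 1}"]) auto

lemma integral_has_vector_derivative_Ici:
  fixes f :: "real \<Rightarrow> 'a :: banach"
  assumes "continuous_on {0..} f" "0 \<le> t"
  shows "((\<lambda>u. integral {0..u} f) has_vector_derivative f t) (at t within {0..})"
proof -
  have "continuous_on {0..t + 1} f" by (rule continuous_on_subset[OF assms(1)]) auto
  from integral_has_vector_derivative[OF this, of t] assms(2) show ?thesis by (simp add: at_within_Ici)
qed

lemma has_vector_derivative_inner_const:
  "(f has_vector_derivative f') F \<Longrightarrow> ((\<lambda>t. inner (f t) c) has_real_derivative inner f' c) F"
  unfolding has_real_derivative_iff_has_vector_derivative
  by (rule bounded_linear.has_vector_derivative[OF bounded_linear_inner_left])

lemma zero_deriv_Ici:
  fixes f :: "real \<Rightarrow> real"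
  assumes "\<And>t. 0 \<le> t \<Longrightarrow> (f has_real_derivative 0) (at t within {0..})" "0 \<le> a" "0 \<le> b"
  shows "f a = f b"
  using has_field_derivative_zero_constant[of "{0..}" f] assms by (metis atLeast_iff convex_real_interval(1))

lemma weak_solD:
  assumes "weak_sol m N X {0..} G P D Q"
  shows "continuous_on {0..} P" "continuous_on {0..} D" "continuous_on {0..} Q"
    "J \<in> {1..N} \<Longrightarrow> continuous_on {0..} (G J)" "0 \<le> t \<Longrightarrow> wd (P t) (D t)"
    "test1 a \<Longrightarrow> test1 b \<Longrightarrow> 0 \<le> t \<Longrightarrow>
      ((\<lambda>s. inner (P s) (tc a b)) has_real_derivative inner (Q t) (tc a b)) (at t within {0..})"
    "test1 a \<Longrightarrow> test1 b \<Longrightarrow> 0 \<le> t \<Longrightarrow>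
      ((\<lambda>s. inner (Q s) (tc a b)) has_real_derivative
          (- inner (D t) (td a b) - m\<^sup>2 * inner (P t) (tc a b) + (\<Sum>J\<in>{1..N}. inner (G J t) (cpl a b (X J)))))
          (at t within {0..})"
  using assms unfolding weak_sol_def by auto

text \<open>As \<open>Q\<close> is norm continuous, its integral is differentiable in norm; it has
  the same derivative as \<open>P\<close> against every test function, hence differs from
  \<open>P\<close> by a constant vector.\<close>

lemma weak_sol_strong:
  assumes w: "weak_sol m N X {0..} G P D Q" and "0 \<le> t"
  shows "(P has_vector_derivative Q t) (at t within {0..})"
proof -
  note w = weak_solD[OF w]
  have dI: "((\<lambda>u. integral {0..u} Q) has_vector_derivative Q t) (at t within {0..})" if "0 \<le> t" for t
    by (rule integral_has_vector_derivative_Ici[OF w(3) that])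
  have eq: "P 0 + integral {0..t} Q = P t" if "0 \<le> t" for t
  proof (rule eq_if_tests)
    fix a b assume ab: "test1 a" "test1 b"
    have "inner (P t) (tc a b) - inner (integral {0..t} Q) (tc a b) = inner (P 0) (tc a b) - inner (integral {0..0} Q) (tc a b)"
    proof (rule zero_deriv_Ici[OF _ that order_refl])
      fix s :: real assume s: "0 \<le> s"
      from DERIV_diff[OF w(6)[OF ab s] has_vector_derivative_inner_const[OF dI[OF s], of "tc a b"]]
      show "((\<lambda>s. inner (P s) (tc a b) - inner (integral {0..s} Q) (tc a b)) has_real_derivative 0) (at s within {0..})"
        by simp
    qed
    then show "inner (P 0 + integral {0..t} Q) (tc a b) = inner (P t) (tc a b)" by (simp add: inner_add_left)
  qed
  have "((\<lambda>u. P 0 + integral {0..u} Q) has_vector_derivative 0 + Q t) (at t within {0..})"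
    by (intro has_vector_derivative_add has_vector_derivative_const dI assms)
  then show ?thesis
    using has_vector_derivative_transform[of t "{0..}" P "\<lambda>u. P 0 + integral {0..u} Q" "Q t"] eq assms(2) by simp
qed

text \<open>The equation integrated in time depends on \<open>\<xi>\<close> and
  \<open>\<xi>'\<close> only through bounded functionals, so it extends from test functions to all
  functions of finite energy by density. The differential form would need control of the limit of
  derivatives.\<close>

lemma weak_sol_balance:
  assumes w: "weak_sol m N X {0..} G P D Q" and "wd \<xi> \<xi>'" and ab: "0 \<le> a" "0 \<le> b"
  shows "inner (Q b - Q a) \<xi> = - inner (integral {0..b} D - integral {0..a} D) \<xi>'
     - m\<^sup>2 * inner (integral {0..b} P - integral {0..a} P) \<xi>
     + (\<Sum>J\<in>{1..N}. inner (integral {0..b} (G J) - integral {0..a} (G J)) (ev (X J) \<xi> \<xi>'))"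
proof -
  note w = weak_solD[OF w]
  have test: "inner (Q b - Q a) (tc f g) = - inner (integral {0..b} D - integral {0..a} D) (td f g)
     - m\<^sup>2 * inner (integral {0..b} P - integral {0..a} P) (tc f g)
     + (\<Sum>J\<in>{1..N}. inner (integral {0..b} (G J) - integral {0..a} (G J)) (ev (X J) (tc f g) (td f g)))"
    if fg: "test1 f" "test1 g" for f g
  proof -
    let ?K = "\<lambda>t. inner (Q t) (tc f g) - (- inner (integral {0..t} D) (td f g) - m\<^sup>2 * inner (integral {0..t} P) (tc f g)
       + (\<Sum>J\<in>{1..N}. inner (integral {0..t} (G J)) (cpl f g (X J))))"
    have "?K b = ?K a"
    proof (rule zero_deriv_Ici[OF _ ab(2,1)])
      fix t :: real assume t: "0 \<le> t"
      have "(?K has_real_derivative (- inner (D t) (td f g) - m\<^sup>2 * inner (P t) (tc f g) + (\<Sum>J\<in>{1..N}. inner (G J t) (cpl f g (X J))))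
        - (- inner (D t) (td f g) - m\<^sup>2 * inner (P t) (tc f g) + (\<Sum>J\<in>{1..N}. inner (G J t) (cpl f g (X J))))) (at t within {0..})"
        by (intro DERIV_diff DERIV_add DERIV_minus DERIV_cmult DERIV_sum w(7) fg t has_vector_derivative_inner_const
            integral_has_vector_derivative_Ici w(1,2,4))
      then show "(?K has_real_derivative 0) (at t within {0..})" by simp
    qed
    then show ?thesis
      by (simp add: ev_test fg inner_diff_left sum_subtractf algebra_simps)
  qed
  obtain f g where fg: "\<And>n. test1 (f n)" "\<And>n. test1 (g n)"
    "(\<lambda>n. tc (f n) (g n)) \<longlonglongrightarrow> \<xi>" "(\<lambda>n. td (f n) (g n)) \<longlonglongrightarrow> \<xi>'"
    using wd_approx_seq[OF assms(2)] by blast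
  have "(\<lambda>n. inner (Q b - Q a) (tc (f n) (g n))) \<longlonglongrightarrow> inner (Q b - Q a) \<xi>"
    by (intro tendsto_intros fg)
  moreover have "(\<lambda>n. - inner (integral {0..b} D - integral {0..a} D) (td (f n) (g n))
     - m\<^sup>2 * inner (integral {0..b} P - integral {0..a} P) (tc (f n) (g n))
     + (\<Sum>J\<in>{1..N}. inner (integral {0..b} (G J) - integral {0..a} (G J)) (ev (X J) (tc (f n) (g n)) (td (f n) (g n)))))
    \<longlonglongrightarrow> - inner (integral {0..b} D - integral {0..a} D) \<xi>'
     - m\<^sup>2 * inner (integral {0..b} P - integral {0..a} P) \<xi>
     + (\<Sum>J\<in>{1..N}. inner (integral {0..b} (G J) - integral {0..a} (G J)) (ev (X J) \<xi> \<xi>'))"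
    by (intro tendsto_intros tendsto_ev fg)
  ultimately show ?thesis
    using LIMSEQ_unique by (simp only: test[OF fg(1,2)])
qed

text \<open>The balance over the interval from 0 to \<open>s\<close> writes
  \<open>inner (Q s) \<xi>\<close> through time integrals of continuous functions, which can be
  differentiated again.\<close>

lemma weak_sol_deriv_H1:
  assumes w: "weak_sol m N X {0..} G P D Q" and \<xi>: "wd \<xi> \<xi>'" and t: "0 \<le> t"
  shows "((\<lambda>s. inner (Q s) \<xi>) has_real_derivative
          (- inner (D t) \<xi>' - m\<^sup>2 * inner (P t) \<xi> + (\<Sum>J\<in>{1..N}. inner (G J t) (ev (X J) \<xi> \<xi>')))) (at t within {0..})"
proof -
  note w' = weak_solD[OF w]
  let ?K = "\<lambda>s. inner (Q 0) \<xi> + (- inner (integral {0..s} D) \<xi>' - m\<^sup>2 * inner (integral {0..s} P) \<xi>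
       + (\<Sum>J\<in>{1..N}. inner (integral {0..s} (G J)) (ev (X J) \<xi> \<xi>')))"
  have "(?K has_real_derivative 0 + (- inner (D t) \<xi>' - m\<^sup>2 * inner (P t) \<xi> + (\<Sum>J\<in>{1..N}. inner (G J t) (ev (X J) \<xi> \<xi>')))) (at t within {0..})"
    by (intro DERIV_diff DERIV_add DERIV_minus DERIV_cmult DERIV_sum DERIV_const t has_vector_derivative_inner_const
            integral_has_vector_derivative_Ici w'(1,2,4))
  then have K: "(?K has_real_derivative (- inner (D t) \<xi>' - m\<^sup>2 * inner (P t) \<xi> + (\<Sum>J\<in>{1..N}. inner (G J t) (ev (X J) \<xi> \<xi>')))) (at t within {0..})"
    by simp
  have "?K s = inner (Q s) \<xi>" if "0 \<le> s" for s
    using weak_sol_balance[OF w \<xi> order_refl that] by (simp add: inner_diff_left)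
  then show ?thesis
    by (intro has_field_derivative_transform_within[OF K, of 1]) (use t in auto)
qed

lemma mulI_tc: "test1 a \<Longrightarrow> test1 b \<Longrightarrow> mulI (tc a b) = tc (\<lambda>x. - b x) a"
  by (simp add: mulI_cl L2_cpl) (simp add: cpl_def[abs_def] imaginary_unit.code complex_mult)

lemma wd_mulI:
  assumes "wd f g" shows "wd (mulI f) (mulI g)"
  unfolding wd_def
proof (intro allI impI)
  fix a b assume t: "test1 a" "test1 b"
  have "deriv (\<lambda>x. - b x) = (\<lambda>x. - deriv b x)"
    by (intro ext DERIV_imp_deriv DERIV_minus test1_has_deriv t)
  then have "td (\<lambda>x. - b x) a = mulI (td a b)" using t by (simp add: mulI_tc test1_deriv)
  moreover have "inner f (td (\<lambda>x. - b x) a) = - inner g (tc (\<lambda>x. - b x) a)"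
    using assms t unfolding wd_def by (simp add: test1_uminus)
  ultimately show "inner (mulI f) (td a b) = - inner (mulI g) (tc a b)"
    using t by (simp add: inner_mulI_left mulI_tc)
qed

lemma ev_mulI: "ev x (mulI f) (mulI g) = \<i> * ev x f g"
  by (simp add: ev_def complex_eq_iff inner_mulI_left)

section \<open>Conservation of charge and energy\<close>

text \<open>The equation for \<open>Q\<close> is tested with \<open>\<i>\<close> times
  \<open>P\<close>, a curve of finite energy. The three field terms vanish because
  \<open>mulI\<close> is antisymmetric, and each source vanishes because its force is orthogonal to
  \<open>\<i>\<close> times the trace.\<close>

theorem charge_conservation:
  assumes w: "weak_sol m N X {0..} G P D Q" and nl: "\<And>J. J \<in> {1..N} \<Longrightarrow> nl (F J) (U J)"
    and G: "\<And>J s. J \<in> {1..N} \<Longrightarrow> 0 \<le> s \<Longrightarrow> G J s = F J (ev (X J) (P s) (D s))"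
    and t: "0 \<le> t"
  shows "inner (Q t) (mulI (P t)) = inner (Q 0) (mulI (P 0))"
proof (rule zero_deriv_Ici[OF _ t order_refl])
  fix t :: real assume t: "0 \<le> t"
  note w' = weak_solD[OF w]
  have "((\<lambda>s. inner (Q s) (mulI (P s))) has_real_derivative
      (- inner (D t) (mulI (D t)) - m\<^sup>2 * inner (P t) (mulI (P t)) + (\<Sum>J\<in>{1..N}. inner (G J t) (ev (X J) (mulI (P t)) (mulI (D t)))))
      + inner (Q t) (mulI (Q t))) (at t within {0..})"
    using t w'
    by (intro weak_strong_product weak_sol_deriv_H1[OF w] wd_mulI weak_sol_strong[OF w]
        bounded_linear.has_vector_derivative[OF bounded_linear_mulI]) auto
  moreover have "inner (G J t) (ev (X J) (mulI (P t)) (mulI (D t))) = 0" if "J \<in> {1..N}" for J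
    using nl[OF that] G[OF that t] unfolding nl_def by (simp add: ev_mulI)
  moreover have "inner f (mulI f) = 0" for f using inner_mulI_self[of f] by (simp add: inner_commute)
  ultimately show "((\<lambda>s. inner (Q s) (mulI (P s))) has_real_derivative 0) (at t within {0..})" by simp
qed

lemma has_vector_derivative_shift_Ici:
  assumes "(f has_vector_derivative f') (at (t + h) within {0..})" "0 \<le> h"
  shows "((\<lambda>s. f (s + h)) has_vector_derivative f') (at t within {0..})"
proof -
  have "((\<lambda>s. s + h) has_vector_derivative 1) (at t within {0..})"
    by (auto intro!: derivative_eq_intros)
  moreover have "(f has_vector_derivative f') (at (t + h) within (\<lambda>s. s + h) ` {0..})"
    by (rule has_vector_derivative_within_subset[OF assms(1)]) (use assms(2) in auto)
  ultimately show ?thesis using vector_diff_chain_within[of "\<lambda>s. s + h" 1 t "{0..}" f f'] by (simp add: o_def)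
qed

definition energy :: "real \<Rightarrow> l2 \<Rightarrow> l2 \<Rightarrow> l2 \<Rightarrow> real" where
  "energy m p d q = ((norm q)\<^sup>2 + (norm d)\<^sup>2 + m\<^sup>2 * (norm p)\<^sup>2) / 2"

text \<open>The energy \<open>e h\<close> of the Steklov averages over \<open>[t, t + h]\<close> (multiplied by \<open>h\<^sup>2\<close>) is
  differentiable in time, although the energy of the solution itself is not known to be.\<close>

lemma averaged_energy_deriv:
  assumes w: "weak_sol m N X {0..} G P D Q" and h: "0 < h" and t: "0 \<le> t"
  defines "e \<equiv> (\<lambda>t. energy m (integral {0..t + h} P - integral {0..t} P) (integral {0..t + h} D - integral {0..t} D) (P (t + h) - P t))"
    and "y \<equiv> (\<lambda>J t. ev (X J) (P t) (D t))"
  shows "(e has_real_derivative (\<Sum>J\<in>{1..N}. inner (integral {0..t + h} (G J) - integral {0..t} (G J)) (y J (t + h) - y J t)))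
    (at t within {0..})"
proof -
  note w' = weak_solD[OF w]
  have sq: "((\<lambda>s. (norm (f s))\<^sup>2) has_real_derivative 2 * inner f' (f t)) (at t within {0..})"
    if "(f has_vector_derivative f') (at t within {0..})" for f :: "real \<Rightarrow> l2" and f'
  proof -
    have "((\<lambda>s. inner (f s) (f s)) has_vector_derivative inner (f t) f' + inner f' (f t)) (at t within {0..})"
      by (rule bounded_bilinear.has_vector_derivative[OF bounded_bilinear_inner that that])
    then show ?thesis
      by (simp add: power2_norm_eq_inner has_real_derivative_iff_has_vector_derivative inner_commute)
  qed
  have th: "0 \<le> t + h" using t h by simp
  have dd: "((\<lambda>s. f (s + h) - f s) has_vector_derivative f' (t + h) - f' t) (at t within {0..})"
    if "\<And>t. 0 \<le> t \<Longrightarrow> (f has_vector_derivative f' t) (at t within {0..})" for f f' :: "real \<Rightarrow> l2"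
    by (intro has_vector_derivative_diff has_vector_derivative_shift_Ici that t th) (use h in simp)
  let ?ip = "integral {0..t + h} P - integral {0..t} P" and ?id = "integral {0..t + h} D - integral {0..t} D"
  let ?p = "P (t + h) - P t" and ?d = "D (t + h) - D t" and ?q = "Q (t + h) - Q t"
  have "(e has_real_derivative (2 * inner ?q ?p + 2 * inner ?d ?id + m\<^sup>2 * (2 * inner ?p ?ip)) / 2) (at t within {0..})"
    unfolding e_def energy_def
    by (intro DERIV_cdivide DERIV_add DERIV_cmult sq dd[of P Q] weak_sol_strong[OF w]
        dd[of "\<lambda>t. integral {0..t} P" P] dd[of "\<lambda>t. integral {0..t} D" D] integral_has_vector_derivative_Ici w'(1,2))
  \<comment> \<open>The balance over \<open>[t, t + h]\<close> is tested with the increment of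
    \<open>P\<close>, whose space derivative is the increment of \<open>D\<close>. Its field terms
    cancel the last two terms of the derivative of \<open>e\<close>, and only the sources
    remain.\<close>
  moreover have "inner ?q ?p = - inner ?id ?d - m\<^sup>2 * inner ?ip ?p
     + (\<Sum>J\<in>{1..N}. inner (integral {0..t + h} (G J) - integral {0..t} (G J)) (ev (X J) ?p ?d))"
    by (intro weak_sol_balance[OF w] wd_diff w'(5) t th)
  ultimately show ?thesis by (simp add: y_def ev_diff inner_commute)
qed


lemma inverse_Suc_at_within:
  "0 \<le> t \<Longrightarrow> filterlim (\<lambda>n. t + 1 / real (Suc n)) (at t within {0..}) sequentially"
  unfolding filterlim_at
proof
  assume "0 \<le> t"
  show "\<forall>\<^sub>F n in sequentially. t + 1 / real (Suc n) \<in> {0..} \<and> t + 1 / real (Suc n) \<noteq> t"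
    using \<open>0 \<le> t\<close> by (intro always_eventually allI) (auto intro: add_nonneg_nonneg)
  have "(\<lambda>n. t + inverse (real (Suc n))) \<longlonglongrightarrow> t + 0"
    by (intro tendsto_add tendsto_const LIMSEQ_inverse_real_of_nat)
  then show "(\<lambda>n. t + 1 / real (Suc n)) \<longlonglongrightarrow> t" by (simp add: inverse_eq_divide)
qed

lemma forward_quotient_tendsto:
  fixes f :: "real \<Rightarrow> 'a :: real_normed_vector"
  assumes "(f has_vector_derivative f') (at t within {0..})" "0 \<le> t"
  shows "(\<lambda>n. real (Suc n) *\<^sub>R (f (t + 1 / real (Suc n)) - f t)) \<longlonglongrightarrow> f'"
proof -
  have "((\<lambda>s. (f s - f t) /\<^sub>R (s - t)) \<longlongrightarrow> f') (at t within {0..})"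
    using assms(1) by (simp add: has_vector_derivative_quotient)
  from filterlim_compose[OF this inverse_Suc_at_within[OF assms(2)]] show ?thesis by simp
qed

text \<open>The averaged energy is compared with the averaged potential. By the embedding
  \<open>\<bar>f\<bar>\<^sup>2 \<le> \<parallel>f\<parallel> \<parallel>f'\<parallel>\<close>, the traces \<open>y\<close> satisfy \<open>\<bar>y (t + h) - y t\<bar>\<^sup>2 = o(h)\<close> uniformly,
  since \<open>P\<close> is Lipschitz and \<open>D\<close> is uniformly continuous; this is just enough to
  control the quadratic error of the first order expansion of \<open>U\<close> after division by \<open>h\<close>.\<close>

theorem energy_conservation:
  assumes w: "weak_sol m N X {0..} G P D Q" and nl: "\<And>J. J \<in> {1..N} \<Longrightarrow> nl (F J) (U J)"
    and G: "\<And>J s. J \<in> {1..N} \<Longrightarrow> 0 \<le> s \<Longrightarrow> s < c \<Longrightarrow> G J s = F J (ev (X J) (P s) (D s))"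
    and b: "0 \<le> b" "b < c"
  shows "energy m (P b) (D b) (Q b) + (\<Sum>J\<in>{1..N}. U J (ev (X J) (P b) (D b)))
    = energy m (P 0) (D 0) (Q 0) + (\<Sum>J\<in>{1..N}. U J (ev (X J) (P 0) (D 0)))"
proof -
  note w' = weak_solD[OF w]
  define y where "y J t = ev (X J) (P t) (D t)" for J t
  have cy: "continuous_on {0..} (y J)" for J unfolding y_def by (intro continuous_intros w'(1,2))
  \<comment> \<open>A compact interval strictly below \<open>c\<close>, with room for the averaging
    window to the right of \<open>b\<close>, on which the sources are still given by
    \<open>F\<close>.\<close>
  define c' where "c' = (b + c) / 2"
  have c': "b < c'" "c' < c" "0 \<le> c'" using b by (auto simp: c'_def)
  have sub: "{0..c'} \<subseteq> {0..}" by auto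
  have bnd: "\<exists>B>0. \<forall>t\<in>{0..c'}. norm (f t) \<le> B" if "continuous_on {0..} f" for f :: "real \<Rightarrow> 'a :: real_normed_vector"
  proof -
    have "compact (f ` {0..c'})" by (rule compact_continuous_image[OF continuous_on_subset[OF that sub]]) simp
    from compact_imp_bounded[OF this] obtain B where B: "\<forall>x\<in>f ` {0..c'}. norm x \<le> B" unfolding bounded_iff by blast
    have "norm (f t) \<le> \<bar>B\<bar> + 1" if "t \<in> {0..c'}" for t using bspec[OF B imageI[OF that]] by linarith
    then show ?thesis by (intro exI[of _ "\<bar>B\<bar> + 1"]) auto
  qed
  obtain BQ where BQ: "BQ > 0" "\<And>t. t \<in> {0..c'} \<Longrightarrow> norm (Q t) \<le> BQ" using bnd[OF w'(3)] by blast
  have "\<exists>B. \<forall>J t. t \<in> {0..c'} \<longrightarrow> cmod (y J t) \<le> B"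
  proof -
    obtain B1 where B1: "B1 > 0" "\<And>t. t \<in> {0..c'} \<Longrightarrow> norm (P t) \<le> B1" using bnd[OF w'(1)] by blast
    obtain B2 where B2: "B2 > 0" "\<And>t. t \<in> {0..c'} \<Longrightarrow> norm (D t) \<le> B2" using bnd[OF w'(2)] by blast
    have "cmod (y J t) \<le> 2 * (B1 + B2)" if "t \<in> {0..c'}" for J t
      using ev_bound[of "X J" "P t" "D t"] B1(2)[OF that] B2(2)[OF that] by (simp add: y_def)
    then show ?thesis by blast
  qed
  then obtain R where R: "\<And>J t. t \<in> {0..c'} \<Longrightarrow> cmod (y J t) \<le> R" by blast
  have "\<exists>L. \<forall>J\<in>{1..N}. L J \<ge> 0 \<and> (\<forall>z w. cmod z \<le> R \<longrightarrow> cmod w \<le> R \<longrightarrow>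
         cmod (F J z - F J w) \<le> L J * cmod (z - w) \<and> \<bar>U J w - U J z + inner (F J z) (w - z)\<bar> \<le> L J * (cmod (w - z))\<^sup>2)"
    by (rule bchoice) (use nl in \<open>unfold nl_def, blast\<close>)
  then obtain L where L0: "\<And>J. J \<in> {1..N} \<Longrightarrow> L J \<ge> 0"
    and L: "\<And>J z w. J \<in> {1..N} \<Longrightarrow> cmod z \<le> R \<Longrightarrow> cmod w \<le> R \<Longrightarrow> cmod (F J z - F J w) \<le> L J * cmod (z - w)"
      "\<And>J z w. J \<in> {1..N} \<Longrightarrow> cmod z \<le> R \<Longrightarrow> cmod w \<le> R \<Longrightarrow> \<bar>U J w - U J z + inner (F J z) (w - z)\<bar> \<le> L J * (cmod (w - z))\<^sup>2"
    by blast
  have cU: "continuous_on {0..} (\<lambda>t. U J (y J t))" if "J \<in> {1..N}" for J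
    using nl[OF that] unfolding nl_def by (auto intro: continuous_on_compose2[OF _ cy])
  have Lip: "norm (P s - P t) \<le> BQ * \<bar>s - t\<bar>" if "s \<in> {0..c'}" "t \<in> {0..c'}" for s t
  proof -
    have "norm (P s - P t) \<le> BQ * norm (s - t)"
    proof (rule differentiable_bound[of "{0..c'}" P "\<lambda>t h. h *\<^sub>R Q t"])
      show "(P has_derivative (\<lambda>h. h *\<^sub>R Q x)) (at x within {0..c'})" if "x \<in> {0..c'}" for x
        using has_vector_derivative_within_subset[OF weak_sol_strong[OF w, of x] sub] that
        by (simp add: has_vector_derivative_def)
      show "onorm (\<lambda>h. h *\<^sub>R Q x) \<le> BQ" if "x \<in> {0..c'}" for x
        using BQ(2)[OF that] by (simp add: onorm_scaleR_left[OF bounded_linear_ident] onorm_id)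
    qed (use that in auto)
    then show ?thesis by simp
  qed
  define e where "e h t = energy m (integral {0..t + h} P - integral {0..t} P)
      (integral {0..t + h} D - integral {0..t} D) (P (t + h) - P t)" for h t
  define V where "V J t = integral {0..t} (\<lambda>s. U J (y J s))" for J t
  \<comment> \<open>The averaged energy, normalised by \<open>h\<^sup>2\<close>, plus the mean of
    the potential over \<open>[t, t + h]\<close>; it converges to the true Hamiltonian as
    \<open>h\<close> tends to 0.\<close>
  define \<Phi> where "\<Phi> h t = e h t / h\<^sup>2 + (\<Sum>J\<in>{1..N}. (V J (t + h) - V J t) / h)" for h t
  have dV: "(V J has_vector_derivative U J (y J t)) (at t within {0..})" if "J \<in> {1..N}" "0 \<le> t" for J t
    unfolding V_def by (rule integral_has_vector_derivative_Ici[OF cU[OF that(1)] that(2)])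
  define H where "H t = energy m (P t) (D t) (Q t) + (\<Sum>J\<in>{1..N}. U J (y J t))" for t
  have lim: "(\<lambda>n. \<Phi> (1 / real (Suc n)) t) \<longlonglongrightarrow> H t" if t: "0 \<le> t" for t
  proof -
    have "(\<lambda>n. energy m (real (Suc n) *\<^sub>R (integral {0..t + 1 / real (Suc n)} P - integral {0..t} P))
        (real (Suc n) *\<^sub>R (integral {0..t + 1 / real (Suc n)} D - integral {0..t} D))
        (real (Suc n) *\<^sub>R (P (t + 1 / real (Suc n)) - P t))
        + (\<Sum>J\<in>{1..N}. real (Suc n) *\<^sub>R (V J (t + 1 / real (Suc n)) - V J t))) \<longlonglongrightarrow> H t"
      unfolding H_def energy_def
      by (intro tendsto_intros forward_quotient_tendsto weak_sol_strong[OF w] integral_has_vector_derivative_Ici w'(1,2) dV t) auto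
    moreover have "energy m (k *\<^sub>R p) (k *\<^sub>R d) (k *\<^sub>R q) = energy m p d q * k\<^sup>2" for k p d q
      by (simp add: energy_def power_mult_distrib algebra_simps)
    ultimately show ?thesis
      unfolding \<Phi>_def e_def by (simp add: power_inverse divide_inverse mult.commute)
  qed
  have close: "\<bar>H b - H 0\<bar> \<le> \<epsilon>" if \<epsilon>: "\<epsilon> > 0" for \<epsilon>
  proof -
    define \<Lambda> where "\<Lambda> = (\<Sum>J\<in>{1..N}. 2 * L J)"
    have \<Lambda>: "\<Lambda> \<ge> 0" unfolding \<Lambda>_def by (intro sum_nonneg) (use L0 in auto)
    \<comment> \<open>The modulus of continuity demanded of \<open>D\<close>, chosen so that the
      total variation of \<open>\<Phi> h\<close> over \<open>[0, b]\<close> stays below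
      \<open>\<epsilon>\<close>.\<close>
    define \<eta> where "\<eta> = \<epsilon> / ((\<Lambda> + 1) * BQ * (b + 1))"
    have \<eta>: "\<eta> > 0" unfolding \<eta>_def using \<epsilon> \<Lambda> BQ b by (intro divide_pos_pos mult_pos_pos) auto
    have "uniformly_continuous_on {0..c'} D"
      by (rule compact_uniformly_continuous[OF continuous_on_subset[OF w'(2) sub]]) simp
    then obtain \<delta> where \<delta>: "\<delta> > 0" "\<And>s t. s \<in> {0..c'} \<Longrightarrow> t \<in> {0..c'} \<Longrightarrow> \<bar>s - t\<bar> < \<delta> \<Longrightarrow> norm (D s - D t) < \<eta>"
      using \<eta> unfolding uniformly_continuous_on_def by (metis dist_norm real_norm_def)
    have step: "\<bar>\<Phi> h b - \<Phi> h 0\<bar> \<le> \<epsilon>" if h: "0 < h" "h < \<delta>" "h < c' - b" for h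
    proof -
      have osc: "(cmod (y J s - y J t))\<^sup>2 \<le> BQ * h * \<eta>" if "s \<in> {0..c'}" "t \<in> {0..c'}" "\<bar>s - t\<bar> \<le> h" for J s t
      proof -
        have "(cmod (y J s - y J t))\<^sup>2 = (cmod (ev (X J) (P s - P t) (D s - D t)))\<^sup>2" by (simp add: y_def ev_diff)
        also have "\<dots> \<le> norm (P s - P t) * norm (D s - D t)" by (intro ev_sup wd_diff w'(5)) (use that in auto)
        also have "\<dots> \<le> (BQ * \<bar>s - t\<bar>) * \<eta>"
          using \<delta>(2)[OF that(1,2)] that h BQ by (intro mult_mono Lip) auto
        also have "\<dots> \<le> (BQ * h) * \<eta>" using that BQ \<eta> by (intro mult_right_mono mult_left_mono) auto
        finally show ?thesis .
      qed
      \<comment> \<open>The decisive cancellation: the impulse of the force against the increment of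
        the trace is, to leading order, minus \<open>h\<close> times the increment of the potential.
        Freezing the force at time \<open>t\<close> and expanding the potential to first order each
        cost \<open>L J * (BQ * h * \<eta>)\<close> per unit of time.\<close>
      have local: "\<bar>inner (integral {0..t + h} (G J) - integral {0..t} (G J)) (y J (t + h) - y J t)
          + h * (U J (y J (t + h)) - U J (y J t))\<bar> \<le> 2 * L J * (BQ * h * \<eta>) * h"
        if J: "J \<in> {1..N}" and t: "t \<in> {0..b}" for J t
      proof -
        let ?\<Delta> = "y J (t + h) - y J t" and ?u = "U J (y J (t + h)) - U J (y J t)"
        let ?g = "\<lambda>s. inner (integral {0..s} (G J)) ?\<Delta> + s * ?u"
        have "norm (?g (t + h) - ?g t) \<le> (2 * L J * (BQ * h * \<eta>)) * norm ((t + h) - t)"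
        proof (rule field_differentiable_bound[of "{t..t + h}" ?g "\<lambda>s. inner (G J s) ?\<Delta> + 1 * ?u"])
          fix s assume s: "s \<in> {t..t + h}"
          then have sc: "s \<in> {0..c'}" "t \<in> {0..c'}" "t + h \<in> {0..c'}" "\<bar>s - t\<bar> \<le> h" using t h c' by auto
          have "(?g has_real_derivative inner (G J s) ?\<Delta> + 1 * ?u) (at s within {0..})"
            by (intro DERIV_add has_vector_derivative_inner_const integral_has_vector_derivative_Ici w'(4) J
                DERIV_cmult_right DERIV_ident) (use sc in auto)
          then show "(?g has_real_derivative inner (G J s) ?\<Delta> + 1 * ?u) (at s within {t..t + h})"
            by (rule has_field_derivative_subset) (use t in auto)
          have Gs: "G J s = F J (y J s)" unfolding y_def using sc c' by (intro G J) auto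
          let ?A = "inner (F J (y J s) - F J (y J t)) ?\<Delta>" and ?B = "?u + inner (F J (y J t)) ?\<Delta>"
          let ?\<omega> = "sqrt (BQ * h * \<eta>)"
          have eq: "inner (G J s) ?\<Delta> + 1 * ?u = ?A + ?B" by (simp add: Gs inner_diff_left)
          have \<omega>: "cmod (y J s - y J t) \<le> ?\<omega>" "cmod ?\<Delta> \<le> ?\<omega>"
            by (rule real_le_rsqrt[OF osc], use sc h in auto)+
          have "\<bar>?A\<bar> \<le> cmod (F J (y J s) - F J (y J t)) * cmod ?\<Delta>"
            by (rule Cauchy_Schwarz_ineq2)
          also have "\<dots> \<le> (L J * cmod (y J s - y J t)) * cmod ?\<Delta>"
            by (intro mult_right_mono L(1) J R sc) auto
          also have "\<dots> \<le> (L J * ?\<omega>) * ?\<omega>"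
            using \<omega> L0[OF J] BQ h \<eta> by (intro mult_mono mult_left_mono mult_nonneg_nonneg) auto
          also have "\<dots> = L J * (BQ * h * \<eta>)" using BQ h \<eta> by (simp add: mult.assoc)
          finally have A: "\<bar>?A\<bar> \<le> L J * (BQ * h * \<eta>)" .
          have "\<bar>?B\<bar> \<le> L J * (cmod ?\<Delta>)\<^sup>2"
            by (intro L(2) J R sc)
          also have "\<dots> \<le> L J * (BQ * h * \<eta>)"
            using sc h L0[OF J] by (intro mult_left_mono osc) auto
          finally have B: "\<bar>?B\<bar> \<le> L J * (BQ * h * \<eta>)" .
          show "norm (inner (G J s) ?\<Delta> + 1 * ?u) \<le> 2 * L J * (BQ * h * \<eta>)"
            unfolding eq using A B abs_triangle_ineq[of ?A ?B] by simp
        qed (use h in auto)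
        then show ?thesis using h by (simp add: inner_diff_left algebra_simps)
      qed
      let ?\<Phi>' = "\<lambda>t. (\<Sum>J\<in>{1..N}. inner (integral {0..t + h} (G J) - integral {0..t} (G J)) (y J (t + h) - y J t)) / h\<^sup>2
          + (\<Sum>J\<in>{1..N}. (U J (y J (t + h)) - U J (y J t)) / h)"
      have "norm (\<Phi> h b - \<Phi> h 0) \<le> (\<Lambda> * BQ * \<eta>) * norm (b - 0)"
      proof (rule field_differentiable_bound[of "{0..b}" "\<Phi> h" ?\<Phi>'])
        fix t assume t: "t \<in> {0..b}"
        then have t0: "0 \<le> t" by simp
        have "((\<lambda>s. V J (s + h) - V J s) has_real_derivative U J (y J (t + h)) - U J (y J t)) (at t within {0..})" if "J \<in> {1..N}" for J
          unfolding has_real_derivative_iff_has_vector_derivative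
          by (intro has_vector_derivative_diff has_vector_derivative_shift_Ici dV that t0) (use t0 h in auto)
        moreover have "(e h has_real_derivative (\<Sum>J\<in>{1..N}. inner (integral {0..t + h} (G J) - integral {0..t} (G J)) (y J (t + h) - y J t))) (at t within {0..})"
          unfolding e_def y_def by (rule averaged_energy_deriv[OF w h(1) t0])
        ultimately have "(\<Phi> h has_real_derivative ?\<Phi>' t) (at t within {0..})"
          unfolding \<Phi>_def by (intro DERIV_add DERIV_sum DERIV_cdivide)
        then show "(\<Phi> h has_real_derivative ?\<Phi>' t) (at t within {0..b})"
          by (rule has_field_derivative_subset) auto
        let ?S = "\<Sum>J\<in>{1..N}. inner (integral {0..t + h} (G J) - integral {0..t} (G J)) (y J (t + h) - y J t)
            + h * (U J (y J (t + h)) - U J (y J t))"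
        have eq: "?\<Phi>' t = ?S / h\<^sup>2"
          using h by (simp add: sum.distrib add_divide_distrib sum_divide_distrib power2_eq_square flip: sum_distrib_left)
        have S1: "\<bar>?S\<bar> \<le> (\<Sum>J\<in>{1..N}. 2 * L J * (BQ * h * \<eta>) * h)"
          by (rule order_trans[OF sum_abs sum_mono[OF local]]) (use t in auto)
        have S2: "(\<Sum>J\<in>{1..N}. 2 * L J * (BQ * h * \<eta>) * h) = (\<Lambda> * BQ * \<eta>) * h\<^sup>2"
          unfolding \<Lambda>_def sum_distrib_right by (simp add: power2_eq_square mult_ac)
        have le: "\<bar>?S\<bar> \<le> (\<Lambda> * BQ * \<eta>) * h\<^sup>2" by (rule ord_le_eq_trans[OF S1 S2])
        show "norm (?\<Phi>' t) \<le> \<Lambda> * BQ * \<eta>"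
          unfolding eq using le h by (simp add: divide_le_eq)
      qed (use b in auto)
      also have "\<dots> \<le> ((\<Lambda> + 1) * BQ * (b + 1)) * \<eta>"
      proof -
        have "(\<Lambda> * (BQ * \<eta>)) * b \<le> ((\<Lambda> + 1) * (BQ * \<eta>)) * (b + 1)"
          using \<Lambda> BQ \<eta> b by (intro mult_mono) auto
        then show ?thesis using b by (simp add: mult_ac)
      qed
      also have "\<dots> = \<epsilon>"
      proof -
        have "(\<Lambda> + 1) * BQ * (b + 1) \<noteq> 0" using \<Lambda> BQ b by auto
        then show ?thesis by (simp add: \<eta>_def)
      qed
      finally show ?thesis by simp
    qed
    have "(\<lambda>n. \<bar>\<Phi> (1 / real (Suc n)) b - \<Phi> (1 / real (Suc n)) 0\<bar>) \<longlonglongrightarrow> \<bar>H b - H 0\<bar>"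
      by (intro tendsto_intros lim b order_refl)
    moreover have "\<forall>\<^sub>F n in sequentially. 1 / real (Suc n) < min \<delta> (c' - b)"
    proof -
      have "(\<lambda>n. 1 / real (Suc n)) \<longlonglongrightarrow> 0" using LIMSEQ_inverse_real_of_nat by (simp add: inverse_eq_divide)
      then show ?thesis by (rule order_tendstoD) (use \<delta> c' in auto)
    qed
    then have "\<forall>\<^sub>F n in sequentially. \<bar>\<Phi> (1 / real (Suc n)) b - \<Phi> (1 / real (Suc n)) 0\<bar> \<le> \<epsilon>"
      by eventually_elim (rule step, auto)
    ultimately show ?thesis by (intro tendsto_upperbound) auto
  qed
  have "\<bar>H b - H 0\<bar> \<le> 0" by (rule field_le_epsilon) (use close in simp)
  then show ?thesis by (simp add: H_def y_def)
qed

section \<open>Duhamel's formula along characteristics\<close>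

text \<open>In the frame moving with velocity \<open>k = 1\<close> or \<open>k = -1\<close>, a point source at \<open>X\<close> of strength
  \<open>g\<close> switched on during \<open>(0, t)\<close> has accumulated the following function of the
  characteristic coordinate \<open>c\<close>, which is met by the source at time \<open>k * (X - c)\<close>.\<close>

definition src :: "real \<Rightarrow> real \<Rightarrow> (real \<Rightarrow> complex) \<Rightarrow> real \<Rightarrow> l2" where
  "src k X g t = cl (\<lambda>c. indicator {0<..<t} (k * (X - c)) * g (k * (X - c)))"

lemma src_measurable:
  fixes g :: "real \<Rightarrow> complex"
  assumes "continuous_on {0..} g" "0 \<le> t"
  shows "(\<lambda>s. indicator {t<..<u} s * g s) \<in> borel_measurable borel"
proof -
  have "(\<lambda>s. indicator {t<..<u} s *\<^sub>R g s) \<in> borel_measurable borel"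
    by (rule borel_measurable_continuous_on_indicator)
       (use assms in \<open>auto intro: continuous_on_subset\<close>)
  moreover have "indicator {t<..<u} s *\<^sub>R g s = indicator {t<..<u} s * g s" for s by (simp add: indicator_def)
  ultimately show ?thesis by simp
qed

lemma src_interval:
  assumes g: "continuous_on {0..} g" and k: "k \<in> {1, -1::real}" and t: "0 \<le> t" "t \<le> u"
    and B: "\<And>s. t \<le> s \<Longrightarrow> s \<le> u \<Longrightarrow> cmod (g s) \<le> B"
  shows "L2 (\<lambda>c. indicator {t<..<u} (k * (X - c)) * g (k * (X - c)))"
    "norm (cl (\<lambda>c. indicator {t<..<u} (k * (X - c)) * g (k * (X - c)))) \<le> B * sqrt (u - t)"
proof -
  let ?f = "\<lambda>c. indicator {t<..<u} (k * (X - c)) * g (k * (X - c))"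
  have m: "?f \<in> borel_measurable lborel"
    using measurable_compose[OF _ src_measurable[OF g t(1), of u], of "\<lambda>c. k * (X - c)" lborel] by simp
  have B0: "0 \<le> B" using B[of t] t norm_ge_zero[of "g t"] by (meson order_refl order_trans)
  have b: "cmod (?f c) \<le> B" for c
    using B[of "k * (X - c)"] B0 by (auto simp: indicator_def norm_mult)
  consider "k = 1" | "k = -1" using k by blast
  then have "L2 ?f \<and> norm (cl ?f) \<le> B * sqrt (u - t)"
  proof cases
    case 1
    have z: "?f c = 0" if "c < X - u \<or> X - t < c" for c
    proof -
      have "k * (X - c) \<notin> {t<..<u}" using that 1 by auto
      then show ?thesis by simp
    qed
    have "X - u \<le> X - t" using t by simp
    from L2_bounded_support[OF m b z this] show ?thesis by simp
  next
    case 2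
    have z: "?f c = 0" if "c < X + t \<or> X + u < c" for c
    proof -
      have "k * (X - c) \<notin> {t<..<u}" using that 2 by auto
      then show ?thesis by simp
    qed
    have "X + t \<le> X + u" using t by simp
    from L2_bounded_support[OF m b z this] show ?thesis by simp
  qed
  then show "L2 ?f" "norm (cl ?f) \<le> B * sqrt (u - t)" by auto
qed

lemma continuous_bounded_on:
  fixes g :: "real \<Rightarrow> 'a :: real_normed_vector"
  assumes "continuous_on {0..} g"
  obtains B where "B > 0" "\<And>s. 0 \<le> s \<Longrightarrow> s \<le> T \<Longrightarrow> norm (g s) \<le> B"
proof -
  have "compact (g ` {0..T})" by (rule compact_continuous_image[OF continuous_on_subset[OF assms]]) auto
  from compact_imp_bounded[OF this] obtain B where B: "\<forall>x\<in>g ` {0..T}. norm x \<le> B" unfolding bounded_iff by blast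
  have "norm (g s) \<le> \<bar>B\<bar> + 1" if "0 \<le> s" "s \<le> T" for s
  proof -
    have "g s \<in> g ` {0..T}" using that by auto
    from bspec[OF B this] show ?thesis by linarith
  qed
  then show ?thesis using that[of "\<bar>B\<bar> + 1"] by auto
qed

lemma L2_src:
  assumes "continuous_on {0..} g" "k \<in> {1, -1::real}" "0 \<le> t"
  shows "L2 (\<lambda>c. indicator {0<..<t} (k * (X - c)) * g (k * (X - c)))"
proof -
  obtain B where "\<And>s. 0 \<le> s \<Longrightarrow> s \<le> t \<Longrightarrow> cmod (g s) \<le> B" using continuous_bounded_on[OF assms(1)] by blast
  from src_interval(1)[OF assms(1,2) order_refl assms(3) this] show ?thesis .
qed

lemma src_diff:
  assumes "continuous_on {0..} g" "continuous_on {0..} h" "k \<in> {1, -1::real}" "0 \<le> t"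
  shows "src k X g t - src k X h t = src k X (\<lambda>s. g s - h s) t"
  unfolding src_def cl_diff[OF L2_src[OF assms(1,3,4)] L2_src[OF assms(2,3,4)]]
  by (rule arg_cong[where f=cl]) (auto simp: indicator_def)

lemma src_0: "src k X g 0 = 0"
  by (simp add: src_def cl_zero)

lemma src_zero_fun: "src k X (\<lambda>s. 0) t = 0"
  by (simp add: src_def cl_zero)

text \<open>Emission during \<open>[t, u]\<close> occupies an interval of length
  \<open>u - t\<close> on the characteristic axis and is bounded there, so the norm of the increment
  is at most of order \<open>sqrt (u - t)\<close>.\<close>

lemma src_continuous:
  assumes g: "continuous_on {0..} g" and k: "k \<in> {1, -1::real}"
  shows "continuous_on {0..} (src k X g)"
proof (rule continuous_on_subset)
  have est: "norm (src k X g u - src k X g t) \<le> B * sqrt (u - t)"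
    if B: "B > 0" "\<And>s. 0 \<le> s \<Longrightarrow> s \<le> T \<Longrightarrow> norm (g s) \<le> B" and tu: "0 \<le> t" "t \<le> u" "u \<le> T" for t u T B
  proof -
    have "src k X g u - src k X g t = cl (\<lambda>c. indicator {t<..<u} (k * (X - c)) * g (k * (X - c)))"
    proof -
      have eq: "src k X g u - src k X g t
          = cl (\<lambda>c. indicator {0<..<u} (k * (X - c)) * g (k * (X - c)) - indicator {0<..<t} (k * (X - c)) * g (k * (X - c)))"
        unfolding src_def using g k tu by (simp add: cl_diff L2_src)
      also have "\<dots> = cl (\<lambda>c. indicator {t<..<u} (k * (X - c)) * g (k * (X - c)))"
      proof (subst cl_eq_iff)
        show "L2 (\<lambda>c. indicator {0<..<u} (k * (X - c)) * g (k * (X - c)) - indicator {0<..<t} (k * (X - c)) * g (k * (X - c)))"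
          using g k tu by (intro L2_diff L2_src) auto
        show "L2 (\<lambda>c. indicator {t<..<u} (k * (X - c)) * g (k * (X - c)))"
          by (rule src_interval(1)[OF g k tu(1,2), of B]) (use B tu in auto)
        \<comment> \<open>The two sides differ at most where \<open>k * (X - c) = t\<close>, which
          is a single point \<open>c\<close>.\<close>
        show "AE c in lborel. indicator {0<..<u} (k * (X - c)) * g (k * (X - c)) - indicator {0<..<t} (k * (X - c)) * g (k * (X - c))
            = indicator {t<..<u} (k * (X - c)) * g (k * (X - c))"
          using AE_lborel_singleton[of "X - k * t"]
        proof eventually_elim
          case (elim c)
          have "k * (X - c) \<noteq> t" using elim k by auto
          then show ?case using tu by (auto simp: indicator_def)
        qed
      qed
      finally show ?thesis .
    qed
    also have "norm \<dots> \<le> B * sqrt (u - t)"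
      by (rule src_interval(2)[OF g k tu(1,2)]) (use B tu in auto)
    finally show ?thesis .
  qed
  show "continuous_on {0..} (src k X g)"
    unfolding continuous_on_def
  proof
    fix t :: real assume t: "t \<in> {0..}"
    obtain B where B: "B > 0" "\<And>s. 0 \<le> s \<Longrightarrow> s \<le> t + 1 \<Longrightarrow> norm (g s) \<le> B" using continuous_bounded_on[OF g] by blast
    have "((\<lambda>u. B * sqrt \<bar>u - t\<bar>) \<longlongrightarrow> B * sqrt \<bar>t - t\<bar>) (at t within {0..})" by (intro tendsto_intros)
    then have z: "((\<lambda>u. B * sqrt \<bar>u - t\<bar>) \<longlongrightarrow> 0) (at t within {0..})" by simp
    have "((\<lambda>u. norm (src k X g u - src k X g t)) \<longlongrightarrow> 0) (at t within {0..})"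
    proof (rule tendsto_sandwich[OF _ _ tendsto_const z])
      show "\<forall>\<^sub>F u in at t within {0..}. norm (src k X g u - src k X g t) \<le> B * sqrt \<bar>u - t\<bar>"
        unfolding eventually_at
      proof (intro exI[of _ 1] conjI ballI impI)
        fix u assume u: "u \<in> {0..}" "u \<noteq> t \<and> dist u t < 1"
        then have "u \<le> t + 1" by (auto simp: dist_real_def)
        then show "norm (src k X g u - src k X g t) \<le> B * sqrt \<bar>u - t\<bar>"
          using est[OF B, where t=t and u=u] est[OF B, where t=u and u=t] u t by (cases "t \<le> u") (auto simp: norm_minus_commute)
      qed simp
    qed auto
    then show "(src k X g \<longlongrightarrow> src k X g t) (at t within {0..})" by (rule LIM_zero_cancel[OF tendsto_norm_zero_cancel])
  qed
qed simp

text \<open>Changing variables from the characteristic coordinate back to time makes the squared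
  norm the integral of the squared modulus of \<open>g\<close> over \<open>(0, t)\<close>. The
  square root of an integrated exponential leaves \<open>1 / sqrt (2 * \<mu>)\<close>, still small
  for large \<open>\<mu>\<close>.\<close>

lemma src_exp_bound:
  assumes g: "continuous_on {0..} g" and k: "k \<in> {1, -1::real}" and t: "0 \<le> t" and "\<mu> > 0"
    and B: "\<And>s. 0 \<le> s \<Longrightarrow> s \<le> t \<Longrightarrow> cmod (g s) \<le> B * exp (\<mu> * s)"
  shows "norm (src k X g t) \<le> B * exp (\<mu> * t) / sqrt (2 * \<mu>)"
proof -
  have "cmod (g 0) \<le> B" using B[of 0] t by simp
  then have B0: "0 \<le> B" by (rule order_trans[OF norm_ge_zero])
  let ?h = "\<lambda>s. indicator {0<..<t} s * g s"
  have [measurable]: "?h \<in> borel_measurable borel" by (rule src_measurable[OF g order_refl])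
  have k': "- k \<in> {1, -1}" using k by auto
  have aff: "k * (X - c) = k * X + (- k) * c" for c by (simp add: algebra_simps)
  have L: "L2 (\<lambda>c. ?h (k * (X - c)))" by (rule L2_src[OF g k t])
  have "(norm (src k X g t))\<^sup>2 = (\<integral>c. (cmod (?h (k * X + (- k) * c)))\<^sup>2 \<partial>lborel)"
    unfolding src_def using L by (simp add: norm_cl_sq l2sq_def aff)
  also have "\<dots> = (\<integral>s. (cmod (?h s))\<^sup>2 \<partial>lborel)" by (rule integral_lborel_affine(1)[OF k'])
  also have "\<dots> \<le> (\<integral>s. B\<^sup>2 * exp (2 * \<mu> * s) * indicator {0..t} s \<partial>lborel)"
  proof (rule integral_mono)
    show "integrable lborel (\<lambda>s. (cmod (?h s))\<^sup>2)"
      using L2_integrable[OF L] integral_lborel_affine(2)[OF k', of "\<lambda>s. (cmod (?h s))\<^sup>2" "k * X"] by (simp add: aff)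
    show "integrable lborel (\<lambda>s. B\<^sup>2 * exp (2 * \<mu> * s) * indicator {0..t} s)"
      using borel_integrable_compact[of "{0..t}" "\<lambda>s. B\<^sup>2 * exp (2 * \<mu> * s)"] by (simp add: continuous_intros mult.commute)
    show "(cmod (?h s))\<^sup>2 \<le> B\<^sup>2 * exp (2 * \<mu> * s) * indicator {0..t} s" for s
    proof (cases "s \<in> {0<..<t}")
      case True
      then have "(cmod (g s))\<^sup>2 \<le> (B * exp (\<mu> * s))\<^sup>2" by (intro power_mono B) auto
      then show ?thesis using True by (simp add: power_mult_distrib exp_double[symmetric] mult.assoc)
    qed (auto simp: indicator_def)
  qed
  also have "\<dots> = B\<^sup>2 * exp (2 * \<mu> * t) / (2 * \<mu>) - B\<^sup>2 * exp (2 * \<mu> * 0) / (2 * \<mu>)"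
    by (rule integral_FTC_Icc_real[OF t]) (use \<open>\<mu> > 0\<close> in \<open>auto intro!: derivative_eq_intros continuous_intros\<close>)
  also have "\<dots> \<le> (B * exp (\<mu> * t) / sqrt (2 * \<mu>))\<^sup>2"
    using \<open>\<mu> > 0\<close> by (simp add: power_divide power_mult_distrib exp_double[symmetric] mult.assoc)
  finally show ?thesis by (rule power2_le_imp_le) (use B0 \<open>\<mu> > 0\<close> in simp)
qed

text \<open>In the coordinate moving with velocity \<open>k\<close> the point \<open>X\<close> sits
  at \<open>X - k * s\<close> at time \<open>s\<close>, so the pairing is a time integral of the
  strength against the test function at this point.\<close>

lemma src_deriv:
  assumes g: "continuous_on {0..} g" and k: "k \<in> {1, -1::real}" and t: "0 \<le> t" and ab: "test1 a" "test1 b"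
  shows "((\<lambda>t. inner (src k X g t) (tc a b)) has_real_derivative inner (g t) (cpl a b (X - k * t))) (at t within {0..})"
proof -
  let ?f = "\<lambda>s. inner (g s) (cpl a b (X - k * s))"
  have cf: "continuous_on {0..} ?f"
    by (intro continuous_intros g continuous_on_compose2[OF cpl_continuous[OF ab, of UNIV]]) auto
  have k': "- k \<in> {1, -1}" using k by auto
  have kk: "k * k = 1" using k by auto
  have aff: "k * (X - c) = k * X + (- k) * c" for c by (simp add: algebra_simps)
  have eq: "inner (src k X g t) (tc a b) = integral {0..t} ?f" if t: "0 \<le> t" for t
  proof -
    let ?\<phi> = "\<lambda>s. indicator {0<..<t} s * ?f s"
    have "inner (src k X g t) (tc a b) = (\<integral>c. ?\<phi> (k * X + (- k) * c) \<partial>lborel)"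
    proof -
      have "X - k * (k * X + (- k) * c) = c" for c
        using kk by (simp add: right_diff_distrib mult.assoc[symmetric])
      then have "inner (indicator {0<..<t} (k * (X - c)) * g (k * (X - c))) (cpl a b c) = ?\<phi> (k * X + (- k) * c)" for c
        by (simp add: aff indicator_def)
      then show ?thesis unfolding src_def using L2_src[OF g k t] ab by (simp add: inner_cl L2_cpl)
    qed
    also have "\<dots> = (\<integral>s. ?\<phi> s \<partial>lborel)" by (rule integral_lborel_affine(1)[OF k'])
    also have "\<dots> = (LINT s:{0<..<t}|lborel. ?f s)" by (simp add: set_lebesgue_integral_def)
    also have "\<dots> = integral {0<..<t} ?f"
    proof (rule set_borel_integral_eq_integral(2))
      have "set_integrable lborel {0..t} ?f"
        by (rule borel_integrable_atLeastAtMost') (rule continuous_on_subset[OF cf], simp)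
      then show "set_integrable lborel {0<..<t} ?f" by (rule set_integrable_subset) auto
    qed
    also have "\<dots> = integral {0..t} ?f" by (simp add: integral_open_interval_real)
    finally show ?thesis .
  qed
  have "((\<lambda>t. integral {0..t} ?f) has_real_derivative ?f t) (at t within {0..})"
    unfolding has_real_derivative_iff_has_vector_derivative by (rule integral_has_vector_derivative_Ici[OF cf t])
  then show ?thesis
    by (rule has_field_derivative_transform_within[of _ _ _ _ 1]) (use t eq in auto)
qed

lemma integral_exp_bound:
  fixes f :: "real \<Rightarrow> l2"
  assumes f: "continuous_on {0..} f" and t: "0 \<le> t" and "\<mu> > 0"
    and B: "\<And>s. 0 \<le> s \<Longrightarrow> s \<le> t \<Longrightarrow> norm (f s) \<le> B * exp (\<mu> * s)"
  shows "norm (integral {0..t} f) \<le> B * exp (\<mu> * t) / \<mu>"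
proof -
  have "norm (f 0) \<le> B" using B[of 0] t by simp
  then have B0: "0 \<le> B" by (rule order_trans[OF norm_ge_zero])
  have I: "((\<lambda>s. B * exp (\<mu> * s)) has_integral (B * exp (\<mu> * t) / \<mu> - B * exp (\<mu> * 0) / \<mu>)) {0..t}"
    by (rule fundamental_theorem_of_calculus[OF t])
       (use \<open>\<mu> > 0\<close> in \<open>auto intro!: derivative_eq_intros simp: has_real_derivative_iff_has_vector_derivative[symmetric]\<close>)
  have "norm (integral {0..t} f) \<le> integral {0..t} (\<lambda>s. B * exp (\<mu> * s))"
  proof (rule integral_norm_bound_integral)
    show "f integrable_on {0..t}" by (intro integrable_continuous_real continuous_on_subset[OF f]) auto
  qed (use I B in \<open>auto intro: has_integral_integrable\<close>)
  also have "\<dots> = B * exp (\<mu> * t) / \<mu> - B * exp (\<mu> * 0) / \<mu>" by (rule integral_unique[OF I])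
  also have "\<dots> \<le> B * exp (\<mu> * t) / \<mu>" using B0 \<open>\<mu> > 0\<close> by simp
  finally show ?thesis .
qed

lemma shift_tc_chain:
  assumes "test1 a" "test1 b"
  shows "((\<lambda>s. shift (c * s) (tc a b)) has_vector_derivative - c *\<^sub>R shift (c * t) (td a b)) (at t within S)"
proof -
  have 1: "((\<lambda>s. c * s) has_vector_derivative c) (at t within S)"
    by (auto intro!: derivative_eq_intros simp: has_real_derivative_iff_has_vector_derivative[symmetric])
  have 2: "((\<lambda>s. shift s (tc a b)) has_vector_derivative - shift (c * t) (td a b)) (at (c * t) within (\<lambda>s. c * s) ` S)"
    by (rule has_vector_derivative_at_within[OF shift_tc_has_vector_derivative[OF assms]])
  show ?thesis using vector_diff_chain_within[OF 1 2] by (simp add: o_def)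
qed

section \<open>The mild formulation as a fixed point problem\<close>

type_synonym phase = "l2 \<times> l2 \<times> l2"

locale lipschitz_problem =
  fixes m :: real and N :: nat and X :: "nat \<Rightarrow> real" and f :: "nat \<Rightarrow> complex \<Rightarrow> complex" and L :: real
  assumes m_pos: "m > 0" and L_nonneg: "L \<ge> 0"
    and lip: "\<And>J z w. J \<in> {1..N} \<Longrightarrow> cmod (f J z - f J w) \<le> L * cmod (z - w)"
    and f_zero: "\<And>J. J \<in> {1..N} \<Longrightarrow> f J 0 = 0"
begin

text \<open>A phase \<open>(V\<^sub>1, V\<^sub>2, p)\<close> at time \<open>t\<close> encodes the displacement \<open>p\<close>, its space derivative
  \<open>vd\<close> and its velocity \<open>vq\<close> through \<open>vq - vd = shift t V\<^sub>1\<close> and \<open>vq + vd = shift (- t) V\<^sub>2\<close>.\<close>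

definition vp :: "(real \<Rightarrow> phase) \<Rightarrow> real \<Rightarrow> l2" where
  "vp W t = snd (snd (W t))"

definition vd :: "(real \<Rightarrow> phase) \<Rightarrow> real \<Rightarrow> l2" where
  "vd W t = (1/2) *\<^sub>R (shift (- t) (fst (snd (W t))) - shift t (fst (W t)))"

definition vq :: "(real \<Rightarrow> phase) \<Rightarrow> real \<Rightarrow> l2" where
  "vq W t = (1/2) *\<^sub>R (shift t (fst (W t)) + shift (- t) (fst (snd (W t))))"

definition force :: "(real \<Rightarrow> phase) \<Rightarrow> nat \<Rightarrow> real \<Rightarrow> complex" where
  "force W J t = f J (ev (X J) (vp W t) (vd W t))"

text \<open>The combination \<open>Q - k *\<^sub>R D\<close> is transported with velocity
  \<open>k\<close>. In the moving frame the transport disappears, and what drives it is the mass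
  term, translated back, together with the point sources.\<close>

definition duhamel :: "real \<Rightarrow> (real \<Rightarrow> phase) \<Rightarrow> real \<Rightarrow> l2" where
  "duhamel k W t = integral {0..t} (\<lambda>s. shift (- k * s) (- (m\<^sup>2) *\<^sub>R vp W s)) + (\<Sum>J\<in>{1..N}. src k (X J) (force W J) t)"

text \<open>The three components are treated as independent unknowns. That \<open>vd\<close> is the
  space derivative of \<open>vp\<close> is not imposed here, which makes the space of curves linear
  and the map easy to iterate.\<close>

definition mild :: "phase \<Rightarrow> (real \<Rightarrow> phase) \<Rightarrow> real \<Rightarrow> phase" where
  "mild W0 W t = (fst W0 + duhamel 1 W t, fst (snd W0) + duhamel (- 1) W t, snd (snd W0) + integral {0..t} (vq W))"

lemma f_continuous:
  assumes "J \<in> {1..N}" shows "continuous_on S (f J)"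
proof -
  have "L-lipschitz_on S (f J)"
    using lip[OF assms] L_nonneg by (intro lipschitz_onI) (auto simp: dist_norm)
  then show ?thesis by (rule lipschitz_on_continuous_on)
qed

lemma continuous_components:
  assumes "continuous_on S W"
  shows "continuous_on S (\<lambda>t. fst (W t))" "continuous_on S (\<lambda>t. fst (snd (W t)))"
    "continuous_on S (vp W)" "continuous_on S (vd W)" "continuous_on S (vq W)"
    "J \<in> {1..N} \<Longrightarrow> continuous_on S (force W J)"
proof -
  show c: "continuous_on S (\<lambda>t. fst (W t))" "continuous_on S (\<lambda>t. fst (snd (W t)))" "continuous_on S (vp W)"
    unfolding vp_def by (intro continuous_intros assms)+
  show d: "continuous_on S (vd W)" "continuous_on S (vq W)"
    unfolding vd_def vq_def by (intro continuous_intros c)+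
  show "J \<in> {1..N} \<Longrightarrow> continuous_on S (force W J)"
    unfolding force_def by (intro continuous_on_compose2[OF f_continuous] continuous_intros c d) auto
qed

lemma duhamel_continuous:
  assumes "continuous_on {0..} W" "k \<in> {1, -1}"
  shows "continuous_on {0..} (duhamel k W)"
proof -
  note c = continuous_components[OF assms(1)]
  have "continuous_on {0..} (\<lambda>s. shift (- k * s) (- (m\<^sup>2) *\<^sub>R vp W s))" by (intro continuous_intros c)
  then have "continuous_on {0..} (\<lambda>t. integral {0..t} (\<lambda>s. shift (- k * s) (- (m\<^sup>2) *\<^sub>R vp W s)))"
    by (intro continuous_on_vector_derivative[OF integral_has_vector_derivative_Ici]) auto
  then show ?thesis
    unfolding duhamel_def by (intro continuous_on_add continuous_on_sum src_continuous c(6) assms)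
qed

lemma mild_continuous:
  assumes "continuous_on {0..} W"
  shows "continuous_on {0..} (mild W0 W)"
proof -
  have "continuous_on {0..} (\<lambda>t. integral {0..t} (vq W))"
    by (intro continuous_on_vector_derivative[OF integral_has_vector_derivative_Ici] continuous_components(5)[OF assms]) auto
  then show ?thesis
    unfolding mild_def by (intro continuous_on_Pair continuous_on_add continuous_on_const duhamel_continuous assms) auto
qed

lemma phase_norm: "norm (fst w) \<le> norm w" "norm (fst (snd w)) \<le> norm w" "norm (snd (snd w)) \<le> norm (w :: phase)"
  "norm w \<le> norm (fst w) + norm (fst (snd w)) + norm (snd (snd w))"
proof -
  have 1: "norm (fst w) \<le> norm w" "norm (snd w) \<le> norm w"
    using norm_fst_le[of "fst w" "snd w"] norm_snd_le[of "snd w" "fst w"] by simp_all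
  have 2: "norm (fst (snd w)) \<le> norm (snd w)" "norm (snd (snd w)) \<le> norm (snd w)"
    using norm_fst_le[of "fst (snd w)" "snd (snd w)"] norm_snd_le[of "snd (snd w)" "fst (snd w)"] by simp_all
  from 1 2 show "norm (fst w) \<le> norm w" "norm (fst (snd w)) \<le> norm w" "norm (snd (snd w)) \<le> norm w" by linarith+
  show "norm w \<le> norm (fst w) + norm (fst (snd w)) + norm (snd (snd w))"
    using norm_Pair_le[of "fst w" "snd w"] norm_Pair_le[of "fst (snd w)" "snd (snd w)"] by simp
qed

text \<open>The Lipschitz constant of \<open>mild\<close> in the norm with weight
  \<open>exp (- (\<mu> * t))\<close>. Each of the two Duhamel components contributes
  \<open>m\<^sup>2 / \<mu>\<close> from the mass term and \<open>4 * L / sqrt (2 * \<mu>)\<close>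
  from each source, where 4 comes from \<open>ev_bound\<close> applied to two components; the
  velocity integral contributes \<open>1 / \<mu>\<close>.\<close>

definition gain :: "real \<Rightarrow> real" where
  "gain \<mu> = (2 * m\<^sup>2 + 1) / \<mu> + 8 * L * real N / sqrt (2 * \<mu>)"

text \<open>The initial phases may differ, so that one estimate yields the contraction, the
  boundedness of the weighted image (by comparison with the zero curve) and the stability of fixed
  points.\<close>

lemma mild_lipschitz:
  assumes W: "continuous_on {0..} W" "continuous_on {0..} W'" and t: "0 \<le> t" and "\<mu> > 0"
    and \<delta>: "\<And>s. 0 \<le> s \<Longrightarrow> s \<le> t \<Longrightarrow> norm (W s - W' s) \<le> \<delta> * exp (\<mu> * s)"
  shows "norm (mild W0 W t - mild W0' W' t) \<le> norm (W0 - W0') + gain \<mu> * (\<delta> * exp (\<mu> * t))"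
proof -
  note c = continuous_components[OF W(1)] and c' = continuous_components[OF W(2)]
  have dp: "norm (vp W s - vp W' s) \<le> \<delta> * exp (\<mu> * s)" if "0 \<le> s" "s \<le> t" for s
    using order_trans[OF phase_norm(3)[of "W s - W' s"] \<delta>[OF that]] by (simp add: vp_def)
  have half: "norm ((1/2) *\<^sub>R (x + y)) \<le> r" if "norm x \<le> r" "norm y \<le> r" for x y :: l2 and r
    using norm_triangle_ineq[of x y] that by simp
  have comp: "norm (shift r (fst (W s)) - shift r (fst (W' s))) \<le> \<delta> * exp (\<mu> * s)"
      "norm (shift r (fst (snd (W s))) - shift r (fst (snd (W' s)))) \<le> \<delta> * exp (\<mu> * s)"
    if "0 \<le> s" "s \<le> t" for s r
    using order_trans[OF phase_norm(1)[of "W s - W' s"] \<delta>[OF that]] order_trans[OF phase_norm(2)[of "W s - W' s"] \<delta>[OF that]]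
    by (simp_all flip: shift_diff)
  have dq: "norm (vq W s - vq W' s) \<le> \<delta> * exp (\<mu> * s)" if "0 \<le> s" "s \<le> t" for s
  proof -
    have "vq W s - vq W' s = (1/2) *\<^sub>R ((shift s (fst (W s)) - shift s (fst (W' s)))
        + (shift (- s) (fst (snd (W s))) - shift (- s) (fst (snd (W' s)))))"
      by (simp add: vq_def algebra_simps)
    then show ?thesis using half[OF comp(1)[OF that] comp(2)[OF that]] by simp
  qed
  have dd: "norm (vd W s - vd W' s) \<le> \<delta> * exp (\<mu> * s)" if "0 \<le> s" "s \<le> t" for s
  proof -
    have "vd W s - vd W' s = (1/2) *\<^sub>R ((shift (- s) (fst (snd (W s))) - shift (- s) (fst (snd (W' s))))
        + - (shift s (fst (W s)) - shift s (fst (W' s))))"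
      by (simp add: vd_def algebra_simps)
    moreover have "norm (- (shift s (fst (W s)) - shift s (fst (W' s)))) \<le> \<delta> * exp (\<mu> * s)"
      unfolding norm_minus_cancel by (rule comp(1)[OF that])
    ultimately show ?thesis using half[OF comp(2)[OF that]] by simp
  qed
  have dforce: "cmod (force W J s - force W' J s) \<le> (4 * L * \<delta>) * exp (\<mu> * s)" if "0 \<le> s" "s \<le> t" and J: "J \<in> {1..N}" for s J
  proof -
    have "cmod (force W J s - force W' J s) \<le> L * cmod (ev (X J) (vp W s - vp W' s) (vd W s - vd W' s))"
      unfolding force_def ev_diff by (rule lip[OF J])
    also have "\<dots> \<le> L * (2 * (norm (vp W s - vp W' s) + norm (vd W s - vd W' s)))"
      by (intro mult_left_mono ev_bound L_nonneg)
    also have "\<dots> \<le> L * (2 * (\<delta> * exp (\<mu> * s) + \<delta> * exp (\<mu> * s)))"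
      by (intro mult_left_mono add_mono dp dd that L_nonneg) auto
    finally show ?thesis by (simp add: algebra_simps)
  qed
  have dduh: "norm (duhamel k W t - duhamel k W' t) \<le> (m\<^sup>2 / \<mu> + 4 * L * real N / sqrt (2 * \<mu>)) * (\<delta> * exp (\<mu> * t))"
    if k: "k \<in> {1, -1}" for k
  proof -
    let ?i = "\<lambda>W s. shift (- k * s) (- (m\<^sup>2) *\<^sub>R vp W s)"
    have ci: "continuous_on {0..} (?i W)" "continuous_on {0..} (?i W')" by (intro continuous_intros c c')+
    have ii: "(?i W) integrable_on {0..t}" "(?i W') integrable_on {0..t}"
      by (intro integrable_continuous_real continuous_on_subset[OF ci(1)] continuous_on_subset[OF ci(2)]; auto)+
    have "norm (integral {0..t} (?i W) - integral {0..t} (?i W')) = norm (integral {0..t} (\<lambda>s. ?i W s - ?i W' s))"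
      using Henstock_Kurzweil_Integration.integral_diff[OF ii] by simp
    also have "\<dots> \<le> (m\<^sup>2 * \<delta>) * exp (\<mu> * t) / \<mu>"
    proof (rule integral_exp_bound[OF _ t \<open>\<mu> > 0\<close>])
      show "continuous_on {0..} (\<lambda>s. ?i W s - ?i W' s)" by (intro continuous_on_diff ci)
      show "norm (?i W s - ?i W' s) \<le> m\<^sup>2 * \<delta> * exp (\<mu> * s)" if "0 \<le> s" "s \<le> t" for s
      proof -
        have "?i W s - ?i W' s = shift (- k * s) (- (m\<^sup>2) *\<^sub>R (vp W s - vp W' s))"
          by (simp add: shift_diff[symmetric] scaleR_diff_right)
        then have "norm (?i W s - ?i W' s) = m\<^sup>2 * norm (vp W s - vp W' s)" by simp
        then show ?thesis using mult_left_mono[OF dp[OF that], of "m\<^sup>2"] by (simp add: mult.assoc)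
      qed
    qed
    finally have 1: "norm (integral {0..t} (?i W) - integral {0..t} (?i W')) \<le> (m\<^sup>2 * \<delta>) * exp (\<mu> * t) / \<mu>" .
    have "norm ((\<Sum>J\<in>{1..N}. src k (X J) (force W J) t) - (\<Sum>J\<in>{1..N}. src k (X J) (force W' J) t))
        \<le> (\<Sum>J\<in>{1..N}. norm (src k (X J) (\<lambda>s. force W J s - force W' J s) t))"
      unfolding sum_subtractf[symmetric]
      by (rule order_trans[OF norm_sum], rule sum_mono) (use k t c(6) c'(6) in \<open>simp add: src_diff\<close>)
    also have "\<dots> \<le> (\<Sum>J\<in>{1..N}. (4 * L * \<delta>) * exp (\<mu> * t) / sqrt (2 * \<mu>))"
      by (intro sum_mono src_exp_bound k t \<open>\<mu> > 0\<close> dforce continuous_on_diff c(6) c'(6))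
    finally have 2: "norm ((\<Sum>J\<in>{1..N}. src k (X J) (force W J) t) - (\<Sum>J\<in>{1..N}. src k (X J) (force W' J) t))
        \<le> real N * ((4 * L * \<delta>) * exp (\<mu> * t) / sqrt (2 * \<mu>))" by simp
    have "duhamel k W t - duhamel k W' t = (integral {0..t} (?i W) - integral {0..t} (?i W'))
        + ((\<Sum>J\<in>{1..N}. src k (X J) (force W J) t) - (\<Sum>J\<in>{1..N}. src k (X J) (force W' J) t))"
      by (simp add: duhamel_def)
    then have "norm (duhamel k W t - duhamel k W' t) \<le> (m\<^sup>2 * \<delta>) * exp (\<mu> * t) / \<mu> + real N * ((4 * L * \<delta>) * exp (\<mu> * t) / sqrt (2 * \<mu>))"
      using norm_triangle_mono[OF 1 2] by simp
    also have "\<dots> = (m\<^sup>2 / \<mu> + 4 * L * real N / sqrt (2 * \<mu>)) * (\<delta> * exp (\<mu> * t))"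
      by (simp add: algebra_simps)
    finally show ?thesis .
  qed
  have iq: "vq W integrable_on {0..t}" "vq W' integrable_on {0..t}"
    by (intro integrable_continuous_real continuous_on_subset[OF c(5)] continuous_on_subset[OF c'(5)]; auto)+
  have "norm (integral {0..t} (vq W) - integral {0..t} (vq W')) = norm (integral {0..t} (\<lambda>s. vq W s - vq W' s))"
    using Henstock_Kurzweil_Integration.integral_diff[OF iq] by simp
  also have "\<dots> \<le> \<delta> * exp (\<mu> * t) / \<mu>"
    by (rule integral_exp_bound[OF _ t \<open>\<mu> > 0\<close> dq]) (intro continuous_on_diff c c')
  finally have 3: "norm (integral {0..t} (vq W) - integral {0..t} (vq W')) \<le> \<delta> * exp (\<mu> * t) / \<mu>" .
  let ?z = "(duhamel 1 W t - duhamel 1 W' t, duhamel (- 1) W t - duhamel (- 1) W' t,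
      integral {0..t} (vq W) - integral {0..t} (vq W'))"
  let ?g = "(m\<^sup>2 / \<mu> + 4 * L * real N / sqrt (2 * \<mu>)) * (\<delta> * exp (\<mu> * t))"
  have eq: "mild W0 W t - mild W0' W' t = (W0 - W0') + ?z"
    by (simp add: mild_def prod_eq_iff)
  have "norm ?z \<le> ?g + ?g + \<delta> * exp (\<mu> * t) / \<mu>"
    by (rule order_trans[OF phase_norm(4)], simp only: fst_conv snd_conv, intro add_mono dduh 3) auto
  also have "?g + ?g + \<delta> * exp (\<mu> * t) / \<mu> = gain \<mu> * (\<delta> * exp (\<mu> * t))"
    by (simp add: gain_def distrib_right add_divide_distrib) (simp add: mult_ac)
  finally have "norm ?z \<le> gain \<mu> * (\<delta> * exp (\<mu> * t))" .
  then show ?thesis unfolding eq using norm_triangle_ineq[of "W0 - W0'" ?z] by linarith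
qed

section \<open>Existence and stability of fixed points\<close>

lemma gain_small: obtains \<mu> where "\<mu> > 0" "gain \<mu> \<le> 1/2"
proof -
  define a b where "a = 2 * m\<^sup>2 + 1" and "b = 8 * L * real N"
  have a: "a > 0" unfolding a_def by (intro add_nonneg_pos) auto
  have b: "b \<ge> 0" unfolding b_def using L_nonneg by simp
  \<comment> \<open>The summand \<open>4 * a\<close> makes \<open>a / \<mu>\<close> at most 1/4, and
    \<open>8 * b\<^sup>2\<close> makes \<open>sqrt (2 * \<mu>)\<close> at least
    \<open>4 * b\<close>.\<close>
  define \<mu> where "\<mu> = 4 * a + 8 * b\<^sup>2"
  have \<mu>: "\<mu> > 0" unfolding \<mu>_def using a by (intro add_pos_nonneg) auto
  have "4 * b \<le> sqrt (2 * \<mu>)"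
    by (rule real_le_rsqrt) (use a in \<open>simp add: \<mu>_def power_mult_distrib\<close>)
  then have "b / sqrt (2 * \<mu>) \<le> 1/4" using \<mu> by (simp add: divide_le_eq)
  moreover have "a / \<mu> \<le> 1/4" using \<mu> by (simp add: divide_le_eq) (simp add: \<mu>_def)
  ultimately have "a / \<mu> + b / sqrt (2 * \<mu>) \<le> 1/2" by linarith
  then have "gain \<mu> \<le> 1/2" by (simp only: gain_def a_def[symmetric] b_def[symmetric])
  with \<mu> show ?thesis using that by blast
qed

lemma mild_zero: "0 \<le> t \<Longrightarrow> mild W0 (\<lambda>s. 0) t = W0"
proof -
  have "vd (\<lambda>s. 0) = (\<lambda>s. 0)" "vq (\<lambda>s. 0) = (\<lambda>s. 0)" "vp (\<lambda>s. 0) = (\<lambda>s. 0)"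
    using linear_0[OF linear_shift] by (auto simp: vd_def vq_def vp_def)
  moreover from this have "force (\<lambda>s. 0) J = (\<lambda>s. 0)" if "J \<in> {1..N}" for J
    using f_zero[OF that] by (auto simp: force_def ev_zero)
  ultimately show ?thesis
    using linear_0[OF linear_shift] by (simp add: mild_def duhamel_def src_zero_fun prod_eq_iff)
qed

text \<open>Let \<open>\<delta>\<close> be the maximum over \<open>[0, t]\<close> of the weighted
  distance, attained at \<open>r\<close>. The Lipschitz estimate at \<open>r\<close> bounds
  \<open>\<delta>\<close> by half of itself plus the initial distance, and the half is
  absorbed.\<close>

lemma fixed_point_stability:
  assumes W: "continuous_on {0..} W" "continuous_on {0..} W'"
    and eq: "\<And>t. 0 \<le> t \<Longrightarrow> W t = mild W0 W t" "\<And>t. 0 \<le> t \<Longrightarrow> W' t = mild W0' W' t"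
    and t: "0 \<le> t" and \<mu>: "\<mu> > 0" "gain \<mu> \<le> 1/2"
  shows "norm (W t - W' t) \<le> 2 * exp (\<mu> * t) * norm (W0 - W0')"
proof -
  let ?n = "\<lambda>s. exp (- (\<mu> * s)) * norm (W s - W' s)"
  have "continuous_on {0..t} ?n"
    by (intro continuous_intros continuous_on_subset[OF W(1)] continuous_on_subset[OF W(2)]) auto
  then obtain r where r: "r \<in> {0..t}" "\<And>s. s \<in> {0..t} \<Longrightarrow> ?n s \<le> ?n r"
    using continuous_attains_sup[of "{0..t}" ?n] t by fastforce
  define \<delta> where "\<delta> = ?n r"
  have le: "norm (W s - W' s) \<le> \<delta> * exp (\<mu> * s)" if "0 \<le> s" "s \<le> t" for s
    using r(2)[of s] that by (simp add: \<delta>_def exp_minus field_simps)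
  have "norm (W r - W' r) \<le> norm (W0 - W0') + gain \<mu> * (\<delta> * exp (\<mu> * r))"
    using eq[of r] r(1) mild_lipschitz[OF W _ \<mu>(1) le, of r W0 W0'] by simp
  also have "\<dots> \<le> norm (W0 - W0') + 1/2 * (\<delta> * exp (\<mu> * r))"
    by (intro add_left_mono mult_right_mono \<mu>) (simp add: \<delta>_def)
  finally have "\<delta> * exp (\<mu> * r) \<le> norm (W0 - W0') + 1/2 * (\<delta> * exp (\<mu> * r))"
    by (simp add: \<delta>_def exp_minus field_simps)
  then have "\<delta> * exp (\<mu> * r) \<le> 2 * norm (W0 - W0')" by simp
  moreover have "\<delta> * 1 \<le> \<delta> * exp (\<mu> * r)"
    using r(1) \<mu> by (intro mult_left_mono) (auto simp: \<delta>_def)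
  ultimately have "\<delta> \<le> 2 * norm (W0 - W0')" by simp
  then have "\<delta> * exp (\<mu> * t) \<le> 2 * norm (W0 - W0') * exp (\<mu> * t)" by (intro mult_right_mono) auto
  from order_trans[OF le[OF t order_refl] this] show ?thesis by (simp add: mult_ac)
qed

lemma fixed_point_exists:
  obtains W where "continuous_on {0..} W" "\<And>t. 0 \<le> t \<Longrightarrow> W t = mild W0 W t"
proof -
  obtain \<mu> where \<mu>: "\<mu> > 0" "gain \<mu> \<le> 1/2" by (rule gain_small)
  define E where "E w t = exp (\<mu> * t) *\<^sub>R apply_bcontfun w t" for w :: "real \<Rightarrow>\<^sub>C phase" and t
  have cE: "continuous_on S (E w)" for S w
    unfolding E_def by (intro continuous_on_scaleR continuous_on_apply_bcontfun continuous_intros)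
  \<comment> \<open>Bounded continuous functions live on the whole line; negative times are filled
    with the value at 0. The weight removes exponential growth, so the map stays among bounded
    functions.\<close>
  define \<Theta> where "\<Theta> w t = exp (- (\<mu> * max 0 t)) *\<^sub>R mild W0 (E w) (max 0 t)" for w t
  have cM: "continuous_on UNIV (\<lambda>t. mild W0 (E w) (max 0 t))" for w
    by (rule continuous_on_compose2[OF mild_continuous[OF cE, of W0 w]]) (auto intro!: continuous_intros)
  have Ediff: "norm (E w s - E w' s) \<le> dist w w' * exp (\<mu> * s)" for w w' s
  proof -
    have "norm (E w s - E w' s) = exp (\<mu> * s) * dist (apply_bcontfun w s) (apply_bcontfun w' s)"
      by (simp add: E_def dist_norm flip: scaleR_diff_right)
    also have "\<dots> \<le> exp (\<mu> * s) * dist w w'" by (intro mult_left_mono dist_bounded) auto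
    finally show ?thesis by (simp add: mult.commute)
  qed
  \<comment> \<open>Comparison with the zero curve, which \<open>mild\<close> with zero initial
    phase maps to zero.\<close>
  have bM: "norm (\<Theta> w t) \<le> norm W0 + 1/2 * norm w" for w t
  proof -
    let ?t = "max 0 t"
    have "norm (mild W0 (E w) ?t - mild 0 (\<lambda>s. 0) ?t) \<le> norm (W0 - 0) + gain \<mu> * (dist w 0 * exp (\<mu> * ?t))"
    proof (rule mild_lipschitz[OF cE _ _ \<mu>(1)])
      show "norm (E w s - 0) \<le> dist w 0 * exp (\<mu> * s)" for s
        using Ediff[of w s 0] by (simp add: E_def[of 0])
    qed auto
    then have "norm (mild W0 (E w) ?t) \<le> norm W0 + gain \<mu> * (norm w * exp (\<mu> * ?t))" by (simp add: mild_zero)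
    also have "\<dots> \<le> norm W0 * exp (\<mu> * ?t) + 1/2 * (norm w * exp (\<mu> * ?t))"
      using \<mu> by (intro add_mono mult_right_mono) (auto simp: mult_le_cancel_left1)
    finally have "norm (mild W0 (E w) ?t) \<le> (norm W0 + 1/2 * norm w) * exp (\<mu> * ?t)" by (simp add: algebra_simps)
    then show ?thesis by (simp add: \<Theta>_def exp_minus field_simps)
  qed
  have in_b: "\<Theta> w \<in> bcontfun" for w
  proof (rule bcontfun_normI)
    show "continuous_on UNIV (\<Theta> w)" unfolding \<Theta>_def by (intro continuous_intros cM)
  qed (rule bM)
  define \<Gamma> where "\<Gamma> w = Bcontfun (\<Theta> w)" for w
  have ap: "apply_bcontfun (\<Gamma> w) = \<Theta> w" for w unfolding \<Gamma>_def by (rule Bcontfun_inverse[OF in_b])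
  have contr: "dist (\<Gamma> w) (\<Gamma> w') \<le> 1/2 * dist w w'" for w w'
  proof (rule dist_bound)
    fix t :: real
    let ?t = "max 0 t"
    have "norm (mild W0 (E w) ?t - mild W0 (E w') ?t) \<le> norm (W0 - W0) + gain \<mu> * (dist w w' * exp (\<mu> * ?t))"
      by (rule mild_lipschitz[OF cE cE _ \<mu>(1) Ediff]) auto
    also have "\<dots> \<le> 1/2 * (dist w w' * exp (\<mu> * ?t))"
      using mult_right_mono[OF \<mu>(2), of "dist w w' * exp (\<mu> * ?t)"] by simp
    finally have "norm (mild W0 (E w) ?t - mild W0 (E w') ?t) \<le> (1/2 * dist w w') * exp (\<mu> * ?t)" by simp
    moreover have "dist (\<Theta> w t) (\<Theta> w' t) = exp (- (\<mu> * ?t)) * norm (mild W0 (E w) ?t - mild W0 (E w') ?t)"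
      by (simp add: \<Theta>_def dist_norm flip: scaleR_diff_right)
    ultimately have "exp (\<mu> * ?t) * dist (\<Theta> w t) (\<Theta> w' t) \<le> exp (\<mu> * ?t) * (1/2 * dist w w')"
      by (simp add: exp_minus field_simps)
    then show "dist (apply_bcontfun (\<Gamma> w) t) (apply_bcontfun (\<Gamma> w') t) \<le> 1/2 * dist w w'"
      by (simp add: ap)
  qed
  obtain w where w: "\<Gamma> w = w"
    using banach_fix_type[of "1/2" \<Gamma>] contr by auto
  have "E w t = mild W0 (E w) t" if "0 \<le> t" for t
  proof -
    have "apply_bcontfun w t = exp (- (\<mu> * t)) *\<^sub>R mild W0 (E w) t"
      using ap[of w] w that by (simp add: \<Theta>_def max_def)
    then have "E w t = (exp (\<mu> * t) * exp (- (\<mu> * t))) *\<^sub>R mild W0 (E w) t" by (simp add: E_def)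
    then show ?thesis by (simp add: exp_minus)
  qed
  then show ?thesis using that[OF cE] by blast
qed


lemma duhamel_deriv:
  assumes W: "continuous_on {0..} W" and k: "k \<in> {1, -1}" and t: "0 \<le> t" and ab: "test1 a" "test1 b"
  shows "((\<lambda>t. inner (duhamel k W t) (tc a b)) has_real_derivative
    inner (shift (- k * t) (- (m\<^sup>2) *\<^sub>R vp W t)) (tc a b) + (\<Sum>J\<in>{1..N}. inner (force W J t) (cpl a b (X J - k * t)))) (at t within {0..})"
proof -
  note c = continuous_components[OF W]
  have ci: "continuous_on {0..} (\<lambda>s. shift (- k * s) (- (m\<^sup>2) *\<^sub>R vp W s))" by (intro continuous_intros c)
  show ?thesis
    unfolding duhamel_def inner_add_left inner_sum_left
    by (intro DERIV_add DERIV_sum src_deriv c(6) k t ab has_vector_derivative_inner_const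
        integral_has_vector_derivative_Ici[OF ci t])
qed

text \<open>Passage from the moving to the fixed frame: the translation is moved to the test
  function, and its motion contributes the transport term with \<open>td a b\<close>.\<close>

lemma transport:
  fixes V :: "real \<Rightarrow> l2" and h :: l2 and S :: "nat \<Rightarrow> complex"
  assumes V: "continuous_on {0..} V" and t: "0 \<le> t" and ab: "test1 a" "test1 b"
    and der: "\<And>a b. test1 a \<Longrightarrow> test1 b \<Longrightarrow> ((\<lambda>t. inner (V t) (tc a b)) has_real_derivative
      inner (shift (- k * t) h) (tc a b) + (\<Sum>J\<in>{1..N}. inner (S J) (cpl a b (X J - k * t)))) (at t within {0..})"
  shows "((\<lambda>t. inner (shift (k * t) (V t)) (tc a b)) has_real_derivative
      inner h (tc a b) + (\<Sum>J\<in>{1..N}. inner (S J) (cpl a b (X J))) + k * inner (shift (k * t) (V t)) (td a b)) (at t within {0..})"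
proof -
  let ?a = "\<lambda>x. a (x - - k * t)" and ?b = "\<lambda>x. b (x - - k * t)"
  have t': "test1 ?a" "test1 ?b" by (intro test1_shift ab)+
  have sh: "shift (- k * t) (tc a b) = tc ?a ?b" by (rule shift_tc[OF ab])
  have cp: "cpl ?a ?b (x - k * t) = cpl a b x" for x by (simp add: cpl_def)
  have "((\<lambda>s. inner (V s) (shift (- k * s) (tc a b))) has_real_derivative
      (inner (shift (- k * t) h) (tc ?a ?b) + (\<Sum>J\<in>{1..N}. inner (S J) (cpl ?a ?b (X J - k * t))))
      + inner (V t) (- (- k) *\<^sub>R shift (- k * t) (td a b))) (at t within {0..})"
  proof (rule weak_strong_product[OF _ V _ shift_tc_chain[OF ab]])
    show "((\<lambda>s. inner (V s) (shift (- k * t) (tc a b))) has_real_derivative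
        inner (shift (- k * t) h) (tc ?a ?b) + (\<Sum>J\<in>{1..N}. inner (S J) (cpl ?a ?b (X J - k * t)))) (at t within {0..})"
      unfolding sh by (rule der[OF t'])
  qed (use t in simp)
  then show ?thesis
    unfolding cp sh[symmetric] inner_shift_shift by (simp add: inner_shift_left)
qed

text \<open>Half the sum of the two transport equations is the wave equation for \<open>vq\<close>.
  In half their difference mass term and sources cancel, and the time derivative of
  \<open>vd\<close> becomes the weak space derivative of \<open>vq\<close>; this is what preserves
  the relation between \<open>vp\<close> and \<open>vd\<close>.\<close>

theorem fixed_point_weak_sol:
  assumes W: "continuous_on {0..} W" and eq: "\<And>t. 0 \<le> t \<Longrightarrow> W t = mild W0 W t"
    and W0: "wd (snd (snd W0)) ((1/2) *\<^sub>R (fst (snd W0) - fst W0))"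
  shows "weak_sol m N X {0..} (force W) (vp W) (vd W) (vq W)"
    "W 0 = W0"
proof -
  note c = continuous_components[OF W]
  show W00: "W 0 = W0"
    using eq[of 0] by (simp add: mild_def duhamel_def src_0 prod_eq_iff)
  have dV: "((\<lambda>t. inner (fst (W t)) (tc a b)) has_real_derivative
      inner (shift (- 1 * t) (- (m\<^sup>2) *\<^sub>R vp W t)) (tc a b) + (\<Sum>J\<in>{1..N}. inner (force W J t) (cpl a b (X J - 1 * t)))) (at t within {0..})"
    "((\<lambda>t. inner (fst (snd (W t))) (tc a b)) has_real_derivative
      inner (shift (- (- 1) * t) (- (m\<^sup>2) *\<^sub>R vp W t)) (tc a b) + (\<Sum>J\<in>{1..N}. inner (force W J t) (cpl a b (X J - (- 1) * t)))) (at t within {0..})"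
    if "0 \<le> t" "test1 a" "test1 b" for a b t
  proof -
    have *: "((\<lambda>t. inner (w + duhamel k W t) (tc a b)) has_real_derivative
      inner (shift (- k * t) (- (m\<^sup>2) *\<^sub>R vp W t)) (tc a b) + (\<Sum>J\<in>{1..N}. inner (force W J t) (cpl a b (X J - k * t)))) (at t within {0..})"
      if "k \<in> {1, -1}" for k w
      unfolding inner_add_left[of w]
      using DERIV_add[OF DERIV_const duhamel_deriv[OF W that \<open>0 \<le> t\<close> \<open>test1 a\<close> \<open>test1 b\<close>], of "inner w (tc a b)"] by simp
    have e: "fst (W s) = fst W0 + duhamel 1 W s" "fst (snd (W s)) = fst (snd W0) + duhamel (- 1) W s" if "0 \<le> s" for s
      by (subst eq[OF that], simp add: mild_def)+
    show "((\<lambda>t. inner (fst (W t)) (tc a b)) has_real_derivative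
      inner (shift (- 1 * t) (- (m\<^sup>2) *\<^sub>R vp W t)) (tc a b) + (\<Sum>J\<in>{1..N}. inner (force W J t) (cpl a b (X J - 1 * t)))) (at t within {0..})"
      by (rule has_field_derivative_transform_within[OF *[of 1 "fst W0"], of 1]) (use that e in auto)
    show "((\<lambda>t. inner (fst (snd (W t))) (tc a b)) has_real_derivative
      inner (shift (- (- 1) * t) (- (m\<^sup>2) *\<^sub>R vp W t)) (tc a b) + (\<Sum>J\<in>{1..N}. inner (force W J t) (cpl a b (X J - (- 1) * t)))) (at t within {0..})"
      by (rule has_field_derivative_transform_within[OF *[of "- 1" "fst (snd W0)"], of 1]) (use that e in auto)
  qed
  define v w where "v t = shift t (fst (W t))" and "w t = shift (- t) (fst (snd (W t)))" for t
  have vw: "vd W t = (1/2) *\<^sub>R (w t - v t)" "vq W t = (1/2) *\<^sub>R (v t + w t)" for t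
    by (simp_all add: vd_def vq_def v_def w_def)
  have dv: "((\<lambda>t. inner (v t) (tc a b)) has_real_derivative
      inner (- (m\<^sup>2) *\<^sub>R vp W t) (tc a b) + (\<Sum>J\<in>{1..N}. inner (force W J t) (cpl a b (X J))) + inner (v t) (td a b)) (at t within {0..})"
    "((\<lambda>t. inner (w t) (tc a b)) has_real_derivative
      inner (- (m\<^sup>2) *\<^sub>R vp W t) (tc a b) + (\<Sum>J\<in>{1..N}. inner (force W J t) (cpl a b (X J))) - inner (w t) (td a b)) (at t within {0..})"
    if t: "0 \<le> t" and ab: "test1 a" "test1 b" for a b t
    using transport[OF c(1) t ab dV(1)[OF t]] transport[OF c(2) t ab dV(2)[OF t]] by (simp_all add: v_def w_def)
  have dp: "(vp W has_vector_derivative vq W t) (at t within {0..})" if t: "0 \<le> t" for t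
  proof -
    have "((\<lambda>t. snd (snd W0) + integral {0..t} (vq W)) has_vector_derivative 0 + vq W t) (at t within {0..})"
      by (intro has_vector_derivative_add has_vector_derivative_const integral_has_vector_derivative_Ici c(5) t)
    then have *: "((\<lambda>t. snd (snd W0) + integral {0..t} (vq W)) has_vector_derivative vq W t) (at t within {0..})" by simp
    have "vp W s = snd (snd W0) + integral {0..s} (vq W)" if "0 \<le> s" for s
      unfolding vp_def by (subst eq[OF that]) (simp add: mild_def)
    then show ?thesis
      using has_vector_derivative_transform[of t "{0..}" "vp W" _ "vq W t", OF _ _ *] t by simp
  qed
  have dd: "((\<lambda>t. inner (vd W t) (tc a b)) has_real_derivative - inner (vq W t) (td a b)) (at t within {0..})"
    if "0 \<le> t" "test1 a" "test1 b" for a b t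
  proof -
    have eq: "(\<lambda>t. inner (vd W t) (tc a b)) = (\<lambda>t. 1/2 * (inner (w t) (tc a b) - inner (v t) (tc a b)))"
      by (simp add: vw inner_diff_left)
    show ?thesis
      unfolding eq
      by (rule DERIV_cong[OF DERIV_cmult[OF DERIV_diff[OF dv(2)[OF that] dv(1)[OF that]]]])
         (simp add: vw inner_add_left algebra_simps)
  qed
  have wd: "wd (vp W t) (vd W t)" if t: "0 \<le> t" for t
    unfolding wd_def
  proof (intro allI impI)
    fix a b assume ab: "test1 a" "test1 b"
    \<comment> \<open>The defect in the relation between displacement and space derivative has zero
      time derivative, so it keeps its initial value, which \<open>W0\<close> makes zero.\<close>
    have "inner (vp W t) (td a b) + inner (vd W t) (tc a b) = inner (vp W 0) (td a b) + inner (vd W 0) (tc a b)"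
    proof (rule zero_deriv_Ici[OF _ t order_refl])
      fix s :: real assume s: "0 \<le> s"
      from DERIV_add[OF has_vector_derivative_inner_const[OF dp[OF s], of "td a b"] dd[OF s ab]]
      show "((\<lambda>t. inner (vp W t) (td a b) + inner (vd W t) (tc a b)) has_real_derivative 0) (at s within {0..})" by simp
    qed
    also have "\<dots> = 0"
      using W0 ab unfolding wd_def vp_def vd_def W00 by simp
    finally show "inner (vp W t) (td a b) = - inner (vd W t) (tc a b)" by simp
  qed
  have dq: "((\<lambda>t. inner (vq W t) (tc a b)) has_real_derivative
      - inner (vd W t) (td a b) - m\<^sup>2 * inner (vp W t) (tc a b) + (\<Sum>J\<in>{1..N}. inner (force W J t) (cpl a b (X J)))) (at t within {0..})"
    if "0 \<le> t" "test1 a" "test1 b" for a b t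
  proof -
    have eq: "(\<lambda>t. inner (vq W t) (tc a b)) = (\<lambda>t. 1/2 * (inner (v t) (tc a b) + inner (w t) (tc a b)))"
      by (simp add: vw inner_add_left)
    show ?thesis
      unfolding eq
      by (rule DERIV_cong[OF DERIV_cmult[OF DERIV_add[OF dv(1)[OF that] dv(2)[OF that]]]])
         (simp add: vw inner_diff_left field_simps)
  qed
  show "weak_sol m N X {0..} (force W) (vp W) (vd W) (vq W)"
    unfolding weak_sol_def using c wd dq has_vector_derivative_inner_const[OF dp] by auto
qed

text \<open>The converse, on which uniqueness rests. Against test functions that move along the
  characteristics, the space derivatives of \<open>Q\<close> and \<open>D\<close> cancel, so both
  sides of the Duhamel equation have the same derivative and the same initial value.\<close>

theorem weak_sol_fixed_point:
  assumes w: "weak_sol m N X {0..} G P D Q"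
    and G: "\<And>J t. J \<in> {1..N} \<Longrightarrow> 0 \<le> t \<Longrightarrow> G J t = f J (ev (X J) (P t) (D t))"
  defines "W \<equiv> (\<lambda>t. (shift (- t) (Q t - D t), shift t (Q t + D t), P t))"
  shows "continuous_on {0..} W" "0 \<le> t \<Longrightarrow> W t = mild (W 0) W t"
proof -
  note w' = weak_solD[OF w]
  show cW: "continuous_on {0..} W"
    unfolding W_def by (intro continuous_intros w'(1-3))
  have v: "vp W = P" "vd W = D" "vq W = Q"
    by (auto simp: vp_def vd_def vq_def W_def simp flip: scaleR_2)
  have force: "force W J t = G J t" if "J \<in> {1..N}" "0 \<le> t" for J t
    using G[OF that] by (simp add: force_def v)
  \<comment> \<open>The pairing of \<open>D\<close> with a test function is minus that of
    \<open>P\<close> with its derivative, and \<open>P\<close> has time derivative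
    \<open>Q\<close>.\<close>
  have dD: "((\<lambda>s. inner (D s) (tc a b)) has_real_derivative - inner (Q t) (td a b)) (at t within {0..})"
    if "test1 a" "test1 b" "0 \<le> t" for a b t
  proof -
    have *: "((\<lambda>s. - inner (P s) (td a b)) has_real_derivative - inner (Q t) (td a b)) (at t within {0..})"
      by (intro DERIV_minus w'(6) test1_deriv that)
    show ?thesis
      by (rule has_field_derivative_transform_within[OF *, of 1])
         (use that w'(5) in \<open>auto simp: wd_def\<close>)
  qed
  have key: "shift (- k * t) (Q t - k *\<^sub>R D t) = (Q 0 - k *\<^sub>R D 0) + duhamel k W t"
    if k: "k \<in> {1, -1}" and t: "0 \<le> t" for k t
  proof (rule eq_if_tests)
    fix a b assume ab: "test1 a" "test1 b"
    have kk: "k * k = 1" using k by auto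
    \<comment> \<open>Differentiating the moving test function produces \<open>- k\<close> times the
      pairing with \<open>Q\<close> plus the pairing with \<open>D\<close>, by
      \<open>k * k = 1\<close>; these cancel the derivative terms of the equation.\<close>
    have dL: "((\<lambda>s. inner (Q s - k *\<^sub>R D s) (shift (k * s) (tc a b))) has_real_derivative
       inner (shift (- k * t) (- (m\<^sup>2) *\<^sub>R P t)) (tc a b) + (\<Sum>J\<in>{1..N}. inner (G J t) (cpl a b (X J - k * t)))) (at t within {0..})"
      if t: "0 \<le> t" for t
    proof -
      let ?a = "\<lambda>x. a (x - k * t)" and ?b = "\<lambda>x. b (x - k * t)"
      have t': "test1 ?a" "test1 ?b" by (intro test1_shift ab)+
      have sh: "shift (k * t) (tc a b) = tc ?a ?b" "shift (k * t) (td a b) = td ?a ?b"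
        by (rule shift_tc[OF ab], rule shift_td[OF ab])
      have d: "((\<lambda>s. inner (Q s - k *\<^sub>R D s) (shift (k * s) (tc a b))) has_real_derivative
        ((- inner (D t) (td ?a ?b) - m\<^sup>2 * inner (P t) (tc ?a ?b) + (\<Sum>J\<in>{1..N}. inner (G J t) (cpl ?a ?b (X J))))
          - k * (- inner (Q t) (td ?a ?b))) + inner (Q t - k *\<^sub>R D t) (- k *\<^sub>R shift (k * t) (td a b))) (at t within {0..})"
      proof (rule weak_strong_product[OF _ _ _ shift_tc_chain[OF ab]])
        show "((\<lambda>s. inner (Q s - k *\<^sub>R D s) (shift (k * t) (tc a b))) has_real_derivative
          (- inner (D t) (td ?a ?b) - m\<^sup>2 * inner (P t) (tc ?a ?b) + (\<Sum>J\<in>{1..N}. inner (G J t) (cpl ?a ?b (X J))))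
          - k * (- inner (Q t) (td ?a ?b))) (at t within {0..})"
          unfolding sh inner_diff_left inner_scaleR_left
          by (intro DERIV_diff DERIV_cmult w'(7) dD t t')
        show "continuous_on {0..} (\<lambda>s. Q s - k *\<^sub>R D s)" by (intro continuous_intros w'(2,3))
      qed (use t in simp)
      have e1: "inner (shift (- k * t) (- (m\<^sup>2) *\<^sub>R P t)) (tc a b) = - (m\<^sup>2) * inner (P t) (tc ?a ?b)"
        by (simp add: inner_shift_left sh)
      have e2: "cpl ?a ?b x = cpl a b (x - k * t)" for x by (simp add: cpl_def)
      have e3: "inner (Q t - k *\<^sub>R D t) (- k *\<^sub>R shift (k * t) (td a b)) = - k * inner (Q t) (td ?a ?b) + inner (D t) (td ?a ?b)"
        unfolding sh by (simp add: inner_diff_left kk right_diff_distrib mult.assoc[symmetric])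
      show ?thesis
        by (rule DERIV_cong[OF d]) (unfold e1 e2 e3, simp add: algebra_simps)
    qed
    have dR: "((\<lambda>s. inner (Q 0 - k *\<^sub>R D 0 + duhamel k W s) (tc a b)) has_real_derivative
       inner (shift (- k * t) (- (m\<^sup>2) *\<^sub>R P t)) (tc a b) + (\<Sum>J\<in>{1..N}. inner (G J t) (cpl a b (X J - k * t)))) (at t within {0..})"
      if "0 \<le> t" for t
      unfolding inner_add_left
      using DERIV_add[OF DERIV_const duhamel_deriv[OF cW k that ab], of "inner (Q 0 - k *\<^sub>R D 0) (tc a b)"] force that
      by (simp add: v)
    have "inner (Q t - k *\<^sub>R D t) (shift (k * t) (tc a b)) - inner (Q 0 - k *\<^sub>R D 0 + duhamel k W t) (tc a b)
       = inner (Q 0 - k *\<^sub>R D 0) (shift (k * 0) (tc a b)) - inner (Q 0 - k *\<^sub>R D 0 + duhamel k W 0) (tc a b)"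
    proof (rule zero_deriv_Ici[OF _ t order_refl])
      show "((\<lambda>t. inner (Q t - k *\<^sub>R D t) (shift (k * t) (tc a b)) - inner (Q 0 - k *\<^sub>R D 0 + duhamel k W t) (tc a b))
        has_real_derivative 0) (at s within {0..})" if "0 \<le> s" for s
        using DERIV_diff[OF dL[OF that] dR[OF that]] by simp
    qed
    also have "\<dots> = 0" by (simp add: duhamel_def src_0)
    finally show "inner (shift (- k * t) (Q t - k *\<^sub>R D t)) (tc a b) = inner (Q 0 - k *\<^sub>R D 0 + duhamel k W t) (tc a b)"
      by (simp add: inner_shift_left)
  qed
  show "W t = mild (W 0) W t" if t: "0 \<le> t"
  proof -
    have "(Q has_integral (P t - P 0)) {0..t}"
      by (rule fundamental_theorem_of_calculus[OF t])
         (auto intro: has_vector_derivative_within_subset[OF weak_sol_strong[OF w]])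
    then have "P t = P 0 + integral {0..t} Q" by (simp add: integral_unique)
    then show ?thesis
      using key[of 1 t] key[of "- 1" t] t by (simp add: mild_def v) (simp add: W_def)
  qed
qed

end

section \<open>Time reversal\<close>

lemma glue_continuous:
  fixes f g :: "real \<Rightarrow> 'a :: topological_space"
  assumes "continuous_on {0..} f" "continuous_on {0..} g" "f 0 = g 0"
  shows "continuous_on UNIV (\<lambda>t. if 0 \<le> t then f t else g (- t))"
proof -
  have "continuous_on ({0..} \<union> {..0}) (\<lambda>t. if 0 \<le> t then f t else g (- t))"
  proof (rule continuous_on_If)
    show "continuous_on {..0} (\<lambda>t. g (- t))"
      by (rule continuous_on_compose2[OF assms(2)]) (auto intro!: continuous_intros)
    show "f t = g (- t)" if "t \<in> {0..}" "\<not> 0 \<le> t" for t using that by simp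
    show "f t = g (- t)" if "t \<in> {..0}" "0 \<le> t" for t using that assms(3) by (cases "t = 0") auto
  qed (use assms in auto)
  moreover have "{0..} \<union> {..0} = (UNIV :: real set)" by auto
  ultimately show ?thesis by simp
qed

lemma reverse_deriv:
  assumes "(f has_real_derivative f') (at (- t) within uminus ` S)"
  shows "((\<lambda>s. f (- s)) has_real_derivative - f') (at t within S)"
  using DERIV_image_chain[OF assms DERIV_minus[OF DERIV_ident]] by (simp add: o_def)

lemma glue_deriv:
  fixes f g :: "real \<Rightarrow> real"
  assumes f: "\<And>t. 0 \<le> t \<Longrightarrow> (f has_real_derivative f' t) (at t within {0..})"
    and g: "\<And>t. 0 \<le> t \<Longrightarrow> (g has_real_derivative g' t) (at t within {0..})"
    and 0: "f 0 = g 0" "f' 0 = - g' 0"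
  shows "((\<lambda>t. if 0 \<le> t then f t else g (- t)) has_real_derivative (if 0 \<le> t then f' t else - g' (- t))) (at t)"
proof -
  let ?k = "\<lambda>t. if 0 \<le> t then f t else g (- t)"
  have r: "(?k has_real_derivative f' t) (at t within {0..})" if "0 \<le> t" for t
    by (rule has_field_derivative_transform_within[OF f[OF that], of 1]) (use that in auto)
  have l: "(?k has_real_derivative - g' (- t)) (at t within {..0})" if "t \<le> 0" for t
  proof -
    have "((\<lambda>s. g (- s)) has_real_derivative - g' (- t)) (at t within {..0})"
      by (rule reverse_deriv) (use g[of "- t"] that in simp)
    moreover have "g (- s) = ?k s" if "s \<le> 0" for s using that 0(1) by (cases "s = 0") auto
    ultimately show ?thesis
      using that by - (rule has_field_derivative_transform_within[of "\<lambda>s. g (- s)" _ _ _ 1], auto)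
  qed
  consider "t > 0" | "t < 0" | "t = 0" by linarith
  then show ?thesis
  proof cases
    case 1
    have "at t within {0..} = at t" by (rule at_within_interior) (use 1 in \<open>simp add: interior_Ici\<close>)
    then show ?thesis using r[of t] 1 by simp
  next
    case 2
    have "at t within {..0} = at t" by (rule at_within_interior) (use 2 in \<open>simp add: interior_Iic\<close>)
    then show ?thesis using l[of t] 2 by simp
  next
    case 3
    have "((\<lambda>y. (?k y - ?k 0) / (y - 0)) \<longlongrightarrow> f' 0) (at 0)"
      using r[of 0] l[of 0] 0(2) unfolding has_field_derivative_iff
      by (simp add: filterlim_split_at at_within_Ici_at_right at_within_Iic_at_left)
    then show ?thesis unfolding has_field_derivative_iff using 3 by simp
  qed
qed

text \<open>The equation is of second order in time, so reversing time changes only the sign of the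
  velocity. The solution for negative times is a reversed forward solution started with
  \<open>- Q 0\<close>, and at 0 the one-sided derivatives of all pairings match.\<close>

lemma weak_sol_glue:
  assumes w: "weak_sol m N X {0..} G P D Q" and w': "weak_sol m N X {0..} G' P' D' Q'"
    and 0: "P' 0 = P 0" "D' 0 = D 0" "Q' 0 = - Q 0" "\<And>J. J \<in> {1..N} \<Longrightarrow> G' J 0 = G J 0"
  shows "weak_sol m N X UNIV (\<lambda>J t. if 0 \<le> t then G J t else G' J (- t)) (\<lambda>t. if 0 \<le> t then P t else P' (- t))
    (\<lambda>t. if 0 \<le> t then D t else D' (- t)) (\<lambda>t. if 0 \<le> t then Q t else - Q' (- t))"
proof -
  note w = weak_solD[OF w] and w' = weak_solD[OF w']
  have cQ: "continuous_on UNIV (\<lambda>t. if 0 \<le> t then Q t else (\<lambda>t. - Q' t) (- t))"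
    by (rule glue_continuous) (use w(3) w'(3) 0 in \<open>auto intro: continuous_intros\<close>)
  have dP: "((\<lambda>s. inner (if 0 \<le> s then P s else P' (- s)) (tc a b)) has_real_derivative
      inner (if 0 \<le> t then Q t else - Q' (- t)) (tc a b)) (at t)" if ab: "test1 a" "test1 b" for a b t
  proof -
    have "((\<lambda>s. if 0 \<le> s then inner (P s) (tc a b) else inner (P' (- s)) (tc a b)) has_real_derivative
        (if 0 \<le> t then inner (Q t) (tc a b) else - inner (Q' (- t)) (tc a b))) (at t)"
      by (rule glue_deriv[OF w(6)[OF ab] w'(6)[OF ab]]) (use 0 in auto)
    then show ?thesis by (simp add: if_distrib[of "\<lambda>f. inner f (tc a b)"] cong: if_cong)
  qed
  define h where "h G P D a b = - inner D (td a b) - m\<^sup>2 * inner P (tc a b) + (\<Sum>J\<in>{1..N}. inner (G J) (cpl a b (X J)))"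
    for G :: "nat \<Rightarrow> complex" and P D a b
  have dQ: "((\<lambda>s. inner (if 0 \<le> s then Q s else - Q' (- s)) (tc a b)) has_real_derivative
      h (\<lambda>J. if 0 \<le> t then G J t else G' J (- t)) (if 0 \<le> t then P t else P' (- t)) (if 0 \<le> t then D t else D' (- t)) a b) (at t)"
    if ab: "test1 a" "test1 b" for a b t
  proof -
    have *: "((\<lambda>s. if 0 \<le> s then inner (Q s) (tc a b) else - inner (Q' (- s)) (tc a b)) has_real_derivative
        (if 0 \<le> t then h (\<lambda>J. G J t) (P t) (D t) a b else - (- h (\<lambda>J. G' J (- t)) (P' (- t)) (D' (- t)) a b))) (at t)"
    proof (rule glue_deriv[OF w(7)[OF ab, folded h_def] DERIV_minus[OF w'(7)[OF ab, folded h_def]]])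
      show "inner (Q 0) (tc a b) = - inner (Q' 0) (tc a b)" using 0 by simp
      show "h (\<lambda>J. G J 0) (P 0) (D 0) a b = - (- h (\<lambda>J. G' J 0) (P' 0) (D' 0) a b)"
        using 0 by (simp add: h_def)
    qed
    have eq: "(\<lambda>s. inner (if 0 \<le> s then Q s else - Q' (- s)) (tc a b))
        = (\<lambda>s. if 0 \<le> s then inner (Q s) (tc a b) else - inner (Q' (- s)) (tc a b))" by auto
    show ?thesis unfolding eq by (rule DERIV_cong[OF *]) simp
  qed
  show ?thesis
    unfolding weak_sol_def
    using cQ dP dQ[unfolded h_def] w(5) w'(5) by (auto intro!: glue_continuous w(1,2,4) w'(1,2,4) 0[symmetric])
qed

lemma weak_sol_cong:
  assumes w: "weak_sol m N X T G P D Q" and eq: "\<And>J t. J \<in> {1..N} \<Longrightarrow> t \<in> T \<Longrightarrow> G J t = G' J t"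
  shows "weak_sol m N X T G' P D Q"
proof -
  have "(\<Sum>J\<in>{1..N}. inner (G J t) (cpl a b (X J))) = (\<Sum>J\<in>{1..N}. inner (G' J t) (cpl a b (X J)))"
    if "t \<in> T" for t a b
    by (rule sum.cong) (use eq that in auto)
  moreover have "continuous_on T (G' J)" if "J \<in> {1..N}" for J
    using w that unfolding weak_sol_def by (intro continuous_on_eq[OF _ eq[OF that]]) auto
  ultimately show ?thesis using w unfolding weak_sol_def by simp
qed

lemma weak_sol_reverse:
  assumes w: "weak_sol m N X UNIV G P D Q"
  shows "weak_sol m N X UNIV (\<lambda>J t. G J (- t)) (\<lambda>t. P (- t)) (\<lambda>t. D (- t)) (\<lambda>t. - Q (- t))"
proof -
  have c: "continuous_on UNIV (\<lambda>t. f (- t))" if "continuous_on UNIV f" for f :: "real \<Rightarrow> 'a :: topological_space"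
    by (rule continuous_on_compose2[OF that]) (auto intro!: continuous_intros)
  have rd: "((\<lambda>s. f (- s)) has_real_derivative - f') (at t)" if "(f has_real_derivative f') (at (- t))" for f :: "real \<Rightarrow> real" and f' t
    by (rule reverse_deriv) (use that in simp)
  show ?thesis
    unfolding weak_sol_def
  proof (intro conjI allI impI ballI)
    show "continuous_on UNIV (\<lambda>t. P (- t))" "continuous_on UNIV (\<lambda>t. D (- t))" "continuous_on UNIV (\<lambda>t. - Q (- t))"
      using w unfolding weak_sol_def by (auto intro!: c continuous_on_minus)
    show "continuous_on UNIV (\<lambda>t. G J (- t))" if "J \<in> {1..N}" for J
      using w that unfolding weak_sol_def by (auto intro!: c)
    show "wd (P (- t)) (D (- t))" for t using w unfolding weak_sol_def by auto
    fix a b t assume ab: "test1 a" "test1 b"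
    from w ab have d: "((\<lambda>s. inner (P s) (tc a b)) has_real_derivative inner (Q (- t)) (tc a b)) (at (- t))"
      "((\<lambda>s. inner (Q s) (tc a b)) has_real_derivative - inner (D (- t)) (td a b) - m\<^sup>2 * inner (P (- t)) (tc a b)
         + (\<Sum>J\<in>{1..N}. inner (G J (- t)) (cpl a b (X J)))) (at (- t))"
      unfolding weak_sol_def by auto
    show "((\<lambda>s. inner (P (- s)) (tc a b)) has_real_derivative inner (- Q (- t)) (tc a b)) (at t)"
      using rd[OF d(1)] by simp
    show "((\<lambda>s. inner (- Q (- s)) (tc a b)) has_real_derivative - inner (D (- t)) (td a b) - m\<^sup>2 * inner (P (- t)) (tc a b)
         + (\<Sum>J\<in>{1..N}. inner (G J (- t)) (cpl a b (X J)))) (at t)"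
      unfolding inner_minus_left by (rule DERIV_cong[OF DERIV_minus[OF rd[OF d(2)]]]) simp
  qed
qed

section \<open>Global solutions\<close>

locale point_interaction =
  fixes m :: real and N :: nat and X :: "nat \<Rightarrow> real" and F :: "nat \<Rightarrow> complex \<Rightarrow> complex"
    and U :: "nat \<Rightarrow> complex \<Rightarrow> real" and A B :: "nat \<Rightarrow> real"
  assumes m_pos: "m > 0"
    and nonlin: "\<And>J. J \<in> {1..N} \<Longrightarrow> nl (F J) (U J)"
    and B_nonneg: "\<And>J. J \<in> {1..N} \<Longrightarrow> B J \<ge> 0"
    and U_lower: "\<And>J z. J \<in> {1..N} \<Longrightarrow> U J z \<ge> A J - B J * (cmod z)\<^sup>2"
    and B_sum: "(\<Sum>J\<in>{1..N}. B J) < m"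
begin

definition H :: "l2 \<Rightarrow> l2 \<Rightarrow> l2 \<Rightarrow> real" where
  "H p d q = energy m p d q + (\<Sum>J\<in>{1..N}. U J (ev (X J) p d))"

text \<open>If \<open>e\<close> denotes the free energy, the lower bound on the potentials turns a
  total energy of at most \<open>E\<close> into
  \<open>e / m * (m - sum B {1..N}) \<le> E - sum A {1..N}\<close>; this is the resulting bound for
  \<open>e / m\<close>.\<close>

definition bound :: "real \<Rightarrow> real" where
  "bound E = (E - (\<Sum>J\<in>{1..N}. A J)) / (m - (\<Sum>J\<in>{1..N}. B J))"

text \<open>The bound \<open>ev_sup\<close> followed by the inequality of arithmetic and geometric
  means for \<open>norm d\<close> and \<open>m * norm p\<close>. The factor \<open>m\<close>
  obtained here is the threshold in \<open>B_sum\<close>.\<close>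

lemma ev_le_energy:
  assumes "wd p d" shows "m * (cmod (ev x p d))\<^sup>2 \<le> energy m p d q"
proof -
  have "m * (cmod (ev x p d))\<^sup>2 \<le> m * (norm p * norm d)"
    by (intro mult_left_mono ev_sup assms) (use m_pos in simp)
  also have "\<dots> = (2 * norm d * (m * norm p)) / 2" by simp
  also have "\<dots> \<le> ((norm d)\<^sup>2 + (m * norm p)\<^sup>2) / 2" by (intro divide_right_mono sum_squares_bound) simp
  also have "\<dots> \<le> energy m p d q" by (simp add: energy_def power_mult_distrib)
  finally show ?thesis .
qed

lemma coercive:
  assumes wd: "wd p d" and "H p d q \<le> E"
  shows "energy m p d q \<le> m * bound E" "(cmod (ev x p d))\<^sup>2 \<le> bound E"
proof -
  let ?b = "\<Sum>J\<in>{1..N}. B J" and ?e = "energy m p d q"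
  have "(\<Sum>J\<in>{1..N}. A J) - ?b * (?e / m) \<le> (\<Sum>J\<in>{1..N}. U J (ev (X J) p d))"
    unfolding sum_distrib_right sum_subtractf[symmetric]
  proof (rule sum_mono)
    fix J assume J: "J \<in> {1..N}"
    have "(cmod (ev (X J) p d))\<^sup>2 \<le> ?e / m"
      using ev_le_energy[OF wd, of "X J" q] m_pos by (simp add: field_simps)
    then have "B J * (cmod (ev (X J) p d))\<^sup>2 \<le> B J * (?e / m)" by (intro mult_left_mono B_nonneg J)
    then show "A J - B J * (?e / m) \<le> U J (ev (X J) p d)" using U_lower[OF J, of "ev (X J) p d"] by linarith
  qed
  with assms(2) have "?e - ?b * (?e / m) \<le> E - (\<Sum>J\<in>{1..N}. A J)" unfolding H_def by linarith
  moreover have "?e - ?b * (?e / m) = (?e / m) * (m - ?b)" using m_pos by (simp add: field_simps)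
  ultimately have *: "?e / m \<le> bound E" unfolding bound_def using B_sum by (simp add: pos_le_divide_eq)
  then show "?e \<le> m * bound E" using m_pos by (simp add: field_simps)
  have "(cmod (ev x p d))\<^sup>2 \<le> ?e / m" using ev_le_energy[OF wd, of x q] m_pos by (simp add: field_simps)
  with * show "(cmod (ev x p d))\<^sup>2 \<le> bound E" by linarith
qed

definition forward :: "(real \<Rightarrow> l2) \<Rightarrow> (real \<Rightarrow> l2) \<Rightarrow> (real \<Rightarrow> l2) \<Rightarrow> bool" where
  "forward P D Q \<longleftrightarrow> weak_sol m N X {0..} (\<lambda>J t. F J (ev (X J) (P t) (D t))) P D Q"

lemma forward_conservation:
  assumes "forward P D Q" "0 \<le> t"
  shows "H (P t) (D t) (Q t) = H (P 0) (D 0) (Q 0)"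
    "inner (Q t) (mulI (P t)) = inner (Q 0) (mulI (P 0))"
proof -
  note w = assms(1)[unfolded forward_def]
  show "H (P t) (D t) (Q t) = H (P 0) (D 0) (Q 0)"
    unfolding H_def by (rule energy_conservation[OF w nonlin _ assms(2), where c="t + 1"]) auto
  show "inner (Q t) (mulI (P t)) = inner (Q 0) (mulI (P 0))"
    by (rule charge_conservation[OF w nonlin _ assms(2)]) auto
qed

lemma forward_bound:
  assumes f: "forward P D Q" and "0 \<le> t" and E: "H (P 0) (D 0) (Q 0) \<le> E"
  shows "energy m (P t) (D t) (Q t) \<le> m * bound E" "cmod (ev x (P t) (D t)) \<le> sqrt (bound E)"
proof -
  have wd: "wd (P t) (D t)" using f assms(2) unfolding forward_def by (blast dest: weak_solD(5))
  have "H (P t) (D t) (Q t) \<le> E" using forward_conservation(1)[OF f assms(2)] E by simp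
  note * = coercive[OF wd this]
  show "energy m (P t) (D t) (Q t) \<le> m * bound E" by (rule *(1))
  show "cmod (ev x (P t) (D t)) \<le> sqrt (bound E)" by (rule real_le_rsqrt[OF *(2)])
qed

text \<open>The projection onto a disc fixes its points and does not increase distances, so
  composing with it turns a local Lipschitz bound into a global one.\<close>

abbreviation cut :: "real \<Rightarrow> complex \<Rightarrow> complex" where
  "cut R \<equiv> closest_point (cball 0 R)"

lemma cut_lipschitz_problem:
  assumes R: "0 \<le> R"
  obtains L where "lipschitz_problem m N (\<lambda>J z. F J (cut R z)) L"
proof -
  have "\<exists>L. \<forall>J\<in>{1..N}. L J \<ge> 0 \<and> (\<forall>z w. cmod z \<le> R \<longrightarrow> cmod w \<le> R \<longrightarrow> cmod (F J z - F J w) \<le> L J * cmod (z - w))"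
  proof (rule bchoice, rule ballI)
    fix J assume "J \<in> {1..N}"
    then obtain L where "L \<ge> 0" "\<forall>z w. cmod z \<le> R \<longrightarrow> cmod w \<le> R \<longrightarrow> cmod (F J z - F J w) \<le> L * cmod (z - w)
        \<and> \<bar>U J w - U J z + inner (F J z) (w - z)\<bar> \<le> L * (cmod (w - z))\<^sup>2"
      using nonlin[of J] unfolding nl_def by blast
    then show "\<exists>L\<ge>0. \<forall>z w. cmod z \<le> R \<longrightarrow> cmod w \<le> R \<longrightarrow> cmod (F J z - F J w) \<le> L * cmod (z - w)"
      by (intro exI[of _ L]) auto
  qed
  then obtain L where L: "\<And>J. J \<in> {1..N} \<Longrightarrow> L J \<ge> 0"
    "\<And>J z w. J \<in> {1..N} \<Longrightarrow> cmod z \<le> R \<Longrightarrow> cmod w \<le> R \<Longrightarrow> cmod (F J z - F J w) \<le> L J * cmod (z - w)"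
    by blast
  have b: "cball (0::complex) R \<noteq> {}" using R by auto
  have cut: "cmod (cut R z) \<le> R" for z
    using closest_point_in_set[OF closed_cball b, of z] by simp
  have "lipschitz_problem m N (\<lambda>J z. F J (cut R z)) (\<Sum>J\<in>{1..N}. L J)"
  proof
    show "0 \<le> (\<Sum>J\<in>{1..N}. L J)" by (intro sum_nonneg L)
    fix J z w assume J: "J \<in> {1..N}"
    have "cmod (F J (cut R z) - F J (cut R w)) \<le> L J * cmod (cut R z - cut R w)" by (intro L J cut)
    also have "\<dots> \<le> L J * cmod (z - w)"
      using closest_point_lipschitz[OF convex_cball closed_cball b, of z w] L(1)[OF J]
      by (intro mult_left_mono) (auto simp: dist_norm)
    also have "\<dots> \<le> (\<Sum>J\<in>{1..N}. L J) * cmod (z - w)"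
      by (intro mult_right_mono member_le_sum J L) auto
    finally show "cmod (F J (cut R z) - F J (cut R w)) \<le> (\<Sum>J\<in>{1..N}. L J) * cmod (z - w)" .
  next
    fix J assume "J \<in> {1..N}"
    then show "F J (cut R 0) = 0" using nonlin[of J] R by (simp add: nl_def closest_point_self)
  qed (rule m_pos)
  then show ?thesis by (rule that)
qed

lemma cut_id: "cmod z \<le> R \<Longrightarrow> cut R z = z"
  by (intro closest_point_self) simp

text \<open>The nonlinearity truncated outside the ball of radius \<open>R\<close> has a global solution. As long as its
  traces stay in the ball, conservation of energy confines them to the strictly smaller ball
  of radius \<open>R0\<close>, so that they never reach the truncation.\<close>

theorem forward_exists:
  assumes wd0: "wd p0 d0"
  obtains P D Q where "forward P D Q" "P 0 = p0" "D 0 = d0" "Q 0 = q0"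
proof -
  define E where "E = H p0 d0 q0"
  define R0 where "R0 = sqrt (bound E)"
  \<comment> \<open>A truncation radius strictly above the energy bound, so that the traces would
    have to cross a gap before the truncation acts.\<close>
  define R where "R = R0 + 1"
  have "0 \<le> bound E" using coercive(2)[OF wd0, of q0 E 0] zero_le_power2 unfolding E_def by (meson order_refl order_trans)
  then have R: "0 \<le> R0" "R0 < R" "0 \<le> R" by (auto simp: R0_def R_def)
  obtain L where "lipschitz_problem m N (\<lambda>J z. F J (cut R z)) L" using cut_lipschitz_problem[OF R(3)] by blast
  then interpret lp: lipschitz_problem m N X "\<lambda>J z. F J (cut R z)" L .
  let ?W0 = "(q0 - d0, q0 + d0, p0)"
  obtain W where W: "continuous_on {0..} W" "\<And>t. 0 \<le> t \<Longrightarrow> W t = lp.mild ?W0 W t"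
    using lp.fixed_point_exists by blast
  have half: "(1/2) *\<^sub>R ((a::l2) + a) = a" for a by (simp flip: scaleR_2)
  have "wd (snd (snd ?W0)) ((1/2) *\<^sub>R (fst (snd ?W0) - fst ?W0))" using wd0 half[of d0] by simp
  note fp = lp.fixed_point_weak_sol[OF W this]
  define P D Q where "P = lp.vp W" and "D = lp.vd W" and "Q = lp.vq W"
  have w: "weak_sol m N X {0..} (\<lambda>J t. F J (cut R (ev (X J) (P t) (D t)))) P D Q"
    using fp(1) by (simp add: P_def D_def Q_def lp.force_def[abs_def])
  have init: "P 0 = p0" "D 0 = d0" "Q 0 = q0"
    using half[of d0] half[of q0] by (simp_all add: P_def D_def Q_def lp.vp_def lp.vd_def lp.vq_def fp(2))
  note w' = weak_solD[OF w]
  have cy: "continuous_on S (\<lambda>t. cmod (ev (X J) (P t) (D t)))" if "S \<subseteq> {0..}" for J S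
    by (intro continuous_intros continuous_on_subset[OF w'(1)] continuous_on_subset[OF w'(2)] that)
  have inside: "cmod (ev (X J) (P t) (D t)) \<le> R" if "0 \<le> t" "J \<in> {1..N}" for t J
  proof (rule ccontr)
    assume out: "\<not> ?thesis"
    \<comment> \<open>The times up to \<open>t\<close> at which some trace reaches the truncation
      radius; its infimum \<open>c\<close> is attained and is the first such time. Before
      \<open>c\<close> the truncated force is the true one, so energy is conserved there.\<close>
    define S where "S = (\<Union>J\<in>{1..N}. {s \<in> {0..t}. R \<le> cmod (ev (X J) (P s) (D s))})"
    have "closed {s \<in> {0..t}. R \<le> cmod (ev (X J) (P s) (D s))}" for J
      by (rule continuous_on_closed_Collect_le) (auto intro!: cy)
    then have "closed S" unfolding S_def by (intro closed_UN) auto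
    moreover have ne: "S \<noteq> {}" using out that by (auto simp: S_def not_le intro!: bexI[of _ J] exI[of _ t])
    moreover have bb: "bdd_below S" by (auto simp: S_def intro!: bdd_belowI[of _ 0])
    ultimately have "Inf S \<in> S" by (intro closed_contains_Inf)
    define c where "c = Inf S"
    from \<open>Inf S \<in> S\<close> obtain K where K: "K \<in> {1..N}" "0 \<le> c" "c \<le> t" "R \<le> cmod (ev (X K) (P c) (D c))"
      by (auto simp: S_def c_def)
    have below: "cmod (ev (X J) (P s) (D s)) < R" if "J \<in> {1..N}" "0 \<le> s" "s < c" for J s
    proof (rule ccontr)
      assume "\<not> ?thesis"
      then have "s \<in> S" unfolding S_def using that K by (intro UN_I[of J]) auto
      then show False using cInf_lower[OF _ bb] that by (force simp: c_def)
    qed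
    \<comment> \<open>Time 0 is listed separately for the case \<open>c = 0\<close>, in which there
      are no earlier times and the energy is the initial one.\<close>
    have small: "cmod (ev (X K) (P s) (D s)) \<le> R0" if "0 \<le> s" "s < c \<or> s = 0" for s
    proof -
      have "H (P s) (D s) (Q s) \<le> E"
      proof (cases "s < c")
        case True
        have "H (P s) (D s) (Q s) = H (P 0) (D 0) (Q 0)"
          unfolding H_def
          by (rule energy_conservation[OF w nonlin _ that(1) True])
             (use below in \<open>auto simp: cut_id less_imp_le\<close>)
        then show ?thesis by (simp add: init E_def)
      next
        case False
        then show ?thesis using that by (simp add: init E_def)
      qed
      from coercive(2)[OF w'(5)[OF that(1)] this] show ?thesis unfolding R0_def by (rule real_le_rsqrt)
    qed
    \<comment> \<open>By continuity the bound \<open>R0\<close>, valid before \<open>c\<close>,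
      persists at \<open>c\<close>, where the trace is supposed to be at least
      \<open>R\<close>.\<close>
    have "cmod (ev (X K) (P c) (D c)) \<le> R0"
    proof (cases "c = 0")
      case False
      then have c: "closure {0..<c} = {0..c}" using K(2) by simp
      show ?thesis
        by (rule continuous_le_on_closure[of "{0..<c}" "\<lambda>s. cmod (ev (X K) (P s) (D s))"])
           (use c K small in \<open>auto intro!: cy\<close>)
    qed (use small in auto)
    with K(4) R show False by linarith
  qed
  have "forward P D Q"
    unfolding forward_def by (rule weak_sol_cong[OF w]) (use inside in \<open>auto simp: cut_id\<close>)
  then show ?thesis using that init by blast
qed

text \<open>An energy of at most \<open>E\<close> confines the traces for all time, so all such
  solutions solve one and the same truncated problem, and the stability of its fixed points is
  uniform over them. Uniqueness is the case of equal data.\<close>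

theorem forward_stability:
  obtains K where "K \<ge> 0"
    "\<And>P D Q P' D' Q' t. forward P D Q \<Longrightarrow> forward P' D' Q' \<Longrightarrow> H (P 0) (D 0) (Q 0) \<le> E \<Longrightarrow> H (P' 0) (D' 0) (Q' 0) \<le> E
      \<Longrightarrow> 0 \<le> t \<Longrightarrow> t \<le> T \<Longrightarrow>
      norm (P t - P' t) + norm (D t - D' t) + norm (Q t - Q' t)
        \<le> K * (norm (P 0 - P' 0) + norm (D 0 - D' 0) + norm (Q 0 - Q' 0))"
proof -
  define R where "R = \<bar>sqrt (bound E)\<bar>"
  obtain L where "lipschitz_problem m N (\<lambda>J z. F J (cut R z)) L" using cut_lipschitz_problem[of R] by (auto simp: R_def)
  then interpret lp: lipschitz_problem m N X "\<lambda>J z. F J (cut R z)" L .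
  obtain \<mu> where \<mu>: "\<mu> > 0" "lp.gain \<mu> \<le> 1/2" by (rule lp.gain_small)
  \<comment> \<open>The 12 is the product of 2 from the stability of fixed points, 2 from the
    initial phase in terms of the three fields, and 3 from recovering the three fields from the
    phase.\<close>
  let ?K = "12 * exp (\<mu> * \<bar>T\<bar>)"
  show ?thesis
  proof (rule that[of ?K])
    fix P D Q P' D' Q' t
    assume f: "forward P D Q" "forward P' D' Q'" and E: "H (P 0) (D 0) (Q 0) \<le> E" "H (P' 0) (D' 0) (Q' 0) \<le> E"
      and t: "0 \<le> t" "t \<le> T"
    define W where "W P D Q t = (shift (- t) (Q t - D t), shift t (Q t + D t), P t)" for P D Q :: "real \<Rightarrow> l2" and t
    have fp: "continuous_on {0..} (W P D Q)" "\<And>t. 0 \<le> t \<Longrightarrow> W P D Q t = lp.mild (W P D Q 0) (W P D Q) t"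
      if f: "forward P D Q" and E: "H (P 0) (D 0) (Q 0) \<le> E" for P D Q
    proof -
      have G: "F J (ev (X J) (P t) (D t)) = F J (cut R (ev (X J) (P t) (D t)))" if "J \<in> {1..N}" "0 \<le> t" for J t
        using forward_bound(2)[OF f that(2) E, of "X J"] by (subst cut_id) (auto simp: R_def)
      note * = lp.weak_sol_fixed_point[OF f[unfolded forward_def] G]
      show "continuous_on {0..} (W P D Q)" "\<And>t. 0 \<le> t \<Longrightarrow> W P D Q t = lp.mild (W P D Q 0) (W P D Q) t"
        unfolding W_def by (rule *; assumption)+
    qed
    have st: "norm (W P D Q t - W P' D' Q' t) \<le> 2 * exp (\<mu> * t) * norm (W P D Q 0 - W P' D' Q' 0)"
      by (rule lp.fixed_point_stability[OF fp(1)[OF f(1) E(1)] fp(1)[OF f(2) E(2)] fp(2)[OF f(1) E(1)] fp(2)[OF f(2) E(2)] t(1) \<mu>])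
    let ?p = "\<lambda>t. P t - P' t" and ?d = "\<lambda>t. D t - D' t" and ?q = "\<lambda>t. Q t - Q' t"
    have Wd: "W P D Q t - W P' D' Q' t = (shift (- t) (?q t - ?d t), shift t (?q t + ?d t), ?p t)" for t
      by (simp add: W_def shift_diff shift_add algebra_simps)
    have "norm (W P D Q 0 - W P' D' Q' 0) \<le> norm (?q 0 - ?d 0) + norm (?q 0 + ?d 0) + norm (?p 0)"
      unfolding Wd by (rule order_trans[OF lp.phase_norm(4)]) simp
    also have "\<dots> \<le> 2 * (norm (?p 0) + norm (?d 0) + norm (?q 0))"
    proof -
      have "x + y + p \<le> 2 * (p + d + q)" if "x \<le> q + d" "y \<le> q + d" "0 \<le> p" for x y p d q :: real
        using that by simp
      then show ?thesis using norm_triangle_ineq4[of "?q 0" "?d 0"] norm_triangle_ineq[of "?q 0" "?d 0"] norm_ge_zero[of "?p 0"] by blast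
    qed
    finally have 0: "norm (W P D Q 0 - W P' D' Q' 0) \<le> 2 * (norm (?p 0) + norm (?d 0) + norm (?q 0))" .
    let ?n = "norm (W P D Q t - W P' D' Q' t)"
    have c: "norm (?q t - ?d t) \<le> ?n" "norm (?q t + ?d t) \<le> ?n" "norm (?p t) \<le> ?n"
      using lp.phase_norm(1-3)[of "W P D Q t - W P' D' Q' t"] unfolding Wd by simp_all
    have "2 * norm (?q t) \<le> 2 * ?n"
    proof -
      have "2 *\<^sub>R ?q t = (?q t - ?d t) + (?q t + ?d t)" by (simp add: scaleR_2)
      then have "2 * norm (?q t) = norm ((?q t - ?d t) + (?q t + ?d t))" by (metis abs_numeral norm_scaleR)
      then show ?thesis using norm_triangle_ineq[of "?q t - ?d t" "?q t + ?d t"] c by linarith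
    qed
    moreover have "2 * norm (?d t) \<le> 2 * ?n"
    proof -
      have "2 *\<^sub>R ?d t = (?q t + ?d t) - (?q t - ?d t)" by (simp add: scaleR_2)
      then have "2 * norm (?d t) = norm ((?q t + ?d t) - (?q t - ?d t))" by (metis abs_numeral norm_scaleR)
      then show ?thesis using norm_triangle_ineq4[of "?q t + ?d t" "?q t - ?d t"] c by linarith
    qed
    ultimately have "norm (?p t) + norm (?d t) + norm (?q t) \<le> 3 * ?n" using c by linarith
    also have "\<dots> \<le> 3 * (2 * exp (\<mu> * t) * (2 * (norm (?p 0) + norm (?d 0) + norm (?q 0))))"
      using order_trans[OF st mult_left_mono[OF 0]] by simp
    also have "\<dots> = 12 * exp (\<mu> * t) * (norm (?p 0) + norm (?d 0) + norm (?q 0))" by simp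
    also have "\<dots> \<le> ?K * (norm (?p 0) + norm (?d 0) + norm (?q 0))"
      using t \<mu> by (intro mult_right_mono mult_left_mono) auto
    finally show "norm (?p t) + norm (?d t) + norm (?q t) \<le> ?K * (norm (?p 0) + norm (?d 0) + norm (?q 0))" .
  qed simp
qed


section \<open>Transfer to distributional solutions on the whole line\<close>

definition HE :: "state \<Rightarrow> real" where
  "HE \<Psi> = H (cl (fst \<Psi>)) (cl (wderiv (fst \<Psi>))) (cl (snd \<Psi>))"

text \<open>A solution on the whole line is studied as two forward solutions, the second one
  reversed in time, so that every statement for negative times reduces to one for nonnegative
  times.\<close>

lemma solution_forward:
  assumes sol: "is_solution m N X F \<Psi>0 \<Psi>" and \<Psi>0: "\<Psi>0 \<in> Espace"
  defines "P \<equiv> (\<lambda>t. cl (fst (\<Psi> t)))" and "D \<equiv> (\<lambda>t. cl (wderiv (fst (\<Psi> t))))" and "Q \<equiv> (\<lambda>t. cl (snd (\<Psi> t)))"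
  shows "forward P D Q" "forward (\<lambda>t. P (- t)) (\<lambda>t. D (- t)) (\<lambda>t. - Q (- t))"
    "P 0 = cl (fst \<Psi>0)" "D 0 = cl (wderiv (fst \<Psi>0))" "Q 0 = cl (snd \<Psi>0)"
proof -
  have E: "\<Psi> t \<in> Espace" for t using sol by (simp add: is_solution_def)
  have G: "F J (fst (\<Psi> t) (X J)) = F J (ev (X J) (P t) (D t))" for J t
    by (simp add: P_def D_def EspaceD[OF E])
  have w: "weak_sol m N X UNIV (\<lambda>J t. F J (ev (X J) (P t) (D t))) P D Q"
    unfolding G[symmetric] unfolding P_def D_def Q_def
    by (rule solution_weak_sol[OF sol m_pos]) (rule nl_continuous[OF nonlin])
  show "forward P D Q"
    unfolding forward_def by (rule weak_sol_subset[OF w]) simp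
  show "forward (\<lambda>t. P (- t)) (\<lambda>t. D (- t)) (\<lambda>t. - Q (- t))"
    unfolding forward_def by (rule weak_sol_subset[OF weak_sol_reverse[OF w]]) simp
  have i: "fst (\<Psi> 0) = fst \<Psi>0" "AE x in lborel. snd (\<Psi> 0) x = snd \<Psi>0 x"
    using sol by (simp_all add: is_solution_def)
  show "P 0 = cl (fst \<Psi>0)" "D 0 = cl (wderiv (fst \<Psi>0))" "Q 0 = cl (snd \<Psi>0)"
    using i EspaceD(3)[OF E] EspaceD(3)[OF \<Psi>0] by (simp_all add: P_def D_def Q_def cl_eq_iff)
qed

lemma H_minus: "H p d (- q) = H p d q"
  by (simp add: H_def energy_def)

lemma solution_conservation:
  assumes sol: "is_solution m N X F \<Psi>0 \<Psi>" and \<Psi>0: "\<Psi>0 \<in> Espace"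
  shows "HE (\<Psi> t) = HE \<Psi>0"
    "inner (cl (snd (\<Psi> t))) (mulI (cl (fst (\<Psi> t)))) = inner (cl (snd \<Psi>0)) (mulI (cl (fst \<Psi>0)))"
proof -
  note f = solution_forward[OF assms]
  have "HE (\<Psi> t) = HE \<Psi>0 \<and> inner (cl (snd (\<Psi> t))) (mulI (cl (fst (\<Psi> t)))) = inner (cl (snd \<Psi>0)) (mulI (cl (fst \<Psi>0)))"
  proof (cases "0 \<le> t")
    case True
    show ?thesis using forward_conservation[OF f(1) True] f(3-5) by (simp add: HE_def)
  next
    case False
    then have "0 \<le> - t" by simp
    from forward_conservation[OF f(2) this] f(3-5) show ?thesis by (simp add: HE_def H_minus)
  qed
  then show "HE (\<Psi> t) = HE \<Psi>0"
    "inner (cl (snd (\<Psi> t))) (mulI (cl (fst (\<Psi> t)))) = inner (cl (snd \<Psi>0)) (mulI (cl (fst \<Psi>0)))" by auto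
qed

lemma solution_exists:
  assumes "\<Psi>0 \<in> Espace" shows "\<exists>\<Psi>. is_solution m N X F \<Psi>0 \<Psi>"
proof -
  let ?p = "cl (fst \<Psi>0)" and ?d = "cl (wderiv (fst \<Psi>0))" and ?q = "cl (snd \<Psi>0)"
  have wd: "wd ?p ?d" by (rule EspaceD(5)[OF assms])
  obtain P D Q where f: "forward P D Q" "P 0 = ?p" "D 0 = ?d" "Q 0 = ?q" by (rule forward_exists[OF wd])
  obtain P' D' Q' where f': "forward P' D' Q'" "P' 0 = ?p" "D' 0 = ?d" "Q' 0 = - ?q" by (rule forward_exists[OF wd])
  have w: "weak_sol m N X UNIV
     (\<lambda>J t. if 0 \<le> t then F J (ev (X J) (P t) (D t)) else F J (ev (X J) (P' (- t)) (D' (- t))))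
     (\<lambda>t. if 0 \<le> t then P t else P' (- t)) (\<lambda>t. if 0 \<le> t then D t else D' (- t)) (\<lambda>t. if 0 \<le> t then Q t else - Q' (- t))"
    by (rule weak_sol_glue[OF f(1)[unfolded forward_def] f'(1)[unfolded forward_def]]) (simp_all add: f f')
  have "is_solution m N X F \<Psi>0 (\<lambda>t. ((\<lambda>x. ev x (if 0 \<le> t then P t else P' (- t)) (if 0 \<le> t then D t else D' (- t))),
      rep_l2 (if 0 \<le> t then Q t else - Q' (- t))))"
    by (rule weak_sol_solution[OF w]) (use f m_pos assms in auto)
  then show ?thesis by blast
qed

lemma solution_stability:
  obtains K where "K \<ge> 0"
    "\<And>\<Phi> \<Phi>' \<Psi> \<Psi>'. is_solution m N X F \<Phi> \<Psi> \<Longrightarrow> is_solution m N X F \<Phi>' \<Psi>' \<Longrightarrow> \<Phi> \<in> Espace \<Longrightarrow> \<Phi>' \<in> Espace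
      \<Longrightarrow> HE \<Phi> \<le> E \<Longrightarrow> HE \<Phi>' \<le> E \<Longrightarrow>
      norm (cl (fst (\<Psi> t)) - cl (fst (\<Psi>' t))) + norm (cl (wderiv (fst (\<Psi> t))) - cl (wderiv (fst (\<Psi>' t))))
        + norm (cl (snd (\<Psi> t)) - cl (snd (\<Psi>' t)))
      \<le> K * (norm (cl (fst \<Phi>) - cl (fst \<Phi>')) + norm (cl (wderiv (fst \<Phi>)) - cl (wderiv (fst \<Phi>')))
        + norm (cl (snd \<Phi>) - cl (snd \<Phi>')))"
proof -
  obtain K where K: "K \<ge> 0"
    "\<And>P D Q P' D' Q' s. forward P D Q \<Longrightarrow> forward P' D' Q' \<Longrightarrow> H (P 0) (D 0) (Q 0) \<le> E \<Longrightarrow> H (P' 0) (D' 0) (Q' 0) \<le> E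
      \<Longrightarrow> 0 \<le> s \<Longrightarrow> s \<le> \<bar>t\<bar> \<Longrightarrow>
      norm (P s - P' s) + norm (D s - D' s) + norm (Q s - Q' s)
        \<le> K * (norm (P 0 - P' 0) + norm (D 0 - D' 0) + norm (Q 0 - Q' 0))"
    using forward_stability by blast
  show ?thesis
  proof (rule that[OF K(1)])
    fix \<Phi> \<Phi>' \<Psi> \<Psi>'
    assume s: "is_solution m N X F \<Phi> \<Psi>" "is_solution m N X F \<Phi>' \<Psi>'" and \<Phi>: "\<Phi> \<in> Espace" "\<Phi>' \<in> Espace"
      and E: "HE \<Phi> \<le> E" "HE \<Phi>' \<le> E"
    note f = solution_forward[OF s(1) \<Phi>(1)] and f' = solution_forward[OF s(2) \<Phi>(2)]
    show "norm (cl (fst (\<Psi> t)) - cl (fst (\<Psi>' t))) + norm (cl (wderiv (fst (\<Psi> t))) - cl (wderiv (fst (\<Psi>' t))))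
        + norm (cl (snd (\<Psi> t)) - cl (snd (\<Psi>' t)))
      \<le> K * (norm (cl (fst \<Phi>) - cl (fst \<Phi>')) + norm (cl (wderiv (fst \<Phi>)) - cl (wderiv (fst \<Phi>')))
        + norm (cl (snd \<Phi>) - cl (snd \<Phi>')))"
    proof (cases "0 \<le> t")
      case True
      show ?thesis using K(2)[OF f(1) f'(1), of t] E True by (simp add: f(3-5) f'(3-5) HE_def)
    next
      case False
      have m: "norm (- a - - b) = norm (a - b)" for a b :: l2 by (simp add: norm_minus_commute)
      show ?thesis using K(2)[OF f(2) f'(2), of "- t"] E False by (simp add: f(3-5) f'(3-5) HE_def H_minus m[simplified])
    qed
  qed
qed

lemma solution_unique:
  assumes s: "is_solution m N X F \<Psi>0 \<Psi>1" "is_solution m N X F \<Psi>0 \<Psi>2" and \<Psi>0: "\<Psi>0 \<in> Espace"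
  shows "fst (\<Psi>1 t) = fst (\<Psi>2 t)" "AE x in lborel. snd (\<Psi>1 t) x = snd (\<Psi>2 t) x"
proof -
  obtain K where "norm (cl (fst (\<Psi>1 t)) - cl (fst (\<Psi>2 t))) + norm (cl (wderiv (fst (\<Psi>1 t))) - cl (wderiv (fst (\<Psi>2 t))))
        + norm (cl (snd (\<Psi>1 t)) - cl (snd (\<Psi>2 t)))
      \<le> K * (norm (cl (fst \<Psi>0) - cl (fst \<Psi>0)) + norm (cl (wderiv (fst \<Psi>0)) - cl (wderiv (fst \<Psi>0)))
        + norm (cl (snd \<Psi>0) - cl (snd \<Psi>0)))"
    using solution_stability[of "HE \<Psi>0" t] s \<Psi>0 by (metis order_refl)
  then have z: "norm (cl (fst (\<Psi>1 t)) - cl (fst (\<Psi>2 t))) + norm (cl (wderiv (fst (\<Psi>1 t))) - cl (wderiv (fst (\<Psi>2 t))))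
        + norm (cl (snd (\<Psi>1 t)) - cl (snd (\<Psi>2 t))) \<le> 0" by simp
  have nn: "0 \<le> norm (cl (fst (\<Psi>1 t)) - cl (fst (\<Psi>2 t)))" "0 \<le> norm (cl (wderiv (fst (\<Psi>1 t))) - cl (wderiv (fst (\<Psi>2 t))))"
    "0 \<le> norm (cl (snd (\<Psi>1 t)) - cl (snd (\<Psi>2 t)))" by simp_all
  from z nn have "norm (cl (fst (\<Psi>1 t)) - cl (fst (\<Psi>2 t))) = 0" "norm (cl (wderiv (fst (\<Psi>1 t))) - cl (wderiv (fst (\<Psi>2 t)))) = 0"
    "norm (cl (snd (\<Psi>1 t)) - cl (snd (\<Psi>2 t))) = 0" by linarith+
  then have eq: "cl (fst (\<Psi>1 t)) = cl (fst (\<Psi>2 t))" "cl (wderiv (fst (\<Psi>1 t))) = cl (wderiv (fst (\<Psi>2 t)))"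
    "cl (snd (\<Psi>1 t)) = cl (snd (\<Psi>2 t))" by simp_all
  have E: "\<Psi>1 t \<in> Espace" "\<Psi>2 t \<in> Espace" using s by (simp_all add: is_solution_def)
  have "fst (\<Psi>1 t) x = fst (\<Psi>2 t) x" for x
    using EspaceD(6)[OF E(1), of x] EspaceD(6)[OF E(2), of x] eq by simp
  then show "fst (\<Psi>1 t) = fst (\<Psi>2 t)" by blast
  show "AE x in lborel. snd (\<Psi>1 t) x = snd (\<Psi>2 t) x"
    using eq(3) EspaceD(3)[OF E(1)] EspaceD(3)[OF E(2)] by (simp add: cl_eq_iff)
qed

text \<open>The stability constant depends on a common upper bound for the energies; continuity of
  the Hamiltonian on the energy space supplies it near a given state.\<close>

lemma HE_locally_bounded:
  assumes "\<Phi> \<in> Espace"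
  obtains \<delta> where "\<delta> > 0" "\<And>\<Psi>. \<Psi> \<in> Espace \<Longrightarrow> enorm m (sdiff \<Psi> \<Phi>) < \<delta> \<Longrightarrow> HE \<Psi> \<le> HE \<Phi> + 1"
proof -
  let ?h = "\<lambda>z :: l2 \<times> l2 \<times> l2. H (fst z) (fst (snd z)) (snd (snd z))"
  have "continuous_on UNIV ?h"
  proof -
    have "continuous_on UNIV (\<lambda>z :: l2 \<times> l2 \<times> l2. U J (ev (X J) (fst z) (fst (snd z))))" if J: "J \<in> {1..N}" for J
    proof (rule continuous_on_compose2[where t=UNIV and g="U J"])
      show "continuous_on UNIV (U J)" using nonlin[OF J] by (simp add: nl_def)
      show "continuous_on UNIV (\<lambda>z :: l2 \<times> l2 \<times> l2. ev (X J) (fst z) (fst (snd z)))" by (intro continuous_intros)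
    qed simp
    then show ?thesis unfolding H_def energy_def by (intro continuous_intros) auto
  qed
  then have c: "isCont ?h (cl (fst \<Phi>), cl (wderiv (fst \<Phi>)), cl (snd \<Phi>))"
    by (rule continuous_on_interior) simp
  define w where "w = (cl (fst \<Phi>), cl (wderiv (fst \<Phi>)), cl (snd \<Phi>))"
  have "\<exists>\<epsilon>>0. \<forall>z. dist z w < \<epsilon> \<longrightarrow> dist (?h z) (?h w) < 1"
    using c[folded w_def, unfolded continuous_at_eps_delta] zero_less_one by simp
  then obtain \<epsilon> where "\<epsilon> > 0" and \<epsilon>w: "\<forall>z. dist z w < \<epsilon> \<longrightarrow> dist (?h z) (?h w) < 1" by (elim exE conjE)
  note \<epsilon> = \<open>\<epsilon> > 0\<close> \<epsilon>w[rule_format, unfolded w_def]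
  \<comment> \<open>In the energy norm, the displacement costs a factor \<open>1 / m\<close>, space
    derivative and velocity cost 1 each.\<close>
  define \<delta> where "\<delta> = \<epsilon> / (1 / m + 2)"
  have m2: "1 / m + 2 > 0" using m_pos by (intro add_pos_pos) auto
  then have \<delta>: "\<delta> > 0" unfolding \<delta>_def using \<epsilon> by simp
  show ?thesis
  proof (rule that[OF \<delta>])
    fix \<Psi> assume \<Psi>: "\<Psi> \<in> Espace" and d: "enorm m (sdiff \<Psi> \<Phi>) < \<delta>"
    let ?z = "(cl (fst \<Psi>), cl (wderiv (fst \<Psi>)), cl (snd \<Psi>))" and ?w = "(cl (fst \<Phi>), cl (wderiv (fst \<Phi>)), cl (snd \<Phi>))"
    let ?n = "enorm m (sdiff \<Psi> \<Phi>)"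
    note e = norm_le_enorm_sdiff[OF \<Psi> assms m_pos]
    have "norm (cl (fst \<Psi>) - cl (fst \<Phi>)) \<le> ?n / m" using e(3) m_pos by (simp add: field_simps)
    moreover have "dist ?z ?w \<le> norm (cl (fst \<Psi>) - cl (fst \<Phi>)) + (norm (cl (wderiv (fst \<Psi>)) - cl (wderiv (fst \<Phi>)))
        + norm (cl (snd \<Psi>) - cl (snd \<Phi>)))"
      unfolding dist_norm diff_Pair by (intro order_trans[OF norm_Pair_le] add_left_mono norm_Pair_le)
    ultimately have "dist ?z ?w \<le> ?n / m + (?n + ?n)" using e by linarith
    also have "\<dots> = ?n * (1 / m + 2)" by (simp add: algebra_simps)
    also have "\<dots> < \<delta> * (1 / m + 2)" by (rule mult_strict_right_mono[OF d m2])
    also have "\<dots> = \<epsilon>" unfolding \<delta>_def using m2 by simp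
    finally have "dist (?h ?z) (?h ?w) < 1" by (rule \<epsilon>(2))
    then show "HE \<Psi> \<le> HE \<Phi> + 1" by (simp add: HE_def dist_real_def)
  qed
qed

lemma solution_continuous_dependence:
  assumes \<Phi>: "\<Phi> \<in> Espace" and "\<epsilon> > 0"
  shows "\<exists>\<delta>>0. \<forall>\<Psi>1\<in>Espace. enorm m (sdiff \<Psi>1 \<Phi>) < \<delta> \<longrightarrow>
        (\<forall>S0 S1. is_solution m N X F \<Phi> S0 \<and> is_solution m N X F \<Psi>1 S1 \<longrightarrow> enorm m (sdiff (S1 t) (S0 t)) < \<epsilon>)"
proof -
  obtain \<delta>0 where \<delta>0: "\<delta>0 > 0" "\<And>\<Psi>. \<Psi> \<in> Espace \<Longrightarrow> enorm m (sdiff \<Psi> \<Phi>) < \<delta>0 \<Longrightarrow> HE \<Psi> \<le> HE \<Phi> + 1"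
    using HE_locally_bounded[OF \<Phi>] by blast
  obtain K where K: "K \<ge> 0"
    "\<And>\<Phi>1 \<Phi>' \<Psi> \<Psi>'. is_solution m N X F \<Phi>1 \<Psi> \<Longrightarrow> is_solution m N X F \<Phi>' \<Psi>' \<Longrightarrow> \<Phi>1 \<in> Espace \<Longrightarrow> \<Phi>' \<in> Espace
      \<Longrightarrow> HE \<Phi>1 \<le> HE \<Phi> + 1 \<Longrightarrow> HE \<Phi>' \<le> HE \<Phi> + 1 \<Longrightarrow>
      norm (cl (fst (\<Psi> t)) - cl (fst (\<Psi>' t))) + norm (cl (wderiv (fst (\<Psi> t))) - cl (wderiv (fst (\<Psi>' t))))
        + norm (cl (snd (\<Psi> t)) - cl (snd (\<Psi>' t)))
      \<le> K * (norm (cl (fst \<Phi>1) - cl (fst \<Phi>')) + norm (cl (wderiv (fst \<Phi>1)) - cl (wderiv (fst \<Phi>')))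
        + norm (cl (snd \<Phi>1) - cl (snd \<Phi>')))"
    using solution_stability[of "HE \<Phi> + 1" t] by blast
  \<comment> \<open>The factor \<open>1 + m\<close> passes from the sum of the three norms to
    \<open>enorm\<close>, the factor \<open>1 / m + 2\<close> passes back at time 0, and the final 1
    makes \<open>C\<close> positive.\<close>
  define C where "C = (1 + m) * (K * (1 / m + 2)) + 1"
  have C: "C > 0" unfolding C_def using K(1) m_pos by (intro add_nonneg_pos mult_nonneg_nonneg) auto
  show ?thesis
  proof (intro exI[of _ "min \<delta>0 (\<epsilon> / C)"] conjI ballI impI allI)
    show "0 < min \<delta>0 (\<epsilon> / C)" using \<delta>0(1) assms(2) C by simp
    fix \<Psi>1 S0 S1
    assume \<Psi>1: "\<Psi>1 \<in> Espace" and d: "enorm m (sdiff \<Psi>1 \<Phi>) < min \<delta>0 (\<epsilon> / C)"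
      and s: "is_solution m N X F \<Phi> S0 \<and> is_solution m N X F \<Psi>1 S1"
    let ?n = "enorm m (sdiff \<Psi>1 \<Phi>)"
    have E: "S0 t \<in> Espace" "S1 t \<in> Espace" using s by (simp_all add: is_solution_def)
    let ?p = "norm (cl (fst (S1 t)) - cl (fst (S0 t)))" and ?d = "norm (cl (wderiv (fst (S1 t))) - cl (wderiv (fst (S0 t))))"
      and ?q = "norm (cl (snd (S1 t)) - cl (snd (S0 t)))"
    note e = norm_le_enorm_sdiff[OF \<Psi>1 \<Phi> m_pos]
    have "norm (cl (fst \<Psi>1) - cl (fst \<Phi>)) \<le> ?n / m" using e(3) m_pos by (simp add: field_simps)
    then have "norm (cl (fst \<Psi>1) - cl (fst \<Phi>)) + norm (cl (wderiv (fst \<Psi>1)) - cl (wderiv (fst \<Phi>))) + norm (cl (snd \<Psi>1) - cl (snd \<Phi>))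
        \<le> ?n / m + ?n + ?n" using e by linarith
    also have "\<dots> = (1 / m + 2) * ?n" by (simp add: algebra_simps)
    finally have init: "norm (cl (fst \<Psi>1) - cl (fst \<Phi>)) + norm (cl (wderiv (fst \<Psi>1)) - cl (wderiv (fst \<Phi>))) + norm (cl (snd \<Psi>1) - cl (snd \<Phi>))
        \<le> (1 / m + 2) * ?n" .
    have "?p + ?d + ?q \<le> K * (norm (cl (fst \<Psi>1) - cl (fst \<Phi>)) + norm (cl (wderiv (fst \<Psi>1)) - cl (wderiv (fst \<Phi>))) + norm (cl (snd \<Psi>1) - cl (snd \<Phi>)))"
      by (rule K(2)) (use s \<Psi>1 \<Phi> \<delta>0(2)[OF \<Psi>1] d in auto)
    also have "\<dots> \<le> K * ((1 / m + 2) * ?n)" by (rule mult_left_mono[OF init K(1)])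
    finally have sum: "?p + ?d + ?q \<le> K * (1 / m + 2) * ?n" by (simp add: mult.assoc)
    have "enorm m (sdiff (S1 t) (S0 t)) \<le> ?q + ?d + m * ?p"
      by (rule enorm_sdiff_le[OF E(2,1) m_pos])
    also have "\<dots> \<le> (1 + m) * (?p + ?d + ?q)"
    proof -
      have "0 \<le> ?p" "0 \<le> m * ?d" "0 \<le> m * ?q" using m_pos by simp_all
      moreover have "(1 + m) * (?p + ?d + ?q) = ?p + ?d + ?q + m * ?p + m * ?d + m * ?q" by (simp add: algebra_simps)
      ultimately show ?thesis by linarith
    qed
    also have "\<dots> \<le> (1 + m) * (K * (1 / m + 2) * ?n)" using m_pos by (intro mult_left_mono sum) simp
    also have "\<dots> = (C - 1) * ?n" by (simp add: C_def)
    also have "\<dots> \<le> C * ?n" using enorm_eq(2)[OF sdiff_Espace(1)[OF \<Psi>1 \<Phi>]] by (intro mult_right_mono) auto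
    also have "\<dots> < C * (\<epsilon> / C)" using d C by (intro mult_strict_left_mono) auto
    also have "\<dots> = \<epsilon>" using C by simp
    finally show "enorm m (sdiff (S1 t) (S0 t)) < \<epsilon>" .
  qed
qed

lemma Ham_eq:
  assumes "\<Psi> \<in> Espace" shows "Ham m N X U \<Psi> = HE \<Psi>"
proof -
  note e = EspaceD[OF assms]
  have "(\<integral>x. (cmod (snd \<Psi> x))\<^sup>2 + (cmod (wderiv (fst \<Psi>) x))\<^sup>2 + m\<^sup>2 * (cmod (fst \<Psi> x))\<^sup>2 \<partial>lborel)
      = l2sq (snd \<Psi>) + l2sq (wderiv (fst \<Psi>)) + m\<^sup>2 * l2sq (fst \<Psi>)"
    unfolding l2sq_def using L2_integrable[OF e(2)] L2_integrable[OF e(3)] L2_integrable[OF e(4)] by simp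
  then show ?thesis
    unfolding Ham_def HE_def H_def energy_def using e by (simp add: norm_cl_sq)
qed

text \<open>The integrand is a number minus its conjugate, hence \<open>2 * \<i>\<close> times an
  imaginary part; together with the prefactor the charge is real.\<close>

lemma Charge_eq:
  assumes "\<Psi> \<in> Espace" shows "Charge \<Psi> = - complex_of_real (inner (cl (snd \<Psi>)) (mulI (cl (fst \<Psi>))))"
proof -
  note e = EspaceD[OF assms]
  have L: "L2 (\<lambda>x. \<i> * fst \<Psi> x)" using e by auto
  have "cnj (fst \<Psi> x) * snd \<Psi> x - cnj (snd \<Psi> x) * fst \<Psi> x = 2 * \<i> * complex_of_real (inner (snd \<Psi> x) (\<i> * fst \<Psi> x))" for x
    by (simp add: complex_eq_iff inner_complex_def algebra_simps)
  then show ?thesis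
    unfolding Charge_def using e L by (simp add: mulI_cl inner_cl)
qed

lemma solution_a_priori:
  assumes s: "is_solution m N X F \<Psi>0 \<Psi>" and \<Psi>0: "\<Psi>0 \<in> Espace"
  shows "enorm m (\<Psi> t) \<le> sqrt (2 * (m * bound (HE \<Psi>0)))"
proof -
  have E: "\<Psi> t \<in> Espace" using s by (simp add: is_solution_def)
  have "HE (\<Psi> t) \<le> HE \<Psi>0" using solution_conservation(1)[OF s \<Psi>0] by simp
  from coercive(1)[OF EspaceD(5)[OF E] this[unfolded HE_def[of "\<Psi> t"]]]
  have "(enorm m (\<Psi> t))\<^sup>2 \<le> 2 * (m * bound (HE \<Psi>0))"
    unfolding enorm_eq(1)[OF E] energy_def by simp
  then show ?thesis by (rule real_le_rsqrt)
qed

end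

theorem theorem2p1:
  fixes m :: real and N :: nat and X :: "nat \<Rightarrow> real"
    and u :: "nat \<Rightarrow> real \<Rightarrow> real" and F :: "nat \<Rightarrow> complex \<Rightarrow> complex"
    and A B :: "nat \<Rightarrow> real"
  assumes m_pos: "m > 0"
    and N_pos: "N \<ge> 1"
    and X_incr: "\<And>i j. 1 \<le> i \<Longrightarrow> i < j \<Longrightarrow> j \<le> N \<Longrightarrow> X i < X j"
    and u_C2: "\<And>J. J \<in> {1..N} \<Longrightarrow> C2 (u J)"
    and F_grad: "\<And>J z. J \<in> {1..N} \<Longrightarrow> F J z = - cgrad (\<lambda>w. u J ((cmod w)\<^sup>2)) z"
    and B_nonneg: "\<And>J. J \<in> {1..N} \<Longrightarrow> B J \<ge> 0"
    and U_lower: "\<And>J z. J \<in> {1..N} \<Longrightarrow> u J ((cmod z)\<^sup>2) \<ge> A J - B J * (cmod z)\<^sup>2"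
    and B_sum: "(\<Sum>J\<in>{1..N}. B J) < m"
  shows
    \<comment> \<open>(i) existence and uniqueness\<close>
    "(\<forall>\<Psi>0\<in>Espace. (\<exists>\<Psi>. is_solution m N X F \<Psi>0 \<Psi>)
        \<and> (\<forall>\<Psi>1 \<Psi>2. is_solution m N X F \<Psi>0 \<Psi>1 \<and> is_solution m N X F \<Psi>0 \<Psi>2 \<longrightarrow>
             (\<forall>t. fst (\<Psi>1 t) = fst (\<Psi>2 t) \<and> (AE x in lborel. snd (\<Psi>1 t) x = snd (\<Psi>2 t) x))))
   \<comment> \<open>(ii) continuity of W(t) on E\<close>
   \<and> (\<forall>t. \<forall>\<Psi>0\<in>Espace. \<forall>\<epsilon>>0. \<exists>\<delta>>0. \<forall>\<Psi>1\<in>Espace. enorm m (sdiff \<Psi>1 \<Psi>0) < \<delta> \<longrightarrow>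
        (\<forall>S0 S1. is_solution m N X F \<Psi>0 S0 \<and> is_solution m N X F \<Psi>1 S1 \<longrightarrow>
            enorm m (sdiff (S1 t) (S0 t)) < \<epsilon>))
   \<comment> \<open>(iii) conservation of energy and charge\<close>
   \<and> (\<forall>\<Psi>0\<in>Espace. \<forall>\<Psi>. is_solution m N X F \<Psi>0 \<Psi> \<longrightarrow>
        (\<forall>t s. Ham m N X (\<lambda>J w. u J ((cmod w)\<^sup>2)) (\<Psi> t) = Ham m N X (\<lambda>J w. u J ((cmod w)\<^sup>2)) (\<Psi> s)
             \<and> Charge (\<Psi> t) = Charge (\<Psi> s)))
   \<comment> \<open>(iv) a priori bound\<close>
   \<and> (\<forall>\<Psi>0\<in>Espace. \<exists>C. \<forall>\<Psi>. is_solution m N X F \<Psi>0 \<Psi> \<longrightarrow> (\<forall>t. enorm m (\<Psi> t) \<le> C))"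
proof -
  interpret point_interaction m N X F "\<lambda>J w. u J ((cmod w)\<^sup>2)" A B
  proof
    show "nl (F J) (\<lambda>w. u J ((cmod w)\<^sup>2))" if "J \<in> {1..N}" for J
      by (rule nl_radial[OF u_C2[OF that] F_grad[OF that]])
  qed (use m_pos B_nonneg U_lower B_sum in auto)
  have cons: "Ham m N X (\<lambda>J w. u J ((cmod w)\<^sup>2)) (\<Psi> t) = Ham m N X (\<lambda>J w. u J ((cmod w)\<^sup>2)) (\<Psi> s)
      \<and> Charge (\<Psi> t) = Charge (\<Psi> s)"
    if "\<Psi>0 \<in> Espace" "is_solution m N X F \<Psi>0 \<Psi>" for \<Psi>0 \<Psi> t s
  proof -
    have E: "\<Psi> t \<in> Espace" for t using that(2) by (simp add: is_solution_def)
    show ?thesis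
      using solution_conservation[OF that(2,1)] by (simp add: Ham_eq[OF E] Charge_eq[OF E])
  qed
  show ?thesis
  proof (intro conjI ballI allI impI)
    fix \<Psi>0 assume "\<Psi>0 \<in> Espace"
    then show "\<exists>\<Psi>. is_solution m N X F \<Psi>0 \<Psi>" by (rule solution_exists)
  next
    fix \<Psi>0 \<Psi>1 \<Psi>2 t
    assume "\<Psi>0 \<in> Espace" "is_solution m N X F \<Psi>0 \<Psi>1 \<and> is_solution m N X F \<Psi>0 \<Psi>2"
    then show "fst (\<Psi>1 t) = fst (\<Psi>2 t)" "AE x in lborel. snd (\<Psi>1 t) x = snd (\<Psi>2 t) x"
      using solution_unique by blast+
  next
    fix t \<epsilon> :: real and \<Psi>0 assume "\<Psi>0 \<in> Espace" "0 < \<epsilon>"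
    then show "\<exists>\<delta>>0. \<forall>\<Psi>1\<in>Espace. enorm m (sdiff \<Psi>1 \<Psi>0) < \<delta> \<longrightarrow>
        (\<forall>S0 S1. is_solution m N X F \<Psi>0 S0 \<and> is_solution m N X F \<Psi>1 S1 \<longrightarrow> enorm m (sdiff (S1 t) (S0 t)) < \<epsilon>)"
      by (rule solution_continuous_dependence)
  next
    fix \<Psi>0 \<Psi> t s assume "\<Psi>0 \<in> Espace" "is_solution m N X F \<Psi>0 \<Psi>"
    from cons[OF this, of t s]
    show "Ham m N X (\<lambda>J w. u J ((cmod w)\<^sup>2)) (\<Psi> t) = Ham m N X (\<lambda>J w. u J ((cmod w)\<^sup>2)) (\<Psi> s)"
      "Charge (\<Psi> t) = Charge (\<Psi> s)" by simp_all
  next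
    fix \<Psi>0 assume "\<Psi>0 \<in> Espace"
    then show "\<exists>C. \<forall>\<Psi>. is_solution m N X F \<Psi>0 \<Psi> \<longrightarrow> (\<forall>t. enorm m (\<Psi> t) \<le> C)"
      using solution_a_priori by blast
  qed
qed

end
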